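(* For each $n$, let $A_1(n),\dots,A_k(n)$ and $B_1(n),\dots,B_\ell(n)$ be deterministic matrices in $M_n(\mathbb C)$ and let $U=U(n)$ be an $n\times n$ Haar unitary random matrix, such that (1) $A_1(n),\dots,A_k(n)$ are Hermitian; (2) $((A_1(n),\dots,A_k(n)),\mathrm{Tr}_n)$ converges in compact distribution, as $n\to\infty$, to a $k$-tuple of selfadjoint compact operators $((a_1,\dots,a_k),\mathrm{Tr}_H)$ on a separable Hilbert space $H$; (3) $((B_1(n),\dots,B_\ell(n)),\mathrm{tr}_n)$ converges in distribution, as $n\to\infty$, to an $\ell$-tuple of elements in a non-commutative probability space; (4) $\sup_{n}\|B_i(n)\|<\infty$ for every $i=1,\dots,\ell$ (operator norm). Let $P(x_1,\dots,x_k,y_1,\dots,y_\ell)$ be a selfadjoint non-commutative $*$-polynomial, with selfadjoint variables $x_1,\dots,x_k$, such that $P(0,\dots,0,y_1,\dots,y_\ell)=0$. Then $P(A_1(n),\dots,A_k(n),U(n)B_1(n)U(n)^*,\dots,U(n)B_\ell(n)U(n)^* )$ converges in eigenvalues to a deterministic compact operator almost surely as $n\to\infty$.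
   Context: $\mathrm{Tr}_n$ is the non-normalized trace on $M_n(\mathbb C)$, $\mathrm{tr}_n=\frac1n\mathrm{Tr}_n$, $\mathrm{Tr}_H$ the trace on $H$. The $U(n)$ are defined on a common probability space and are distributed according to normalized Haar measure on the unitary group. $C_{0,\mathrm b}(\mathbb R)$ is the set of real-valued bounded continuous functions on $\mathbb R$ that vanish in a neighborhood of $0$. For selfadjoint compact operators $a_i(n)$ on separable Hilbert spaces $H_n$ and $a_i$ on $H$ ($i=1,\dots,k$), $(a_1(n),\dots,a_k(n))$ converges in compact distribution to $(a_1,\dots,a_k)$ with respect to $\mathrm{Tr}_{H_n},\mathrm{Tr}_H$ if for all $f_1,\dots,f_k\in C_{0,\mathrm b}(\mathbb R)$, $p\ge1$ and $(i_1,\dots,i_p)\in\{1,\dots,k\}^p$, $\lim_{n\to\infty}\mathrm{Tr}_{H_n}(f_{i_1}(a_{i_1}(n))\cdots f_{i_p}(a_{i_p}(n)))=\mathrm{Tr}_H(f_{i_1}(a_{i_1})\cdots f_{i_p}(a_{i_p}))$. (Here $H_n=\mathbb C^n$.) A non-commutative probability space is a unital $*$-algebra with a tracial positive $*$-preserving linear functional $\tau$ with $\tau(1)=1$. Convergence in distribution of $((B_j(n))_j,\mathrm{tr}_n)$ to $((b_j)_j,\tau)$ means convergence of all $*$-moments $\mathrm{tr}_n(B_{j_1}(n)^{\varepsilon_1}\cdots B_{j_p}(n)^{\varepsilon_p})\to\tau(b_{j_1}^{\varepsilon_1}\cdots b_{j_p}^{\varepsilon_p})$, $p\ge1$, $\varepsilon_i\in\{1,*\}$.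 Convergence in eigenvalues: for a selfadjoint compact operator $a$ on a separable Hilbert space, let $\lambda_1^+(a)\ge\lambda_2^+(a)\ge\cdots\ge0$ be its nonnegative eigenvalues (with multiplicity) in nonincreasing order and $\lambda_1^-(a)\le\lambda_2^-(a)\le\cdots\le0$ its nonpositive eigenvalues in nondecreasing order, finite lists being padded with infinitely many zeros. Then $a_n$ converges to $a$ in eigenvalues if $\lambda_i^{u}(a_n)\to\lambda_i^{u}(a)$ for all $i\ge1$, $u\in\{+,-\}$ (the underlying Hilbert spaces may differ). *)

theory Defs
  imports
    "HOL-Probability.Probability"
    "HOL-Library.Poly_Mapping"
    "Jordan_Normal_Form.Char_Poly"
    "Jordan_Normal_Form.Schur_Decomposition"
begin

(* the finitely-supported sum of HOL-Library would make the notation for infinite series ambiguous *)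
no_syntax
  "_Sum_any" :: "pttrn \<Rightarrow> 'a \<Rightarrow> 'a::comm_monoid_add"  (\<open>(\<open>indent=2 notation=\<open>binder \<Sum>\<close>\<close>\<Sum>_. _)\<close> [0, 10] 10)

section \<open>Complex vector spaces, *-algebras and Hilbert spaces\<close>

class scaleC =
  fixes scaleC :: "complex \<Rightarrow> 'a \<Rightarrow> 'a"  (infixr \<open>*\<^sub>C\<close> 75)

class complex_vector = scaleC + ab_group_add +
  assumes scaleC_add_right: "c *\<^sub>C (x + y) = c *\<^sub>C x + c *\<^sub>C y"
    and scaleC_add_left: "(c + d) *\<^sub>C x = c *\<^sub>C x + d *\<^sub>C x"
    and scaleC_scaleC: "c *\<^sub>C d *\<^sub>C x = (c * d) *\<^sub>C x"
    and scaleC_one: "1 *\<^sub>C x = x"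

global_interpretation complex_vector: vector_space "scaleC :: complex \<Rightarrow> 'a \<Rightarrow> 'a::complex_vector"
  defines cspan = complex_vector.span
    and cdim = complex_vector.dim
  by standard (simp_all add: scaleC_add_right scaleC_add_left scaleC_scaleC scaleC_one)

class complex_star_algebra = complex_vector + ring_1 +
  fixes star :: "'a \<Rightarrow> 'a"
  assumes scaleC_mult_left: "(c *\<^sub>C x) * y = c *\<^sub>C (x * y)"
    and scaleC_mult_right: "x * (c *\<^sub>C y) = c *\<^sub>C (x * y)"
    and star_star: "star (star x) = x"
    and star_add: "star (x + y) = star x + star y"
    and star_scaleC: "star (c *\<^sub>C x) = cnj c *\<^sub>C star x"
    and star_mult: "star (x * y) = star y * star x"

text \<open>
  The underlying real Hilbert space structure (norm, topology, completeness) is that of the library;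
  the complex inner product is linear in its second argument.
\<close>

class complex_hilbert = complex_vector + real_inner + complete_space +
  fixes cinner :: "'a \<Rightarrow> 'a \<Rightarrow> complex"
  assumes scaleR_scaleC: "r *\<^sub>R x = complex_of_real r *\<^sub>C x"
    and cinner_commute: "cinner x y = cnj (cinner y x)"
    and cinner_add_right: "cinner x (y + z) = cinner x y + cinner x z"
    and cinner_scaleC_right: "cinner x (c *\<^sub>C y) = c * cinner x y"
    and inner_eq_Re_cinner: "inner x y = Re (cinner x y)"


section \<open>The Hilbert space of square-summable sequences\<close>

typedef ell2 = "{x :: nat \<Rightarrow> complex. summable (\<lambda>i. (cmod (x i))\<^sup>2)}"
  morphisms ell2_nth Abs_ell2
  by (rule exI[of _ "\<lambda>_. 0"]) simp

setup_lifting type_definition_ell2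

lemma ell2_eqI: "(\<And>i. ell2_nth x i = ell2_nth y i) \<Longrightarrow> x = y"
  by (metis ell2_nth_inject ext)

lemma ell2_summable: "summable (\<lambda>i. (cmod (ell2_nth x i))\<^sup>2)"
  using ell2_nth[of x] by simp

lemma summable_sq_add:
  fixes x y :: "nat \<Rightarrow> complex"
  assumes "summable (\<lambda>i. (cmod (x i))\<^sup>2)" "summable (\<lambda>i. (cmod (y i))\<^sup>2)"
  shows "summable (\<lambda>i. (cmod (x i + y i))\<^sup>2)"
proof (rule summable_comparison_test)
  show "summable (\<lambda>i. 2 * (cmod (x i))\<^sup>2 + 2 * (cmod (y i))\<^sup>2)"
    using assms by (intro summable_add summable_mult)
  have "(cmod (x i + y i))\<^sup>2 \<le> 2 * (cmod (x i))\<^sup>2 + 2 * (cmod (y i))\<^sup>2" for i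
  proof -
    have "(cmod (x i + y i))\<^sup>2 \<le> (cmod (x i) + cmod (y i))\<^sup>2"
      by (intro power_mono norm_triangle_ineq) auto
    also have "\<dots> \<le> 2 * (cmod (x i))\<^sup>2 + 2 * (cmod (y i))\<^sup>2"
      using zero_le_power2[of "cmod (x i) - cmod (y i)"]
      by (simp add: power2_eq_square algebra_simps)
    finally show ?thesis .
  qed
  then show "\<exists>N. \<forall>n\<ge>N. norm ((cmod (x n + y n))\<^sup>2) \<le> 2 * (cmod (x n))\<^sup>2 + 2 * (cmod (y n))\<^sup>2"
    by auto
qed

lemma summable_sq_scale:
  fixes x :: "nat \<Rightarrow> complex"
  assumes "summable (\<lambda>i. (cmod (x i))\<^sup>2)"
  shows "summable (\<lambda>i. (cmod (c * x i))\<^sup>2)"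
  using summable_mult[OF assms, of "(cmod c)\<^sup>2"] by (simp add: norm_mult power_mult_distrib)

lemma summable_prod:
  fixes x y :: "nat \<Rightarrow> complex"
  assumes "summable (\<lambda>i. (cmod (x i))\<^sup>2)" "summable (\<lambda>i. (cmod (y i))\<^sup>2)"
  shows "summable (\<lambda>i. cnj (x i) * y i)"
proof (rule summable_comparison_test)
  show "summable (\<lambda>i. (cmod (x i))\<^sup>2 + (cmod (y i))\<^sup>2)"
    using assms by (intro summable_add)
  have "cmod (x i) * cmod (y i) \<le> (cmod (x i))\<^sup>2 + (cmod (y i))\<^sup>2" for i
  proof -
    have "0 \<le> cmod (x i) * cmod (y i)" by simp
    then show ?thesis using sum_squares_bound[of "cmod (x i)" "cmod (y i)"] by linarith
  qed
  then show "\<exists>N. \<forall>n\<ge>N. norm (cnj (x n) * y n) \<le> (cmod (x n))\<^sup>2 + (cmod (y n))\<^sup>2"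
    by (auto simp: norm_mult)
qed

instantiation ell2 :: complex_vector
begin

lift_definition zero_ell2 :: ell2 is "\<lambda>_. 0" by simp
lift_definition plus_ell2 :: "ell2 \<Rightarrow> ell2 \<Rightarrow> ell2" is "\<lambda>x y i. x i + y i"
  by (rule summable_sq_add)
lift_definition uminus_ell2 :: "ell2 \<Rightarrow> ell2" is "\<lambda>x i. - x i" by simp
lift_definition minus_ell2 :: "ell2 \<Rightarrow> ell2 \<Rightarrow> ell2" is "\<lambda>x y i. x i - y i"
  subgoal for x y using summable_sq_add[of x "\<lambda>i. - y i"] by simp
  done
lift_definition scaleC_ell2 :: "complex \<Rightarrow> ell2 \<Rightarrow> ell2" is "\<lambda>c x i. c * x i"
  by (rule summable_sq_scale)

instance
  by standard (transfer; simp add: algebra_simps)+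

end

instantiation ell2 :: real_inner
begin

lift_definition scaleR_ell2 :: "real \<Rightarrow> ell2 \<Rightarrow> ell2" is "\<lambda>r x i. complex_of_real r * x i"
  by (rule summable_sq_scale)
definition inner_ell2 :: "ell2 \<Rightarrow> ell2 \<Rightarrow> real" where
  "inner_ell2 x y = Re (\<Sum>i. cnj (ell2_nth x i) * ell2_nth y i)"
definition norm_ell2 :: "ell2 \<Rightarrow> real" where
  "norm_ell2 x = sqrt (inner x x)"
definition sgn_ell2 :: "ell2 \<Rightarrow> ell2" where
  "sgn_ell2 x = inverse (norm x) *\<^sub>R x"
definition dist_ell2 :: "ell2 \<Rightarrow> ell2 \<Rightarrow> real" where
  "dist_ell2 x y = norm (x - y)"
definition uniformity_ell2 :: "(ell2 \<times> ell2) filter" where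
  "uniformity_ell2 = (INF e\<in>{0<..}. principal {(x, y). dist x y < e})"
definition open_ell2 :: "ell2 set \<Rightarrow> bool" where
  "open_ell2 S \<longleftrightarrow> (\<forall>x\<in>S. \<forall>\<^sub>F (x', y) in uniformity. x' = x \<longrightarrow> y \<in> S)"

lemma inner_ell2_alt: "inner x y = (\<Sum>i. Re (cnj (ell2_nth x i) * ell2_nth y i))"
  unfolding inner_ell2_def
  using bounded_linear.suminf[OF bounded_linear_Re summable_prod[OF ell2_summable ell2_summable]]
  by metis

lemma summable_inner_ell2: "summable (\<lambda>i. Re (cnj (ell2_nth x i) * ell2_nth y i))"
  by (rule summable_Re[OF summable_prod[OF ell2_summable ell2_summable]])

lemma inner_ell2_self: "inner x x = (\<Sum>i. (cmod (ell2_nth x i))\<^sup>2)"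
proof -
  have "Re (cnj z * z) = (cmod z)\<^sup>2" for z
    by (simp only: cmod_power2) (simp add: power2_eq_square)
  then show ?thesis by (simp only: inner_ell2_alt)
qed

instance
proof
  fix x y z :: ell2 and r s :: real
  show "r *\<^sub>R (x + y) = r *\<^sub>R x + r *\<^sub>R y" by transfer (simp add: algebra_simps)
  show "(r + s) *\<^sub>R x = r *\<^sub>R x + s *\<^sub>R x" by transfer (simp add: algebra_simps)
  show "r *\<^sub>R s *\<^sub>R x = (r * s) *\<^sub>R x" by transfer (simp add: mult.assoc)
  show "1 *\<^sub>R x = x" by transfer simp
  show "dist x y = norm (x - y)" by (rule dist_ell2_def)
  show "sgn x = inverse (norm x) *\<^sub>R x" by (rule sgn_ell2_def)
  show "uniformity = (INF e\<in>{0<..}. principal {(x :: ell2, y). dist x y < e})"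
    by (rule uniformity_ell2_def)
  show "open S \<longleftrightarrow> (\<forall>x\<in>S. \<forall>\<^sub>F (x', y) in uniformity. x' = x \<longrightarrow> y \<in> S)" for S :: "ell2 set"
    by (rule open_ell2_def)
  show "inner x y = inner y x"
    unfolding inner_ell2_alt by (simp add: algebra_simps)
  show "inner (x + y) z = inner x z + inner y z"
    unfolding inner_ell2_alt
    by (subst suminf_add[OF summable_inner_ell2 summable_inner_ell2])
      (simp add: plus_ell2.rep_eq algebra_simps)
  show "inner (r *\<^sub>R x) y = r * inner x y"
    unfolding inner_ell2_alt
    by (subst suminf_mult[OF summable_inner_ell2, symmetric])
      (simp add: scaleR_ell2.rep_eq algebra_simps)
  show "0 \<le> inner x x"
    unfolding inner_ell2_self by (intro suminf_nonneg ell2_summable) auto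
  show "inner x x = 0 \<longleftrightarrow> x = 0"
    unfolding inner_ell2_self
    by (subst suminf_eq_zero_iff[OF ell2_summable])
      (auto intro!: ell2_eqI simp: zero_ell2.rep_eq)
  show "norm x = sqrt (inner x x)" by (rule norm_ell2_def)
qed

end

lemma norm_ell2_sq: "(norm x)\<^sup>2 = (\<Sum>i. (cmod (ell2_nth x i))\<^sup>2)"
  unfolding inner_ell2_self[symmetric] by (simp add: power2_norm_eq_inner)

lemma sum_le_norm_ell2: "(\<Sum>i<K. (cmod (ell2_nth x i))\<^sup>2) \<le> (norm x)\<^sup>2"
  unfolding norm_ell2_sq by (intro sum_le_suminf ell2_summable) auto

lemma nth_le_norm_ell2: "cmod (ell2_nth x i) \<le> norm x"
proof (rule power2_le_imp_le)
  have "(cmod (ell2_nth x i))\<^sup>2 \<le> (\<Sum>i<Suc i. (cmod (ell2_nth x i))\<^sup>2)"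
    by (simp add: sum_nonneg)
  also have "\<dots> \<le> (norm x)\<^sup>2" by (rule sum_le_norm_ell2)
  finally show "(cmod (ell2_nth x i))\<^sup>2 \<le> (norm x)\<^sup>2" .
qed simp

instance ell2 :: complete_space
proof
  fix X :: "nat \<Rightarrow> ell2"
  assume X: "Cauchy X"
  have "Cauchy (\<lambda>n. ell2_nth (X n) i)" for i
  proof (rule metric_CauchyI)
    fix e :: real assume "0 < e"
    then obtain N where N: "\<And>m n. m \<ge> N \<Longrightarrow> n \<ge> N \<Longrightarrow> dist (X m) (X n) < e"
      using metric_CauchyD[OF X] by blast
    have "dist (ell2_nth (X m) i) (ell2_nth (X n) i) < e" if "m \<ge> N" "n \<ge> N" for m n
      using N[OF that] nth_le_norm_ell2[of "X m - X n" i]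
      by (simp add: dist_norm minus_ell2.rep_eq)
    then show "\<exists>N. \<forall>m\<ge>N. \<forall>n\<ge>N. dist (ell2_nth (X m) i) (ell2_nth (X n) i) < e" by blast
  qed
  then have "\<forall>i. \<exists>l. (\<lambda>n. ell2_nth (X n) i) \<longlonglongrightarrow> l"
    by (simp add: Cauchy_convergent_iff convergent_def)
  then obtain x where x: "\<And>i. (\<lambda>n. ell2_nth (X n) i) \<longlonglongrightarrow> x i" by metis
  have part: "(\<Sum>i<K. (cmod (x i - ell2_nth (X n) i))\<^sup>2) \<le> e\<^sup>2"
    if N: "\<And>m. m \<ge> N \<Longrightarrow> dist (X m) (X n) < e" for e n N K
  proof (rule LIMSEQ_le_const2)
    show "(\<lambda>m. \<Sum>i<K. (cmod (ell2_nth (X m) i - ell2_nth (X n) i))\<^sup>2)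
        \<longlonglongrightarrow> (\<Sum>i<K. (cmod (x i - ell2_nth (X n) i))\<^sup>2)"
      by (intro tendsto_sum tendsto_power tendsto_norm tendsto_diff x tendsto_const)
    have "(\<Sum>i<K. (cmod (ell2_nth (X m) i - ell2_nth (X n) i))\<^sup>2) \<le> e\<^sup>2" if "m \<ge> N" for m
    proof -
      have "(\<Sum>i<K. (cmod (ell2_nth (X m - X n) i))\<^sup>2) \<le> (norm (X m - X n))\<^sup>2"
        by (rule sum_le_norm_ell2)
      also have "\<dots> \<le> e\<^sup>2"
        using N[OF that] by (intro power_mono) (auto simp: dist_norm)
      finally show ?thesis by (simp add: minus_ell2.rep_eq)
    qed
    then show "\<exists>N. \<forall>m\<ge>N. (\<Sum>i<K. (cmod (ell2_nth (X m) i - ell2_nth (X n) i))\<^sup>2) \<le> e\<^sup>2" by blast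
  qed
  have summ: "summable (\<lambda>i. (cmod (x i - ell2_nth (X n) i))\<^sup>2)"
    if N: "\<And>m. m \<ge> N \<Longrightarrow> dist (X m) (X n) < e" for e n N
    by (rule summableI_nonneg_bounded[where x = "e\<^sup>2"]) (auto intro: part[OF N])
  obtain N1 where N1: "\<And>m n. m \<ge> N1 \<Longrightarrow> n \<ge> N1 \<Longrightarrow> dist (X m) (X n) < 1"
    using metric_CauchyD[OF X, of 1] by auto
  have "summable (\<lambda>i. (cmod ((x i - ell2_nth (X N1) i) + ell2_nth (X N1) i))\<^sup>2)"
    by (rule summable_sq_add[OF summ[where N = N1 and e = 1] ell2_summable]) (auto intro: N1)
  then have xs: "summable (\<lambda>i. (cmod (x i))\<^sup>2)" by simp
  define L where "L = Abs_ell2 x"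
  have L: "ell2_nth L = x" unfolding L_def by (rule Abs_ell2_inverse) (use xs in simp)
  have "X \<longlonglongrightarrow> L"
  proof (rule metric_LIMSEQ_I)
    fix r :: real assume r: "0 < r"
    then obtain N where N: "\<And>m n. m \<ge> N \<Longrightarrow> n \<ge> N \<Longrightarrow> dist (X m) (X n) < r / 2"
      using metric_CauchyD[OF X, of "r/2"] by auto
    have "dist (X n) L < r" if n: "n \<ge> N" for n
    proof -
      have Nn: "\<And>m. m \<ge> N \<Longrightarrow> dist (X m) (X n) < r / 2" using N n by blast
      have "(norm (L - X n))\<^sup>2 = (\<Sum>i. (cmod (x i - ell2_nth (X n) i))\<^sup>2)"
        by (simp add: norm_ell2_sq minus_ell2.rep_eq L)
      also have "\<dots> \<le> (r / 2)\<^sup>2"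
        by (rule suminf_le_const[OF summ[OF Nn] part[OF Nn]])
      finally have "norm (L - X n) \<le> r / 2" by (rule power2_le_imp_le) (use r in simp)
      then show ?thesis using r by (simp add: dist_norm norm_minus_commute)
    qed
    then show "\<exists>N. \<forall>n\<ge>N. dist (X n) L < r" by blast
  qed
  then show "convergent X" by (auto simp: convergent_def)
qed

instantiation ell2 :: complex_hilbert
begin

definition cinner_ell2 :: "ell2 \<Rightarrow> ell2 \<Rightarrow> complex" where
  "cinner_ell2 x y = (\<Sum>i. cnj (ell2_nth x i) * ell2_nth y i)"

instance
proof
  fix x y z :: ell2 and r :: real and c :: complex
  note summ = summable_prod[OF ell2_summable ell2_summable]
  show "r *\<^sub>R x = complex_of_real r *\<^sub>C x" by transfer simp
  show "cinner x y = cnj (cinner y x)"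
    unfolding cinner_ell2_def
    by (subst bounded_linear.suminf[OF bounded_linear_cnj summ]) (simp add: mult.commute)
  show "cinner x (y + z) = cinner x y + cinner x z"
    unfolding cinner_ell2_def
    by (subst suminf_add[OF summ summ]) (simp add: plus_ell2.rep_eq algebra_simps)
  show "cinner x (c *\<^sub>C y) = c * cinner x y"
    unfolding cinner_ell2_def
    by (subst suminf_mult[OF summ, symmetric]) (simp add: scaleC_ell2.rep_eq algebra_simps)
  show "inner x y = Re (cinner x y)" unfolding cinner_ell2_def inner_ell2_def ..
qed

end

lemma separable_ell2: "separable_space (euclidean :: ell2 topology)"
proof -
  define g :: "(rat \<times> rat) list \<Rightarrow> nat \<Rightarrow> complex" where
    "g q i = (if i < length q then Complex (of_rat (fst (q ! i))) (of_rat (snd (q ! i))) else 0)" for q i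
  have gs: "summable (\<lambda>i. (cmod (g q i))\<^sup>2)" for q
    by (rule summable_finite[of "{..<length q}"]) (auto simp: g_def)
  define D where "D = range (\<lambda>q. Abs_ell2 (g q))"
  have nth: "ell2_nth (Abs_ell2 (g q)) = g q" for q using gs by (simp add: Abs_ell2_inverse)
  have approx: "\<exists>p :: rat \<times> rat. cmod (z - Complex (of_rat (fst p)) (of_rat (snd p))) < e"
    if e: "e > 0" for z e
  proof -
    have "\<exists>q :: rat. \<bar>t - of_rat q\<bar> < e / 2" for t :: real
    proof -
      obtain q :: rat where "t - e / 2 < of_rat q" "of_rat q < t + e / 2"
        using of_rat_dense[of "t - e / 2" "t + e / 2"] e by auto
      then have "\<bar>t - of_rat q\<bar> < e / 2" by linarith
      then show ?thesis by blast
    qed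
    then obtain a b :: rat where "\<bar>Re z - of_rat a\<bar> < e / 2" "\<bar>Im z - of_rat b\<bar> < e / 2"
      by metis
    then have "cmod (z - Complex (of_rat a) (of_rat b)) < e"
      using cmod_le[of "z - Complex (of_rat a) (of_rat b)"] by simp
    then show ?thesis by (intro exI[of _ "(a, b)"]) simp
  qed
  have "x \<in> closure D" for x
  proof (subst closure_approachable, intro allI impI)
    fix e :: real assume e: "e > 0"
    let ?f = "\<lambda>i. (cmod (ell2_nth x i))\<^sup>2"
    obtain K where K: "norm (\<Sum>i. ?f (i + K)) < e\<^sup>2 / 2"
      using suminf_exist_split[OF _ ell2_summable, of "e\<^sup>2 / 2" x] e by auto
    define d where "d = sqrt (e\<^sup>2 / (2 * (real K + 1)))"
    have d: "d > 0" "d\<^sup>2 = e\<^sup>2 / (2 * (real K + 1))" using e by (auto simp: d_def)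
    have "\<forall>i. \<exists>p :: rat \<times> rat.
        cmod (ell2_nth x i - Complex (of_rat (fst p)) (of_rat (snd p))) < d"
      using approx[OF d(1)] by blast
    then obtain p :: "nat \<Rightarrow> rat \<times> rat" where p: "\<And>i.
        cmod (ell2_nth x i - Complex (of_rat (fst (p i))) (of_rat (snd (p i)))) < d"
      unfolding choice_iff by blast
    let ?q = "map p [0..<K]"
    let ?y = "Abs_ell2 (g ?q)"
    have "(norm (x - ?y))\<^sup>2 = (\<Sum>i. (cmod (ell2_nth x i - g ?q i))\<^sup>2)"
      by (simp add: norm_ell2_sq minus_ell2.rep_eq nth)
    also have "\<dots> = (\<Sum>i. (cmod (ell2_nth x (i + K) - g ?q (i + K)))\<^sup>2)
        + (\<Sum>i<K. (cmod (ell2_nth x i - g ?q i))\<^sup>2)"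
      using ell2_summable[of "x - ?y"]
      by (intro suminf_split_initial_segment) (simp add: minus_ell2.rep_eq nth)
    also have "(\<Sum>i. (cmod (ell2_nth x (i + K) - g ?q (i + K)))\<^sup>2) = (\<Sum>i. ?f (i + K))"
      by (simp add: g_def)
    also have "(\<Sum>i<K. (cmod (ell2_nth x i - g ?q i))\<^sup>2) \<le> (\<Sum>i<K. d\<^sup>2)"
      using p by (intro sum_mono power_mono) (auto simp: g_def less_imp_le)
    also have "(\<Sum>i<K. d\<^sup>2) \<le> e\<^sup>2 / 2"
    proof -
      have "(\<Sum>i<K. d\<^sup>2) = (e\<^sup>2 / 2) * (real K / (real K + 1))" by (simp add: d(2))
      also have "\<dots> \<le> (e\<^sup>2 / 2) * 1" by (intro mult_left_mono) auto
      finally show ?thesis by simp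
    qed
    finally have "(norm (x - ?y))\<^sup>2 < e\<^sup>2" using K by simp
    then have "norm (x - ?y) < e" by (rule power2_less_imp_less) (use e in simp)
    then show "\<exists>y\<in>D. dist y x < e"
      by (intro bexI[of _ ?y]) (auto simp: D_def dist_norm norm_minus_commute)
  qed
  then have "closure D = UNIV" by blast
  moreover have "countable D" unfolding D_def by simp
  ultimately show ?thesis
    unfolding separable_space_def by (auto intro!: exI[of _ D])
qed


section \<open>Operators on Hilbert spaces\<close>

definition selfadjoint_compact :: "('h::complex_hilbert \<Rightarrow> 'h) \<Rightarrow> bool" where
  "selfadjoint_compact a \<longleftrightarrow>
     Vector_Spaces.linear scaleC scaleC a \<and>
     compact (closure (a ` cball 0 1)) \<and>
     (\<forall>x y. cinner (a x) y = cinner x (a y))"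

definition eigenspace :: "('h::complex_hilbert \<Rightarrow> 'h) \<Rightarrow> real \<Rightarrow> 'h set" where
  "eigenspace a t = {x. a x = t *\<^sub>R x}"

definition orth_proj :: "'h::complex_hilbert set \<Rightarrow> 'h \<Rightarrow> 'h" where
  "orth_proj S x = (THE y. y \<in> S \<and> (\<forall>z\<in>S. cinner z (x - y) = 0))"

text \<open>
  Functional calculus \<open>f(a) = \<Sum>\<^sub>t f(t) E\<^sub>t\<close> of a selfadjoint compact operator, where
  \<open>E\<^sub>t\<close> is the projection onto the eigenspace of \<open>t\<close>. The (at most countable) sum over all eigenvalues,
  possibly including \<open>0\<close>, converges strongly for bounded \<open>f\<close>; it is finite if \<open>f\<close> vanishes near \<open>0\<close>.
\<close>

definition op_fun :: "(real \<Rightarrow> real) \<Rightarrow> ('h::complex_hilbert \<Rightarrow> 'h) \<Rightarrow> 'h \<Rightarrow> 'h" where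
  "op_fun f a x = (\<Sum>\<^sub>\<infinity>t\<in>{t. eigenspace a t \<noteq> {0}}. f t *\<^sub>R orth_proj (eigenspace a t) x)"

definition orthonormal_basis :: "'h::complex_hilbert set \<Rightarrow> bool" where
  "orthonormal_basis E \<longleftrightarrow>
     (\<forall>e\<in>E. norm e = 1) \<and> (\<forall>e\<in>E. \<forall>e'\<in>E. e \<noteq> e' \<longrightarrow> cinner e e' = 0) \<and>
     closure (cspan E) = UNIV"

text \<open>For trace-class operators the value does not depend on the chosen basis.\<close>

definition op_trace :: "('h::complex_hilbert \<Rightarrow> 'h) \<Rightarrow> complex" where
  "op_trace a = (\<Sum>\<^sub>\<infinity>e\<in>(SOME E. orthonormal_basis E). cinner e (a e))"


section \<open>Matrices\<close>

definition unitary_group :: "nat \<Rightarrow> complex mat set" where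
  "unitary_group n =
     {V \<in> carrier_mat n n. V * mat_adjoint V = 1\<^sub>m n \<and> mat_adjoint V * V = 1\<^sub>m n}"

definition mat_trace :: "complex mat \<Rightarrow> complex" where
  "mat_trace A = (\<Sum>i<dim_row A. A $$ (i, i))"

definition vec_l2norm :: "complex Matrix.vec \<Rightarrow> real" where
  "vec_l2norm v = sqrt (\<Sum>i<dim_vec v. (cmod (vec_index v i))\<^sup>2)"

definition mat_op_norm :: "complex mat \<Rightarrow> real" where
  "mat_op_norm A =
     (SUP v\<in>{v \<in> carrier_vec (dim_col A). vec_l2norm v \<le> 1}. vec_l2norm (A *\<^sub>v v))"

text \<open>
  Functional calculus of a Hermitian matrix through a unitary diagonalisation; the result does not
  depend on the diagonalisation.
\<close>

definition mat_fun :: "nat \<Rightarrow> (real \<Rightarrow> real) \<Rightarrow> complex mat \<Rightarrow> complex mat" where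
  "mat_fun n f A = (THE F. \<exists>V\<in>unitary_group n. \<exists>d :: nat \<Rightarrow> real.
     A = V * mat_diag n (\<lambda>i. complex_of_real (d i)) * mat_adjoint V \<and>
     F = V * mat_diag n (\<lambda>i. complex_of_real (f (d i))) * mat_adjoint V)"

definition mat_prod :: "nat \<Rightarrow> complex mat list \<Rightarrow> complex mat" where
  "mat_prod n As = foldr (*) As (1\<^sub>m n)"


section \<open>Convergence in compact distribution\<close>

definition C0b :: "(real \<Rightarrow> real) set" where
  "C0b = {f. continuous_on UNIV f \<and> bounded (range f) \<and> (\<exists>\<epsilon>>0. \<forall>t. \<bar>t\<bar> < \<epsilon> \<longrightarrow> f t = 0)}"

definition converges_in_compact_distribution ::
  "nat \<Rightarrow> (nat \<Rightarrow> nat \<Rightarrow> complex mat) \<Rightarrow> (nat \<Rightarrow> 'h::complex_hilbert \<Rightarrow> 'h) \<Rightarrow> bool" where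
  "converges_in_compact_distribution k A a \<longleftrightarrow>
     (\<forall>f :: nat \<Rightarrow> real \<Rightarrow> real. (\<forall>i<k. f i \<in> C0b) \<longrightarrow>
       (\<forall>is :: nat list. is \<noteq> [] \<and> set is \<subseteq> {..<k} \<longrightarrow>
         (\<lambda>n. mat_trace (mat_prod n (map (\<lambda>i. mat_fun n (f i) (A n i)) is)))
           \<longlonglongrightarrow> op_trace (foldr (\<circ>) (map (\<lambda>i. op_fun (f i) (a i)) is) id)))"


section \<open>Non-commutative probability spaces and convergence of *-moments\<close>

definition nc_probability :: "('b::complex_star_algebra \<Rightarrow> complex) \<Rightarrow> bool" where
  "nc_probability \<tau> \<longleftrightarrow>
     Vector_Spaces.linear scaleC (*) \<tau> \<and>
     \<tau> 1 = 1 \<and>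
     (\<forall>x y. \<tau> (x * y) = \<tau> (y * x)) \<and>
     (\<forall>x. \<tau> (star x * x) \<in> \<real>\<^sub>\<ge>\<^sub>0) \<and>
     (\<forall>x. \<tau> (star x) = cnj (\<tau> x))"

text \<open>In a word \<open>[(j\<^sub>1, s\<^sub>1), \<dots>]\<close> the flag \<open>s\<close> says whether the adjoint is taken.\<close>

definition converges_in_distribution ::
  "nat \<Rightarrow> (nat \<Rightarrow> nat \<Rightarrow> complex mat) \<Rightarrow>
   (nat \<Rightarrow> 'b::complex_star_algebra) \<Rightarrow> ('b \<Rightarrow> complex) \<Rightarrow> bool" where
  "converges_in_distribution l B b \<tau> \<longleftrightarrow>
     (\<forall>w :: (nat \<times> bool) list. w \<noteq> [] \<and> fst ` set w \<subseteq> {..<l} \<longrightarrow>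
       (\<lambda>n. mat_trace
            (mat_prod n (map (\<lambda>(j, s). if s then mat_adjoint (B n j) else B n j) w)) / of_nat n)
         \<longlonglongrightarrow> \<tau> (prod_list (map (\<lambda>(j, s). if s then star (b j) else b j) w)))"


section \<open>Non-commutative *-polynomials\<close>

text \<open>
  \<open>X_var i\<close> is a selfadjoint variable, \<open>Y_var j False\<close> is the variable \<open>y\<^sub>j\<close> and \<open>Y_var j True\<close> its adjoint.
  A *-polynomial is a finitely supported family of coefficients on words.
\<close>

datatype letter = X_var nat | Y_var nat bool

type_synonym nc_poly = "letter list \<Rightarrow>\<^sub>0 complex"

primrec letter_star :: "letter \<Rightarrow> letter" where
  "letter_star (X_var i) = X_var i"
| "letter_star (Y_var j s) = Y_var j (\<not> s)"

definition nc_star :: "nc_poly \<Rightarrow> nc_poly" where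
  "nc_star P =
     (\<Sum>w\<in>Poly_Mapping.keys P. Poly_Mapping.single (rev (map letter_star w)) (cnj (Poly_Mapping.lookup P w)))"

definition nc_poly_in :: "nat \<Rightarrow> nat \<Rightarrow> nc_poly \<Rightarrow> bool" where
  "nc_poly_in k l P \<longleftrightarrow>
     (\<forall>w\<in>Poly_Mapping.keys P. set w \<subseteq> X_var ` {..<k} \<union> {Y_var j s | j s. j < l})"

text \<open>The *-polynomial \<open>P(0,\<dots>,0,y\<^sub>1,\<dots>)\<close>: monomials containing some \<open>x\<^sub>i\<close> become zero.\<close>

definition subst_X_zero :: "nc_poly \<Rightarrow> nc_poly" where
  "subst_X_zero P =
     (\<Sum>w\<in>Poly_Mapping.keys P. if \<exists>i. X_var i \<in> set w then 0 else Poly_Mapping.single w (Poly_Mapping.lookup P w))"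

primrec letter_eval ::
  "(nat \<Rightarrow> complex mat) \<Rightarrow> (nat \<Rightarrow> complex mat) \<Rightarrow> letter \<Rightarrow> complex mat" where
  "letter_eval A B (X_var i) = A i"
| "letter_eval A B (Y_var j s) = (if s then mat_adjoint (B j) else B j)"

definition nc_eval ::
  "nat \<Rightarrow> nc_poly \<Rightarrow> (nat \<Rightarrow> complex mat) \<Rightarrow> (nat \<Rightarrow> complex mat) \<Rightarrow> complex mat" where
  "nc_eval n P A B = Matrix.mat n n (\<lambda>ij.
     \<Sum>w\<in>Poly_Mapping.keys P. Poly_Mapping.lookup P w * (mat_prod n (map (letter_eval A B) w) $$ ij))"


section \<open>Haar unitary random matrices\<close>

text \<open>
  The Borel \<open>\<sigma>\<close>-algebra of the unitary group is generated by the matrix entries. The normalized Haar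
  measure is the translation-invariant probability measure on it.
\<close>

definition unitary_borel :: "nat \<Rightarrow> complex mat measure" where
  "unitary_borel n = vimage_algebra (unitary_group n)
     (\<lambda>V. \<lambda>ij\<in>{..<n} \<times> {..<n}. V $$ ij) (\<Pi>\<^sub>M ij\<in>{..<n} \<times> {..<n}. borel)"

definition normalized_haar :: "nat \<Rightarrow> complex mat measure \<Rightarrow> bool" where
  "normalized_haar n \<mu> \<longleftrightarrow>
     prob_space \<mu> \<and> sets \<mu> = sets (unitary_borel n) \<and>
     (\<forall>V\<in>unitary_group n.
        distr \<mu> (unitary_borel n) (\<lambda>W. V * W) = \<mu> \<and>
        distr \<mu> (unitary_borel n) (\<lambda>W. W * V) = \<mu>)"

definition haar_unitary :: "'w measure \<Rightarrow> nat \<Rightarrow> ('w \<Rightarrow> complex mat) \<Rightarrow> bool" where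
  "haar_unitary M n U \<longleftrightarrow>
     U \<in> measurable M (unitary_borel n) \<and> normalized_haar n (distr M (unitary_borel n) U)"


section \<open>Convergence in eigenvalues\<close>

text \<open>
  For a multiplicity function \<open>m\<close>, \<open>pos_eigenvalues m\<close> lists the positive eigenvalues in nonincreasing
  order according to multiplicity and, if there are only finitely many of them, continues with
  zeros: a sequence of nonnegative numbers in which each \<open>t > 0\<close> occurs exactly \<open>m t\<close> times.
  (An eigenvalue \<open>0\<close> never changes this list.) Likewise for \<open>neg_eigenvalues\<close>. Indices start at 0.
\<close>

definition pos_eigenvalues :: "(real \<Rightarrow> nat) \<Rightarrow> nat \<Rightarrow> real" where
  "pos_eigenvalues m = (THE s. decseq s \<and> (\<forall>i. 0 \<le> s i) \<and>
     (\<forall>t>0. finite {i. s i = t} \<and> card {i. s i = t} = m t))"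

definition neg_eigenvalues :: "(real \<Rightarrow> nat) \<Rightarrow> nat \<Rightarrow> real" where
  "neg_eigenvalues m = (THE s. incseq s \<and> (\<forall>i. s i \<le> 0) \<and>
     (\<forall>t<0. finite {i. s i = t} \<and> card {i. s i = t} = m t))"

definition mat_multiplicity :: "complex mat \<Rightarrow> real \<Rightarrow> nat" where
  "mat_multiplicity A t = Polynomial.order (complex_of_real t) (char_poly A)"

definition op_multiplicity :: "('h::complex_hilbert \<Rightarrow> 'h) \<Rightarrow> real \<Rightarrow> nat" where
  "op_multiplicity a t = cdim (eigenspace a t)"

definition converges_in_eigenvalues ::
  "(nat \<Rightarrow> complex mat) \<Rightarrow> ('h::complex_hilbert \<Rightarrow> 'h) \<Rightarrow> bool" where
  "converges_in_eigenvalues A a \<longleftrightarrow>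
     (\<forall>i. (\<lambda>n. pos_eigenvalues (mat_multiplicity (A n)) i)
            \<longlonglongrightarrow> pos_eigenvalues (op_multiplicity a) i) \<and>
     (\<forall>i. (\<lambda>n. neg_eigenvalues (mat_multiplicity (A n)) i)
            \<longlonglongrightarrow> neg_eigenvalues (op_multiplicity a) i)"

end

theory Submission
  imports Defs
begin

text \<open>
  Since \<open>P(0, y) = 0\<close>, every monomial contains some \<open>x\<^sub>i\<close>. Soft thresholding replaces \<open>A\<^sub>i(n)\<close>, up to
  \<open>\<epsilon>\<close> in operator norm, by a matrix \<open>F\<^sub>i(n)\<close> whose rank stays bounded in \<open>n\<close> because of the convergence
  in compact distribution; by Weyl's inequality this moves the ordered eigenvalues of \<open>P\<close> by \<open>O(\<epsilon>)\<close>.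

  For words \<open>W\<close> in the \<open>B\<^sub>j(n)\<close> and fixed vectors \<open>x, y\<close> of norm at most 1, the sesquilinear form of \<open>U W U\<^sup>*\<close>
  at \<open>(x, y)\<close> is almost surely asymptotic to \<open>tr\<^sub>n(W)\<close> times the inner product of \<open>x\<close> and \<open>y\<close>. By
  polarisation and diagonalisation this reduces to a fourth moment bound for \<open>\<Sum> c\<^sub>i |(U\<^sup>* x)\<^sub>i|\<^sup>2\<close> with
  \<open>\<Sum> c\<^sub>i = 0\<close>, which follows from exchangeability and an eighth moment bound for one coordinate, and
  Borel-Cantelli. Expanding the \<open>F\<^sub>i(n)\<close> in boundedly many eigenvectors turns this into
  \<open>Tr(F\<^bsub>i1\<^esub> U W\<^sub>1 U\<^sup>* F\<^bsub>i2\<^esub> U W\<^sub>2 U\<^sup>* \<dots>) - tr\<^sub>n(W\<^sub>1) tr\<^sub>n(W\<^sub>2) \<dots> Tr(F\<^bsub>i1\<^esub> F\<^bsub>i2\<^esub> \<dots>) \<rightarrow> 0\<close>.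
  Hence all moments of the truncated polynomial converge to deterministic limits, and these determine
  the limits of its ordered eigenvalues.
\<close>

text \<open>The obstacle is uniformity in n: the matrices, their eigenvectors and U(n) all change
  with n, and nothing ties the U(n) for different n together, so almost sure convergence has to come
  from a summable moment bound. The second moment of a centred quadratic form is only of order 1/n;
  the fourth is of order 1/n^2. Apart from absorbing the unitary that diagonalises W, its estimate
  uses Haar invariance in two ways only: permuting coordinates, and rotating one coordinate into the
  direction of a sign vector. Almost sure statements survive only countable intersections. The forms
  are therefore tested on eigenvectors of the deterministic A_i(n) with thresholds 1/(m+1), so that
  words, indices and thresholds range over countable sets. The limit operator only has to have the
  right eigenvalues, so a diagonal operator on square-summable sequences can be taken; what needs
  proof is that the limiting eigenvalues tend to 0.\<close>

section \<open>Adjoints, norms and traces of complex matrices\<close>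

lemma mat_adjoint_dims [simp]:
  "dim_row (mat_adjoint A) = dim_col A" "dim_col (mat_adjoint A) = dim_row A"
  by (auto simp: mat_adjoint_def)

lemma mat_adjoint_carrier [simp]:
  "A \<in> carrier_mat n m \<Longrightarrow> mat_adjoint A \<in> carrier_mat m n"
  by (intro carrier_matI) auto

lemma mat_adjoint_index [simp]:
  fixes A :: "complex mat"
  assumes "i < dim_col A" "j < dim_row A"
  shows "mat_adjoint A $$ (i, j) = cnj (A $$ (j, i))"
  using assms by (simp add: mat_adjoint_def mat_of_rows_index)

lemma mat_adjoint_adjoint [simp]: "mat_adjoint (mat_adjoint A) = (A :: complex mat)"
  by (rule eq_matI) auto

lemma mat_adjoint_mult:
  fixes A B :: "complex mat"
  assumes "A \<in> carrier_mat n m" "B \<in> carrier_mat m p"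
  shows "mat_adjoint (A * B) = mat_adjoint B * mat_adjoint A"
  using assms by (intro eq_matI) (auto simp: scalar_prod_def mult.commute)

lemma mat_adjoint_one [simp]: "mat_adjoint (1\<^sub>m n) = (1\<^sub>m n :: complex mat)"
  by (rule eq_matI) auto

lemma unitary_groupD:
  assumes "V \<in> unitary_group n"
  shows "V \<in> carrier_mat n n" "mat_adjoint V \<in> carrier_mat n n"
    "V * mat_adjoint V = 1\<^sub>m n" "mat_adjoint V * V = 1\<^sub>m n"
  using assms by (auto simp: unitary_group_def)

lemma unitary_group_adjoint: "V \<in> unitary_group n \<Longrightarrow> mat_adjoint V \<in> unitary_group n"
  by (auto simp: unitary_group_def)

lemma unitary_cancel:
  assumes "V \<in> unitary_group n" "D \<in> carrier_mat n p"
  shows "V * (mat_adjoint V * D) = D" "mat_adjoint V * (V * D) = D"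
  using unitary_groupD[OF assms(1)] assms(2)
  by (simp_all flip: assoc_mult_mat[of _ n n _ n D p])

lemma unitary_group_mult:
  assumes "V \<in> unitary_group n" "W \<in> unitary_group n"
  shows "V * W \<in> unitary_group n"
proof -
  note V = unitary_groupD[OF assms(1)] and W = unitary_groupD[OF assms(2)]
  have "V * W * (mat_adjoint W * mat_adjoint V) = 1\<^sub>m n"
    using assoc_mult_mat[OF V(1) W(1) mult_carrier_mat[OF W(2) V(2)]] unitary_cancel(1)[OF assms(2) V(2)] V(3)
    by simp
  moreover have "mat_adjoint W * mat_adjoint V * (V * W) = 1\<^sub>m n"
    using assoc_mult_mat[OF W(2) V(2) mult_carrier_mat[OF V(1) W(1)]] unitary_cancel(2)[OF assms(1) W(1)] W(4)
    by simp
  ultimately show ?thesis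
    using V W mat_adjoint_mult[OF V(1) W(1)] by (simp add: unitary_group_def)
qed

section \<open>Inner product and Euclidean norm of vectors\<close>

lemma cscalar_prod_conv: "v \<bullet>c u = (\<Sum>i<dim_vec u. v $ i * cnj (u $ i))"
  for u v :: "complex Matrix.vec"
  by (simp add: scalar_prod_def atLeast0LessThan)

lemma mult_mat_vec_conv:
  "i < dim_row A \<Longrightarrow> (A *\<^sub>v v) $ i = (\<Sum>j<dim_vec v. A $$ (i, j) * v $ j)" if "dim_col A = dim_vec v"
  using that by (simp add: scalar_prod_def atLeast0LessThan)

lemma mult_mat_conv:
  "A \<in> carrier_mat n m \<Longrightarrow> B \<in> carrier_mat m p \<Longrightarrow> i < n \<Longrightarrow> j < p \<Longrightarrow>
    (A * B) $$ (i, j) = (\<Sum>k<m. A $$ (i, k) * B $$ (k, j))"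
  by (simp add: scalar_prod_def atLeast0LessThan)

lemma cscalar_prod_adjoint:
  fixes A :: "complex mat"
  assumes "A \<in> carrier_mat n m" "v \<in> carrier_vec m" "u \<in> carrier_vec n"
  shows "(A *\<^sub>v v) \<bullet>c u = v \<bullet>c (mat_adjoint A *\<^sub>v u)"
proof -
  have "(A *\<^sub>v v) \<bullet>c u = (\<Sum>i<n. \<Sum>j<m. A $$ (i, j) * v $ j * cnj (u $ i))"
    using assms by (simp add: cscalar_prod_conv mult_mat_vec_conv sum_distrib_right del: index_mult_mat_vec)
  also have "\<dots> = (\<Sum>j<m. \<Sum>i<n. A $$ (i, j) * v $ j * cnj (u $ i))" by (rule sum.swap)
  also have "\<dots> = v \<bullet>c (mat_adjoint A *\<^sub>v u)"
    using assms by (simp add: cscalar_prod_conv mult_mat_vec_conv sum_distrib_left mult_ac del: index_mult_mat_vec)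
  finally show ?thesis .
qed

lemma vec_l2norm_sq: "(vec_l2norm v)\<^sup>2 = (\<Sum>i<dim_vec v. (cmod (v $ i))\<^sup>2)"
  by (simp add: vec_l2norm_def sum_nonneg)

lemma vec_l2norm_nonneg [simp]: "0 \<le> vec_l2norm v"
  by (simp add: vec_l2norm_def sum_nonneg)

lemma vec_l2norm_L2: "vec_l2norm v = L2_set (\<lambda>i. cmod (v $ i)) {..<dim_vec v}"
  by (simp add: vec_l2norm_def L2_set_def)

lemma cscalar_prod_self: "v \<bullet>c v = complex_of_real ((vec_l2norm v)\<^sup>2)"
  by (simp add: cscalar_prod_conv vec_l2norm_sq complex_norm_square [symmetric] flip: of_real_power)

lemma vec_l2norm_eq_0: "v \<in> carrier_vec n \<Longrightarrow> vec_l2norm v = 0 \<longleftrightarrow> v = 0\<^sub>v n"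
  using cscalar_prod_self[of v] conjugate_square_eq_0_vec[of v n] by auto

lemma vec_l2norm_triangle:
  assumes "u \<in> carrier_vec n" "v \<in> carrier_vec n"
  shows "vec_l2norm (u + v) \<le> vec_l2norm u + vec_l2norm v"
proof -
  have "vec_l2norm (u + v) \<le> L2_set (\<lambda>i. cmod (u $ i) + cmod (v $ i)) {..<n}"
    using assms by (auto simp: vec_l2norm_L2 intro!: L2_set_mono norm_triangle_ineq)
  also have "\<dots> \<le> vec_l2norm u + vec_l2norm v"
    using assms L2_set_triangle_ineq by (auto simp: vec_l2norm_L2)
  finally show ?thesis .
qed

lemma vec_l2norm_smult: "vec_l2norm (c \<cdot>\<^sub>v v) = cmod c * vec_l2norm v"
proof -
  have "vec_l2norm (c \<cdot>\<^sub>v v) = L2_set (\<lambda>i. cmod c * cmod (v $ i)) {..<dim_vec v}"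
    unfolding vec_l2norm_L2 by (rule L2_set_cong) (auto simp: norm_mult)
  then show ?thesis by (simp add: vec_l2norm_L2 L2_set_right_distrib)
qed

lemma vec_l2norm_zero [simp]: "vec_l2norm (0\<^sub>v n) = 0"
  by (simp add: vec_l2norm_def)

lemma cscalar_prod_bound:
  assumes "u \<in> carrier_vec n" "v \<in> carrier_vec n"
  shows "cmod (v \<bullet>c u) \<le> vec_l2norm v * vec_l2norm u"
proof -
  have "cmod (v \<bullet>c u) \<le> (\<Sum>i<n. \<bar>cmod (v $ i)\<bar> * \<bar>cmod (u $ i)\<bar>)"
    using assms by (auto simp: cscalar_prod_conv norm_mult intro!: sum_norm_le)
  also have "\<dots> \<le> vec_l2norm v * vec_l2norm u"
    using assms L2_set_mult_ineq[where A = "{..<n}" and f = "\<lambda>i. cmod (v $ i)" and g = "\<lambda>i. cmod (u $ i)"]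
    by (simp add: vec_l2norm_L2)
  finally show ?thesis .
qed

lemma vec_l2norm_unitary:
  assumes "V \<in> unitary_group n" "v \<in> carrier_vec n"
  shows "vec_l2norm (V *\<^sub>v v) = vec_l2norm v"
proof -
  note V = unitary_groupD[OF assms(1)]
  have "(V *\<^sub>v v) \<bullet>c (V *\<^sub>v v) = v \<bullet>c (mat_adjoint V *\<^sub>v (V *\<^sub>v v))"
    using V assms by (subst cscalar_prod_adjoint[of _ n n]) auto
  also have "mat_adjoint V *\<^sub>v (V *\<^sub>v v) = v"
    using V assms by (subst assoc_mult_mat_vec[symmetric, of _ n n _ n]) auto
  finally have "(vec_l2norm (V *\<^sub>v v))\<^sup>2 = (vec_l2norm v)\<^sup>2"
    by (simp only: cscalar_prod_self of_real_eq_iff)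
  then show ?thesis by (simp add: power2_eq_iff_nonneg)
qed

text \<open>A norm bound tested on vectors, with the dimension built in. It passes through sums,
  products and adjoints without touching the supremum in \<open>mat_op_norm\<close>.\<close>

definition op_bounded :: "nat \<Rightarrow> real \<Rightarrow> complex mat \<Rightarrow> bool" where
  "op_bounded n C W \<longleftrightarrow> 0 \<le> C \<and> W \<in> carrier_mat n n \<and>
     (\<forall>v\<in>carrier_vec n. vec_l2norm (W *\<^sub>v v) \<le> C * vec_l2norm v)"

lemma op_bounded_mono: "op_bounded n C W \<Longrightarrow> C \<le> D \<Longrightarrow> op_bounded n D W"
  unfolding op_bounded_def using order_trans[OF _ mult_right_mono[OF _ vec_l2norm_nonneg]] by force

lemma op_bounded_mult:
  assumes "op_bounded n C V" "op_bounded n D W"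
  shows "op_bounded n (C * D) (V * W)"
  unfolding op_bounded_def
proof (intro conjI ballI)
  fix v :: "complex Matrix.vec" assume v: "v \<in> carrier_vec n"
  have VW: "V \<in> carrier_mat n n" "W \<in> carrier_mat n n" using assms by (auto simp: op_bounded_def)
  have "vec_l2norm (V * W *\<^sub>v v) = vec_l2norm (V *\<^sub>v (W *\<^sub>v v))"
    using VW v by (simp add: assoc_mult_mat_vec[of _ n n _ n])
  also have "\<dots> \<le> C * vec_l2norm (W *\<^sub>v v)"
    using assms VW v by (auto simp: op_bounded_def)
  also have "\<dots> \<le> C * (D * vec_l2norm v)"
    using assms v by (intro mult_left_mono) (auto simp: op_bounded_def)
  finally show "vec_l2norm (V * W *\<^sub>v v) \<le> C * D * vec_l2norm v" by simp
qed (use assms in \<open>auto simp: op_bounded_def\<close>)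

lemma op_bounded_add:
  assumes "op_bounded n C V" "op_bounded n D W"
  shows "op_bounded n (C + D) (V + W)"
  unfolding op_bounded_def
proof (intro conjI ballI)
  fix v :: "complex Matrix.vec" assume v: "v \<in> carrier_vec n"
  have VW: "V \<in> carrier_mat n n" "W \<in> carrier_mat n n" using assms by (auto simp: op_bounded_def)
  have "vec_l2norm ((V + W) *\<^sub>v v) \<le> vec_l2norm (V *\<^sub>v v) + vec_l2norm (W *\<^sub>v v)"
    using VW v by (simp add: add_mult_distrib_mat_vec[of _ n n] vec_l2norm_triangle[of _ n])
  also have "\<dots> \<le> C * vec_l2norm v + D * vec_l2norm v"
    using assms v by (intro add_mono) (auto simp: op_bounded_def)
  finally show "vec_l2norm ((V + W) *\<^sub>v v) \<le> (C + D) * vec_l2norm v" by (simp add: algebra_simps)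
qed (use assms in \<open>auto simp: op_bounded_def\<close>)

lemma op_bounded_smult:
  assumes "op_bounded n C V"
  shows "op_bounded n (cmod c * C) (c \<cdot>\<^sub>m V)"
  unfolding op_bounded_def
proof (intro conjI ballI)
  fix v :: "complex Matrix.vec" assume v: "v \<in> carrier_vec n"
  have V: "V \<in> carrier_mat n n" using assms by (auto simp: op_bounded_def)
  have "(c \<cdot>\<^sub>m V) *\<^sub>v v = c \<cdot>\<^sub>v (V *\<^sub>v v)" using V v by auto
  then show "vec_l2norm ((c \<cdot>\<^sub>m V) *\<^sub>v v) \<le> cmod c * C * vec_l2norm v"
    using assms v by (auto simp: op_bounded_def vec_l2norm_smult mult.assoc intro!: mult_left_mono)
qed (use assms in \<open>auto simp: op_bounded_def\<close>)

lemma op_bounded_zero: "op_bounded n 0 (0\<^sub>m n n)"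
proof -
  have "0\<^sub>m n n *\<^sub>v v = 0\<^sub>v n" if "v \<in> carrier_vec n" for v :: "complex Matrix.vec"
    using that by (intro eq_vecI) auto
  then show ?thesis by (auto simp: op_bounded_def)
qed

lemma op_bounded_unitary: "V \<in> unitary_group n \<Longrightarrow> op_bounded n 1 V"
  by (simp add: op_bounded_def vec_l2norm_unitary unitary_groupD(1))

lemma op_bounded_one: "op_bounded n 1 (1\<^sub>m n)"
  by (auto simp: op_bounded_def)

text \<open>With w the adjoint of V applied to v, the square of |w| equals the inner product of V w
  and v, so it is at most C |w| |v|; divide by |w|.\<close>

lemma op_bounded_adjoint:
  assumes "op_bounded n C V"
  shows "op_bounded n C (mat_adjoint V)"
  unfolding op_bounded_def
proof (intro conjI ballI)
  fix v :: "complex Matrix.vec" assume v: "v \<in> carrier_vec n"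
  have V: "V \<in> carrier_mat n n" using assms by (auto simp: op_bounded_def)
  define w where "w = mat_adjoint V *\<^sub>v v"
  have w: "w \<in> carrier_vec n" unfolding w_def using V v by (intro mult_mat_vec_carrier[of _ n n]) auto
  have "w \<bullet>c w = (V *\<^sub>v w) \<bullet>c v"
    using V v w by (simp add: cscalar_prod_adjoint[of V n n] w_def)
  then have "(vec_l2norm w)\<^sup>2 = cmod ((V *\<^sub>v w) \<bullet>c v)"
    by (metis cscalar_prod_self norm_of_real abs_of_nonneg zero_le_power2)
  also have "\<dots> \<le> vec_l2norm (V *\<^sub>v w) * vec_l2norm v"
    using V v w by (intro cscalar_prod_bound[of _ n]) auto
  also have "\<dots> \<le> C * vec_l2norm w * vec_l2norm v"
    using assms w by (intro mult_right_mono) (auto simp: op_bounded_def)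
  finally have "vec_l2norm w * vec_l2norm w \<le> (C * vec_l2norm v) * vec_l2norm w"
    by (simp add: power2_eq_square mult_ac)
  then have "vec_l2norm w \<le> C * vec_l2norm v"
    using assms by (cases "vec_l2norm w = 0") (auto simp: op_bounded_def less_le)
  then show "vec_l2norm (mat_adjoint V *\<^sub>v v) \<le> C * vec_l2norm v" by (simp add: w_def)
qed (use assms in \<open>auto simp: op_bounded_def\<close>)

text \<open>A crude bound by the norms of the rows. It shows that the supremum in
  \<open>mat_op_norm\<close> is taken over a set bounded above.\<close>

lemma vec_l2norm_mult_bounded:
  assumes "A \<in> carrier_mat n m"
  shows "\<exists>K\<ge>0. \<forall>v\<in>carrier_vec m. vec_l2norm (A *\<^sub>v v) \<le> K * vec_l2norm v"
proof (intro exI conjI ballI)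
  let ?r = "\<lambda>i. vec_l2norm (conjugate (Matrix.row A i))"
  show "0 \<le> (\<Sum>i<n. ?r i)" by (simp add: sum_nonneg)
  fix v :: "complex Matrix.vec" assume v: "v \<in> carrier_vec m"
  have "vec_l2norm (A *\<^sub>v v) \<le> (\<Sum>i<n. \<bar>cmod ((A *\<^sub>v v) $ i)\<bar>)"
    using assms L2_set_le_sum_abs[of "\<lambda>i. cmod ((A *\<^sub>v v) $ i)" "{..<n}"]
    by (simp add: vec_l2norm_L2 del: index_mult_mat_vec)
  also have "\<dots> \<le> (\<Sum>i<n. ?r i * vec_l2norm v)"
  proof (rule sum_mono)
    fix i assume i: "i \<in> {..<n}"
    have "(A *\<^sub>v v) $ i = v \<bullet>c conjugate (Matrix.row A i)"
      using assms v i comm_scalar_prod[of v m "Matrix.row A i"] by auto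
    then show "\<bar>cmod ((A *\<^sub>v v) $ i)\<bar> \<le> ?r i * vec_l2norm v"
      using cscalar_prod_bound[of "conjugate (Matrix.row A i)" m v] assms v i
      by (auto simp: mult.commute)
  qed
  finally show "vec_l2norm (A *\<^sub>v v) \<le> (\<Sum>i<n. ?r i) * vec_l2norm v"
    by (simp add: sum_distrib_right)
qed

lemma op_bounded_mat_op_norm:
  assumes "A \<in> carrier_mat n n" "mat_op_norm A \<le> C"
  shows "op_bounded n C A"
proof -
  obtain K where K: "K \<ge> 0" "\<And>v. v \<in> carrier_vec n \<Longrightarrow> vec_l2norm (A *\<^sub>v v) \<le> K * vec_l2norm v"
    using vec_l2norm_mult_bounded[OF assms(1)] by blast
  have bdd: "bdd_above ((\<lambda>v. vec_l2norm (A *\<^sub>v v)) ` {v \<in> carrier_vec n. vec_l2norm v \<le> 1})"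
  proof (rule bdd_aboveI2[of _ _ K])
    fix v assume "v \<in> {v \<in> carrier_vec n. vec_l2norm v \<le> 1}"
    then show "vec_l2norm (A *\<^sub>v v) \<le> K"
      using K(2)[of v] mult_left_mono[of "vec_l2norm v" 1 K] K(1) by simp
  qed
  have le: "vec_l2norm (A *\<^sub>v v) \<le> C" if "v \<in> carrier_vec n" "vec_l2norm v \<le> 1" for v
    using cSUP_upper[OF _ bdd, of v] that assms by (auto simp: mat_op_norm_def)
  \<comment> \<open>The zero vector is an admissible test vector in every dimension, including
    0.\<close>
  have "0 \<le> C" using order_trans[OF vec_l2norm_nonneg le[of "0\<^sub>v n"]] by simp
  moreover have "vec_l2norm (A *\<^sub>v v) \<le> C * vec_l2norm v" if v: "v \<in> carrier_vec n" for v
  proof (cases "vec_l2norm v = 0")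
    case True
    then have "v = 0\<^sub>v n" using v vec_l2norm_eq_0 by blast
    moreover have "A *\<^sub>v 0\<^sub>v n = 0\<^sub>v n" using assms(1) by auto
    ultimately show ?thesis by simp
  next
    case False
    then have pos: "vec_l2norm v > 0" using vec_l2norm_nonneg[of v] by linarith
    let ?c = "complex_of_real (1 / vec_l2norm v)"
    have "vec_l2norm (A *\<^sub>v (?c \<cdot>\<^sub>v v)) \<le> C"
      using v pos by (intro le) (auto simp: vec_l2norm_smult norm_divide)
    moreover have "A *\<^sub>v (?c \<cdot>\<^sub>v v) = ?c \<cdot>\<^sub>v (A *\<^sub>v v)"
      using assms v by (simp add: mult_mat_vec[of _ n n])
    ultimately show ?thesis using pos by (simp add: vec_l2norm_smult norm_divide field_simps)
  qed
  ultimately show ?thesis using assms(1) by (simp add: op_bounded_def)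
qed

section \<open>The trace and its cyclicity\<close>

lemma mat_trace_carrier: "A \<in> carrier_mat n n \<Longrightarrow> mat_trace A = (\<Sum>i<n. A $$ (i, i))"
  by (simp add: mat_trace_def)

lemma mat_trace_comm:
  assumes "A \<in> carrier_mat n m" "B \<in> carrier_mat m n"
  shows "mat_trace (A * B) = mat_trace (B * A)"
proof -
  have "mat_trace (A * B) = (\<Sum>i<n. \<Sum>j<m. A $$ (i, j) * B $$ (j, i))"
    using assms by (auto simp: mat_trace_def scalar_prod_def atLeast0LessThan)
  also have "\<dots> = (\<Sum>j<m. \<Sum>i<n. B $$ (j, i) * A $$ (i, j))"
    by (subst sum.swap) (simp add: mult.commute)
  also have "\<dots> = mat_trace (B * A)"
    using assms by (auto simp: mat_trace_def scalar_prod_def atLeast0LessThan)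
  finally show ?thesis .
qed

lemma mat_trace_add:
  assumes "A \<in> carrier_mat n n" "B \<in> carrier_mat n n"
  shows "mat_trace (A + B) = mat_trace A + mat_trace B"
  using assms by (simp add: mat_trace_def sum.distrib)

lemma mat_trace_smult: "A \<in> carrier_mat n n \<Longrightarrow> mat_trace (c \<cdot>\<^sub>m A) = c * mat_trace A"
  by (simp add: mat_trace_def sum_distrib_left)

lemma mat_trace_diag: "mat_trace (mat_diag n f) = (\<Sum>i<n. f i)"
  by (simp add: mat_trace_def mat_diag_def)

lemma mat_trace_conj_unitary:
  assumes "V \<in> unitary_group n" "W \<in> carrier_mat n n"
  shows "mat_trace (V * W * mat_adjoint V) = mat_trace W"
proof -
  note V = unitary_groupD[OF assms(1)]
  have "mat_trace (V * W * mat_adjoint V) = mat_trace (mat_adjoint V * (V * W))"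
    using V assms by (intro mat_trace_comm[of _ n n]) auto
  also have "mat_adjoint V * (V * W) = W"
    using V assms by (simp add: assoc_mult_mat[symmetric, of _ n n _ n _ n])
  finally show ?thesis .
qed

section \<open>Spectral theorem and functional calculus for Hermitian matrices\<close>

lemma unitary_groupI:
  assumes "V \<in> carrier_mat n n" "mat_adjoint V * V = 1\<^sub>m n"
  shows "V \<in> unitary_group n"
  using assms mat_mult_left_right_inverse[of "mat_adjoint V" n V] by (auto simp: unitary_group_def)

text \<open>Complete v to a basis and orthogonalise; Gram-Schmidt keeps the first vector, and only
  the normalisation rescales it. Used to split off an eigenvector in the spectral theorem and to
  rotate a Haar unitary towards a prescribed direction.\<close>

lemma unitary_with_first_column:
  fixes v :: "complex Matrix.vec"
  assumes v: "v \<in> carrier_vec n" "v \<noteq> 0\<^sub>v n" and n: "n \<noteq> 0"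
  shows "\<exists>W\<in>unitary_group n. \<exists>c. col W 0 = c \<cdot>\<^sub>v v"
proof -
  interpret cof_vec_space n "TYPE(complex)" .
  define b where "b = basis_completion v"
  define ws where "ws = gram_schmidt n b"
  from basis_completion[OF v, folded b_def]
  have span_b: "span (set b) = carrier_vec n" and dist_b: "distinct b"
    and indep: "\<not> lin_dep (set b)" and b: "set b \<subseteq> carrier_vec n" and hdb: "hd b = v"
    and len_b: "length b = n" by auto
  from hdb len_b n obtain vs where bv: "b = v # vs" by (cases b, auto)
  from gram_schmidt_result[OF b dist_b indep refl, folded ws_def]
  have ws: "set ws \<subseteq> carrier_vec n" "corthogonal ws" "length ws = n"
    by (auto simp: len_b)
  from gram_schmidt_hd[OF v(1), of vs, folded bv] have hdws: "hd ws = v" unfolding ws_def .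
  define c where "c i = complex_of_real (1 / vec_l2norm (ws ! i))" for i
  define W where "W = Matrix.mat n n (\<lambda>(i, j). c j * (ws ! j) $ i)"
  have wsc: "ws ! i \<in> carrier_vec n" if "i < n" for i using that ws by auto
  have nz: "vec_l2norm (ws ! i) \<noteq> 0" if "i < n" for i
  proof -
    have "ws ! i \<bullet>c ws ! i \<noteq> 0" using corthogonalD[OF ws(2)] ws(3) that by auto
    then show ?thesis by (simp add: cscalar_prod_self)
  qed
  have W: "W \<in> carrier_mat n n" by (simp add: W_def)
  have "mat_adjoint W * W = 1\<^sub>m n"
  proof (rule eq_matI)
    fix i j assume "i < dim_row (1\<^sub>m n :: complex mat)" "j < dim_col (1\<^sub>m n :: complex mat)"
    then have ij: "i < n" "j < n" by auto
    have "(mat_adjoint W * W) $$ (i, j) = (\<Sum>k<n. cnj (c i) * c j * ((ws ! j) $ k * cnj ((ws ! i) $ k)))"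
      using W ij mult_mat_conv[of "mat_adjoint W" n n W n i j]
      by (auto simp: W_def mult_ac intro!: sum.cong)
    also have "\<dots> = cnj (c i) * c j * (ws ! j \<bullet>c ws ! i)"
      using wsc[OF ij(1)] by (simp add: cscalar_prod_conv sum_distrib_left)
    also have "\<dots> = (if i = j then 1 else 0)"
    proof (cases "i = j")
      case True
      then show ?thesis using nz[OF ij(1)]
        by (simp add: cscalar_prod_self c_def power2_eq_square)
    next
      case False
      then have "ws ! j \<bullet>c ws ! i = 0" using corthogonalD[OF ws(2)] ws(3) ij by auto
      then show ?thesis using False by simp
    qed
    finally show "(mat_adjoint W * W) $$ (i, j) = 1\<^sub>m n $$ (i, j)" using ij by simp
  qed (use W in auto)
  then have "W \<in> unitary_group n" using W by (intro unitary_groupI)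
  moreover have "col W 0 = c 0 \<cdot>\<^sub>v v"
  proof -
    have "ws ! 0 = v" using hdws ws(3) n by (cases ws) auto
    then show ?thesis using n v by (intro eq_vecI) (auto simp: W_def)
  qed
  ultimately show ?thesis by blast
qed

text \<open>Deflation. Conjugating with a unitary whose first column is an eigenvector makes the
  first column of the matrix a multiple of the first unit vector. Hermitian symmetry clears the
  first row as well and makes the eigenvalue real, and the induction hypothesis applies to the
  remaining block.\<close>

theorem hermitian_spectral:
  fixes A :: "complex mat"
  assumes "A \<in> carrier_mat n n" "mat_adjoint A = A"
  shows "\<exists>V\<in>unitary_group n. \<exists>d :: nat \<Rightarrow> real.
    A = V * mat_diag n (\<lambda>i. complex_of_real (d i)) * mat_adjoint V"
  using assms
proof (induction n arbitrary: A)
  case 0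
  have "A = 1\<^sub>m 0 * mat_diag 0 (\<lambda>i. complex_of_real 0) * mat_adjoint (1\<^sub>m 0)"
    by (rule eq_matI) (use 0 in auto)
  then show ?case by (intro bexI[of _ "1\<^sub>m 0"] exI[of _ "\<lambda>_. 0"]) (auto simp: unitary_group_def)
next
  case (Suc n A)
  let ?N = "Suc n"
  note A = Suc.prems(1)
  obtain as where as: "char_poly A = (\<Prod>a\<leftarrow>as. [:- a, 1:])" "length as = ?N"
    using char_poly_factorized[OF A] by blast
  then obtain e0 es where "as = e0 # es" by (cases as) auto
  then have "poly (char_poly A) e0 = 0" using as by simp
  then have "eigenvalue A e0" using eigenvalue_root_char_poly[OF A] by blast
  then obtain v where v: "v \<in> carrier_vec ?N" "v \<noteq> 0\<^sub>v ?N" "A *\<^sub>v v = e0 \<cdot>\<^sub>v v"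
    using A unfolding eigenvalue_def eigenvector_def by auto
  obtain W c where W: "W \<in> unitary_group ?N" "col W 0 = c \<cdot>\<^sub>v v"
    using unitary_with_first_column[OF v(1,2)] by blast
  note WD = unitary_groupD[OF W(1)]
  define A' where "A' = mat_adjoint W * (A * W)"
  have A': "A' \<in> carrier_mat ?N ?N" using WD A by (simp add: A'_def mult_carrier_mat[of _ ?N ?N])
  have herm: "mat_adjoint A' = A'"
  proof -
    have "mat_adjoint A' = mat_adjoint (A * W) * W"
      using WD A by (simp add: A'_def mat_adjoint_mult[of _ ?N ?N _ ?N])
    also have "mat_adjoint (A * W) = mat_adjoint W * A"
      using WD A Suc.prems(2) by (simp add: mat_adjoint_mult[of _ ?N ?N _ ?N])
    finally show ?thesis using WD A by (simp add: A'_def assoc_mult_mat[of _ ?N ?N _ ?N _ ?N])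
  qed
  have sym: "A' $$ (i, j) = cnj (A' $$ (j, i))" if "i < ?N" "j < ?N" for i j
    using arg_cong[OF herm, of "\<lambda>M. M $$ (i, j)"] that A' by auto
  have "A *\<^sub>v col W 0 = e0 \<cdot>\<^sub>v col W 0"
    using v A by (simp add: W(2) mult_mat_vec[of _ ?N ?N] smult_smult_assoc mult.commute)
  then have col0: "col (A * W) 0 = e0 \<cdot>\<^sub>v col W 0"
    using col_mult2[OF A WD(1), of 0] by simp
  have first: "A' $$ (i, 0) = (if i = 0 then e0 else 0)" if i: "i < ?N" for i
  proof -
    have "A' $$ (i, 0) = Matrix.row (mat_adjoint W) i \<bullet> col (A * W) 0"
      unfolding A'_def using i WD A by (subst index_mult_mat) auto
    also have "\<dots> = e0 * (Matrix.row (mat_adjoint W) i \<bullet> col W 0)"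
      using i WD unfolding col0 by (subst scalar_prod_smult_distrib[of _ ?N]) (auto intro: carrier_vecI)
    also have "Matrix.row (mat_adjoint W) i \<bullet> col W 0 = (mat_adjoint W * W) $$ (i, 0)"
      using i WD by (subst index_mult_mat) auto
    finally show ?thesis using i by (simp add: WD(4))
  qed
  have e0: "e0 = complex_of_real (Re e0)"
    using sym[of 0 0] first[of 0] by (simp add: complex_eq_iff)
  define A3 where "A3 = Matrix.mat n n (\<lambda>(i, j). A' $$ (Suc i, Suc j))"
  have "A3 \<in> carrier_mat n n" by (simp add: A3_def)
  moreover have "mat_adjoint A3 = A3"
    by (rule eq_matI) (auto simp: A3_def sym[symmetric])
  ultimately obtain V3 d3 where V3: "V3 \<in> unitary_group n"
    "A3 = V3 * mat_diag n (\<lambda>i. complex_of_real (d3 i)) * mat_adjoint V3"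
    using Suc.IH by blast
  note V3D = unitary_groupD[OF V3(1)]
  define V' where "V' = Matrix.mat ?N ?N (\<lambda>(i, j). if i = 0 \<or> j = 0 then (if i = j then 1 else 0) else V3 $$ (i - 1, j - 1))"
  define d where "d = case_nat (Re e0) d3"
  have V': "V' \<in> carrier_mat ?N ?N" by (simp add: V'_def)
  have "mat_adjoint V' * V' = 1\<^sub>m ?N"
  proof (rule eq_matI)
    fix i j assume "i < dim_row (1\<^sub>m ?N :: complex mat)" "j < dim_col (1\<^sub>m ?N :: complex mat)"
    then have ij: "i < ?N" "j < ?N" by auto
    have "(mat_adjoint V' * V') $$ (i, j) = (\<Sum>k<?N. cnj (V' $$ (k, i)) * V' $$ (k, j))"
      using V' ij by (subst mult_mat_conv[of _ ?N ?N]) (auto intro!: sum.cong)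
    also have "\<dots> = cnj (V' $$ (0, i)) * V' $$ (0, j) + (\<Sum>k<n. cnj (V' $$ (Suc k, i)) * V' $$ (Suc k, j))"
      by (rule sum.lessThan_Suc_shift)
    also have "\<dots> = (if i = j then 1 else 0)"
    proof (cases "i = 0 \<or> j = 0")
      case True
      then show ?thesis using ij by (auto simp: V'_def)
    next
      case False
      have "(\<Sum>k<n. cnj (V3 $$ (k, i - 1)) * V3 $$ (k, j - 1)) = (mat_adjoint V3 * V3) $$ (i - 1, j - 1)"
        using V3D ij False by (subst mult_mat_conv[of _ n n]) (auto intro!: sum.cong)
      also have "\<dots> = (if i = j then 1 else 0)" unfolding V3D using ij False by auto
      finally show ?thesis using ij False by (simp add: V'_def)
    qed
    finally show "(mat_adjoint V' * V') $$ (i, j) = 1\<^sub>m ?N $$ (i, j)" using ij by simp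
  qed (use V' in auto)
  then have V'u: "V' \<in> unitary_group ?N" using V' by (intro unitary_groupI)
  let ?D = "mat_diag ?N (\<lambda>i. complex_of_real (d i))"
  have A'_eq: "A' = V' * ?D * mat_adjoint V'"
  proof (rule eq_matI)
    show "dim_row A' = dim_row (V' * ?D * mat_adjoint V')" "dim_col A' = dim_col (V' * ?D * mat_adjoint V')"
      using A' V' by auto
    fix i j assume "i < dim_row (V' * ?D * mat_adjoint V')" "j < dim_col (V' * ?D * mat_adjoint V')"
    then have ij: "i < ?N" "j < ?N" using V' by auto
    have VD: "V' * ?D = Matrix.mat ?N ?N (\<lambda>(i, j). V' $$ (i, j) * complex_of_real (d j))"
      by (rule mat_diag_mult_right[OF V'])
    have "(V' * ?D * mat_adjoint V') $$ (i, j) = (\<Sum>k<?N. V' $$ (i, k) * complex_of_real (d k) * cnj (V' $$ (j, k)))"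
      using V' ij by (subst mult_mat_conv[of _ ?N ?N]) (auto simp: VD intro!: sum.cong)
    also have "\<dots> = V' $$ (i, 0) * complex_of_real (d 0) * cnj (V' $$ (j, 0))
       + (\<Sum>k<n. V' $$ (i, Suc k) * complex_of_real (d (Suc k)) * cnj (V' $$ (j, Suc k)))"
      by (rule sum.lessThan_Suc_shift)
    also have "\<dots> = A' $$ (i, j)"
    proof (cases "i = 0 \<or> j = 0")
      case True
      have "A' $$ (i, j) = (if i = j then e0 else 0)"
      proof (cases "j = 0")
        case True then show ?thesis using first ij by simp
      next
        case False
        then show ?thesis using first[of j] sym[of i j] ij True by auto
      qed
      then show ?thesis using ij True e0 by (auto simp: V'_def d_def)
    next
      case False
      have VD3: "V3 * mat_diag n (\<lambda>i. complex_of_real (d3 i)) =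
          Matrix.mat n n (\<lambda>(i, j). V3 $$ (i, j) * complex_of_real (d3 j))"
        by (rule mat_diag_mult_right[OF V3D(1)])
      have "A' $$ (i, j) = A3 $$ (i - 1, j - 1)" using ij False by (auto simp: A3_def)
      also have "\<dots> = (\<Sum>k<n. V3 $$ (i - 1, k) * complex_of_real (d3 k) * cnj (V3 $$ (j - 1, k)))"
        unfolding V3(2) using V3D ij False
        by (subst mult_mat_conv[of _ n n]) (auto simp: VD3 intro!: sum.cong)
      finally show ?thesis using ij False by (simp add: V'_def d_def)
    qed
    finally show "A' $$ (i, j) = (V' * ?D * mat_adjoint V') $$ (i, j)" by simp
  qed
  have D: "?D \<in> carrier_mat ?N ?N" by simp
  have "A = W * A' * mat_adjoint W"
  proof -
    have "W * A' = A * W"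
      unfolding A'_def using WD(1,2) A by (simp add: unitary_cancel[OF W(1), of _ ?N])
    then have "W * A' * mat_adjoint W = A * (W * mat_adjoint W)"
      using WD(1,2) A by (simp add: assoc_mult_mat[of A ?N ?N W ?N _ ?N])
    then show ?thesis using WD A by simp
  qed
  also have "\<dots> = (W * V') * ?D * mat_adjoint (W * V')"
  proof -
    have c: "V' * ?D \<in> carrier_mat ?N ?N" using V' by (rule mult_carrier_mat) simp
    then show ?thesis
    unfolding A'_eq mat_adjoint_mult[OF WD(1) V']
    using assoc_mult_mat[OF WD(1) c, of "mat_adjoint V'" ?N] assoc_mult_mat[OF WD(1) V' D]
      assoc_mult_mat[of "W * (V' * ?D)" ?N ?N "mat_adjoint V'" ?N "mat_adjoint W" ?N] V' WD
    by simp
  qed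
  finally show ?case using unitary_group_mult[OF W(1) V'u] by blast
qed

text \<open>With Q the adjoint of W times V, both equations become intertwining relations between
  diagonal matrices. Entrywise, Q(i,j) nonzero forces d j = e i, and then f takes the same value at
  both. This makes the description in \<open>mat_fun\<close> unambiguous.\<close>

lemma mat_fun_diag_unique:
  assumes "V \<in> unitary_group n" "W \<in> unitary_group n"
    and eq: "V * mat_diag n (\<lambda>i. complex_of_real (d i)) * mat_adjoint V =
      W * mat_diag n (\<lambda>i. complex_of_real (e i)) * mat_adjoint W"
  shows "V * mat_diag n (\<lambda>i. complex_of_real (f (d i))) * mat_adjoint V =
      W * mat_diag n (\<lambda>i. complex_of_real (f (e i))) * mat_adjoint W"
proof -
  note V = unitary_groupD[OF assms(1)] and W = unitary_groupD[OF assms(2)]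
  define Q where "Q = mat_adjoint W * V"
  have Q: "Q \<in> carrier_mat n n" using V W by (simp add: Q_def mult_carrier_mat[of _ n n])
  have tr: "V * mat_diag n g * mat_adjoint V = W * mat_diag n h * mat_adjoint W \<longleftrightarrow>
     Q * mat_diag n g = mat_diag n h * Q" for g h
  proof
    let ?G = "mat_diag n g" and ?H = "mat_diag n h"
    have c: "?G \<in> carrier_mat n n" "?H \<in> carrier_mat n n" by auto
    note as = assoc_mult_mat[of _ n n _ n _ n] mult_carrier_mat[of _ n n _ n]
    note cancel = unitary_cancel[OF assms(1)] unitary_cancel[OF assms(2)]
    have l: "mat_adjoint W * (V * ?G * mat_adjoint V) * V = Q * ?G"
      using V(1,2,4) W(1,2) c by (simp add: as Q_def right_mult_one_mat[of _ n n])
    have r: "mat_adjoint W * (W * ?H * mat_adjoint W) * V = ?H * Q"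
      using V(1,2) W(1,2) c by (simp add: as Q_def cancel[of _ n])
    show "Q * ?G = ?H * Q" if "V * ?G * mat_adjoint V = W * ?H * mat_adjoint W"
      using l r that by simp
    show "V * ?G * mat_adjoint V = W * ?H * mat_adjoint W" if QG: "Q * ?G = ?H * Q"
    proof -
      have "V * ?G * mat_adjoint V = W * (Q * ?G) * mat_adjoint V"
        using V(1,2) W(1,2) c by (simp add: as Q_def cancel[of _ n])
      also have "\<dots> = W * ?H * mat_adjoint W"
        unfolding QG using V(1,2,3) W(1,2) c by (simp add: as Q_def cancel[of _ n])
      finally show ?thesis .
    qed
  qed
  have key: "Q $$ (i, j) * complex_of_real (d j) = complex_of_real (e i) * Q $$ (i, j)"
    if "i < n" "j < n" for i j
    using arg_cong[OF eq[unfolded tr], of "\<lambda>M. M $$ (i, j)"] that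
    by (simp add: mat_diag_mult_left[OF Q] mat_diag_mult_right[OF Q])
  have "Q $$ (i, j) * complex_of_real (f (d j)) = complex_of_real (f (e i)) * Q $$ (i, j)"
    if "i < n" "j < n" for i j
  proof (cases "Q $$ (i, j) = 0")
    case False
    then have "d j = e i" using key[OF that] by (simp add: mult.commute)
    then show ?thesis by simp
  qed simp
  then show ?thesis unfolding tr
    by (auto simp: mat_diag_mult_left[OF Q] mat_diag_mult_right[OF Q])
qed

lemma mat_fun_diag:
  assumes "V \<in> unitary_group n"
    and "A = V * mat_diag n (\<lambda>i. complex_of_real (d i)) * mat_adjoint V"
  shows "mat_fun n f A = V * mat_diag n (\<lambda>i. complex_of_real (f (d i))) * mat_adjoint V"
  unfolding mat_fun_def
proof (rule the_equality)
  show "\<exists>V'\<in>unitary_group n. \<exists>d'. A = V' * mat_diag n (\<lambda>i. complex_of_real (d' i)) * mat_adjoint V' \<and>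
     V * mat_diag n (\<lambda>i. complex_of_real (f (d i))) * mat_adjoint V =
     V' * mat_diag n (\<lambda>i. complex_of_real (f (d' i))) * mat_adjoint V'"
    using assms by blast
qed (use assms mat_fun_diag_unique in metis)

section \<open>Multiplicities as root orders of the characteristic polynomial\<close>

lemma order_prod_linear:
  fixes a :: complex
  shows "Polynomial.order a (\<Prod>x\<leftarrow>xs. [:- x, 1:]) = count_list xs a"
proof (induction xs)
  case (Cons x xs)
  have nz: "(\<Prod>x\<leftarrow>xs. [:- x, 1:]) \<noteq> (0 :: complex poly)" by (simp add: prod_list_zero_iff image_iff)
  have "Polynomial.order a [:- x, 1:] = (if x = a then 1 else 0)"
    using order_power_n_n[of a 1] by (auto intro: order_0I)
  then show ?case using Cons nz order_mult[of "[:- x, 1:]" "\<Prod>x\<leftarrow>xs. [:- x, 1:]" a] 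
    by (simp del: mult_pCons_left)
qed simp

lemma mat_multiplicity_diag:
  assumes V: "V \<in> unitary_group n"
    and A: "A = V * mat_diag n (\<lambda>i. complex_of_real (d i)) * mat_adjoint V"
  shows "mat_multiplicity A t = card {i. i < n \<and> d i = t}"
proof -
  let ?D = "mat_diag n (\<lambda>i. complex_of_real (d i))"
  note VD = unitary_groupD[OF V]
  have "similar_mat_wit A ?D V (mat_adjoint V)"
    using VD by (intro similar_mat_witI[of _ _ n]) (auto simp: A mult_carrier_mat[of _ n n])
  then have "char_poly A = char_poly ?D"
    by (intro char_poly_similar) (auto simp: similar_mat_def)
  also have "\<dots> = (\<Prod>a\<leftarrow>diag_mat ?D. [:- a, 1:])"
    by (rule char_poly_upper_triangular[of _ n]) (auto simp: mat_diag_def)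
  finally have "mat_multiplicity A t = count_list (diag_mat ?D) (complex_of_real t)"
    by (simp add: mat_multiplicity_def order_prod_linear)
  also have "diag_mat ?D = map (\<lambda>i. complex_of_real (d i)) [0..<n]"
    by (auto simp: diag_mat_def mat_diag_def)
  also have "count_list \<dots> (complex_of_real t) = card {i. i < n \<and> d i = t}"
    by (auto simp: count_list_eq_length_filter length_filter_conv_card intro!: arg_cong[of _ _ card])
  finally show ?thesis .
qed

text \<open>Take the conjugated vectors as rows and pad with zero rows to a square matrix. Its last
  row vanishes, so the transpose kills the last unit vector, the determinant is 0 and the kernel is
  nontrivial.\<close>

lemma exists_orthogonal_vector:
  fixes fs :: "complex Matrix.vec list"
  assumes fs: "set fs \<subseteq> carrier_vec n" "length fs < n"
  shows "\<exists>v\<in>carrier_vec n. v \<noteq> 0\<^sub>v n \<and> (\<forall>f\<in>set fs. v \<bullet>c f = 0)"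
proof -
  define L where "L = Matrix.mat n n (\<lambda>(i, j). if i < length fs then cnj ((fs ! i) $ j) else 0)"
  have L: "L \<in> carrier_mat n n" by (simp add: L_def)
  have "transpose_mat L *\<^sub>v unit_vec n (n - 1) = 0\<^sub>v n"
    using fs by (intro eq_vecI) (auto simp: L_def scalar_prod_right_unit)
  moreover have "unit_vec n (n - 1) \<noteq> (0\<^sub>v n :: complex Matrix.vec)"
    using fs unit_vec_nonzero[of "n - 1" n] by auto
  ultimately have "det (transpose_mat L) = 0"
    using L det_0_iff_vec_prod_zero[of "transpose_mat L" n] unit_vec_carrier[of n "n - 1"]
    by (metis transpose_carrier_mat)
  then have "det L = 0" using det_transpose[OF L] by simp
  then obtain v where v: "v \<in> carrier_vec n" "v \<noteq> 0\<^sub>v n" "L *\<^sub>v v = 0\<^sub>v n"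
    using det_0_iff_vec_prod_zero[OF L] by blast
  have "v \<bullet>c f = 0" if f: "f \<in> set fs" for f
  proof -
    obtain i where i: "i < length fs" "f = fs ! i" using f by (metis in_set_conv_nth)
    have fc: "fs ! i \<in> carrier_vec n" using i fs by auto
    have "(L *\<^sub>v v) $ i = (\<Sum>j<n. L $$ (i, j) * v $ j)"
      using L v i fs by (subst mult_mat_vec_conv) auto
    also have "\<dots> = v \<bullet>c f"
      using i fs fc by (auto simp: cscalar_prod_conv L_def mult.commute intro!: sum.cong)
    finally show ?thesis using v(3) i fs by simp
  qed
  then show ?thesis using v by blast
qed

section \<open>Weyl's inequality in counting form\<close>

lemma quadratic_form_diag:
  assumes V: "V \<in> unitary_group n" and v: "v \<in> carrier_vec n"
    and A: "A = V * mat_diag n (\<lambda>i. complex_of_real (d i)) * mat_adjoint V"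
  shows "(A *\<^sub>v v) \<bullet>c v = complex_of_real (\<Sum>i<n. d i * (cmod ((mat_adjoint V *\<^sub>v v) $ i))\<^sup>2)"
proof -
  note VD = unitary_groupD[OF V]
  let ?D = "mat_diag n (\<lambda>i. complex_of_real (d i))"
  define w where "w = mat_adjoint V *\<^sub>v v"
  have w: "w \<in> carrier_vec n" using VD v by (simp add: w_def mult_mat_vec_carrier[of _ n n])
  have D: "?D \<in> carrier_mat n n" by simp
  have "A *\<^sub>v v = V *\<^sub>v (?D *\<^sub>v w)"
    unfolding A w_def using VD v D
    by (simp add: assoc_mult_mat_vec[of _ n n _ n] mult_carrier_mat[of _ n n] mult_mat_vec_carrier[of _ n n])
  then have "(A *\<^sub>v v) \<bullet>c v = (?D *\<^sub>v w) \<bullet>c w"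
    using cscalar_prod_adjoint[OF VD(1), of "?D *\<^sub>v w" v] v mult_mat_vec_carrier[OF D w]
    by (simp add: w_def)
  also have "?D *\<^sub>v w = Matrix.vec n (\<lambda>i. complex_of_real (d i) * w $ i)"
    using w by (intro eq_vecI)
      (auto simp: mult_mat_vec_conv mat_diag_def if_distrib [where f = "\<lambda>x. x * _"] cong: if_cong simp del: index_mult_mat_vec)
  also have "\<dots> \<bullet>c w = complex_of_real (\<Sum>i<n. d i * (cmod (w $ i))\<^sup>2)"
    using w by (auto simp: cscalar_prod_conv mult.assoc complex_norm_square [symmetric] simp flip: of_real_power intro!: sum.cong)
  finally show ?thesis by (simp add: w_def)
qed

text \<open>If the inequality failed, fewer than n linear conditions would make v orthogonal to the
  eigenvectors of X for eigenvalues at most t + \<delta> and to those of Y for eigenvalues above t.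
  On such a v the form of Y is at most t |v|^2 and that of X exceeds (t + \<delta>) |v|^2. Comparing
  counts avoids any minimax formula.\<close>

lemma weyl_count:
  assumes V: "V \<in> unitary_group n"
    and X: "X = V * mat_diag n (\<lambda>i. complex_of_real (d i)) * mat_adjoint V"
    and W: "W \<in> unitary_group n"
    and Y: "Y = W * mat_diag n (\<lambda>i. complex_of_real (e i)) * mat_adjoint W"
    and le: "\<And>v. v \<in> carrier_vec n \<Longrightarrow>
      Re ((X *\<^sub>v v) \<bullet>c v) \<le> Re ((Y *\<^sub>v v) \<bullet>c v) + \<delta> * (vec_l2norm v)\<^sup>2"
  shows "card {i. i < n \<and> t + \<delta> < d i} \<le> card {i. i < n \<and> t < e i}"
proof (rule ccontr)
  note VD = unitary_groupD[OF V] and WD = unitary_groupD[OF W]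
  define S where "S = {i. i < n \<and> \<not> t + \<delta> < d i}"
  define S' where "S' = {i. i < n \<and> t < e i}"
  assume "\<not> ?thesis"
  moreover have "card {i. i < n \<and> t + \<delta> < d i} + card S = card {..<n}"
  proof -
    have "{i. i < n \<and> t + \<delta> < d i} \<union> S = {..<n}" by (auto simp: S_def)
    then show ?thesis by (subst card_Un_disjoint[symmetric]) (auto simp: S_def)
  qed
  ultimately have less: "card S + card S' < n" by (simp add: S'_def)
  have fin: "finite S" "finite S'" by (auto simp: S_def S'_def)
  define fs where "fs = map (col V) (sorted_list_of_set S) @ map (col W) (sorted_list_of_set S')"
  have "set fs \<subseteq> carrier_vec n" using VD WD fin by (auto simp: fs_def S_def S'_def intro!: carrier_vecI)
  moreover have "length fs < n" using less by (simp add: fs_def)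
  ultimately obtain v where v: "v \<in> carrier_vec n" "v \<noteq> 0\<^sub>v n" "\<And>f. f \<in> set fs \<Longrightarrow> v \<bullet>c f = 0"
    using exists_orthogonal_vector by blast
  have comp: "(mat_adjoint Z *\<^sub>v v) $ i = v \<bullet>c col Z i" if "Z \<in> carrier_mat n n" "i < n" for Z i
    using that v by (auto simp: cscalar_prod_conv mult_mat_vec_conv mult.commute simp del: index_mult_mat_vec)
  have z1: "(mat_adjoint V *\<^sub>v v) $ i = 0" if "i \<in> S" for i
    using that v(3)[of "col V i"] fin VD by (subst comp) (auto simp: fs_def S_def)
  have z2: "(mat_adjoint W *\<^sub>v v) $ i = 0" if "i \<in> S'" for i
    using that v(3)[of "col W i"] fin WD by (subst comp) (auto simp: fs_def S'_def)
  have nrm: "(\<Sum>i<n. (cmod ((mat_adjoint Z *\<^sub>v v) $ i))\<^sup>2) = (vec_l2norm v)\<^sup>2" if "Z \<in> unitary_group n" for Z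
  proof -
    have "(vec_l2norm (mat_adjoint Z *\<^sub>v v))\<^sup>2 = (vec_l2norm v)\<^sup>2"
      using vec_l2norm_unitary[OF unitary_group_adjoint[OF that] v(1)] by simp
    moreover have "dim_col Z = n" using that by (auto simp: unitary_group_def)
    ultimately show ?thesis by (simp add: vec_l2norm_sq)
  qed
  have "Re ((Y *\<^sub>v v) \<bullet>c v) = (\<Sum>i<n. e i * (cmod ((mat_adjoint W *\<^sub>v v) $ i))\<^sup>2)"
    by (simp only: quadratic_form_diag[OF W v(1) Y] Re_complex_of_real)
  also have "\<dots> \<le> (\<Sum>i<n. t * (cmod ((mat_adjoint W *\<^sub>v v) $ i))\<^sup>2)"
  proof (rule sum_mono)
    fix i assume "i \<in> {..<n}"
    then show "e i * (cmod ((mat_adjoint W *\<^sub>v v) $ i))\<^sup>2 \<le> t * (cmod ((mat_adjoint W *\<^sub>v v) $ i))\<^sup>2"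
      using z2[of i] by (cases "i \<in> S'") (auto simp: S'_def intro!: mult_right_mono simp del: index_mult_mat_vec)
  qed
  also have "\<dots> = t * (vec_l2norm v)\<^sup>2" using nrm[OF W] by (simp add: sum_distrib_left[symmetric] del: index_mult_mat_vec)
  finally have Yle: "Re ((Y *\<^sub>v v) \<bullet>c v) \<le> t * (vec_l2norm v)\<^sup>2" .
  \<comment> \<open>A nonzero coordinate gives strictness: it lies outside S, so it belongs to an
    eigenvalue above t + \<delta>.\<close>
  have "\<exists>i<n. (mat_adjoint V *\<^sub>v v) $ i \<noteq> 0"
  proof (rule ccontr)
    assume "\<not> ?thesis"
    then have "(\<Sum>i<n. (cmod ((mat_adjoint V *\<^sub>v v) $ i))\<^sup>2) = 0" by (simp del: index_mult_mat_vec)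
    then show False using nrm[OF V] v vec_l2norm_eq_0 by auto
  qed
  then obtain i0 where i0: "i0 < n" "(mat_adjoint V *\<^sub>v v) $ i0 \<noteq> 0" by blast
  have "(t + \<delta>) * (vec_l2norm v)\<^sup>2 = (\<Sum>i<n. (t + \<delta>) * (cmod ((mat_adjoint V *\<^sub>v v) $ i))\<^sup>2)"
    using nrm[OF V] by (simp add: sum_distrib_left[symmetric] del: index_mult_mat_vec)
  also have "\<dots> < (\<Sum>i<n. d i * (cmod ((mat_adjoint V *\<^sub>v v) $ i))\<^sup>2)"
  proof (rule sum_strict_mono_ex1)
    show "\<forall>i\<in>{..<n}. (t + \<delta>) * (cmod ((mat_adjoint V *\<^sub>v v) $ i))\<^sup>2 \<le> d i * (cmod ((mat_adjoint V *\<^sub>v v) $ i))\<^sup>2"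
    proof
      fix i assume "i \<in> {..<n}"
      then show "(t + \<delta>) * (cmod ((mat_adjoint V *\<^sub>v v) $ i))\<^sup>2 \<le> d i * (cmod ((mat_adjoint V *\<^sub>v v) $ i))\<^sup>2"
        using z1[of i] by (cases "i \<in> S") (auto simp: S_def intro!: mult_right_mono simp del: index_mult_mat_vec)
    qed
    have "t + \<delta> < d i0" using z1[of i0] i0 by (auto simp: S_def simp del: index_mult_mat_vec)
    then show "\<exists>a\<in>{..<n}. (t + \<delta>) * (cmod ((mat_adjoint V *\<^sub>v v) $ a))\<^sup>2 < d a * (cmod ((mat_adjoint V *\<^sub>v v) $ a))\<^sup>2"
      using i0 by (intro bexI[of _ i0]) (auto intro!: mult_strict_right_mono simp del: index_mult_mat_vec)
  qed simp
  also have "\<dots> = Re ((X *\<^sub>v v) \<bullet>c v)"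
    by (simp only: quadratic_form_diag[OF V v(1) X] Re_complex_of_real)
  finally show False using le[OF v(1)] Yle by (simp add: algebra_simps)
qed

section \<open>Ordered eigenvalue lists\<close>

text \<open>Look at the value \<open>s i\<close> at the first difference. Since s' is decreasing and
  already smaller at i, it can take this value only before i, where the lists agree; but s takes it
  at i too, so the multiplicities differ.\<close>

lemma decreasing_list_unique_aux:
  fixes s s' :: "nat \<Rightarrow> real"
  assumes s: "\<And>t. t > 0 \<Longrightarrow> finite {i. s i = t} \<and> card {i. s i = t} = m t"
    and s': "decseq s'" "\<And>i. 0 \<le> s' i" "\<And>t. t > 0 \<Longrightarrow> card {i. s' i = t} = m t"
    and less: "s' i < s i" and eq: "\<And>j. j < i \<Longrightarrow> s j = s' j"
  shows False
proof -
  have pos: "s i > 0" using s'(2)[of i] less by linarith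
  have "{j. s' j = s i} \<subset> {j. s j = s i}"
  proof
    show "{j. s' j = s i} \<subseteq> {j. s j = s i}"
    proof safe
      fix j assume j: "s' j = s i"
      have "j < i" using decseqD[OF s'(1), of i j] j less by force
      then show "s j = s i" using eq j by simp
    qed
    have "i \<in> {j. s j = s i}" "i \<notin> {j. s' j = s i}" using less by auto
    then show "{j. s' j = s i} \<noteq> {j. s j = s i}" by metis
  qed
  then have "card {j. s' j = s i} < card {j. s j = s i}"
    using s[OF pos] by (intro psubset_card_mono) auto
  then show False using s[OF pos] s'(3)[OF pos] by simp
qed

lemma decreasing_list_unique:
  fixes s s' :: "nat \<Rightarrow> real"
  assumes "decseq s" "\<And>i. 0 \<le> s i" "\<And>t. t > 0 \<Longrightarrow> finite {i. s i = t} \<and> card {i. s i = t} = m t"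
    and "decseq s'" "\<And>i. 0 \<le> s' i" "\<And>t. t > 0 \<Longrightarrow> finite {i. s' i = t} \<and> card {i. s' i = t} = m t"
  shows "s = s'"
proof (rule ccontr)
  assume "s \<noteq> s'"
  then obtain i0 where "s i0 \<noteq> s' i0" by blast
  then obtain i where i: "s i \<noteq> s' i" "\<And>j. j < i \<Longrightarrow> s j = s' j"
    using exists_least_iff[of "\<lambda>i. s i \<noteq> s' i"] by blast
  then consider "s' i < s i" | "s i < s' i" by linarith
  then show False
  proof cases
    case 1
    then show False using decreasing_list_unique_aux[of s m s' i] assms i by blast
  next
    case 2
    then show False using decreasing_list_unique_aux[of s' m s i] assms i(2) by metis
  qed
qed

lemma pos_eigenvalues_eqI:
  assumes "decseq s" "\<And>i. 0 \<le> s i" "\<And>t. t > 0 \<Longrightarrow> finite {i. s i = t} \<and> card {i. s i = t} = m t"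
  shows "pos_eigenvalues m = s"
  unfolding pos_eigenvalues_def
proof (rule the_equality)
  fix s' assume "decseq s' \<and> (\<forall>i. 0 \<le> s' i) \<and> (\<forall>t>0. finite {i. s' i = t} \<and> card {i. s' i = t} = m t)"
  then show "s' = s" using decreasing_list_unique[of s' m s] assms by blast
qed (use assms in blast)

text \<open>Negation reduces increasing lists of nonpositive numbers to the decreasing lists treated
  above, so the negative eigenvalues need no separate theory.\<close>

lemma neg_eigenvalues_eqI:
  assumes "decseq s" "\<And>i. 0 \<le> s i"
    "\<And>t. t > 0 \<Longrightarrow> finite {i. s i = t} \<and> card {i. s i = t} = m (- t)"
  shows "neg_eigenvalues m = (\<lambda>i. - s i)"
  unfolding neg_eigenvalues_def
proof (rule the_equality)
  have "finite {i. - s i = t} \<and> card {i. - s i = t} = m t" if "t < 0" for t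
  proof -
    have "{i. - s i = t} = {i. s i = - t}" by auto
    then show ?thesis using assms(3)[of "- t"] that by simp
  qed
  then show "incseq (\<lambda>i. - s i) \<and> (\<forall>i. - s i \<le> 0) \<and>
      (\<forall>t<0. finite {i. - s i = t} \<and> card {i. - s i = t} = m t)"
    using assms by (auto simp: incseq_def decseq_def)
next
  fix s' assume s': "incseq s' \<and> (\<forall>i. s' i \<le> 0) \<and> (\<forall>t<0. finite {i. s' i = t} \<and> card {i. s' i = t} = m t)"
  have "(\<lambda>i. - s' i) = s"
  proof (rule decreasing_list_unique[of _ "\<lambda>t. m (- t)"])
    show "decseq (\<lambda>i. - s' i)" using s' by (auto simp: incseq_def decseq_def)
    fix t :: real assume "t > 0"
    moreover have "{i. - s' i = t} = {i. s' i = - t}" by auto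
    ultimately show "finite {i. - s' i = t} \<and> card {i. - s' i = t} = m (- t)" using s' by simp
  qed (use s' assms in auto)
  then show "s' = (\<lambda>i. - s i)" by (metis minus_minus)
qed

definition eig_count :: "nat \<Rightarrow> (nat \<Rightarrow> real) \<Rightarrow> real \<Rightarrow> nat" where
  "eig_count n d t = card {i. i < n \<and> t < d i}"

definition eig_mult :: "nat \<Rightarrow> (nat \<Rightarrow> real) \<Rightarrow> real \<Rightarrow> nat" where
  "eig_mult n d t = card {i. i < n \<and> d i = t}"

text \<open>The witness is the sorted list of the positive d i, continued by zeros. Indices start at
  0, so the entry with index i exceeds t exactly when at least i + 1 of the d j do.\<close>

lemma finite_pos_eigenvalues:
  fixes d :: "nat \<Rightarrow> real"
  shows "\<exists>s. decseq s \<and> (\<forall>i. 0 \<le> s i) \<and>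
    (\<forall>t>0. finite {i. s i = t} \<and> card {i. s i = t} = eig_mult n d t) \<and>
    (\<forall>t\<ge>0. \<forall>i. t < s i \<longleftrightarrow> i < eig_count n d t)"
proof -
  define L where "L = rev (sort (map d (filter (\<lambda>i. 0 < d i) [0..<n])))"
  define s where "s i = (if i < length L then L ! i else 0)" for i
  have Lpos: "L ! i > 0" if "i < length L" for i
  proof -
    have "L ! i \<in> set L" using that by simp
    then show ?thesis by (auto simp: L_def)
  qed
  have "L ! j \<le> L ! i" if "i \<le> j" "j < length L" for i j
  proof -
    define M where "M = sort (map d (filter (\<lambda>i. 0 < d i) [0..<n]))"
    have "sorted M" "L = rev M" by (auto simp: M_def L_def)
    then show ?thesis using that by (auto simp: rev_nth intro!: sorted_nth_mono)
  qed
  then have dec: "decseq s" using Lpos by (auto simp: decseq_def s_def less_imp_le)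
  have nonneg: "0 \<le> s i" for i using Lpos by (auto simp: s_def less_imp_le)
  have count: "card {i. i < length L \<and> Q (L ! i)} = card {i. i < n \<and> Q (d i)}" if Q: "\<And>t. Q t \<Longrightarrow> t > 0" for Q
  proof -
    have "card {i. i < length L \<and> Q (L ! i)} = size (filter_mset Q (mset L))"
      by (simp add: length_filter_conv_card [symmetric] mset_filter [symmetric] del: mset_filter)
    also have "mset L = mset (map d (filter (\<lambda>i. 0 < d i) [0..<n]))" by (simp add: L_def)
    also have "size (filter_mset Q \<dots>) = length (filter Q (map d (filter (\<lambda>i. 0 < d i) [0..<n])))"
      by (metis mset_filter size_mset)
    also have "\<dots> = length (filter (\<lambda>i. Q (d i)) [0..<n])"
    proof -
      have "(\<lambda>i. 0 < d i \<and> (Q \<circ> d) i) = (\<lambda>i. Q (d i))" using Q by (auto simp: fun_eq_iff)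
      then show ?thesis by (simp add: filter_map)
    qed
    also have "\<dots> = card {i. i < n \<and> Q (d i)}"
      by (auto simp: length_filter_conv_card intro!: arg_cong[of _ _ card])
    finally show ?thesis .
  qed
  have sQ: "{i. Q (s i)} = {i. i < length L \<and> Q (L ! i)}" if "\<not> Q 0" for Q
    using that by (auto simp: s_def split: if_splits)
  have 1: "finite {i. s i = t} \<and> card {i. s i = t} = eig_mult n d t" if "t > 0" for t
    using sQ[of "\<lambda>x. x = t"] count[of "\<lambda>x. x = t"] that by (auto simp: eig_mult_def)
  have 2: "t < s i \<longleftrightarrow> i < eig_count n d t" if t: "t \<ge> 0" for t i
  proof -
    let ?S = "{i. t < s i}"
    have S: "finite ?S" "card ?S = eig_count n d t"
      using sQ[of "\<lambda>x. t < x"] count[of "\<lambda>x. t < x"] that by (auto simp: eig_count_def)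
    show ?thesis
    proof
      assume "t < s i"
      then have "{..i} \<subseteq> ?S" using decseqD[OF dec] by (auto intro: less_le_trans)
      from card_mono[OF S(1) this] show "i < eig_count n d t" using S(2) by simp
    next
      assume i: "i < eig_count n d t"
      show "t < s i"
      proof (rule ccontr)
        assume i': "\<not> t < s i"
        have "x < i" if "t < s x" for x
          using decseqD[OF dec, of i x] that i' by (cases "x < i") auto
        then have "?S \<subseteq> {..<i}" by blast
        then have "card ?S \<le> i" using card_mono[of "{..<i}" ?S] by simp
        then show False using S i by simp
      qed
    qed
  qed
  show ?thesis using dec nonneg 1 2 by blast
qed

definition eig_list :: "nat \<Rightarrow> (nat \<Rightarrow> real) \<Rightarrow> nat \<Rightarrow> real" where
  "eig_list n d = pos_eigenvalues (eig_mult n d)"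

text \<open>The equivalence of t < \<open>eig_list n d i\<close> and i <
  \<open>eig_count n d t\<close> is the bridge by which counting inequalities become inequalities
  between ordered eigenvalues.\<close>

lemma eig_list_props:
  shows decseq_eig_list: "decseq (eig_list n d)"
    and eig_list_nonneg: "0 \<le> eig_list n d i"
    and less_eig_list_iff: "t \<ge> 0 \<Longrightarrow> t < eig_list n d i \<longleftrightarrow> i < eig_count n d t"
    and neg_eigenvalues_eig_list: "neg_eigenvalues (eig_mult n (\<lambda>i. - d i)) = (\<lambda>i. - eig_list n d i)"
proof -
  obtain s where s: "decseq s" "\<forall>i. 0 \<le> s i"
    "\<forall>t>0. finite {i. s i = t} \<and> card {i. s i = t} = eig_mult n d t"
    "\<forall>t\<ge>0. \<forall>i. t < s i \<longleftrightarrow> i < eig_count n d t"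
    using finite_pos_eigenvalues[of n d] by blast
  have eq: "eig_list n d = s" unfolding eig_list_def by (rule pos_eigenvalues_eqI) (use s in auto)
  have "eig_mult n (\<lambda>i. - d i) (- t) = eig_mult n d t" for t
    unfolding eig_mult_def by (auto intro!: arg_cong[of _ _ card])
  then have "neg_eigenvalues (eig_mult n (\<lambda>i. - d i)) = (\<lambda>i. - s i)"
    by (intro neg_eigenvalues_eqI) (use s in auto)
  then show "decseq (eig_list n d)" "0 \<le> eig_list n d i"
    "t \<ge> 0 \<Longrightarrow> t < eig_list n d i \<longleftrightarrow> i < eig_count n d t"
    "neg_eigenvalues (eig_mult n (\<lambda>i. - d i)) = (\<lambda>i. - eig_list n d i)"
    using s by (auto simp: eq)
qed

text \<open>Apply the counting inequality at the level t = \<open>eig_list n e i\<close>, above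
  which e has at most i values.\<close>

lemma eig_list_le_add:
  assumes le: "\<And>t. t \<ge> 0 \<Longrightarrow> eig_count n d (t + \<delta>) \<le> eig_count n e t" and \<delta>: "\<delta> \<ge> 0"
  shows "eig_list n d i \<le> eig_list n e i + \<delta>"
proof (rule ccontr)
  assume "\<not> ?thesis"
  then have "eig_list n e i + \<delta> < eig_list n d i" by simp
  then have "i < eig_count n d (eig_list n e i + \<delta>)"
    using less_eig_list_iff[of "eig_list n e i + \<delta>" n d i] eig_list_nonneg[of n e i] \<delta> by simp
  then have "i < eig_count n e (eig_list n e i)"
    using le[OF eig_list_nonneg[of n e i]] by simp
  then show False using less_eig_list_iff[OF eig_list_nonneg[of n e i], of n e i] by simp
qed

section \<open>Eigenvalue lists and moments\<close>

text \<open>Compactness gives a limit L along a subsequence. If the whole sequence did not follow,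
  it would cross two levels between L and some other value infinitely often. Positive levels suffice
  because the sequence is nonnegative.\<close>

lemma convergent_if_no_crossing:
  fixes x :: "nat \<Rightarrow> real"
  assumes bd: "\<And>n. 0 \<le> x n" "\<And>n. x n \<le> K"
    and cross: "\<And>t1 t2. 0 < t1 \<Longrightarrow> t1 < t2 \<Longrightarrow> \<not> ((\<exists>\<^sub>F n in sequentially. x n \<le> t1) \<and> (\<exists>\<^sub>F n in sequentially. t2 < x n))"
  shows "convergent x"
proof -
  have "\<forall>n. x n \<in> {0..K}" using bd by auto
  then obtain L r where r: "L \<in> {0..K}" "strict_mono r" "(x \<circ> r) \<longlonglongrightarrow> L"
    using compact_Icc[of 0 K] unfolding compact_def by meson
  have freq: "\<exists>\<^sub>F n in sequentially. Q (x n)" if ev: "eventually (\<lambda>n. Q ((x \<circ> r) n)) sequentially" for Q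
  proof -
    obtain N where N: "\<And>n. n \<ge> N \<Longrightarrow> Q (x (r n))" using ev unfolding eventually_sequentially o_def by blast
    have "\<exists>n\<ge>M. Q (x n)" for M
      using N[of "max N M"] seq_suble[OF r(2), of "max N M"] by (intro exI[of _ "r (max N M)"]) auto
    then show ?thesis by (simp add: frequently_sequentially)
  qed
  have "x \<longlonglongrightarrow> L"
  proof (rule order_tendstoI)
    fix a assume a: "a < L"
    \<comment> \<open>The points at one and two thirds of the way from \<open>max a 0\<close> to L;
      the maximum keeps t1 positive when L > 0.\<close>
    define t1 where "t1 = (2 * max a 0 + L) / 3"
    define t2 where "t2 = (max a 0 + 2 * L) / 3"
    show "\<forall>\<^sub>F n in sequentially. a < x n"
    proof (cases "L = 0")
      case True
      then have "a < x n" for n using a bd(1)[of n] by linarith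
      then show ?thesis by simp
    next
      case False
      then have t: "0 < t1" "t1 < t2" "a < t1" "t2 < L" using r(1) a by (auto simp: t1_def t2_def max_def)
      have "\<exists>\<^sub>F n in sequentially. t2 < x n"
        using freq order_tendstoD(1)[OF r(3) t(4)] by simp
      then have "\<forall>\<^sub>F n in sequentially. \<not> x n \<le> t1"
        using cross[OF t(1,2)] by (simp add: frequently_def)
      then show ?thesis by eventually_elim (use t in auto)
    qed
  next
    fix a assume a: "L < a"
    define t1 where "t1 = (2 * L + a) / 3"
    define t2 where "t2 = (L + 2 * a) / 3"
    have t: "0 < t1" "t1 < t2" "L < t1" "t2 < a" using r(1) a by (auto simp: t1_def t2_def)
    have "\<forall>\<^sub>F n in sequentially. (x \<circ> r) n \<le> t1"
      using order_tendstoD(2)[OF r(3) t(3)] by eventually_elim simp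
    then have "\<exists>\<^sub>F n in sequentially. x n \<le> t1" using freq[of "\<lambda>y. y \<le> t1"] by simp
    then have "\<forall>\<^sub>F n in sequentially. \<not> t2 < x n"
      using cross[OF t(1,2)] by (simp add: frequently_def)
    then show "\<forall>\<^sub>F n in sequentially. x n < a" by eventually_elim (use t in auto)
  qed
  then show ?thesis by (auto simp: convergent_def)
qed

lemma convergent_if_approx:
  fixes x :: "nat \<Rightarrow> real"
  assumes "\<And>\<delta>. \<delta> > 0 \<Longrightarrow> \<exists>y. convergent y \<and> (\<forall>\<^sub>F n in sequentially. \<bar>x n - y n\<bar> \<le> \<delta>)"
  shows "convergent x"
proof -
  have "Cauchy x"
  proof (rule metric_CauchyI)
    fix e :: real assume "e > 0"
    then obtain y where y: "convergent y" "\<forall>\<^sub>F n in sequentially. \<bar>x n - y n\<bar> \<le> e / 4"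
      using assms[of "e / 4"] by auto
    then obtain N1 where N1: "\<And>n. n \<ge> N1 \<Longrightarrow> \<bar>x n - y n\<bar> \<le> e / 4"
      by (auto simp: eventually_sequentially)
    obtain N2 where N2: "\<And>m n. m \<ge> N2 \<Longrightarrow> n \<ge> N2 \<Longrightarrow> dist (y m) (y n) < e / 4"
      using metric_CauchyD[OF convergent_Cauchy[OF y(1)], of "e / 4"] \<open>e > 0\<close> by auto
    have "dist (x m) (x n) < e" if "m \<ge> max N1 N2" "n \<ge> max N1 N2" for m n
      using N1[of m] N1[of n] N2[of m n] that \<open>e > 0\<close> unfolding dist_real_def by linarith
    then show "\<exists>M. \<forall>m\<ge>M. \<forall>n\<ge>M. dist (x m) (x n) < e" by blast
  qed
  then show ?thesis by (simp add: Cauchy_convergent_iff)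
qed

text \<open>Choosing C at least 1, so that C is at most C^2, lets the same constant bound the sum of
  squares and every single entry.\<close>

lemma second_moment_bounded:
  fixes e :: "nat \<Rightarrow> nat \<Rightarrow> real"
  assumes "convergent (\<lambda>n. \<Sum>j<N n. e n j ^ 2)"
  obtains C where "C > 0" "\<And>n. (\<Sum>j<N n. e n j ^ 2) \<le> C" "\<And>n j. j < N n \<Longrightarrow> \<bar>e n j\<bar> \<le> C"
proof -
  obtain C0 where C0: "C0 > 0" "\<And>n. \<bar>\<Sum>j<N n. e n j ^ 2\<bar> \<le> C0"
    using convergent_imp_Bseq[OF assms] by (auto simp: Bseq_def)
  define C where "C = max C0 1"
  have 1: "(\<Sum>j<N n. e n j ^ 2) \<le> C" for n using C0(2)[of n] by (auto simp: C_def)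
  have "\<bar>e n j\<bar> \<le> C" if "j < N n" for n j
  proof -
    have "e n j ^ 2 \<le> (\<Sum>j<N n. e n j ^ 2)" using that by (intro member_le_sum) auto
    also have "\<dots> \<le> C" by (rule 1)
    also have "\<dots> \<le> C ^ 2" by (rule self_le_power) (auto simp: C_def)
    finally have "\<bar>e n j\<bar> ^ 2 \<le> C ^ 2" by simp
    then show ?thesis by (rule power2_le_imp_le) (simp add: C_def)
  qed
  then show ?thesis using that[of C] 1 by (auto simp: C_def)
qed

text \<open>Polynomials approximate g uniformly on [-C, C]. The number of summands is unbounded, but
  the factor \<open>e n j ^ 2\<close> turns a uniform error \<delta> / C into a total error of at
  most \<delta>.\<close>

lemma test_function_convergent:
  fixes e :: "nat \<Rightarrow> nat \<Rightarrow> real"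
  assumes mom: "\<And>p. p \<ge> 2 \<Longrightarrow> convergent (\<lambda>n. \<Sum>j<N n. e n j ^ p)"
    and g: "continuous_on UNIV g"
  shows "convergent (\<lambda>n. \<Sum>j<N n. e n j ^ 2 * g (e n j))"
proof (rule convergent_if_approx)
  fix \<delta> :: real assume \<delta>: "\<delta> > 0"
  obtain C where C: "C > 0" "\<And>n. (\<Sum>j<N n. e n j ^ 2) \<le> C" "\<And>n j. j < N n \<Longrightarrow> \<bar>e n j\<bar> \<le> C"
    using second_moment_bounded[OF mom[of 2]] by auto
  have "\<delta> / C > 0" using \<delta> C by simp
  then obtain q where q: "real_polynomial_function q" "\<And>x. x \<in> {-C..C} \<Longrightarrow> \<bar>g x - q x\<bar> < \<delta> / C"
    using Stone_Weierstrass_real_polynomial_function[of "{-C..C}" g "\<delta> / C"] g continuous_on_subset[OF g]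
    by auto
  obtain a r where a: "q = (\<lambda>x. \<Sum>i\<le>r. a i * x ^ i)"
    using q(1) by (auto simp: real_polynomial_function_iff_sum)
  have "(\<Sum>j<N n. e n j ^ 2 * q (e n j)) = (\<Sum>i\<le>r. a i * (\<Sum>j<N n. e n j ^ (2 + i)))" for n
    unfolding a sum_distrib_left
    by (subst sum.swap) (simp add: power_add mult_ac power2_eq_square)
  moreover have "convergent (\<lambda>n. \<Sum>i\<le>r. a i * (\<Sum>j<N n. e n j ^ (2 + i)))"
    by (intro convergent_sum convergent_mult convergent_const mom) auto
  ultimately have "convergent (\<lambda>n. \<Sum>j<N n. e n j ^ 2 * q (e n j))" by simp
  moreover have "\<bar>(\<Sum>j<N n. e n j ^ 2 * g (e n j)) - (\<Sum>j<N n. e n j ^ 2 * q (e n j))\<bar> \<le> \<delta>" for n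
  proof -
    have "\<bar>(\<Sum>j<N n. e n j ^ 2 * g (e n j)) - (\<Sum>j<N n. e n j ^ 2 * q (e n j))\<bar>
       = \<bar>\<Sum>j<N n. e n j ^ 2 * (g (e n j) - q (e n j))\<bar>"
      by (simp add: sum_subtractf right_diff_distrib)
    also have "\<dots> \<le> (\<Sum>j<N n. e n j ^ 2 * (\<delta> / C))"
    proof (rule sum_abs[THEN order_trans], rule sum_mono)
      fix j assume "j \<in> {..<N n}"
      then have "e n j \<in> {-C..C}" using C(3)[of j n] by auto
      then have "\<bar>g (e n j) - q (e n j)\<bar> \<le> \<delta> / C" using q(2) by force
      then have "e n j ^ 2 * \<bar>g (e n j) - q (e n j)\<bar> \<le> e n j ^ 2 * (\<delta> / C)" by (rule mult_left_mono) simp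
      then show "\<bar>e n j ^ 2 * (g (e n j) - q (e n j))\<bar> \<le> e n j ^ 2 * (\<delta> / C)"
        by (simp add: abs_mult)
    qed
    also have "\<dots> = (\<Sum>j<N n. e n j ^ 2) * (\<delta> / C)" by (simp only: sum_distrib_right)
    also have "\<dots> \<le> C * (\<delta> / C)" using C \<delta> by (intro mult_right_mono) auto
    finally show ?thesis using C by simp
  qed
  ultimately show "\<exists>y. convergent y \<and> (\<forall>\<^sub>F n in sequentially.
      \<bar>(\<Sum>j<N n. e n j ^ 2 * g (e n j)) - y n\<bar> \<le> \<delta>)"
    by (intro exI[of _ "\<lambda>n. \<Sum>j<N n. e n j ^ 2 * q (e n j)"]) auto
qed

text \<open>A ramp f rising from 0 at t1 to 1 at t2 lies between the indicators of (t2, infinity)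
  and (t1, infinity). Its sum over the eigenvalues converges, so the count above t1 cannot be small
  infinitely often while the count above t2 is large infinitely often.\<close>

lemma eig_list_convergent_of_moments:
  fixes e :: "nat \<Rightarrow> nat \<Rightarrow> real"
  assumes mom: "\<And>p. p \<ge> 2 \<Longrightarrow> convergent (\<lambda>n. \<Sum>j<N n. e n j ^ p)"
  shows "convergent (\<lambda>n. eig_list (N n) (e n) i)"
proof -
  obtain C where C: "C > 0" "\<And>n. (\<Sum>j<N n. e n j ^ 2) \<le> C" "\<And>n j. j < N n \<Longrightarrow> \<bar>e n j\<bar> \<le> C"
    using second_moment_bounded[OF mom[of 2]] by auto
  show ?thesis
  proof (rule convergent_if_no_crossing)
    show "0 \<le> eig_list (N n) (e n) i" for n by (rule eig_list_nonneg)
    show "eig_list (N n) (e n) i \<le> C" for n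
    proof -
      have "{j. j < N n \<and> C < e n j} = {}" using C(3)[of _ n] by force
      then have "eig_count (N n) (e n) C = 0" unfolding eig_count_def by simp
      then show ?thesis using less_eig_list_iff[of C "N n" "e n" i] C by auto
    qed
    fix t1 t2 :: real assume t: "0 < t1" "t1 < t2"
    define f where "f t = max 0 (min 1 ((t - t1) / (t2 - t1)))" for t
    \<comment> \<open>Dividing by the square of \<open>max t t1\<close> instead of t keeps g
      continuous at 0; nothing changes, since f vanishes up to t1.\<close>
    define g where "g t = f t / (max t t1)\<^sup>2" for t
    have "continuous_on UNIV g"
      unfolding g_def f_def using t by (intro continuous_intros) auto
    then have "convergent (\<lambda>n. \<Sum>j<N n. e n j ^ 2 * g (e n j))"
      by (intro test_function_convergent mom)
    moreover have "x\<^sup>2 * g x = f x" for x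
      using t by (auto simp: g_def f_def max_def divide_simps)
    ultimately obtain F where F: "(\<lambda>n. \<Sum>j<N n. f (e n j)) \<longlonglongrightarrow> F" by (auto simp: convergent_def)
    have up: "(\<Sum>j<N n. f (e n j)) \<le> real (eig_count (N n) (e n) t1)" for n
    proof -
      have "(\<Sum>j<N n. f (e n j)) \<le> (\<Sum>j<N n. if t1 < e n j then 1 else 0)"
        using t by (intro sum_mono) (auto simp: f_def divide_simps max_def)
      also have "\<dots> = real (eig_count (N n) (e n) t1)"
        by (simp add: eig_count_def sum.If_cases Int_def)
      finally show ?thesis .
    qed
    have lo: "real (eig_count (N n) (e n) t2) \<le> (\<Sum>j<N n. f (e n j))" for n
    proof -
      have "real (eig_count (N n) (e n) t2) = (\<Sum>j<N n. if t2 < e n j then 1 else 0)"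
        by (simp add: eig_count_def sum.If_cases Int_def)
      also have "\<dots> \<le> (\<Sum>j<N n. f (e n j))"
        using t by (intro sum_mono) (auto simp: f_def divide_simps)
      finally show ?thesis .
    qed
    show "\<not> ((\<exists>\<^sub>F n in sequentially. eig_list (N n) (e n) i \<le> t1) \<and> (\<exists>\<^sub>F n in sequentially. t2 < eig_list (N n) (e n) i))"
    proof safe
      assume 1: "\<exists>\<^sub>F n in sequentially. eig_list (N n) (e n) i \<le> t1"
        and 2: "\<exists>\<^sub>F n in sequentially. t2 < eig_list (N n) (e n) i"
      \<comment> \<open>If F exceeded i, eventually more than i eigenvalues would exceed t1. Once F
        is at most i, the integer count above t2 is eventually below i + 1, hence at most i.\<close>
      have "F \<le> real i"
      proof (rule ccontr)
        assume "\<not> F \<le> real i"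
        then have "\<forall>\<^sub>F n in sequentially. real i < (\<Sum>j<N n. f (e n j))" using order_tendstoD(1)[OF F] by simp
        then have "\<forall>\<^sub>F n in sequentially. \<not> eig_list (N n) (e n) i \<le> t1"
        proof eventually_elim
          case (elim n)
          then have "i < eig_count (N n) (e n) t1" using up[of n] by linarith
          then show ?case using less_eig_list_iff[of t1 "N n" "e n" i] t by simp
        qed
        then show False using 1 by (simp add: frequently_def)
      qed
      then have "\<forall>\<^sub>F n in sequentially. (\<Sum>j<N n. f (e n j)) < real i + 1" using order_tendstoD(2)[OF F] by simp
      then have "\<forall>\<^sub>F n in sequentially. \<not> t2 < eig_list (N n) (e n) i"
      proof eventually_elim
        case (elim n)
        then have "real (eig_count (N n) (e n) t2) < real i + 1" using lo[of n] by linarith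
        then show ?case using less_eig_list_iff[of t2 "N n" "e n" i] t by simp
      qed
      then show False using 2 by (simp add: frequently_def)
    qed
  qed
qed

text \<open>Serves twice: to compare two families with equal limiting moments, and to place positive
  and negative eigenvalues on one diagonal.\<close>

lemma tendsto_interleave:
  fixes x y :: "nat \<Rightarrow> 'a::topological_space"
  assumes "x \<longlonglongrightarrow> L" "y \<longlonglongrightarrow> L"
  shows "(\<lambda>n. if even n then x (n div 2) else y (n div 2)) \<longlonglongrightarrow> L"
proof -
  have "filterlim (\<lambda>n::nat. n div 2) at_top sequentially"
    unfolding filterlim_at_top
  proof
    fix Z :: nat
    show "\<forall>\<^sub>F n in sequentially. Z \<le> n div 2"
      using eventually_ge_at_top[of "2 * Z"] by eventually_elim auto
  qed
  then have *: "(\<lambda>n. x (n div 2)) \<longlonglongrightarrow> L" "(\<lambda>n. y (n div 2)) \<longlonglongrightarrow> L"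
    using assms by (auto intro: filterlim_compose)
  show ?thesis
  proof (rule topological_tendstoI)
    fix S assume "open S" "L \<in> S"
    then have "\<forall>\<^sub>F n in sequentially. x (n div 2) \<in> S" "\<forall>\<^sub>F n in sequentially. y (n div 2) \<in> S"
      using * by (auto intro: topological_tendstoD)
    then show "\<forall>\<^sub>F n in sequentially. (if even n then x (n div 2) else y (n div 2)) \<in> S"
      by eventually_elim auto
  qed
qed

text \<open>Convergence along each family is known; that the limit depends on the moments alone
  follows by interleaving a family with a fixed reference family. The merged family has the same
  moments, so its lists converge, and the even and odd subsequences share their limit.\<close>

lemma eig_list_limit_determined:
  fixes \<mu> :: "nat \<Rightarrow> real"
  shows "\<exists>s. \<forall>N (e :: nat \<Rightarrow> nat \<Rightarrow> real). (\<forall>p\<ge>2. (\<lambda>n. \<Sum>j<N n. e n j ^ p) \<longlonglongrightarrow> \<mu> p) \<longrightarrow>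
    (\<forall>i. (\<lambda>n. eig_list (N n) (e n) i) \<longlonglongrightarrow> s i)"
proof (cases "\<exists>N (e :: nat \<Rightarrow> nat \<Rightarrow> real). \<forall>p\<ge>2. (\<lambda>n. \<Sum>j<N n. e n j ^ p) \<longlonglongrightarrow> \<mu> p")
  case True
  then obtain N0 and e0 :: "nat \<Rightarrow> nat \<Rightarrow> real" where e0: "\<forall>p\<ge>2. (\<lambda>n. \<Sum>j<N0 n. e0 n j ^ p) \<longlonglongrightarrow> \<mu> p" by blast
  have "convergent (\<lambda>n. eig_list (N0 n) (e0 n) i)" for i
    by (rule eig_list_convergent_of_moments) (use e0 in \<open>auto simp: convergent_def\<close>)
  then obtain s where s: "\<And>i. (\<lambda>n. eig_list (N0 n) (e0 n) i) \<longlonglongrightarrow> s i"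
    unfolding convergent_def by metis
  show ?thesis
  proof (intro exI allI impI)
    fix N and e :: "nat \<Rightarrow> nat \<Rightarrow> real" and i
    assume e: "\<forall>p\<ge>2. (\<lambda>n. \<Sum>j<N n. e n j ^ p) \<longlonglongrightarrow> \<mu> p"
    define N' where "N' n = (if even n then N0 (n div 2) else N (n div 2))" for n
    define e' where "e' n = (if even n then e0 (n div 2) else e (n div 2))" for n
    have "(\<lambda>n. \<Sum>j<N' n. e' n j ^ p) \<longlonglongrightarrow> \<mu> p" if "p \<ge> 2" for p
    proof -
      have "(\<lambda>n. \<Sum>j<N' n. e' n j ^ p) =
        (\<lambda>n. if even n then \<Sum>j<N0 (n div 2). e0 (n div 2) j ^ p else \<Sum>j<N (n div 2). e (n div 2) j ^ p)"
        by (auto simp: N'_def e'_def)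
      then show ?thesis using tendsto_interleave[OF e0[rule_format, OF that] e[rule_format, OF that]] by simp
    qed
    then have "convergent (\<lambda>n. eig_list (N' n) (e' n) i)"
      by (intro eig_list_convergent_of_moments) (auto simp: convergent_def)
    then obtain L where L: "(\<lambda>n. eig_list (N' n) (e' n) i) \<longlonglongrightarrow> L" by (auto simp: convergent_def)
    have "(\<lambda>n. eig_list (N' (2 * n)) (e' (2 * n)) i) \<longlonglongrightarrow> L"
      using LIMSEQ_subseq_LIMSEQ[OF L, of "\<lambda>n. 2 * n"] by (simp add: strict_mono_def o_def)
    then have "(\<lambda>n. eig_list (N0 n) (e0 n) i) \<longlonglongrightarrow> L" by (simp add: N'_def e'_def)
    then have "L = s i" using s LIMSEQ_unique by blast
    have "(\<lambda>n. eig_list (N' (2 * n + 1)) (e' (2 * n + 1)) i) \<longlonglongrightarrow> L"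
      using LIMSEQ_subseq_LIMSEQ[OF L, of "\<lambda>n. 2 * n + 1"] by (simp add: strict_mono_def o_def)
    then have "(\<lambda>n. eig_list (N n) (e n) i) \<longlonglongrightarrow> L" by (simp add: N'_def e'_def)
    then show "(\<lambda>n. eig_list (N n) (e n) i) \<longlonglongrightarrow> s i" by (simp add: \<open>L = s i\<close>)
  qed
qed blast

text \<open>One list has to serve all sample points. The limits at level m depend on
  \<open>\<mu> m\<close> only, and the lists of d stay within \<open>\<eta> m\<close> of those of e,
  so both limits exist and agree as m grows.\<close>

lemma eig_list_approx_limit:
  fixes d :: "'w \<Rightarrow> nat \<Rightarrow> nat \<Rightarrow> real" and e :: "'w \<Rightarrow> nat \<Rightarrow> nat \<Rightarrow> nat \<Rightarrow> real" and \<eta> :: "nat \<Rightarrow> real"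
  assumes \<eta>: "\<eta> \<longlonglongrightarrow> 0" "\<And>m. \<eta> m \<ge> 0"
    and mom: "\<And>\<omega> m p. \<omega> \<in> G \<Longrightarrow> p \<ge> 2 \<Longrightarrow> (\<lambda>n. \<Sum>j<n. e \<omega> m n j ^ p) \<longlonglongrightarrow> \<mu> m p"
    and close: "\<And>\<omega> m. \<omega> \<in> G \<Longrightarrow> \<forall>\<^sub>F n in sequentially. \<forall>t.
       eig_count n (d \<omega> n) (t + \<eta> m) \<le> eig_count n (e \<omega> m n) t \<and>
       eig_count n (e \<omega> m n) (t + \<eta> m) \<le> eig_count n (d \<omega> n) t"
  shows "\<exists>s. decseq s \<and> (\<forall>i. 0 \<le> s i) \<and> s \<longlonglongrightarrow> 0 \<and>
    (\<forall>\<omega>\<in>G. \<forall>i. (\<lambda>n. eig_list n (d \<omega> n) i) \<longlonglongrightarrow> s i)"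
proof (cases "G = {}")
  case True
  then show ?thesis by (intro exI[of _ "\<lambda>_. 0"]) (auto simp: decseq_def)
next
  case False
  have "\<exists>sm. \<forall>m N (e :: nat \<Rightarrow> nat \<Rightarrow> real). (\<forall>p\<ge>2. (\<lambda>n. \<Sum>j<N n. e n j ^ p) \<longlonglongrightarrow> \<mu> m p) \<longrightarrow>
    (\<forall>i. (\<lambda>n. eig_list (N n) (e n) i) \<longlonglongrightarrow> sm m i)"
    by (rule choice, rule allI, rule eig_list_limit_determined)
  then obtain sm where sm0: "\<And>m N (e :: nat \<Rightarrow> nat \<Rightarrow> real) i. (\<forall>p\<ge>2. (\<lambda>n. \<Sum>j<N n. e n j ^ p) \<longlonglongrightarrow> \<mu> m p) \<Longrightarrow>
    (\<lambda>n. eig_list (N n) (e n) i) \<longlonglongrightarrow> sm m i" by blast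
  have sm: "(\<lambda>n. eig_list n (e \<omega> m n) i) \<longlonglongrightarrow> sm m i" if "\<omega> \<in> G" for \<omega> m i
    by (rule sm0[where N = "\<lambda>n. n"]) (use mom[OF that] in auto)
  have diff: "\<forall>\<^sub>F n in sequentially. \<forall>i. \<bar>eig_list n (d \<omega> n) i - eig_list n (e \<omega> m n) i\<bar> \<le> \<eta> m" if "\<omega> \<in> G" for \<omega> m
    using close[OF that, of m]
  proof eventually_elim
    case (elim n)
    show ?case
    proof
      fix i
      have "eig_list n (d \<omega> n) i \<le> eig_list n (e \<omega> m n) i + \<eta> m"
        by (rule eig_list_le_add) (use elim \<eta> in auto)
      moreover have "eig_list n (e \<omega> m n) i \<le> eig_list n (d \<omega> n) i + \<eta> m"
        by (rule eig_list_le_add) (use elim \<eta> in auto)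
      ultimately show "\<bar>eig_list n (d \<omega> n) i - eig_list n (e \<omega> m n) i\<bar> \<le> \<eta> m" by linarith
    qed
  qed
  have conv: "\<exists>L. (\<lambda>n. eig_list n (d \<omega> n) i) \<longlonglongrightarrow> L \<and> (\<lambda>m. sm m i) \<longlonglongrightarrow> L" if w: "\<omega> \<in> G" for \<omega> i
  proof -
    have "convergent (\<lambda>n. eig_list n (d \<omega> n) i)"
    proof (rule convergent_if_approx)
      fix \<delta> :: real assume "\<delta> > 0"
      then obtain m where m: "\<eta> m < \<delta>"
        using order_tendstoD(2)[OF \<eta>(1)] by (auto simp: eventually_sequentially)
      have "\<forall>\<^sub>F n in sequentially. \<bar>eig_list n (d \<omega> n) i - eig_list n (e \<omega> m n) i\<bar> \<le> \<delta>"
        using diff[OF w, of m]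
      proof eventually_elim
        case (elim n)
        show ?case using elim[rule_format, of i] m by linarith
      qed
      then show "\<exists>y. convergent y \<and> (\<forall>\<^sub>F n in sequentially. \<bar>eig_list n (d \<omega> n) i - y n\<bar> \<le> \<delta>)"
        using sm[OF w] by (auto simp: convergent_def)
    qed
    then obtain L where L: "(\<lambda>n. eig_list n (d \<omega> n) i) \<longlonglongrightarrow> L" by (auto simp: convergent_def)
    have "\<bar>L - sm m i\<bar> \<le> \<eta> m" for m
    proof (rule tendsto_upperbound)
      show "(\<lambda>n. \<bar>eig_list n (d \<omega> n) i - eig_list n (e \<omega> m n) i\<bar>) \<longlonglongrightarrow> \<bar>L - sm m i\<bar>"
        by (intro tendsto_intros L sm w)
      show "\<forall>\<^sub>F n in sequentially. \<bar>eig_list n (d \<omega> n) i - eig_list n (e \<omega> m n) i\<bar> \<le> \<eta> m"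
        using diff[OF w, of m] by eventually_elim auto
    qed simp
    then have "(\<lambda>m. sm m i - L) \<longlonglongrightarrow> 0"
      by (intro Lim_null_comparison[OF _ \<eta>(1)]) (simp add: abs_minus_commute)
    then have "(\<lambda>m. sm m i) \<longlonglongrightarrow> L" by (rule LIM_zero_cancel)
    then show ?thesis using L by blast
  qed
  \<comment> \<open>Only \<open>sm\<close> enters, and it was obtained from the moments before any
    sample point was chosen.\<close>
  define s where "s i = lim (\<lambda>m. sm m i)" for i
  have s: "(\<lambda>n. eig_list n (d \<omega> n) i) \<longlonglongrightarrow> s i" if "\<omega> \<in> G" for \<omega> i
    using conv[OF that, of i] by (auto simp: s_def dest: limI)
  obtain w where w: "w \<in> G" using False by blast
  have "decseq s"
    unfolding decseq_def
  proof (intro allI impI)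
    fix i j :: nat assume "i \<le> j"
    then show "s j \<le> s i"
      by (intro LIMSEQ_le[OF s[OF w] s[OF w]]) (auto intro!: decseqD[OF decseq_eig_list])
  qed
  moreover have nonneg: "0 \<le> s i" for i
    by (rule LIMSEQ_le_const[OF s[OF w]]) (auto intro: eig_list_nonneg)
  moreover have "s \<longlonglongrightarrow> 0"
  proof (rule order_tendstoI)
    fix a :: real assume a: "a < 0"
    have "a < s i" for i using nonneg[of i] a by linarith
    then show "\<forall>\<^sub>F i in sequentially. a < s i" by simp
  next
    fix a :: real assume a: "0 < a"
    then have "0 < a / 2" by simp
    from order_tendstoD(2)[OF \<eta>(1) this]
    obtain m where m: "\<eta> m < a / 2" by (auto simp: eventually_sequentially)
    have "convergent (\<lambda>n. \<Sum>j<n. e w m n j ^ 2)" using mom[OF w, of 2 m] by (auto simp: convergent_def)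
    then obtain C where C: "C > 0" "\<And>n. (\<Sum>j<n. e w m n j ^ 2) \<le> C" "\<And>n j. j < n \<Longrightarrow> \<bar>e w m n j\<bar> \<le> C"
      by (rule second_moment_bounded[where N = "\<lambda>n. n"]) (rule that, assumption+)
    define t where "t = a / 2"
    have t: "t > 0" using a by (simp add: t_def)
    \<comment> \<open>Markov's inequality: each eigenvalue above t contributes at least t^2 to the
      second moment. Hence from index C / t^2 on, the ordered eigenvalues are at most t.\<close>
    have cnt: "real (eig_count n (e w m n) t) * t\<^sup>2 \<le> C" for n
    proof -
      have "real (eig_count n (e w m n) t) * t\<^sup>2 = (\<Sum>j\<in>{j. j < n \<and> t < e w m n j}. t\<^sup>2)"
        by (simp add: eig_count_def)
      also have "\<dots> \<le> (\<Sum>j\<in>{j. j < n \<and> t < e w m n j}. e w m n j ^ 2)"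
        using t by (intro sum_mono power_mono) auto
      also have "\<dots> \<le> (\<Sum>j<n. e w m n j ^ 2)" by (intro sum_mono2) auto
      finally show ?thesis using C(2)[of n] by linarith
    qed
    have "s i < a" if i: "real i \<ge> C / t\<^sup>2" for i
    proof -
      have "eig_list n (e w m n) i \<le> t" for n
      proof -
        have "C \<le> real i * t\<^sup>2" using i t by (simp add: divide_simps)
        then have "real (eig_count n (e w m n) t) * t\<^sup>2 \<le> real i * t\<^sup>2" using cnt[of n] by linarith
        then have "eig_count n (e w m n) t \<le> i" using t by (simp add: mult_le_cancel_right)
        then show ?thesis using less_eig_list_iff[of t n "e w m n" i] t by auto
      qed
      note le = this
      have "\<forall>\<^sub>F n in sequentially. eig_list n (d w n) i \<le> t + \<eta> m"
        using diff[OF w, of m]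
      proof eventually_elim
        case (elim n)
        then show ?case using le[of n] elim[rule_format, of i] by linarith
      qed
      then have "s i \<le> t + \<eta> m" using tendsto_upperbound[OF s[OF w]] by auto
      then show ?thesis using m by (simp add: t_def)
    qed
    moreover have "\<forall>\<^sub>F i in sequentially. real i \<ge> C / t\<^sup>2"
      using filterlim_real_sequentially by (auto simp: filterlim_at_top)
    ultimately show "\<forall>\<^sub>F i in sequentially. s i < a" by (auto elim: eventually_mono)
  qed
  ultimately show ?thesis using s by blast
qed

section \<open>Diagonal operators on square-summable sequences\<close>

lemma ell2_nth_simps [simp]:
  "ell2_nth 0 i = 0" "ell2_nth (x + y) i = ell2_nth x i + ell2_nth y i"
  "ell2_nth (x - y) i = ell2_nth x i - ell2_nth y i" "ell2_nth (c *\<^sub>C x) i = c * ell2_nth x i"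
  "ell2_nth (r *\<^sub>R x) i = complex_of_real r * ell2_nth x i"
  by (simp_all add: zero_ell2.rep_eq plus_ell2.rep_eq minus_ell2.rep_eq scaleC_ell2.rep_eq scaleR_ell2.rep_eq)

lemma ell2_nth_sum [simp]: "ell2_nth (\<Sum>a\<in>S. f a) i = (\<Sum>a\<in>S. ell2_nth (f a) i)"
  by (induction S rule: infinite_finite_induct) auto

lemma summable_sq_dominated:
  fixes x y :: "nat \<Rightarrow> complex"
  assumes "\<And>i. cmod (y i) \<le> K * cmod (x i)" "summable (\<lambda>i. (cmod (x i))\<^sup>2)"
  shows "summable (\<lambda>i. (cmod (y i))\<^sup>2)"
proof (rule summable_comparison_test)
  show "summable (\<lambda>i. K\<^sup>2 * (cmod (x i))\<^sup>2)" using assms(2) by (rule summable_mult)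
  have "(cmod (y i))\<^sup>2 \<le> K\<^sup>2 * (cmod (x i))\<^sup>2" for i
    unfolding power_mult_distrib[symmetric] by (intro power_mono assms) auto
  then show "\<exists>N. \<forall>n\<ge>N. norm ((cmod (y n))\<^sup>2) \<le> K\<^sup>2 * (cmod (x n))\<^sup>2" by simp
qed

lemma norm_ell2_dominated:
  assumes "\<And>i. cmod (ell2_nth y i) \<le> K * cmod (ell2_nth x i)" "K \<ge> 0"
  shows "norm y \<le> K * norm x"
proof (rule power2_le_imp_le)
  have "(norm y)\<^sup>2 \<le> (\<Sum>i. K\<^sup>2 * (cmod (ell2_nth x i))\<^sup>2)"
    unfolding norm_ell2_sq power_mult_distrib[symmetric]
  proof (rule suminf_le)
    show "(cmod (ell2_nth y i))\<^sup>2 \<le> (K * cmod (ell2_nth x i))\<^sup>2" for i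
      by (intro power_mono assms) auto
    show "summable (\<lambda>i. (K * cmod (ell2_nth x i))\<^sup>2)"
      unfolding power_mult_distrib by (intro summable_mult ell2_summable)
  qed (rule ell2_summable)
  also have "\<dots> = K\<^sup>2 * (norm x)\<^sup>2" by (simp add: norm_ell2_sq suminf_mult ell2_summable)
  finally show "(norm y)\<^sup>2 \<le> (K * norm x)\<^sup>2" by (simp add: power_mult_distrib)
qed (use assms in auto)

definition ell2_unit :: "nat \<Rightarrow> ell2" where
  "ell2_unit j = Abs_ell2 (\<lambda>i. if i = j then 1 else 0)"

lemma ell2_nth_unit [simp]: "ell2_nth (ell2_unit j) i = (if i = j then 1 else 0)"
proof -
  have "summable (\<lambda>i. (cmod (if i = j then 1 else 0))\<^sup>2)"
    by (rule summable_finite[of "{j}"]) auto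
  then show ?thesis unfolding ell2_unit_def by (simp add: Abs_ell2_inverse)
qed

definition ell2_trunc :: "nat \<Rightarrow> ell2 \<Rightarrow> ell2" where
  "ell2_trunc K x = (\<Sum>j<K. ell2_nth x j *\<^sub>C ell2_unit j)"

lemma ell2_nth_trunc [simp]: "ell2_nth (ell2_trunc K x) i = (if i < K then ell2_nth x i else 0)"
  by (simp add: ell2_trunc_def if_distrib[where f = "\<lambda>y. _ * y"] sum.delta cong: if_cong)

text \<open>Sequences supported on the first K coordinates, each in a disk of radius R. The
  recursion presents the set as a continuous image of a product, so that compactness follows by
  induction.\<close>

primrec ell2_box :: "real \<Rightarrow> nat \<Rightarrow> ell2 set" where
  "ell2_box R 0 = {0}"
| "ell2_box R (Suc K) = (\<lambda>(x, c). x + c *\<^sub>C ell2_unit K) ` (ell2_box R K \<times> cball 0 R)"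

lemma compact_ell2_box: "compact (ell2_box R K)"
proof (induction K)
  case (Suc K)
  have "bounded_linear (\<lambda>c. c *\<^sub>C ell2_unit K)"
  proof (rule bounded_linear_intro[where K = "norm (ell2_unit K)"])
    fix c d :: complex and r :: real
    show "(c + d) *\<^sub>C ell2_unit K = c *\<^sub>C ell2_unit K + d *\<^sub>C ell2_unit K"
      by (rule scaleC_add_left)
    show "(r *\<^sub>R c) *\<^sub>C ell2_unit K = r *\<^sub>R c *\<^sub>C ell2_unit K"
      by (rule ell2_eqI) (simp add: scaleR_conv_of_real)
    show "norm (c *\<^sub>C ell2_unit K) \<le> norm c * norm (ell2_unit K)"
      by (rule norm_ell2_dominated) (auto simp: norm_mult)
  qed
  then have "continuous_on UNIV (\<lambda>c. c *\<^sub>C ell2_unit K)" by (rule linear_continuous_on)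
  then have "continuous_on (ell2_box R K \<times> cball 0 R) (\<lambda>p. snd p *\<^sub>C ell2_unit K)"
    by (rule continuous_on_compose2) (auto intro: continuous_intros)
  then show ?case
    unfolding ell2_box.simps case_prod_unfold
    by (intro compact_continuous_image compact_Times Suc continuous_intros) auto
qed simp

lemma ell2_trunc_in_box: "(\<And>i. cmod (ell2_nth x i) \<le> R) \<Longrightarrow> ell2_trunc K x \<in> ell2_box R K"
proof (induction K)
  case (Suc K)
  then show ?case
    by (auto simp: ell2_trunc_def intro!: image_eqI[of _ _ "(ell2_trunc K x, ell2_nth x K)"])
qed (simp add: ell2_trunc_def)

text \<open>Finite nets of the approximating compact sets are nets of S, so the closed closure of S
  is totally bounded.\<close>

lemma compact_closure_if_approx:
  fixes S :: "'a::complete_space set"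
  assumes "\<And>e. e > 0 \<Longrightarrow> \<exists>C. compact C \<and> (\<forall>x\<in>S. \<exists>y\<in>C. dist x y \<le> e)"
  shows "compact (closure S)"
  unfolding compact_eq_totally_bounded
proof (intro conjI allI impI)
  show "Topological_Spaces.complete (closure S)" by (simp add: complete_eq_closed)
  fix e :: real assume e: "e > 0"
  then obtain C where C: "compact C" "\<forall>x\<in>S. \<exists>y\<in>C. dist x y \<le> e / 4"
    using assms[of "e / 4"] by auto
  obtain k where k: "finite k" "C \<subseteq> (\<Union>x\<in>k. ball x (e / 4))"
    using C(1)[unfolded compact_eq_totally_bounded] e by (auto dest!: spec[of _ "e / 4"])
  have "S \<subseteq> (\<Union>x\<in>k. cball x (e / 2))"
  proof
    fix x assume "x \<in> S"
    then obtain y where y: "y \<in> C" "dist x y \<le> e / 4" using C(2) by blast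
    then obtain z where z: "z \<in> k" "dist z y < e / 4" using k(2) by auto
    have "dist z x \<le> e / 2" using dist_triangle2[of z x y] y z by linarith
    then show "x \<in> (\<Union>x\<in>k. cball x (e / 2))" using z by auto
  qed
  then have "closure S \<subseteq> (\<Union>x\<in>k. cball x (e / 2))"
    by (rule closure_minimal) (use k in auto)
  also have "\<dots> \<subseteq> (\<Union>x\<in>k. ball x e)" using e by (auto simp: less_le_trans)
  finally show "\<exists>k. finite k \<and> closure S \<subseteq> (\<Union>x\<in>k. ball x e)" using k(1) by blast
qed

definition diag_op :: "(nat \<Rightarrow> real) \<Rightarrow> ell2 \<Rightarrow> ell2" where
  "diag_op d x = Abs_ell2 (\<lambda>i. complex_of_real (d i) * ell2_nth x i)"

lemma ell2_nth_diag_op: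
  assumes "d \<longlonglongrightarrow> 0"
  shows "ell2_nth (diag_op d x) i = complex_of_real (d i) * ell2_nth x i"
proof -
  obtain K where K: "\<And>i. \<bar>d i\<bar> \<le> K" using convergent_imp_Bseq[of d] assms by (auto simp: convergent_def Bseq_def)
  have "summable (\<lambda>i. (cmod (complex_of_real (d i) * ell2_nth x i))\<^sup>2)"
    by (rule summable_sq_dominated[OF _ ell2_summable, of _ K]) (auto simp: norm_mult intro!: mult_right_mono K)
  then show ?thesis unfolding diag_op_def by (simp add: Abs_ell2_inverse)
qed

text \<open>Beyond index K all entries of d are at most e, so cutting off the tail moves the image
  of the unit ball by at most e into a compact box.\<close>

lemma selfadjoint_compact_diag_op:
  assumes d: "d \<longlonglongrightarrow> 0"
  shows "selfadjoint_compact (diag_op d)"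
  unfolding selfadjoint_compact_def
proof (intro conjI allI)
  note nth = ell2_nth_diag_op[OF d]
  show "Vector_Spaces.linear scaleC scaleC (diag_op d)"
    by unfold_locales (auto intro!: ell2_eqI simp: nth algebra_simps)
  show "cinner (diag_op d x) y = cinner x (diag_op d y)" for x y
    by (simp add: cinner_ell2_def nth mult_ac)
  obtain R where R: "R > 0" "\<And>i. \<bar>d i\<bar> \<le> R" using convergent_imp_Bseq[of d] d by (auto simp: convergent_def Bseq_def)
  show "compact (closure (diag_op d ` cball 0 1))"
  proof (rule compact_closure_if_approx)
    fix e :: real assume e: "e > 0"
    have "\<forall>\<^sub>F i in sequentially. dist (d i) 0 < e" using d e by (rule tendstoD)
    then obtain K where K: "\<And>i. i \<ge> K \<Longrightarrow> \<bar>d i\<bar> \<le> e"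
      by (auto simp: eventually_sequentially dist_real_def intro: less_imp_le)
    have "\<exists>y\<in>ell2_box R K. dist (diag_op d x) y \<le> e" if x: "norm x \<le> 1" for x
    proof
      have "cmod (ell2_nth (diag_op d x) i) \<le> R" for i
      proof -
        have "cmod (ell2_nth (diag_op d x) i) = \<bar>d i\<bar> * cmod (ell2_nth x i)" by (simp add: nth norm_mult)
        also have "\<dots> \<le> R * 1" using R nth_le_norm_ell2[of x i] x by (intro mult_mono) auto
        finally show ?thesis by simp
      qed
      then show "ell2_trunc K (diag_op d x) \<in> ell2_box R K" by (rule ell2_trunc_in_box)
      have "norm (diag_op d x - ell2_trunc K (diag_op d x)) \<le> e * norm x"
        by (rule norm_ell2_dominated) (use e K in \<open>auto simp: nth norm_mult intro!: mult_right_mono\<close>)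
      also have "\<dots> \<le> e" using x e by (simp add: mult_left_le)
      finally show "dist (diag_op d x) (ell2_trunc K (diag_op d x)) \<le> e" by (simp add: dist_norm)
    qed
    then show "\<exists>C. compact C \<and> (\<forall>x\<in>diag_op d ` cball 0 1. \<exists>y\<in>C. dist x y \<le> e)"
      by (intro exI[of _ "ell2_box R K"]) (auto simp: compact_ell2_box)
  qed
qed

lemma finite_level_set:
  fixes d :: "nat \<Rightarrow> real"
  assumes "d \<longlonglongrightarrow> 0" "t \<noteq> 0"
  shows "finite {i. d i = t}"
proof -
  have "\<forall>\<^sub>F i in sequentially. dist (d i) 0 < \<bar>t\<bar>" using assms by (intro tendstoD) auto
  then obtain K where K: "\<And>i. i \<ge> K \<Longrightarrow> \<bar>d i\<bar> < \<bar>t\<bar>" by (auto simp: eventually_sequentially dist_real_def)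
  have "{i. d i = t} \<subseteq> {..<K}" using K by (force simp: not_less[symmetric])
  then show ?thesis using finite_subset by blast
qed

text \<open>The eigenspace is spanned by the unit vectors at the indices with d i = t; these are
  finitely many because d tends to 0 and t is not 0.\<close>

lemma op_multiplicity_diag_op:
  assumes d: "d \<longlonglongrightarrow> 0" and t: "t \<noteq> 0"
  shows "op_multiplicity (diag_op d) t = card {i. d i = t}"
proof -
  note nth = ell2_nth_diag_op[OF d]
  define I where "I = {i. d i = t}"
  have fin: "finite I" unfolding I_def by (rule finite_level_set[OF d t])
  have inj: "inj_on ell2_unit I"
    by (rule inj_onI) (metis ell2_nth_unit zero_neq_one)
  have indep: "\<not> complex_vector.dependent (ell2_unit ` I)"
  proof
    assume "complex_vector.dependent (ell2_unit ` I)"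
    then obtain u i where i: "i \<in> I" "u (ell2_unit i) \<noteq> 0" "(\<Sum>v\<in>ell2_unit ` I. u v *\<^sub>C v) = 0"
      using complex_vector.dependent_finite[of "ell2_unit ` I"] fin by auto
    have "0 = ell2_nth (\<Sum>j\<in>I. u (ell2_unit j) *\<^sub>C ell2_unit j) i"
      using i(3) by (simp only: sum.reindex[OF inj] o_def ell2_nth_simps)
    also have "\<dots> = u (ell2_unit i)"
      using fin i(1) by (simp add: if_distrib[where f = "\<lambda>y. _ * y"] cong: if_cong)
    finally show False using i(2) by simp
  qed
  have mem: "x \<in> eigenspace (diag_op d) t \<longleftrightarrow> (\<forall>i. d i = t \<or> ell2_nth x i = 0)" for x
  proof -
    have "x \<in> eigenspace (diag_op d) t \<longleftrightarrow> (\<forall>i. ell2_nth (diag_op d x) i = ell2_nth (t *\<^sub>R x) i)"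
      unfolding eigenspace_def by (auto intro: ell2_eqI)
    then show ?thesis by (simp add: nth disj_commute)
  qed
  have "eigenspace (diag_op d) t = cspan (ell2_unit ` I)"
  proof
    show "cspan (ell2_unit ` I) \<subseteq> eigenspace (diag_op d) t"
    proof (rule complex_vector.span_minimal)
      have "ell2_unit i \<in> eigenspace (diag_op d) t" if "i \<in> I" for i
        unfolding mem using that by (simp add: I_def)
      then show "ell2_unit ` I \<subseteq> eigenspace (diag_op d) t" by blast
      show "complex_vector.subspace (eigenspace (diag_op d) t)"
        unfolding complex_vector.subspace_def Ball_def mem ell2_nth_simps by (metis add_0 mult_zero_right)
    qed
    show "eigenspace (diag_op d) t \<subseteq> cspan (ell2_unit ` I)"
    proof
      fix x assume "x \<in> eigenspace (diag_op d) t"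
      then have z: "ell2_nth x i = 0" if "i \<notin> I" for i using that by (auto simp: mem I_def)
      have "x = (\<Sum>i\<in>I. ell2_nth x i *\<^sub>C ell2_unit i)"
        using fin by (intro ell2_eqI) (auto simp: z if_distrib[where f = "\<lambda>y. _ * y"] cong: if_cong)
      also have "\<dots> \<in> cspan (ell2_unit ` I)"
        by (intro complex_vector.span_sum complex_vector.span_scale complex_vector.span_base) auto
      finally show "x \<in> cspan (ell2_unit ` I)" .
    qed
  qed
  then have "op_multiplicity (diag_op d) t = card (ell2_unit ` I)"
    unfolding op_multiplicity_def using complex_vector.dim_span_eq_card_independent[OF indep] by simp
  then show ?thesis using card_image[OF inj] by (simp add: I_def)
qed

text \<open>The diagonal carries s at even and -s' at odd indices. Zeros occurring in either
  sequence are harmless, since only multiplicities of nonzero values are counted.\<close>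

lemma exists_compact_operator_with_eigenvalues:
  fixes s s' :: "nat \<Rightarrow> real"
  assumes s: "decseq s" "\<And>i. 0 \<le> s i" "s \<longlonglongrightarrow> 0"
    and s': "decseq s'" "\<And>i. 0 \<le> s' i" "s' \<longlonglongrightarrow> 0"
  shows "\<exists>T :: ell2 \<Rightarrow> ell2. selfadjoint_compact T \<and> pos_eigenvalues (op_multiplicity T) = s \<and>
    neg_eigenvalues (op_multiplicity T) = (\<lambda>i. - s' i)"
proof -
  define d where "d n = (if even n then s (n div 2) else - s' (n div 2))" for n
  have d: "d \<longlonglongrightarrow> 0"
    unfolding d_def using tendsto_interleave[OF s(3), of "\<lambda>i. - s' i"] tendsto_minus[OF s'(3)] by simp
  have 1: "card {n. d n = t} = card {i. s i = t}" if t: "t > 0" for t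
  proof -
    have "{n. d n = t} = (\<lambda>i. 2 * i) ` {i. s i = t}"
    proof (intro equalityI subsetI)
      fix n assume n: "n \<in> {n. d n = t}"
      have "even n"
      proof (rule ccontr)
        assume "odd n"
        then have "d n \<le> 0" using s'(2) by (simp add: d_def)
        then show False using n t by simp
      qed
      then show "n \<in> (\<lambda>i. 2 * i) ` {i. s i = t}" using n by (auto simp: d_def image_iff elim!: evenE)
    qed (auto simp: d_def)
    then show ?thesis by (simp add: card_image inj_on_def)
  qed
  have 2: "card {n. d n = - t} = card {i. s' i = t}" if t: "t > 0" for t
  proof -
    have "{n. d n = - t} = (\<lambda>i. 2 * i + 1) ` {i. s' i = t}"
    proof (intro equalityI subsetI)
      fix n assume n: "n \<in> {n. d n = - t}"
      have "odd n"
      proof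
        assume "even n"
        then have "d n \<ge> 0" using s(2) by (simp add: d_def)
        then show False using n t by simp
      qed
      then show "n \<in> (\<lambda>i. 2 * i + 1) ` {i. s' i = t}" using n by (auto simp: d_def image_iff elim!: oddE)
    qed (auto simp: d_def)
    then show ?thesis by (simp add: card_image inj_on_def)
  qed
  have "pos_eigenvalues (op_multiplicity (diag_op d)) = s"
    by (rule pos_eigenvalues_eqI) (use s 1 finite_level_set[OF s(3)] in \<open>auto simp: op_multiplicity_diag_op[OF d]\<close>)
  moreover have "neg_eigenvalues (op_multiplicity (diag_op d)) = (\<lambda>i. - s' i)"
    by (rule neg_eigenvalues_eqI) (use s' 2 finite_level_set[OF s'(3)] in \<open>auto simp: op_multiplicity_diag_op[OF d]\<close>)
  ultimately show ?thesis using selfadjoint_compact_diag_op[OF d] by blast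
qed

section \<open>Khintchine's inequality for eighth moments\<close>

text \<open>Subsets encode sign vectors: summing over \<open>Pow {..<n}\<close> and dividing by 2^n
  is the expectation over independent random signs.\<close>

definition sgn_of :: "nat set \<Rightarrow> nat \<Rightarrow> real" where
  "sgn_of S i = (if i \<in> S then -1 else 1)"

text \<open>Conditioning on the last sign.\<close>

lemma sum_signs_Suc:
  fixes z :: "nat \<Rightarrow> real"
  shows "(\<Sum>S\<in>Pow {..<Suc n}. f (\<Sum>i<Suc n. sgn_of S i * z i)) =
    (\<Sum>S\<in>Pow {..<n}. f ((\<Sum>i<n. sgn_of S i * z i) + z n) + f ((\<Sum>i<n. sgn_of S i * z i) - z n))"
proof -
  have 1: "(\<Sum>i<Suc n. sgn_of S i * z i) = (\<Sum>i<n. sgn_of S i * z i) + z n" if "S \<in> Pow {..<n}" for S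
    using that by (auto simp: sgn_of_def)
  have 2: "(\<Sum>i<Suc n. sgn_of (insert n S) i * z i) = (\<Sum>i<n. sgn_of S i * z i) - z n" if "S \<in> Pow {..<n}" for S
    using that by (auto simp: sgn_of_def intro!: sum.cong)
  have inj: "inj_on (insert n) (Pow {..<n})"
    by (auto simp: inj_on_def insert_ident)
  have "(\<Sum>S\<in>Pow {..<Suc n}. f (\<Sum>i<Suc n. sgn_of S i * z i)) =
      (\<Sum>S\<in>Pow {..<n}. f (\<Sum>i<Suc n. sgn_of S i * z i)) +
      (\<Sum>S\<in>insert n ` Pow {..<n}. f (\<Sum>i<Suc n. sgn_of S i * z i))"
    unfolding lessThan_Suc[of n] Pow_insert by (rule sum.union_disjoint) auto
  also have "(\<Sum>S\<in>insert n ` Pow {..<n}. f (\<Sum>i<Suc n. sgn_of S i * z i)) =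
      (\<Sum>S\<in>Pow {..<n}. f (\<Sum>i<Suc n. sgn_of (insert n S) i * z i))"
    by (simp only: sum.reindex[OF inj] o_def)
  also have "(\<Sum>S\<in>Pow {..<n}. f (\<Sum>i<Suc n. sgn_of S i * z i)) = (\<Sum>S\<in>Pow {..<n}. f ((\<Sum>i<n. sgn_of S i * z i) + z n))"
    by (intro sum.cong refl) (simp only: 1)
  also have "(\<Sum>S\<in>Pow {..<n}. f (\<Sum>i<Suc n. sgn_of (insert n S) i * z i)) = (\<Sum>S\<in>Pow {..<n}. f ((\<Sum>i<n. sgn_of S i * z i) - z n))"
    by (intro sum.cong refl) (simp only: 2)
  finally show ?thesis by (simp add: sum.distrib)
qed

text \<open>The constants 1, 3, 15, 105 are the even moments of a standard Gaussian. All four bounds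
  are carried at once because expanding (a + z)^8 + (a - z)^8 brings in every lower even
  moment.\<close>

lemma khintchine_real_aux:
  fixes z :: "nat \<Rightarrow> real"
  defines "a \<equiv> \<lambda>n S. \<Sum>i<n. sgn_of S i * z i" and "\<sigma> \<equiv> \<lambda>n. \<Sum>i<n. (z i)\<^sup>2"
  shows "(\<Sum>S\<in>Pow {..<n}. a n S ^ 2) \<le> 2 ^ n * \<sigma> n \<and> (\<Sum>S\<in>Pow {..<n}. a n S ^ 4) \<le> 2 ^ n * (3 * \<sigma> n ^ 2) \<and>
    (\<Sum>S\<in>Pow {..<n}. a n S ^ 6) \<le> 2 ^ n * (15 * \<sigma> n ^ 3) \<and>
    (\<Sum>S\<in>Pow {..<n}. a n S ^ 8) \<le> 2 ^ n * (105 * \<sigma> n ^ 4)"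
proof (induction n)
  case 0
  then show ?case by (simp add: a_def \<sigma>_def)
next
  case (Suc n)
  define E where "E k = (\<Sum>S\<in>Pow {..<n}. a n S ^ k)" for k
  define t where "t = (z n)\<^sup>2"
  define s where "s = \<sigma> n"
  have st: "\<sigma> (Suc n) = s + t" "s \<ge> 0" "t \<ge> 0" by (auto simp: \<sigma>_def s_def t_def sum_nonneg)
  have IH: "E 2 \<le> 2 ^ n * s" "E 4 \<le> 2 ^ n * (3 * s\<^sup>2)" "E 6 \<le> 2 ^ n * (15 * s ^ 3)" "E 8 \<le> 2 ^ n * (105 * s ^ 4)"
    using Suc by (auto simp: E_def s_def)
  have card: "(\<Sum>S\<in>Pow {..<n}. 1 :: real) = 2 ^ n" by (simp add: card_Pow)
  have e2: "(\<Sum>S\<in>Pow {..<Suc n}. a (Suc n) S ^ 2) = 2 * E 2 + 2 * t * 2 ^ n"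
  proof -
    have "(\<Sum>S\<in>Pow {..<Suc n}. a (Suc n) S ^ 2) = (\<Sum>S\<in>Pow {..<n}. 2 * a n S ^ 2 + 2 * t * 1)"
      unfolding a_def sum_signs_Suc[where f = "\<lambda>x. x ^ 2"] by (rule sum.cong) (auto simp: t_def power2_eq_square algebra_simps)
    then show ?thesis unfolding sum.distrib sum_distrib_left[symmetric] card E_def by simp
  qed
  have e4: "(\<Sum>S\<in>Pow {..<Suc n}. a (Suc n) S ^ 4) = 2 * E 4 + 12 * t * E 2 + 2 * t\<^sup>2 * 2 ^ n"
  proof -
    have "(\<Sum>S\<in>Pow {..<Suc n}. a (Suc n) S ^ 4) = (\<Sum>S\<in>Pow {..<n}. 2 * a n S ^ 4 + 12 * t * a n S ^ 2 + 2 * t\<^sup>2 * 1)"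
      unfolding a_def sum_signs_Suc[where f = "\<lambda>x. x ^ 4"] by (rule sum.cong) (auto simp: t_def, Groebner_Basis.algebra)
    then show ?thesis unfolding sum.distrib sum_distrib_left[symmetric] card E_def by simp
  qed
  have e6: "(\<Sum>S\<in>Pow {..<Suc n}. a (Suc n) S ^ 6) = 2 * E 6 + 30 * t * E 4 + 30 * t\<^sup>2 * E 2 + 2 * t ^ 3 * 2 ^ n"
  proof -
    have "(\<Sum>S\<in>Pow {..<Suc n}. a (Suc n) S ^ 6) =
      (\<Sum>S\<in>Pow {..<n}. 2 * a n S ^ 6 + 30 * t * a n S ^ 4 + 30 * t\<^sup>2 * a n S ^ 2 + 2 * t ^ 3 * 1)"
      unfolding a_def sum_signs_Suc[where f = "\<lambda>x. x ^ 6"] by (rule sum.cong) (auto simp: t_def, Groebner_Basis.algebra)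
    then show ?thesis unfolding sum.distrib sum_distrib_left[symmetric] card E_def by simp
  qed
  have e8: "(\<Sum>S\<in>Pow {..<Suc n}. a (Suc n) S ^ 8) =
      2 * E 8 + 56 * t * E 6 + 140 * t\<^sup>2 * E 4 + 56 * t ^ 3 * E 2 + 2 * t ^ 4 * 2 ^ n"
  proof -
    have "(\<Sum>S\<in>Pow {..<Suc n}. a (Suc n) S ^ 8) =
      (\<Sum>S\<in>Pow {..<n}. 2 * a n S ^ 8 + 56 * t * a n S ^ 6 + 140 * t\<^sup>2 * a n S ^ 4 + 56 * t ^ 3 * a n S ^ 2 + 2 * t ^ 4 * 1)"
      unfolding a_def sum_signs_Suc[where f = "\<lambda>x. x ^ 8"] by (rule sum.cong) (auto simp: t_def, Groebner_Basis.algebra)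
    then show ?thesis unfolding sum.distrib sum_distrib_left[symmetric] card E_def by simp
  qed
  define q where "q = (2 :: real) ^ n"
  have q: "q \<ge> 0" by (simp add: q_def)
  note IH' = IH[folded q_def]
  have m: "r * u \<le> r * v" if "u \<le> v" "r \<ge> 0" for r u v :: real using that by (rule mult_left_mono)
  have nn: "0 \<le> q * (s ^ i * t ^ j)" for i j using q st by simp
  have b2: "2 * E 2 + 2 * t * q \<le> 2 * q * (s + t)"
    using IH' by (simp add: algebra_simps)
  have b4: "2 * E 4 + 12 * t * E 2 + 2 * t\<^sup>2 * q \<le> 2 * q * (3 * (s + t)\<^sup>2)"
  proof -
    have "2 * E 4 + 12 * t * E 2 + 2 * t\<^sup>2 * q \<le> 2 * (q * (3 * s\<^sup>2)) + 12 * t * (q * s) + 2 * t\<^sup>2 * q"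
      using IH' st by (intro add_mono m) auto
    \<comment> \<open>The subtracted term is the gap between Gaussian and sign moments: t^2 has
      coefficient 2 on the left against 6 in the bound. The terms subtracted in the sixth and eighth
      moments arise in the same way.\<close>
    also have "\<dots> = 2 * q * (3 * (s + t)\<^sup>2) - 4 * (q * (s ^ 0 * t ^ 2))" by Groebner_Basis.algebra
    finally show ?thesis using nn[of 0 2] by linarith
  qed
  have b6: "2 * E 6 + 30 * t * E 4 + 30 * t\<^sup>2 * E 2 + 2 * t ^ 3 * q \<le> 2 * q * (15 * (s + t) ^ 3)"
  proof -
    have "2 * E 6 + 30 * t * E 4 + 30 * t\<^sup>2 * E 2 + 2 * t ^ 3 * q \<le>
        2 * (q * (15 * s ^ 3)) + 30 * t * (q * (3 * s\<^sup>2)) + 30 * t\<^sup>2 * (q * s) + 2 * t ^ 3 * q"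
      using IH' st by (intro add_mono m) auto
    also have "\<dots> = 2 * q * (15 * (s + t) ^ 3) - 60 * (q * (s ^ 1 * t ^ 2)) - 28 * (q * (s ^ 0 * t ^ 3))" by Groebner_Basis.algebra
    finally show ?thesis using nn[of 1 2] nn[of 0 3] by linarith
  qed
  have b8: "2 * E 8 + 56 * t * E 6 + 140 * t\<^sup>2 * E 4 + 56 * t ^ 3 * E 2 + 2 * t ^ 4 * q \<le> 2 * q * (105 * (s + t) ^ 4)"
  proof -
    have "2 * E 8 + 56 * t * E 6 + 140 * t\<^sup>2 * E 4 + 56 * t ^ 3 * E 2 + 2 * t ^ 4 * q \<le>
        2 * (q * (105 * s ^ 4)) + 56 * t * (q * (15 * s ^ 3)) + 140 * t\<^sup>2 * (q * (3 * s\<^sup>2)) + 56 * t ^ 3 * (q * s) + 2 * t ^ 4 * q"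
      using IH' st by (intro add_mono m) auto
    also have "\<dots> = 2 * q * (105 * (s + t) ^ 4) - 840 * (q * (s ^ 2 * t ^ 2)) - 784 * (q * (s ^ 1 * t ^ 3)) - 208 * (q * (s ^ 0 * t ^ 4))" by Groebner_Basis.algebra
    finally show ?thesis using nn[of 2 2] nn[of 1 3] nn[of 0 4] by linarith
  qed
  show ?case
    unfolding e2 e4 e6 e8 st(1) using b2 b4 b6 b8 by (simp add: q_def)
qed

text \<open>Split into real and imaginary parts. The constant is 840 = 8 * 105, where 8 comes from
  the convexity bound (a + b)^4 <= 8 (a^4 + b^4).\<close>

lemma khintchine_eighth:
  fixes z :: "nat \<Rightarrow> complex"
  shows "(\<Sum>S\<in>Pow {..<n}. cmod (\<Sum>i<n. complex_of_real (sgn_of S i) * z i) ^ 8) \<le> 2 ^ n * (840 * (\<Sum>i<n. (cmod (z i))\<^sup>2) ^ 4)"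
proof -
  let ?r = "\<lambda>S. \<Sum>i<n. sgn_of S i * Re (z i)" and ?s = "\<lambda>S. \<Sum>i<n. sgn_of S i * Im (z i)"
  have pow: "(a + b) ^ 4 \<le> 8 * (a ^ 4 + b ^ 4)" if "a \<ge> 0" "b \<ge> 0" for a b :: real
  proof -
    have "8 * (a ^ 4 + b ^ 4) - (a + b) ^ 4 = (a - b)\<^sup>2 * (7 * a\<^sup>2 + 10 * (a * b) + 7 * b\<^sup>2)"
      by (simp add: power2_eq_square power4_eq_xxxx algebra_simps)
    moreover have "\<dots> \<ge> 0" using that by (intro mult_nonneg_nonneg add_nonneg_nonneg) auto
    ultimately show ?thesis by linarith
  qed
  have pt: "cmod (\<Sum>i<n. complex_of_real (sgn_of S i) * z i) ^ 8 \<le> 8 * (?r S ^ 8 + ?s S ^ 8)" for S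
  proof -
    let ?w = "\<Sum>i<n. complex_of_real (sgn_of S i) * z i"
    have ri: "Re ?w = ?r S" "Im ?w = ?s S" by (simp_all)
    have "cmod ?w ^ 8 = ((cmod ?w)\<^sup>2) ^ 4" by (simp flip: power_mult)
    also have "\<dots> = ((?r S)\<^sup>2 + (?s S)\<^sup>2) ^ 4" by (simp only: cmod_power2 ri)
    also have "\<dots> \<le> 8 * (((?r S)\<^sup>2) ^ 4 + ((?s S)\<^sup>2) ^ 4)" by (rule pow) auto
    finally show ?thesis by (simp flip: power_mult)
  qed
  let ?A = "\<Sum>i<n. (Re (z i))\<^sup>2" and ?B = "\<Sum>i<n. (Im (z i))\<^sup>2"
  have "(\<Sum>S\<in>Pow {..<n}. cmod (\<Sum>i<n. complex_of_real (sgn_of S i) * z i) ^ 8) \<le> (\<Sum>S\<in>Pow {..<n}. 8 * (?r S ^ 8 + ?s S ^ 8))"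
    by (intro sum_mono pt)
  also have "\<dots> = 8 * ((\<Sum>S\<in>Pow {..<n}. ?r S ^ 8) + (\<Sum>S\<in>Pow {..<n}. ?s S ^ 8))"
    by (simp add: sum_distrib_left sum.distrib distrib_left)
  also have "\<dots> \<le> 8 * (2 ^ n * (105 * ?A ^ 4) + 2 ^ n * (105 * ?B ^ 4))"
    using khintchine_real_aux[of "\<lambda>i. Re (z i)" n] khintchine_real_aux[of "\<lambda>i. Im (z i)" n] by simp
  also have "\<dots> = 2 ^ n * (840 * (?A ^ 4 + ?B ^ 4))" by (simp add: algebra_simps)
  also have "\<dots> \<le> 2 ^ n * (840 * (?A + ?B) ^ 4)"
  proof -
    have "a ^ 4 + b ^ 4 \<le> (a + b) ^ 4" if "a \<ge> 0" "b \<ge> 0" for a b :: real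
    proof -
      have "(a + b) ^ 4 - (a ^ 4 + b ^ 4) = 4 * (a ^ 3 * b) + 6 * (a\<^sup>2 * b\<^sup>2) + 4 * (a * b ^ 3)" by Groebner_Basis.algebra
      moreover have "\<dots> \<ge> 0" using that by simp
      ultimately show ?thesis by linarith
    qed
    from this[of ?A ?B] show ?thesis by (intro mult_left_mono) (auto simp: sum_nonneg)
  qed
  also have "?A + ?B = (\<Sum>i<n. (cmod (z i))\<^sup>2)" by (simp add: cmod_power2 sum.distrib)
  finally show ?thesis .
qed

section \<open>A fourth moment bound for exchangeable variables\<close>

definition swap_idx :: "nat \<Rightarrow> nat \<Rightarrow> nat \<Rightarrow> nat" where
  "swap_idx i j k = (if k = i then j else if k = j then i else k)"

lemma swap_idx_swap [simp]: "swap_idx i j (swap_idx i j k) = k"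
  by (auto simp: swap_idx_def)

lemma swap_idx_less [simp]: "i < n \<Longrightarrow> j < n \<Longrightarrow> k < n \<Longrightarrow> swap_idx i j k < n"
  by (auto simp: swap_idx_def)

lemma sum_swap_idx_diff:
  fixes c p :: "nat \<Rightarrow> real"
  assumes "i < n" "j < n"
  shows "(\<Sum>k<n. c k * p k) - (\<Sum>k<n. c k * p (swap_idx i j k)) = (c i - c j) * (p i - p j)"
proof -
  have "(\<Sum>k<n. c k * p k) - (\<Sum>k<n. c k * p (swap_idx i j k)) = (\<Sum>k<n. c k * (p k - p (swap_idx i j k)))"
    by (simp add: sum_subtractf right_diff_distrib)
  also have "\<dots> = (\<Sum>k\<in>{i, j}. c k * (p k - p (swap_idx i j k)))"
    using assms by (intro sum.mono_neutral_right) (auto simp: swap_idx_def)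
  also have "\<dots> = (c i - c j) * (p i - p j)"
    by (cases "i = j") (auto simp: swap_idx_def algebra_simps)
  finally show ?thesis .
qed

text \<open>A class closed under the algebraic operations whose members are integrable for every
  probability measure; it settles the integrability of all polynomial expressions below.\<close>

definition bounded_meas :: "'w measure \<Rightarrow> ('w \<Rightarrow> real) \<Rightarrow> bool" where
  "bounded_meas \<mu> f \<longleftrightarrow> f \<in> borel_measurable \<mu> \<and> (\<exists>B. \<forall>\<omega>\<in>space \<mu>. \<bar>f \<omega>\<bar> \<le> B)"

lemma (in prob_space) integrable_bounded_meas: "bounded_meas M f \<Longrightarrow> integrable M f"
  unfolding bounded_meas_def real_norm_def[symmetric] by (blast intro: integrable_const_bound AE_I2)

lemma bounded_meas_add:
  assumes "bounded_meas \<mu> f" "bounded_meas \<mu> g"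
  shows "bounded_meas \<mu> (\<lambda>\<omega>. f \<omega> + g \<omega>)"
proof -
  obtain A B where AB: "\<And>\<omega>. \<omega> \<in> space \<mu> \<Longrightarrow> \<bar>f \<omega>\<bar> \<le> A" "\<And>\<omega>. \<omega> \<in> space \<mu> \<Longrightarrow> \<bar>g \<omega>\<bar> \<le> B"
    using assms by (auto simp: bounded_meas_def)
  have "\<bar>f \<omega> + g \<omega>\<bar> \<le> A + B" if "\<omega> \<in> space \<mu>" for \<omega>
    using AB[OF that] by linarith
  then show ?thesis using assms by (auto simp: bounded_meas_def)
qed

lemma bounded_meas_mult:
  assumes "bounded_meas \<mu> f" "bounded_meas \<mu> g"
  shows "bounded_meas \<mu> (\<lambda>\<omega>. f \<omega> * g \<omega>)"
proof -
  obtain A B where AB: "\<And>\<omega>. \<omega> \<in> space \<mu> \<Longrightarrow> \<bar>f \<omega>\<bar> \<le> A" "\<And>\<omega>. \<omega> \<in> space \<mu> \<Longrightarrow> \<bar>g \<omega>\<bar> \<le> B"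
    using assms by (auto simp: bounded_meas_def)
  have "\<bar>f \<omega> * g \<omega>\<bar> \<le> A * B" if "\<omega> \<in> space \<mu>" for \<omega>
    unfolding abs_mult using AB[OF that] by (intro mult_mono) auto
  then show ?thesis using assms by (auto simp: bounded_meas_def)
qed

lemma bounded_meas_const: "bounded_meas \<mu> (\<lambda>_. c)"
  by (auto simp: bounded_meas_def)

lemma bounded_meas_minus: "bounded_meas \<mu> f \<Longrightarrow> bounded_meas \<mu> (\<lambda>\<omega>. - f \<omega>)"
  by (auto simp: bounded_meas_def)

lemma bounded_meas_diff:
  "bounded_meas \<mu> f \<Longrightarrow> bounded_meas \<mu> g \<Longrightarrow> bounded_meas \<mu> (\<lambda>\<omega>. f \<omega> - g \<omega>)"
  using bounded_meas_add[of \<mu> f "\<lambda>\<omega>. - g \<omega>"] bounded_meas_minus[of \<mu> g] by simp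

lemma bounded_meas_power: "bounded_meas \<mu> f \<Longrightarrow> bounded_meas \<mu> (\<lambda>\<omega>. f \<omega> ^ k)"
  by (induction k) (auto intro: bounded_meas_const bounded_meas_mult)

lemma bounded_meas_sum:
  "(\<And>i. i \<in> I \<Longrightarrow> bounded_meas \<mu> (\<lambda>\<omega>. f i \<omega>)) \<Longrightarrow> bounded_meas \<mu> (\<lambda>\<omega>. \<Sum>i\<in>I. f i \<omega>)"
  by (induction I rule: infinite_finite_induct) (auto intro: bounded_meas_const bounded_meas_add)

lemmas bounded_meas_intros = bounded_meas_const bounded_meas_minus bounded_meas_diff bounded_meas_add
  bounded_meas_mult bounded_meas_power bounded_meas_sum

text \<open>Stein's method of exchangeable pairs: the sum over all transpositions of the change of
  \<open>S = \<Sum> c\<^sub>i p\<^sub>i\<close> under the transposition equals \<open>2 n S\<close>.\<close>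

lemma exchangeable_fourth_moment:
  fixes p :: "'w \<Rightarrow> nat \<Rightarrow> real" and c :: "nat \<Rightarrow> real"
  assumes "prob_space \<mu>"
    and meas [measurable]: "\<And>i. i < n \<Longrightarrow> (\<lambda>\<omega>. p \<omega> i) \<in> borel_measurable \<mu>"
    and p0: "\<And>\<omega> i. \<omega> \<in> space \<mu> \<Longrightarrow> i < n \<Longrightarrow> 0 \<le> p \<omega> i \<and> p \<omega> i \<le> R"
    and exch: "\<And>(F :: (nat \<Rightarrow> real) \<Rightarrow> real) i j. i < n \<Longrightarrow> j < n \<Longrightarrow> (\<lambda>\<omega>. F (p \<omega>)) \<in> borel_measurable \<mu> \<Longrightarrow>
       (\<integral>\<omega>. F (p \<omega>) \<partial>\<mu>) = (\<integral>\<omega>. F (\<lambda>k. p \<omega> (swap_idx i j k)) \<partial>\<mu>)"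
    and c: "(\<Sum>i<n. c i) = 0" "\<And>i. i < n \<Longrightarrow> \<bar>c i\<bar> \<le> C" and n: "n > 0"
  shows "(\<integral>\<omega>. (\<Sum>i<n. c i * p \<omega> i) ^ 4 \<partial>\<mu>) \<le> 36 * C ^ 4 * (\<integral>\<omega>. (\<Sum>i<n. (p \<omega> i)\<^sup>2)\<^sup>2 \<partial>\<mu>)"
proof -
  interpret prob_space \<mu> by fact
  define S where "S q = (\<Sum>k<n. c k * q k)" for q
  define D where "D i j q = (c i - c j) * (q i - q j)" for i j and q :: "nat \<Rightarrow> real"
  define Q where "Q q = (\<Sum>k<n. (q k)\<^sup>2)" for q :: "nat \<Rightarrow> real"
  have C: "C \<ge> 0" using c(2)[of 0] n by linarith
  have Sm [measurable]: "(\<lambda>\<omega>. S (p \<omega>)) \<in> borel_measurable \<mu>" unfolding S_def by measurable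
  have Qm [measurable]: "(\<lambda>\<omega>. Q (p \<omega>)) \<in> borel_measurable \<mu>" unfolding Q_def by measurable
  have Dm [measurable]: "(\<lambda>\<omega>. D i j (p \<omega>)) \<in> borel_measurable \<mu>" if "i < n" "j < n" for i j
    unfolding D_def using that by measurable
  have pb: "bounded_meas \<mu> (\<lambda>\<omega>. p \<omega> i)" if "i < n" for i
    unfolding bounded_meas_def using p0[OF _ that] meas[OF that] by (auto intro!: exI[of _ R])
  have Sb: "bounded_meas \<mu> (\<lambda>\<omega>. S (p \<omega>))" unfolding S_def by (intro bounded_meas_intros pb) auto
  have Qb: "bounded_meas \<mu> (\<lambda>\<omega>. Q (p \<omega>))" unfolding Q_def by (intro bounded_meas_intros pb) auto
  have Db: "bounded_meas \<mu> (\<lambda>\<omega>. D i j (p \<omega>))" if "i < n" "j < n" for i j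
    unfolding D_def by (intro bounded_meas_intros pb that)
  note int = integrable_bounded_meas bounded_meas_intros Sb Qb Db
  have iS4: "integrable \<mu> (\<lambda>\<omega>. S (p \<omega>) ^ 4)" by (intro int)
  have iQ2: "integrable \<mu> (\<lambda>\<omega>. (Q (p \<omega>))\<^sup>2)" by (intro int)
  have iS2Q: "integrable \<mu> (\<lambda>\<omega>. S (p \<omega>) ^ 2 * Q (p \<omega>))" by (intro int)
  have iDS3: "integrable \<mu> (\<lambda>\<omega>. D i j (p \<omega>) * S (p \<omega>) ^ 3)" if "i < n" "j < n" for i j
    by (intro int that)
  have iD2S2: "integrable \<mu> (\<lambda>\<omega>. D i j (p \<omega>) ^ 2 * S (p \<omega>) ^ 2)" if "i < n" "j < n" for i j
    by (intro int that)
  \<comment> \<open>Under the transposition D changes sign and S becomes S - D. Averaging the two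
    expressions for the expectation of D S^3 gives half that of D (S^3 - (S - D)^3), which is of
    second order in D.\<close>
  have step: "(\<integral>\<omega>. D i j (p \<omega>) * S (p \<omega>) ^ 3 \<partial>\<mu>) \<le> 3 / 2 * (\<integral>\<omega>. D i j (p \<omega>) ^ 2 * S (p \<omega>) ^ 2 \<partial>\<mu>)"
    if ij: "i < n" "j < n" for i j
  proof -
    let ?t = "\<lambda>q k. q (swap_idx i j k)"
    have SD: "S (?t q) = S q - D i j q" for q
      using sum_swap_idx_diff[OF ij, of c q] by (simp add: S_def D_def)
    have DD: "D i j (?t q) = - D i j q" for q by (simp add: D_def swap_idx_def algebra_simps)
    have iT: "integrable \<mu> (\<lambda>\<omega>. (- D i j (p \<omega>)) * (S (p \<omega>) - D i j (p \<omega>)) ^ 3)"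
      by (intro int ij)
    have iT2: "integrable \<mu> (\<lambda>\<omega>. (D i j (p \<omega>))\<^sup>2 * (S (p \<omega>) - D i j (p \<omega>))\<^sup>2)"
      by (intro int ij)
    have e1: "(\<integral>\<omega>. D i j (p \<omega>) * S (p \<omega>) ^ 3 \<partial>\<mu>) = (\<integral>\<omega>. (- D i j (p \<omega>)) * (S (p \<omega>) - D i j (p \<omega>)) ^ 3 \<partial>\<mu>)"
      using exch[OF ij, of "\<lambda>q. D i j q * S q ^ 3"] ij by (simp add: SD DD)
    have e2: "(\<integral>\<omega>. (D i j (p \<omega>))\<^sup>2 * (S (p \<omega>))\<^sup>2 \<partial>\<mu>) = (\<integral>\<omega>. (D i j (p \<omega>))\<^sup>2 * (S (p \<omega>) - D i j (p \<omega>))\<^sup>2 \<partial>\<mu>)"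
      using exch[OF ij, of "\<lambda>q. (D i j q)\<^sup>2 * (S q)\<^sup>2"] ij by (simp add: SD DD)
    \<comment> \<open>The left side is d^2 (s^2 + s (s - d) + (s - d)^2), and the gap to the right
      side is exactly d^4 / 2.\<close>
    have pw: "d * s ^ 3 + (- d) * (s - d) ^ 3 \<le> 3 / 2 * (d\<^sup>2 * s\<^sup>2 + d\<^sup>2 * (s - d)\<^sup>2)" for d s :: real
    proof -
      have "3 / 2 * (d\<^sup>2 * s\<^sup>2 + d\<^sup>2 * (s - d)\<^sup>2) - (d * s ^ 3 + (- d) * (s - d) ^ 3) = 1 / 2 * d ^ 4"
        by (simp add: power2_eq_square power3_eq_cube power4_eq_xxxx field_simps)
      moreover have "1 / 2 * d ^ 4 \<ge> 0" by simp
      ultimately show ?thesis by linarith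
    qed
    have "2 * (\<integral>\<omega>. D i j (p \<omega>) * S (p \<omega>) ^ 3 \<partial>\<mu>) =
      (\<integral>\<omega>. D i j (p \<omega>) * S (p \<omega>) ^ 3 + (- D i j (p \<omega>)) * (S (p \<omega>) - D i j (p \<omega>)) ^ 3 \<partial>\<mu>)"
      by (subst Bochner_Integration.integral_add[OF iDS3[OF ij] iT]) (simp only: e1[symmetric])
    also have "\<dots> \<le> (\<integral>\<omega>. 3 / 2 * ((D i j (p \<omega>))\<^sup>2 * (S (p \<omega>))\<^sup>2 + (D i j (p \<omega>))\<^sup>2 * (S (p \<omega>) - D i j (p \<omega>))\<^sup>2) \<partial>\<mu>)"
      by (intro integral_mono Bochner_Integration.integrable_add integrable_mult_right iDS3 iT iD2S2 iT2 ij pw)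
    also have "\<dots> = 3 / 2 * ((\<integral>\<omega>. (D i j (p \<omega>))\<^sup>2 * (S (p \<omega>))\<^sup>2 \<partial>\<mu>) + (\<integral>\<omega>. (D i j (p \<omega>))\<^sup>2 * (S (p \<omega>) - D i j (p \<omega>))\<^sup>2 \<partial>\<mu>))"
      by (simp only: integral_mult_right_zero Bochner_Integration.integral_add[OF iD2S2[OF ij] iT2])
    also have "\<dots> = 3 * (\<integral>\<omega>. (D i j (p \<omega>))\<^sup>2 * (S (p \<omega>))\<^sup>2 \<partial>\<mu>)" unfolding e2[symmetric] by simp
    finally show ?thesis by simp
  qed
  \<comment> \<open>The centring of c enters here: the mixed terms factor through the sum of the c
    i.\<close>
  have sumD: "(\<Sum>i<n. \<Sum>j<n. D i j q) = 2 * real n * S q" for q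
  proof -
    have "(\<Sum>i<n. \<Sum>j<n. D i j q) = (\<Sum>i<n. \<Sum>j<n. c i * q i + c j * q j - c i * q j - c j * q i)"
      by (simp add: D_def algebra_simps)
    also have "\<dots> = 2 * real n * S q - 2 * ((\<Sum>i<n. c i) * (\<Sum>j<n. q j))"
      by (simp add: sum.distrib sum_subtractf S_def sum_distrib_left[symmetric] sum_distrib_right[symmetric] algebra_simps)
    finally show ?thesis by (simp add: c(1))
  qed
  have sumD2: "(\<Sum>i<n. \<Sum>j<n. D i j (p \<omega>) ^ 2) \<le> 8 * C\<^sup>2 * real n * Q (p \<omega>)" if w: "\<omega> \<in> space \<mu>" for \<omega>
  proof -
    have "(\<Sum>i<n. \<Sum>j<n. D i j (p \<omega>) ^ 2) \<le> (\<Sum>i<n. \<Sum>j<n. (2 * C)\<^sup>2 * ((p \<omega> i)\<^sup>2 + (p \<omega> j)\<^sup>2))"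
    proof (intro sum_mono)
      fix i j assume ij: "i \<in> {..<n}" "j \<in> {..<n}"
      have "(c i - c j)\<^sup>2 \<le> (2 * C)\<^sup>2"
        using c(2)[of i] c(2)[of j] ij by (intro power2_le_iff_abs_le[THEN iffD2]) (auto simp: C)
      \<comment> \<open>The mixed term of the square has the favourable sign because p is
        nonnegative.\<close>
      moreover have "(p \<omega> i - p \<omega> j)\<^sup>2 \<le> (p \<omega> i)\<^sup>2 + (p \<omega> j)\<^sup>2"
        using p0[OF w, of i] p0[OF w, of j] ij by (simp add: power2_diff)
      ultimately show "D i j (p \<omega>) ^ 2 \<le> (2 * C)\<^sup>2 * ((p \<omega> i)\<^sup>2 + (p \<omega> j)\<^sup>2)"
        unfolding D_def power_mult_distrib by (intro mult_mono) auto
    qed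
    also have "\<dots> = 8 * C\<^sup>2 * real n * Q (p \<omega>)"
      by (simp add: sum_distrib_left[symmetric] sum.distrib Q_def power_mult_distrib algebra_simps)
    finally show ?thesis .
  qed
  have "2 * real n * (\<integral>\<omega>. S (p \<omega>) ^ 4 \<partial>\<mu>) = (\<integral>\<omega>. (\<Sum>i<n. \<Sum>j<n. D i j (p \<omega>) * S (p \<omega>) ^ 3) \<partial>\<mu>)"
    by (simp add: sum_distrib_right[symmetric] sumD power4_eq_xxxx power3_eq_cube mult.assoc)
  also have "\<dots> = (\<Sum>i<n. \<Sum>j<n. \<integral>\<omega>. D i j (p \<omega>) * S (p \<omega>) ^ 3 \<partial>\<mu>)"
    by (subst Bochner_Integration.integral_sum, auto intro!: iDS3 Bochner_Integration.integrable_sum sum.cong Bochner_Integration.integral_sum)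
  also have "\<dots> \<le> (\<Sum>i<n. \<Sum>j<n. 3 / 2 * (\<integral>\<omega>. D i j (p \<omega>) ^ 2 * S (p \<omega>) ^ 2 \<partial>\<mu>))"
    by (intro sum_mono step) auto
  also have "\<dots> = 3 / 2 * (\<integral>\<omega>. (\<Sum>i<n. \<Sum>j<n. D i j (p \<omega>) ^ 2 * S (p \<omega>) ^ 2) \<partial>\<mu>)"
  proof -
    have "(\<integral>\<omega>. (\<Sum>i<n. \<Sum>j<n. D i j (p \<omega>) ^ 2 * S (p \<omega>) ^ 2) \<partial>\<mu>) =
        (\<Sum>i<n. \<Sum>j<n. \<integral>\<omega>. D i j (p \<omega>) ^ 2 * S (p \<omega>) ^ 2 \<partial>\<mu>)"
      by (subst Bochner_Integration.integral_sum, auto intro!: iD2S2 Bochner_Integration.integrable_sum sum.cong Bochner_Integration.integral_sum)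
    then show ?thesis by (simp only: sum_distrib_left)
  qed
  also have "\<dots> \<le> 3 / 2 * (\<integral>\<omega>. 8 * C\<^sup>2 * real n * (S (p \<omega>) ^ 2 * Q (p \<omega>)) \<partial>\<mu>)"
  proof (intro mult_left_mono integral_mono)
    show "integrable \<mu> (\<lambda>\<omega>. \<Sum>i<n. \<Sum>j<n. D i j (p \<omega>) ^ 2 * S (p \<omega>) ^ 2)"
      by (intro Bochner_Integration.integrable_sum iD2S2) auto
    show "integrable \<mu> (\<lambda>\<omega>. 8 * C\<^sup>2 * real n * (S (p \<omega>) ^ 2 * Q (p \<omega>)))" by (intro integrable_mult_right iS2Q)
    fix \<omega> assume "\<omega> \<in> space \<mu>"
    from mult_right_mono[OF sumD2[OF this], of "S (p \<omega>) ^ 2"]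
    show "(\<Sum>i<n. \<Sum>j<n. D i j (p \<omega>) ^ 2 * S (p \<omega>) ^ 2) \<le> 8 * C\<^sup>2 * real n * (S (p \<omega>) ^ 2 * Q (p \<omega>))"
      by (simp add: sum_distrib_left mult_ac)
  qed simp
  also have "\<dots> = 2 * real n * (6 * C\<^sup>2 * (\<integral>\<omega>. S (p \<omega>) ^ 2 * Q (p \<omega>) \<partial>\<mu>))" by simp
  finally have "(\<integral>\<omega>. S (p \<omega>) ^ 4 \<partial>\<mu>) \<le> 6 * C\<^sup>2 * (\<integral>\<omega>. S (p \<omega>) ^ 2 * Q (p \<omega>) \<partial>\<mu>)"
    using n by simp
  also have "\<dots> = (\<integral>\<omega>. 6 * C\<^sup>2 * (S (p \<omega>) ^ 2 * Q (p \<omega>)) \<partial>\<mu>)" by simp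
  \<comment> \<open>Young's inequality, with the weight chosen so that half of the fourth moment
    appears. That half, which is finite, is absorbed on the left and doubles 18 to 36.\<close>
  also have "\<dots> \<le> (\<integral>\<omega>. 1 / 2 * S (p \<omega>) ^ 4 + 18 * C ^ 4 * (Q (p \<omega>))\<^sup>2 \<partial>\<mu>)"
  proof (intro integral_mono Bochner_Integration.integrable_add integrable_mult_right iS2Q iS4 iQ2)
    fix \<omega>
    have "1 / 2 * (s\<^sup>2 - 6 * C\<^sup>2 * q)\<^sup>2 = 1 / 2 * s ^ 4 + 18 * C ^ 4 * q\<^sup>2 - 6 * C\<^sup>2 * (s\<^sup>2 * q)" for s q :: real
      by (simp add: power2_eq_square power4_eq_xxxx field_simps)
    moreover have "1 / 2 * (s\<^sup>2 - 6 * C\<^sup>2 * q)\<^sup>2 \<ge> 0" for s q :: real by simp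
    ultimately have "6 * C\<^sup>2 * (s\<^sup>2 * q) \<le> 1 / 2 * s ^ 4 + 18 * C ^ 4 * q\<^sup>2" for s q :: real
      by (metis diff_ge_0_iff_ge)
    then show "6 * C\<^sup>2 * (S (p \<omega>) ^ 2 * Q (p \<omega>)) \<le> 1 / 2 * S (p \<omega>) ^ 4 + 18 * C ^ 4 * (Q (p \<omega>))\<^sup>2" .
  qed
  also have "\<dots> = 1 / 2 * (\<integral>\<omega>. S (p \<omega>) ^ 4 \<partial>\<mu>) + 18 * C ^ 4 * (\<integral>\<omega>. (Q (p \<omega>))\<^sup>2 \<partial>\<mu>)"
    by (subst Bochner_Integration.integral_add) (auto intro: iS4 iQ2)
  finally show ?thesis by (simp add: S_def Q_def)
qed

section \<open>Concentration of quadratic forms in Haar unitaries\<close>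

lemma space_unitary_borel [simp]: "space (unitary_borel n) = unitary_group n"
  by (simp add: unitary_borel_def)

lemma measurable_entry [measurable]:
  assumes "i < n" "j < n"
  shows "(\<lambda>W. W $$ (i, j)) \<in> borel_measurable (unitary_borel n)"
proof -
  let ?P = "\<Pi>\<^sub>M ij\<in>{..<n} \<times> {..<n}. (borel :: complex measure)"
  have "(\<lambda>V. \<lambda>ij\<in>{..<n} \<times> {..<n}. V $$ ij) \<in> unitary_borel n \<rightarrow>\<^sub>M ?P"
    unfolding unitary_borel_def by (rule measurable_vimage_algebra1) (auto simp: space_PiM)
  from measurable_compose[OF this, of "\<lambda>x. x (i, j)" borel] assms
  show ?thesis by (simp add: measurable_component_singleton)
qed

lemma measurable_into_unitary_borel:
  assumes "\<And>x. x \<in> space N \<Longrightarrow> f x \<in> unitary_group n"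
    and "\<And>i j. i < n \<Longrightarrow> j < n \<Longrightarrow> (\<lambda>x. f x $$ (i, j)) \<in> borel_measurable N"
  shows "f \<in> N \<rightarrow>\<^sub>M unitary_borel n"
  unfolding unitary_borel_def
proof (rule measurable_vimage_algebra2)
  show "(\<lambda>x. \<lambda>ij\<in>{..<n} \<times> {..<n}. f x $$ ij) \<in> N \<rightarrow>\<^sub>M (\<Pi>\<^sub>M ij\<in>{..<n} \<times> {..<n}. borel)"
    by (rule measurable_restrict) (use assms(2) in auto)
qed (use assms(1) in auto)

lemma measurable_mult_right_unitary:
  assumes V: "V \<in> unitary_group n"
  shows "(\<lambda>W. W * V) \<in> unitary_borel n \<rightarrow>\<^sub>M unitary_borel n"
proof (rule measurable_into_unitary_borel)
  show "W * V \<in> unitary_group n" if "W \<in> space (unitary_borel n)" for W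
    using that V by (simp add: unitary_group_mult)
  fix i j assume ij: "i < n" "j < n"
  have "(\<lambda>W. \<Sum>k<n. W $$ (i, k) * V $$ (k, j)) \<in> borel_measurable (unitary_borel n)"
    using ij by measurable
  then show "(\<lambda>W. (W * V) $$ (i, j)) \<in> borel_measurable (unitary_borel n)"
    by (rule measurable_cong[THEN iffD1, rotated])
      (use ij V in \<open>auto simp: unitary_group_def scalar_prod_def atLeast0LessThan\<close>)
qed

lemma haar_integral_mult_right:
  fixes H :: "complex mat \<Rightarrow> real"
  assumes \<mu>: "normalized_haar n \<mu>" and V: "V \<in> unitary_group n" and H: "H \<in> borel_measurable \<mu>"
  shows "(\<integral>W. H W \<partial>\<mu>) = (\<integral>W. H (W * V) \<partial>\<mu>)"
proof -
  have s: "sets \<mu> = sets (unitary_borel n)" and inv: "distr \<mu> (unitary_borel n) (\<lambda>W. W * V) = \<mu>"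
    using \<mu> V by (auto simp: normalized_haar_def)
  have "(\<lambda>W. W * V) \<in> \<mu> \<rightarrow>\<^sub>M unitary_borel n"
    using measurable_mult_right_unitary[OF V] measurable_cong_sets[OF s refl] by blast
  moreover have "H \<in> borel_measurable (unitary_borel n)"
    using H measurable_cong_sets[OF s refl] by blast
  ultimately have "(\<integral>W. H W \<partial>distr \<mu> (unitary_borel n) (\<lambda>W. W * V)) = (\<integral>W. H (W * V) \<partial>\<mu>)"
    by (rule integral_distr)
  then show ?thesis by (simp only: inv)
qed

text \<open>The i-th entry of the adjoint of W applied to x, as an explicit sum: this makes
  measurability in the matrix entries visible and gives a total function of i.\<close>

definition coord :: "nat \<Rightarrow> complex Matrix.vec \<Rightarrow> complex mat \<Rightarrow> nat \<Rightarrow> complex" where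
  "coord n x W i = (\<Sum>j<n. cnj (W $$ (j, i)) * x $ j)"

lemma coord_adjoint:
  assumes "W \<in> carrier_mat n n" "x \<in> carrier_vec n" "i < n"
  shows "coord n x W i = (mat_adjoint W *\<^sub>v x) $ i"
  using assms by (simp add: coord_def mult_mat_vec_conv del: index_mult_mat_vec)

lemma coord_mult:
  assumes "W \<in> carrier_mat n n" "V \<in> carrier_mat n n" "i < n"
  shows "coord n x (W * V) i = (\<Sum>k<n. cnj (V $$ (k, i)) * coord n x W k)"
proof -
  have "coord n x (W * V) i = (\<Sum>j<n. \<Sum>k<n. cnj (V $$ (k, i)) * (cnj (W $$ (j, k)) * x $ j))"
    unfolding coord_def
  proof (rule sum.cong[OF refl])
    fix j assume "j \<in> {..<n}"
    then have "(W * V) $$ (j, i) = (\<Sum>k<n. W $$ (j, k) * V $$ (k, i))"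
      using assms by (intro mult_mat_conv) auto
    then show "cnj ((W * V) $$ (j, i)) * x $ j = (\<Sum>k<n. cnj (V $$ (k, i)) * (cnj (W $$ (j, k)) * x $ j))"
      by (simp add: sum_distrib_left sum_distrib_right mult_ac)
  qed
  also have "\<dots> = (\<Sum>k<n. cnj (V $$ (k, i)) * coord n x W k)"
    by (subst sum.swap) (simp add: coord_def sum_distrib_left)
  finally show ?thesis .
qed

lemma sum_coord_sq:
  assumes "W \<in> unitary_group n" "x \<in> carrier_vec n"
  shows "(\<Sum>i<n. (cmod (coord n x W i))\<^sup>2) = (vec_l2norm x)\<^sup>2"
proof -
  note W = unitary_groupD[OF assms(1)]
  have "(\<Sum>i<n. (cmod (coord n x W i))\<^sup>2) = (vec_l2norm (mat_adjoint W *\<^sub>v x))\<^sup>2"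
    using W assms by (simp add: vec_l2norm_sq coord_adjoint del: index_mult_mat_vec)
  then show ?thesis using vec_l2norm_unitary[OF unitary_group_adjoint[OF assms(1)] assms(2)] by simp
qed

lemma cmod_coord_le:
  assumes "W \<in> unitary_group n" "x \<in> carrier_vec n" "i < n"
  shows "(cmod (coord n x W i))\<^sup>2 \<le> (vec_l2norm x)\<^sup>2"
  unfolding sum_coord_sq[OF assms(1,2), symmetric] using assms(3) by (intro member_le_sum) auto

lemma measurable_coord [measurable]:
  "i < n \<Longrightarrow> (\<lambda>W. coord n x W i) \<in> borel_measurable (unitary_borel n)"
  unfolding coord_def
proof (intro borel_measurable_sum borel_measurable_times measurable_const)
  fix j assume "i < n" "j \<in> {..<n}"
  then have "(\<lambda>W. W $$ (j, i)) \<in> borel_measurable (unitary_borel n)" by (intro measurable_entry) auto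
  moreover have "cnj \<in> borel_measurable borel"
    by (intro borel_measurable_continuous_onI continuous_intros)
  ultimately show "(\<lambda>W. cnj (W $$ (j, i))) \<in> borel_measurable (unitary_borel n)"
    by (rule measurable_compose)
qed simp

text \<open>By invariance, the first coordinate has the same law as the component of the random vector in
  the direction of any unit vector; averaging over all sign vectors brings in Khintchine.\<close>

lemma haar_coord_eighth_moment:
  assumes \<mu>: "normalized_haar n \<mu>" and n: "n > 0" and x: "x \<in> carrier_vec n" and i: "i < n"
  shows "(\<integral>W. cmod (coord n x W i) ^ 8 \<partial>\<mu>) \<le> 840 * vec_l2norm x ^ 8 / real n ^ 4"
proof -
  interpret prob_space \<mu> using \<mu> by (simp add: normalized_haar_def)
  have s: "sets \<mu> = sets (unitary_borel n)" using \<mu> by (simp add: normalized_haar_def)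
  have space: "space \<mu> = unitary_group n" using sets_eq_imp_space_eq[OF s] by simp
  have M: "f \<in> borel_measurable \<mu>" if "f \<in> borel_measurable (unitary_borel n)" for f :: "complex mat \<Rightarrow> real"
    using that measurable_cong_sets[OF s refl] by blast
  define m where "m = (\<integral>W. cmod (coord n x W 0) ^ 8 \<partial>\<mu>)"
  \<comment> \<open>Right translation by a unitary with first column c v turns coordinate 0 into the
    conjugate of c times the component along v. The unknown scalar disappears because a column of a
    unitary has norm 1, that is, |c| |v| = 1.\<close>
  have dir: "(\<integral>W. cmod (\<Sum>k<n. cnj (v $ k) * coord n x W k) ^ 8 \<partial>\<mu>) = m * vec_l2norm v ^ 8"
    if v: "v \<in> carrier_vec n" "v \<noteq> 0\<^sub>v n" for v
  proof -
    obtain V c where V: "V \<in> unitary_group n" "col V 0 = c \<cdot>\<^sub>v v"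
      using unitary_with_first_column[OF v] n by auto
    have V0: "V $$ (k, 0) = c * v $ k" if "k < n" for k
      using arg_cong[OF V(2), of "\<lambda>u. u $ k"] that v V(1) n by (auto simp: unitary_group_def)
    have "vec_l2norm (V *\<^sub>v unit_vec n 0) = vec_l2norm (unit_vec n 0)"
      by (rule vec_l2norm_unitary[OF V(1)]) simp
    moreover have "V *\<^sub>v unit_vec n 0 = col V 0"
      using V(1) n by (auto simp: unitary_group_def intro!: eq_vecI)
    moreover have "vec_l2norm (unit_vec n 0) = 1"
    proof -
      have "(\<Sum>i<n. (cmod (if i = 0 then 1 else 0))\<^sup>2) = (\<Sum>i\<in>{0 :: nat}. 1 :: real)"
        using n by (intro sum.mono_neutral_cong_right) auto
      then show ?thesis by (simp add: vec_l2norm_def unit_vec_def)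
    qed
    ultimately have c: "cmod c * vec_l2norm v = 1" by (simp add: V(2) vec_l2norm_smult)
    have "m = (\<integral>W. cmod (coord n x (W * V) 0) ^ 8 \<partial>\<mu>)"
      unfolding m_def by (rule haar_integral_mult_right[OF \<mu> V(1)]) (rule M, use n in measurable)
    also have "\<dots> = (\<integral>W. cmod c ^ 8 * cmod (\<Sum>k<n. cnj (v $ k) * coord n x W k) ^ 8 \<partial>\<mu>)"
    proof (rule Bochner_Integration.integral_cong[OF refl])
      fix W assume "W \<in> space \<mu>"
      then have "coord n x (W * V) 0 = cnj c * (\<Sum>k<n. cnj (v $ k) * coord n x W k)"
        using V(1) n by (subst coord_mult) (auto simp: space unitary_group_def V0 sum_distrib_left mult_ac intro!: sum.cong)
      then show "cmod (coord n x (W * V) 0) ^ 8 = cmod c ^ 8 * cmod (\<Sum>k<n. cnj (v $ k) * coord n x W k) ^ 8"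
        by (simp add: norm_mult power_mult_distrib)
    qed
    also have "\<dots> = cmod c ^ 8 * (\<integral>W. cmod (\<Sum>k<n. cnj (v $ k) * coord n x W k) ^ 8 \<partial>\<mu>)" by simp
    finally have "m * vec_l2norm v ^ 8 = (cmod c * vec_l2norm v) ^ 8 * (\<integral>W. cmod (\<Sum>k<n. cnj (v $ k) * coord n x W k) ^ 8 \<partial>\<mu>)"
      by (simp add: power_mult_distrib)
    then show ?thesis using c by simp
  qed
  have mi: "(\<integral>W. cmod (coord n x W i) ^ 8 \<partial>\<mu>) = m"
  proof -
    have nz: "unit_vec n i \<noteq> (0\<^sub>v n :: complex Matrix.vec)" using i by simp
    have "(\<Sum>k<n. (cmod (if k = i then 1 else 0))\<^sup>2) = (\<Sum>k\<in>{i}. 1 :: real)"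
      using i by (intro sum.mono_neutral_cong_right) auto
    then have "vec_l2norm (unit_vec n i) = 1" by (simp add: vec_l2norm_def unit_vec_def)
    moreover have "(\<Sum>k<n. cnj (unit_vec n i $ k) * coord n x W k) = coord n x W i" for W
    proof -
      have "(\<Sum>k<n. cnj (unit_vec n i $ k) * coord n x W k) = (\<Sum>k\<in>{i}. coord n x W k)"
        using i by (intro sum.mono_neutral_cong_right) (auto simp: unit_vec_def)
      then show ?thesis by simp
    qed
    ultimately show ?thesis using dir[OF unit_vec_carrier nz] by simp
  qed
  \<comment> \<open>Sign vectors have norm sqrt n, whence the factor n^4 in the eighth
    power.\<close>
  define v where "v S = Matrix.vec n (\<lambda>k. complex_of_real (sgn_of S k))" for S
  have nv: "vec_l2norm (v S) ^ 8 = real n ^ 4" for S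
  proof -
    have "vec_l2norm (v S) ^ 8 = ((vec_l2norm (v S))\<^sup>2) ^ 4" by (simp flip: power_mult)
    also have "(vec_l2norm (v S))\<^sup>2 = real n"
      by (simp add: vec_l2norm_sq v_def sgn_of_def if_distrib cong: if_cong)
    finally show ?thesis .
  qed
  have vnz: "v S \<noteq> 0\<^sub>v n" for S
  proof
    assume "v S = 0\<^sub>v n"
    then have "vec_l2norm (v S) = 0" by simp
    then show False using nv[of S] n by simp
  qed
  have e: "(\<integral>W. cmod (\<Sum>k<n. complex_of_real (sgn_of S k) * coord n x W k) ^ 8 \<partial>\<mu>) = m * real n ^ 4" for S
  proof -
    have "(\<Sum>k<n. complex_of_real (sgn_of S k) * coord n x W k) = (\<Sum>k<n. cnj (v S $ k) * coord n x W k)" for W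
      by (intro sum.cong) (auto simp: v_def)
    then show ?thesis using dir[of "v S"] vnz[of S] by (simp add: nv) (simp add: v_def)
  qed
  have sb: "bounded_meas \<mu> (\<lambda>W. cmod (\<Sum>k<n. complex_of_real (sgn_of S k) * coord n x W k))" for S
    unfolding bounded_meas_def
  proof (intro conjI exI ballI)
    show "(\<lambda>W. cmod (\<Sum>k<n. complex_of_real (sgn_of S k) * coord n x W k)) \<in> borel_measurable \<mu>"
      by (rule M) measurable
    fix W assume "W \<in> space \<mu>"
    then have W: "W \<in> unitary_group n" by (simp add: space)
    have "cmod (\<Sum>k<n. complex_of_real (sgn_of S k) * coord n x W k) \<le> (\<Sum>k<n. vec_l2norm x)"
    proof (rule sum_norm_le)
      fix k assume "k \<in> {..<n}"
      then have "cmod (coord n x W k) \<le> vec_l2norm x"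
        using cmod_coord_le[OF W x, of k] by (auto intro: power2_le_imp_le)
      then show "cmod (complex_of_real (sgn_of S k) * coord n x W k) \<le> vec_l2norm x"
        by (simp add: norm_mult sgn_of_def)
    qed
    then show "\<bar>cmod (\<Sum>k<n. complex_of_real (sgn_of S k) * coord n x W k)\<bar> \<le> real n * vec_l2norm x" by simp
  qed
  \<comment> \<open>All 2^n sign directions give the same integral. Pointwise, Khintchine bounds
    their sum by the fourth power of the sum of squared coordinates, which is the deterministic
    number |x|^2.\<close>
  have "2 ^ n * (m * real n ^ 4) = (\<Sum>S\<in>Pow {..<n}. m * real n ^ 4)" by (simp add: card_Pow)
  also have "\<dots> = (\<integral>W. (\<Sum>S\<in>Pow {..<n}. cmod (\<Sum>k<n. complex_of_real (sgn_of S k) * coord n x W k) ^ 8) \<partial>\<mu>)"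
    by (subst Bochner_Integration.integral_sum) (auto simp: e intro!: integrable_bounded_meas bounded_meas_power sb)
  also have "\<dots> \<le> (\<integral>W. 2 ^ n * (840 * vec_l2norm x ^ 8) \<partial>\<mu>)"
  proof (rule integral_mono)
    show "integrable \<mu> (\<lambda>W. \<Sum>S\<in>Pow {..<n}. cmod (\<Sum>k<n. complex_of_real (sgn_of S k) * coord n x W k) ^ 8)"
      by (intro Bochner_Integration.integrable_sum integrable_bounded_meas bounded_meas_power sb)
    fix W assume "W \<in> space \<mu>"
    then have W: "W \<in> unitary_group n" by (simp add: space)
    have "vec_l2norm x ^ 8 = ((vec_l2norm x)\<^sup>2) ^ 4" by (simp flip: power_mult)
    then show "(\<Sum>S\<in>Pow {..<n}. cmod (\<Sum>k<n. complex_of_real (sgn_of S k) * coord n x W k) ^ 8) \<le> 2 ^ n * (840 * vec_l2norm x ^ 8)"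
      using khintchine_eighth[of "coord n x W" n] sum_coord_sq[OF W x] by simp
  qed simp
  also have "\<dots> = 2 ^ n * (840 * vec_l2norm x ^ 8)" by (simp add: prob_space)
  finally have "m * real n ^ 4 \<le> 840 * vec_l2norm x ^ 8" by simp
  then show ?thesis using n unfolding mi by (simp add: field_simps)
qed

text \<open>Right translation by the permutation matrix of the transposition. The value 0 at indices
  from n on makes the argument of F a function on all naturals; the transposition respects this
  because it preserves k < n.\<close>

lemma haar_coord_exchangeable:
  fixes F :: "(nat \<Rightarrow> real) \<Rightarrow> real"
  assumes \<mu>: "normalized_haar n \<mu>" and ij: "i < n" "j < n"
    and F: "(\<lambda>W. F (\<lambda>k. if k < n then (cmod (coord n x W k))\<^sup>2 else 0)) \<in> borel_measurable \<mu>"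
  shows "(\<integral>W. F (\<lambda>k. if k < n then (cmod (coord n x W k))\<^sup>2 else 0) \<partial>\<mu>) =
    (\<integral>W. F (\<lambda>k. if swap_idx i j k < n then (cmod (coord n x W (swap_idx i j k)))\<^sup>2 else 0) \<partial>\<mu>)"
proof -
  let ?\<tau> = "swap_idx i j"
  define V :: "complex mat" where "V = Matrix.mat n n (\<lambda>(k, l). if k = ?\<tau> l then 1 else 0)"
  have V: "V \<in> carrier_mat n n" by (simp add: V_def)
  have eq: "?\<tau> k = ?\<tau> l \<longleftrightarrow> k = l" for k l by (metis swap_idx_swap)
  have lt: "?\<tau> k < n \<longleftrightarrow> k < n" for k using swap_idx_less[OF ij] swap_idx_swap by metis
  have "mat_adjoint V * V = 1\<^sub>m n"
  proof (rule eq_matI)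
    fix k l assume "k < dim_row (1\<^sub>m n :: complex mat)" "l < dim_col (1\<^sub>m n :: complex mat)"
    then have kl: "k < n" "l < n" by auto
    have "(mat_adjoint V * V) $$ (k, l) = (\<Sum>q<n. (if q = ?\<tau> k then 1 else 0) * (if q = ?\<tau> l then 1 else 0))"
      using kl V by (subst mult_mat_conv[of _ n n]) (auto simp: V_def intro!: sum.cong)
    also have "\<dots> = (\<Sum>q\<in>{?\<tau> k}. if q = ?\<tau> l then 1 else 0)"
      using kl ij by (intro sum.mono_neutral_cong_right) auto
    finally show "(mat_adjoint V * V) $$ (k, l) = 1\<^sub>m n $$ (k, l)" using kl by (simp add: eq)
  qed (use V in auto)
  then have Vu: "V \<in> unitary_group n" using V by (intro unitary_groupI)
  have "sets \<mu> = sets (unitary_borel n)" using \<mu> by (simp add: normalized_haar_def)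
  from sets_eq_imp_space_eq[OF this] have sp: "space \<mu> = unitary_group n" by simp
  have co: "coord n x (W * V) k = coord n x W (?\<tau> k)" if "W \<in> space \<mu>" "k < n" for W k
  proof -
    have "coord n x (W * V) k = (\<Sum>q<n. cnj (V $$ (q, k)) * coord n x W q)"
      using that V sp by (intro coord_mult) (auto simp: unitary_group_def)
    also have "\<dots> = (\<Sum>q\<in>{?\<tau> k}. coord n x W q)"
      using that ij by (intro sum.mono_neutral_cong_right) (auto simp: V_def)
    finally show ?thesis by simp
  qed
  have "(\<integral>W. F (\<lambda>k. if k < n then (cmod (coord n x W k))\<^sup>2 else 0) \<partial>\<mu>) =
    (\<integral>W. F (\<lambda>k. if k < n then (cmod (coord n x (W * V) k))\<^sup>2 else 0) \<partial>\<mu>)"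
    by (rule haar_integral_mult_right[OF \<mu> Vu F])
  also have "\<dots> = (\<integral>W. F (\<lambda>k. if ?\<tau> k < n then (cmod (coord n x W (?\<tau> k)))\<^sup>2 else 0) \<partial>\<mu>)"
  proof (rule Bochner_Integration.integral_cong[OF refl])
    fix W assume "W \<in> space \<mu>"
    then have "(\<lambda>k. if k < n then (cmod (coord n x (W * V) k))\<^sup>2 else 0) =
      (\<lambda>k. if ?\<tau> k < n then (cmod (coord n x W (?\<tau> k)))\<^sup>2 else 0)"
      by (auto simp: lt co)
    then show "F (\<lambda>k. if k < n then (cmod (coord n x (W * V) k))\<^sup>2 else 0) =
      F (\<lambda>k. if ?\<tau> k < n then (cmod (coord n x W (?\<tau> k)))\<^sup>2 else 0)" by simp
  qed
  finally show ?thesis .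
qed

text \<open>By Cauchy-Schwarz the squared sum of the p_i^2 is at most n times the sum of the p_i^4.
  These are eighth moments of single coordinates, of order n^-4, so the total is of order n^-2. The
  constant is 30240 = 36 * 840.\<close>

lemma haar_weighted_fourth_moment:
  assumes \<mu>: "normalized_haar n \<mu>" and n: "n > 0" and x: "x \<in> carrier_vec n"
    and c: "(\<Sum>i<n. c i) = 0" "\<And>i. i < n \<Longrightarrow> \<bar>c i\<bar> \<le> C"
  shows "(\<integral>W. (\<Sum>i<n. c i * (cmod (coord n x W i))\<^sup>2) ^ 4 \<partial>\<mu>) \<le> 30240 * C ^ 4 * vec_l2norm x ^ 8 / (real n)\<^sup>2"
proof -
  interpret prob_space \<mu> using \<mu> by (simp add: normalized_haar_def)
  have s: "sets \<mu> = sets (unitary_borel n)" using \<mu> by (simp add: normalized_haar_def)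
  have space: "space \<mu> = unitary_group n" using sets_eq_imp_space_eq[OF s] by simp
  have M: "f \<in> borel_measurable \<mu>" if "f \<in> borel_measurable (unitary_borel n)" for f :: "complex mat \<Rightarrow> real"
    using that measurable_cong_sets[OF s refl] by blast
  define p where "p W k = (if k < n then (cmod (coord n x W k))\<^sup>2 else 0)" for W k
  have pb: "bounded_meas \<mu> (\<lambda>W. p W i)" if "i < n" for i
    unfolding bounded_meas_def
  proof (intro conjI exI ballI)
    show "(\<lambda>W. p W i) \<in> borel_measurable \<mu>" unfolding p_def using that by (intro M) measurable
    show "\<bar>p W i\<bar> \<le> (vec_l2norm x)\<^sup>2" if "W \<in> space \<mu>" for W
      using cmod_coord_le[of W n x i] that x \<open>i < n\<close> by (simp add: p_def space)
  qed
  have "(\<integral>W. (\<Sum>i<n. c i * p W i) ^ 4 \<partial>\<mu>) \<le> 36 * C ^ 4 * (\<integral>W. (\<Sum>i<n. (p W i)\<^sup>2)\<^sup>2 \<partial>\<mu>)"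
  proof (rule exchangeable_fourth_moment[where R = "(vec_l2norm x)\<^sup>2"])
    show "prob_space \<mu>" by unfold_locales
    show "(\<lambda>W. p W i) \<in> borel_measurable \<mu>" if "i < n" for i using pb[OF that] by (simp add: bounded_meas_def)
    show "0 \<le> p W i \<and> p W i \<le> (vec_l2norm x)\<^sup>2" if "W \<in> space \<mu>" "i < n" for W i
      using cmod_coord_le[of W n x i] that x by (simp add: p_def space)
    show "(\<integral>W. F (p W) \<partial>\<mu>) = (\<integral>W. F (\<lambda>k. p W (swap_idx i j k)) \<partial>\<mu>)"
      if "i < n" "j < n" "(\<lambda>W. F (p W)) \<in> borel_measurable \<mu>" for F :: "(nat \<Rightarrow> real) \<Rightarrow> real" and i j
      using haar_coord_exchangeable[OF \<mu> that(1,2), of F x] that(3) unfolding p_def by blast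
  qed (use c n in auto)
  also have "(\<integral>W. (\<Sum>i<n. (p W i)\<^sup>2)\<^sup>2 \<partial>\<mu>) \<le> 840 * vec_l2norm x ^ 8 / (real n)\<^sup>2"
  proof -
    have "(\<integral>W. (\<Sum>i<n. (p W i)\<^sup>2)\<^sup>2 \<partial>\<mu>) \<le> (\<integral>W. real n * (\<Sum>i<n. p W i ^ 4) \<partial>\<mu>)"
    proof (rule integral_mono)
      show "integrable \<mu> (\<lambda>W. (\<Sum>i<n. (p W i)\<^sup>2)\<^sup>2)" "integrable \<mu> (\<lambda>W. real n * (\<Sum>i<n. p W i ^ 4))"
        by (intro integrable_bounded_meas bounded_meas_intros pb; simp)+
      fix W
      have "(\<Sum>i<n. 1 * (p W i)\<^sup>2)\<^sup>2 \<le> (\<Sum>i<n. 1\<^sup>2) * (\<Sum>i<n. ((p W i)\<^sup>2)\<^sup>2)"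
        by (rule Cauchy_Schwarz_ineq_sum)
      then show "(\<Sum>i<n. (p W i)\<^sup>2)\<^sup>2 \<le> real n * (\<Sum>i<n. p W i ^ 4)" by (simp flip: power_mult)
    qed
    also have "\<dots> = real n * (\<Sum>i<n. \<integral>W. p W i ^ 4 \<partial>\<mu>)"
      by (subst integral_mult_right_zero, subst Bochner_Integration.integral_sum)
        (auto intro!: integrable_bounded_meas bounded_meas_power pb)
    also have "\<dots> \<le> real n * (\<Sum>i<n. 840 * vec_l2norm x ^ 8 / real n ^ 4)"
    proof (intro mult_left_mono sum_mono)
      fix i assume "i \<in> {..<n}"
      then have "p W i ^ 4 = cmod (coord n x W i) ^ 8" for W by (simp add: p_def flip: power_mult)
      then show "(\<integral>W. p W i ^ 4 \<partial>\<mu>) \<le> 840 * vec_l2norm x ^ 8 / real n ^ 4"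
        using haar_coord_eighth_moment[OF \<mu> n x, of i] \<open>i \<in> {..<n}\<close> by simp
    qed simp
    also have "\<dots> = 840 * vec_l2norm x ^ 8 / (real n)\<^sup>2"
      using n by (simp add: power2_eq_square power4_eq_xxxx)
    finally show ?thesis .
  qed
  finally have "(\<integral>W. (\<Sum>i<n. c i * p W i) ^ 4 \<partial>\<mu>) \<le> 36 * C ^ 4 * (840 * vec_l2norm x ^ 8 / (real n)\<^sup>2)"
    by (simp add: mult_left_mono)
  moreover have "(\<Sum>i<n. c i * p W i) = (\<Sum>i<n. c i * (cmod (coord n x W i))\<^sup>2)" for W
    by (simp add: p_def)
  ultimately show ?thesis by (simp add: mult_ac)
qed

section \<open>From moment bounds to almost sure convergence of forms\<close>

lemma mult_mat_diag_vec:
  fixes w :: "complex Matrix.vec"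
  assumes "w \<in> carrier_vec n"
  shows "mat_diag n g *\<^sub>v w = Matrix.vec n (\<lambda>i. g i * w $ i)"
  using assms
  by (intro eq_vecI)
    (auto simp: mult_mat_vec_conv mat_diag_def if_distrib [where f = "\<lambda>x. x * _"] cong: if_cong simp del: index_mult_mat_vec)

lemma vec_l2norm_unit_vec: "i < n \<Longrightarrow> vec_l2norm (unit_vec n i) = 1"
proof -
  assume "i < n"
  then have "(\<Sum>k<n. (cmod (if k = i then 1 else 0))\<^sup>2) = (\<Sum>k\<in>{i}. 1 :: real)"
    by (intro sum.mono_neutral_cong_right) auto
  then show ?thesis by (simp add: vec_l2norm_def unit_vec_def)
qed

text \<open>Test the norm bound on the unit eigenvector V e_i.\<close>

lemma eigenvalue_op_bounded:
  assumes W: "op_bounded n C W" and V: "V \<in> unitary_group n"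
    and d: "W = V * mat_diag n (\<lambda>i. complex_of_real (d i)) * mat_adjoint V" and i: "i < n"
  shows "\<bar>d i\<bar> \<le> C"
proof -
  note VD = unitary_groupD[OF V]
  let ?D = "mat_diag n (\<lambda>i. complex_of_real (d i))" and ?e = "unit_vec n i :: complex Matrix.vec"
  have D: "?D \<in> carrier_mat n n" by simp
  have "mat_adjoint V *\<^sub>v (V *\<^sub>v ?e) = ?e"
    using VD by (subst assoc_mult_mat_vec[symmetric, of _ n n _ n]) auto
  then have "W *\<^sub>v (V *\<^sub>v ?e) = V *\<^sub>v (?D *\<^sub>v ?e)"
    unfolding d using VD D mult_carrier_mat[OF VD(1) D] mult_mat_vec_carrier[OF VD(1) unit_vec_carrier]
    by (simp add: assoc_mult_mat_vec[of _ n n _ n])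
  moreover have "?D *\<^sub>v ?e = complex_of_real (d i) \<cdot>\<^sub>v ?e"
    using i by (subst mult_mat_diag_vec) (auto intro!: eq_vecI)
  ultimately have "vec_l2norm (W *\<^sub>v (V *\<^sub>v ?e)) = \<bar>d i\<bar>"
    using i by (simp add: vec_l2norm_unitary[OF V] vec_l2norm_smult vec_l2norm_unit_vec)
  moreover have "vec_l2norm (W *\<^sub>v (V *\<^sub>v ?e)) \<le> C * vec_l2norm (V *\<^sub>v ?e)"
    using W mult_mat_vec_carrier[OF VD(1) unit_vec_carrier] by (auto simp: op_bounded_def)
  moreover have "vec_l2norm (V *\<^sub>v ?e) = 1"
    using i by (simp add: vec_l2norm_unitary[OF V] vec_l2norm_unit_vec)
  ultimately show ?thesis by simp
qed

text \<open>The sum over n of the fourth powers has finite expectation, so it is finite almost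
  surely and its terms tend to 0.\<close>

lemma AE_tendsto_zero_fourth_moment:
  fixes X :: "nat \<Rightarrow> 'w \<Rightarrow> real"
  assumes int: "\<And>n. n \<ge> 1 \<Longrightarrow> integrable M (\<lambda>\<omega>. X n \<omega> ^ 4)"
    and le: "\<And>n. n \<ge> 1 \<Longrightarrow> (\<integral>\<omega>. X n \<omega> ^ 4 \<partial>M) \<le> K / (real n)\<^sup>2"
  shows "AE \<omega> in M. (\<lambda>n. X n \<omega>) \<longlonglongrightarrow> 0"
proof -
  \<comment> \<open>The index is shifted by one: the bound K / n^2 is available from n = 1
    on.\<close>
  define Y where "Y n \<omega> = X (Suc n) \<omega> ^ 4" for n \<omega>
  have Y: "integrable M (Y n)" "(\<integral>\<omega>. Y n \<omega> \<partial>M) \<le> K / (real (Suc n))\<^sup>2" for n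
    unfolding Y_def using int[of "Suc n"] le[of "Suc n"] by auto
  have Ym [measurable]: "Y n \<in> borel_measurable M" for n using Y(1) by auto
  have K: "K \<ge> 0"
  proof -
    have "0 \<le> (\<integral>\<omega>. Y 0 \<omega> \<partial>M)" by (intro integral_nonneg_AE) (auto simp: Y_def)
    then show ?thesis using Y(2)[of 0] by simp
  qed
  have "summable (\<lambda>n. K * inverse ((real (Suc n)) ^ 2))"
    by (intro summable_mult, subst summable_Suc_iff) (rule inverse_power_summable, simp)
  then have summ: "summable (\<lambda>n. K / (real (Suc n))\<^sup>2)" by (simp add: divide_inverse)
  have "(\<integral>\<^sup>+\<omega>. (\<Sum>n. ennreal (Y n \<omega>)) \<partial>M) = (\<Sum>n. \<integral>\<^sup>+\<omega>. ennreal (Y n \<omega>) \<partial>M)"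
    by (rule nn_integral_suminf) measurable
  also have "\<dots> \<le> (\<Sum>n. ennreal (K / (real (Suc n))\<^sup>2))"
  proof (rule suminf_le)
    fix n
    have "(\<integral>\<^sup>+\<omega>. ennreal (Y n \<omega>) \<partial>M) = ennreal (\<integral>\<omega>. Y n \<omega> \<partial>M)"
      by (rule nn_integral_eq_integral[OF Y(1)]) (simp add: Y_def)
    then show "(\<integral>\<^sup>+\<omega>. ennreal (Y n \<omega>) \<partial>M) \<le> ennreal (K / (real (Suc n))\<^sup>2)"
      using Y(2)[of n] by (simp add: ennreal_leI)
  qed auto
  also have "\<dots> = ennreal (\<Sum>n. K / (real (Suc n))\<^sup>2)"
    by (intro suminf_ennreal2 summ) (simp add: K)
  finally have "(\<integral>\<^sup>+\<omega>. (\<Sum>n. ennreal (Y n \<omega>)) \<partial>M) < \<top>"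
    by (rule le_less_trans) (rule ennreal_less_top)
  then have "(\<integral>\<^sup>+\<omega>. (\<Sum>n. ennreal (Y n \<omega>)) \<partial>M) \<noteq> \<infinity>" by simp
  then have "AE \<omega> in M. (\<Sum>n. ennreal (Y n \<omega>)) \<noteq> \<infinity>"
    by (intro nn_integral_noteq_infinite) measurable
  then show ?thesis
  proof eventually_elim
    case (elim \<omega>)
    have "summable (\<lambda>n. Y n \<omega>)"
      by (rule summable_suminf_not_top) (use elim in \<open>auto simp: Y_def\<close>)
    then have "(\<lambda>n. Y n \<omega>) \<longlonglongrightarrow> 0" by (rule summable_LIMSEQ_zero)
    then have "(\<lambda>n. root 4 (X (Suc n) \<omega> ^ 4)) \<longlonglongrightarrow> root 4 0"
      unfolding Y_def by (intro tendsto_real_root)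
    moreover have "root 4 (r ^ 4) = \<bar>r\<bar>" for r :: real
      using real_root_power_cancel[of 4 "\<bar>r\<bar>"] by simp
    ultimately have "(\<lambda>n. \<bar>X (Suc n) \<omega>\<bar>) \<longlonglongrightarrow> 0" by simp
    then have "(\<lambda>n. X (Suc n) \<omega>) \<longlonglongrightarrow> 0" by (simp add: tendsto_rabs_zero_iff)
    then show ?case by (rule LIMSEQ_imp_Suc)
  qed
qed

lemma haar_unitary_space: "haar_unitary M n U \<Longrightarrow> \<omega> \<in> space M \<Longrightarrow> U \<omega> \<in> unitary_group n"
  unfolding haar_unitary_def using measurable_space[of U M "unitary_borel n" \<omega>] by simp

text \<open>If V diagonalises W, the law of U V is the same as that of U, and the form becomes the
  sum of the eigenvalues weighted by squared coordinates of x. Subtracting the normalized trace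
  centres the weights, as the fourth moment bound requires.\<close>

lemma haar_hermitian_form_AE:
  assumes M: "prob_space M" and U: "\<And>n. n \<ge> 1 \<Longrightarrow> haar_unitary M n (U n)"
    and W: "\<And>n. n \<ge> 1 \<Longrightarrow> op_bounded n C (W n)" "\<And>n. n \<ge> 1 \<Longrightarrow> mat_adjoint (W n) = W n"
    and x: "\<And>n. n \<ge> 1 \<Longrightarrow> x n \<in> carrier_vec n" "\<And>n. n \<ge> 1 \<Longrightarrow> vec_l2norm (x n) \<le> R"
  shows "AE \<omega> in M. (\<lambda>n. ((U n \<omega> * W n * mat_adjoint (U n \<omega>)) *\<^sub>v x n) \<bullet>c x n
     - mat_trace (W n) / of_nat n * (x n \<bullet>c x n)) \<longlonglongrightarrow> 0"
proof -
  interpret prob_space M by fact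
  have "\<exists>V d. V \<in> unitary_group n \<and> W n = V * mat_diag n (\<lambda>i. complex_of_real (d i)) * mat_adjoint V" if "n \<ge> 1" for n
    using hermitian_spectral[of "W n" n] W(1)[OF that] W(2)[OF that] by (auto simp: op_bounded_def)
  then have "\<forall>n. \<exists>V d. n \<ge> 1 \<longrightarrow> V \<in> unitary_group n \<and> W n = V * mat_diag n (\<lambda>i. complex_of_real (d i)) * mat_adjoint V"
    by blast
  then obtain V d where V: "\<And>n. n \<ge> 1 \<Longrightarrow> V n \<in> unitary_group n"
    and d: "\<And>n. n \<ge> 1 \<Longrightarrow> W n = V n * mat_diag n (\<lambda>i. complex_of_real (d n i)) * mat_adjoint (V n)"
    unfolding choice_iff by blast
  \<comment> \<open>The mean eigenvalue, which is the normalized trace of \<open>W n\<close>; the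
    centred weights are then bounded by C + C.\<close>
  define mn where "mn n = (\<Sum>i<n. d n i) / real n" for n
  define X where "X n Z = (\<Sum>i<n. (d n i - mn n) * (cmod (coord n (x n) Z i))\<^sup>2)" for n Z
  have C: "C \<ge> 0" using W(1)[of 1] by (simp add: op_bounded_def)
  have R: "R \<ge> 0" using x(2)[of 1] vec_l2norm_nonneg[of "x 1"] by linarith
  have db: "\<bar>d n i\<bar> \<le> C" if "n \<ge> 1" "i < n" for n i
    by (rule eigenvalue_op_bounded[OF W(1) V d]) (use that in auto)
  have mb: "\<bar>mn n\<bar> \<le> C" if n: "n \<ge> 1" for n
  proof -
    have "\<bar>\<Sum>i<n. d n i\<bar> \<le> (\<Sum>i<n. C)" by (rule sum_abs[THEN order_trans], rule sum_mono) (use db n in auto)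
    then show ?thesis using n by (simp add: mn_def abs_divide divide_simps mult.commute)
  qed
  have Xm: "X n \<in> borel_measurable (unitary_borel n)" for n
    unfolding X_def by (intro borel_measurable_sum borel_measurable_times borel_measurable_power
      measurable_const measurable_compose[OF measurable_coord borel_measurable_norm]) auto
  have "AE \<omega> in M. (\<lambda>n. X n (U n \<omega> * V n)) \<longlonglongrightarrow> 0"
  proof (rule AE_tendsto_zero_fourth_moment)
    fix n :: nat assume n: "n \<ge> 1"
    note Un = U[OF n]
    have Umeas: "U n \<in> M \<rightarrow>\<^sub>M unitary_borel n" using Un by (simp add: haar_unitary_def)
    let ?\<mu> = "distr M (unitary_borel n) (U n)"
    have \<mu>: "normalized_haar n ?\<mu>" using Un by (simp add: haar_unitary_def)
    have XV: "(\<lambda>Z. X n (Z * V n)) \<in> borel_measurable (unitary_borel n)"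
      by (rule measurable_compose[OF measurable_mult_right_unitary[OF V[OF n]] Xm])
    have Xb: "\<bar>X n Z\<bar> \<le> (C + C) * R\<^sup>2" if Z: "Z \<in> unitary_group n" for Z
    proof -
      have "\<bar>X n Z\<bar> \<le> (\<Sum>i<n. (C + C) * (cmod (coord n (x n) Z i))\<^sup>2)"
        unfolding X_def
      proof (rule sum_abs[THEN order_trans], rule sum_mono)
        fix i assume "i \<in> {..<n}"
        then have "\<bar>d n i - mn n\<bar> \<le> C + C" using db[OF n, of i] mb[OF n] by auto
        then show "\<bar>(d n i - mn n) * (cmod (coord n (x n) Z i))\<^sup>2\<bar> \<le> (C + C) * (cmod (coord n (x n) Z i))\<^sup>2"
          by (simp add: abs_mult mult_right_mono)
      qed
      also have "\<dots> = (C + C) * (vec_l2norm (x n))\<^sup>2"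
        by (simp add: sum_distrib_left[symmetric] sum_coord_sq[OF Z x(1)[OF n]])
      also have "\<dots> \<le> (C + C) * R\<^sup>2" using C x(2)[OF n] by (intro mult_left_mono power_mono) auto
      finally show ?thesis .
    qed
    show "integrable M (\<lambda>\<omega>. X n (U n \<omega> * V n) ^ 4)"
    proof (intro integrable_bounded_meas bounded_meas_power)
      have "(\<lambda>\<omega>. X n (U n \<omega> * V n)) \<in> borel_measurable M" by (rule measurable_compose[OF Umeas XV])
      moreover have "\<bar>X n (U n \<omega> * V n)\<bar> \<le> (C + C) * R\<^sup>2" if "\<omega> \<in> space M" for \<omega>
        by (rule Xb) (intro unitary_group_mult haar_unitary_space[OF Un] that V n)
      ultimately show "bounded_meas M (\<lambda>\<omega>. X n (U n \<omega> * V n))" by (auto simp: bounded_meas_def)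
    qed
    have "(\<integral>\<omega>. X n (U n \<omega> * V n) ^ 4 \<partial>M) = (\<integral>Z. X n (Z * V n) ^ 4 \<partial>?\<mu>)"
      using XV by (intro integral_distr[symmetric] Umeas) measurable
    also have "\<dots> = (\<integral>Z. X n Z ^ 4 \<partial>?\<mu>)"
      using Xm by (intro haar_integral_mult_right[OF \<mu> V[OF n], symmetric]) simp
    also have "\<dots> \<le> 30240 * (C + C) ^ 4 * vec_l2norm (x n) ^ 8 / (real n)\<^sup>2"
      unfolding X_def
    proof (rule haar_weighted_fourth_moment[OF \<mu>])
      show "(\<Sum>i<n. d n i - mn n) = 0" using n by (simp add: sum_subtractf mn_def)
      show "\<bar>d n i - mn n\<bar> \<le> C + C" if "i < n" for i using db[OF n that] mb[OF n] by linarith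
    qed (use n x in auto)
    also have "\<dots> \<le> 30240 * (C + C) ^ 4 * R ^ 8 / (real n)\<^sup>2"
      using x(2)[OF n] C by (intro divide_right_mono mult_left_mono power_mono) auto
    finally show "(\<integral>\<omega>. X n (U n \<omega> * V n) ^ 4 \<partial>M) \<le> 30240 * (C + C) ^ 4 * R ^ 8 / (real n)\<^sup>2" .
  qed
  then show ?thesis
    using AE_space
  proof eventually_elim
    case (elim \<omega>)
    have eq: "((U n \<omega> * W n * mat_adjoint (U n \<omega>)) *\<^sub>v x n) \<bullet>c x n - mat_trace (W n) / of_nat n * (x n \<bullet>c x n)
        = complex_of_real (X n (U n \<omega> * V n))" if n: "n \<ge> 1" for n
    proof -
      define Z where "Z = U n \<omega> * V n"
      note Uu = haar_unitary_space[OF U[OF n] elim(2)]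
      have Z: "Z \<in> unitary_group n" unfolding Z_def by (intro unitary_group_mult Uu V n)
      note UD = unitary_groupD[OF Uu] and VD = unitary_groupD[OF V[OF n]] and ZD = unitary_groupD[OF Z]
      let ?D = "mat_diag n (\<lambda>i. complex_of_real (d n i))"
      have D: "?D \<in> carrier_mat n n" by simp
      have "U n \<omega> * W n * mat_adjoint (U n \<omega>) = Z * ?D * mat_adjoint Z"
      proof -
        have c: "V n * ?D \<in> carrier_mat n n" using VD(1) D by (rule mult_carrier_mat)
        show ?thesis
          unfolding d[OF n] Z_def mat_adjoint_mult[OF UD(1) VD(1)]
          using assoc_mult_mat[OF UD(1) c, of "mat_adjoint (V n)" n] assoc_mult_mat[OF UD(1) VD(1) D]
            assoc_mult_mat[of "U n \<omega> * (V n * ?D)" n n "mat_adjoint (V n)" n "mat_adjoint (U n \<omega>)" n] c VD UD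
          by simp
      qed
      from quadratic_form_diag[OF Z x(1)[OF n] this]
      have "((U n \<omega> * W n * mat_adjoint (U n \<omega>)) *\<^sub>v x n) \<bullet>c x n =
          complex_of_real (\<Sum>i<n. d n i * (cmod (coord n (x n) Z i))\<^sup>2)"
        using ZD x(1)[OF n] by (simp add: coord_adjoint del: index_mult_mat_vec)
      moreover have "mat_trace (W n) = complex_of_real (\<Sum>i<n. d n i)"
        unfolding d[OF n] by (subst mat_trace_conj_unitary[OF V[OF n] D]) (simp add: mat_trace_diag)
      moreover have "X n Z = (\<Sum>i<n. d n i * (cmod (coord n (x n) Z i))\<^sup>2) - mn n * (vec_l2norm (x n))\<^sup>2"
        unfolding X_def left_diff_distrib sum_subtractf
        by (simp add: sum_distrib_left[symmetric] sum_coord_sq[OF Z x(1)[OF n]])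
      ultimately show ?thesis by (simp add: cscalar_prod_self mn_def Z_def)
    qed
    have "(\<lambda>n. complex_of_real (X n (U n \<omega> * V n))) \<longlonglongrightarrow> complex_of_real 0"
      by (intro tendsto_of_real elim)
    then have "(\<lambda>n. complex_of_real (X n (U n \<omega> * V n))) \<longlonglongrightarrow> 0" by simp
    then show ?case
      by (rule Lim_transform_eventually) (rule eventually_sequentiallyI[of 1], simp only: eq)
  qed
qed

lemma smult_mat_vec:
  fixes A :: "complex mat"
  assumes "A \<in> carrier_mat n m" "v \<in> carrier_vec m"
  shows "(c \<cdot>\<^sub>m A) *\<^sub>v v = c \<cdot>\<^sub>v (A *\<^sub>v v)"
  using assms by auto

lemma hermitian_parts:
  assumes W: "op_bounded n C W"
  defines "H1 \<equiv> (1 / 2) \<cdot>\<^sub>m (W + mat_adjoint W)" and "H2 \<equiv> (- \<i> / 2) \<cdot>\<^sub>m (W + (-1) \<cdot>\<^sub>m mat_adjoint W)"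
  shows "op_bounded n C H1" "op_bounded n C H2" "mat_adjoint H1 = H1" "mat_adjoint H2 = H2" "W = H1 + \<i> \<cdot>\<^sub>m H2"
proof -
  have Wc: "W \<in> carrier_mat n n" using W by (simp add: op_bounded_def)
  show "op_bounded n C H1"
    using op_bounded_smult[OF op_bounded_add[OF W op_bounded_adjoint[OF W]], of "1 / 2"]
    by (simp add: H1_def norm_divide)
  show "op_bounded n C H2"
    using op_bounded_smult[OF op_bounded_add[OF W op_bounded_smult[OF op_bounded_adjoint[OF W], of "-1"]], of "- \<i> / 2"]
    by (simp add: H2_def norm_divide norm_mult)
  show "mat_adjoint H1 = H1" "mat_adjoint H2 = H2"
    using Wc by (auto simp: H1_def H2_def algebra_simps intro!: eq_matI)
  show "W = H1 + \<i> \<cdot>\<^sub>m H2"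
    using Wc by (auto simp: H1_def H2_def algebra_simps intro!: eq_matI)
qed

lemma cscalar_prod_add_left:
  fixes u v w :: "complex Matrix.vec"
  assumes "u \<in> carrier_vec n" "v \<in> carrier_vec n" "w \<in> carrier_vec n"
  shows "(u + v) \<bullet>c w = u \<bullet>c w + v \<bullet>c w"
  using assms by (simp add: cscalar_prod_conv distrib_right sum.distrib)

lemma cscalar_prod_add_right:
  fixes u v w :: "complex Matrix.vec"
  assumes "u \<in> carrier_vec n" "v \<in> carrier_vec n" "w \<in> carrier_vec n"
  shows "w \<bullet>c (u + v) = w \<bullet>c u + w \<bullet>c v"
  using assms by (simp add: cscalar_prod_conv distrib_left sum.distrib)

lemma cscalar_prod_smult_left: "dim_vec u = dim_vec v \<Longrightarrow> (c \<cdot>\<^sub>v u) \<bullet>c v = c * (u \<bullet>c v)"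
  for u v :: "complex Matrix.vec"
  by (simp add: cscalar_prod_conv sum_distrib_left mult.assoc)

lemma cscalar_prod_smult_right: "u \<bullet>c (c \<cdot>\<^sub>v v) = cnj c * (u \<bullet>c v)"
  for u v :: "complex Matrix.vec"
  by (simp add: cscalar_prod_conv sum_distrib_left mult_ac)

text \<open>Over the fourth roots of unity the sums of t, of t^2 and of t times |t|^2 vanish, while
  each t times its conjugate is 1. Only the term with the conjugate of t survives, four
  times.\<close>

lemma polarization:
  fixes x y :: "complex Matrix.vec"
  assumes Z: "Z \<in> carrier_mat n n" and x: "x \<in> carrier_vec n" and y: "y \<in> carrier_vec n"
  shows "4 * ((Z *\<^sub>v x) \<bullet>c y) = (\<Sum>t\<leftarrow>[1, \<i>, -1, -\<i>]. t * ((Z *\<^sub>v (x + t \<cdot>\<^sub>v y)) \<bullet>c (x + t \<cdot>\<^sub>v y)))"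
proof -
  have "(Z *\<^sub>v (x + t \<cdot>\<^sub>v y)) \<bullet>c (x + t \<cdot>\<^sub>v y) = (Z *\<^sub>v x) \<bullet>c x + t * ((Z *\<^sub>v y) \<bullet>c x)
      + cnj t * ((Z *\<^sub>v x) \<bullet>c y) + t * cnj t * ((Z *\<^sub>v y) \<bullet>c y)" for t
  proof -
    have c: "Z *\<^sub>v x \<in> carrier_vec n" "Z *\<^sub>v y \<in> carrier_vec n" "t \<cdot>\<^sub>v y \<in> carrier_vec n" "t \<cdot>\<^sub>v (Z *\<^sub>v y) \<in> carrier_vec n"
      using Z x y by auto
    have "Z *\<^sub>v (x + t \<cdot>\<^sub>v y) = Z *\<^sub>v x + t \<cdot>\<^sub>v (Z *\<^sub>v y)"
      using mult_add_distrib_mat_vec[OF Z x c(3)] mult_mat_vec[OF Z y] by simp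
    then show ?thesis
      using c x y Z by (simp add: cscalar_prod_add_left[of _ n] cscalar_prod_add_right[of _ n] cscalar_prod_smult_left
        cscalar_prod_smult_right algebra_simps del: conjugate_id)
  qed
  then show ?thesis by (simp add: algebra_simps)
qed

text \<open>Polarisation and the splitting of W into Hermitian parts leave eight Hermitian forms, at
  the vectors x + t y of norm at most 2, and finitely many almost sure events intersect.\<close>

theorem haar_bilinear_form_AE:
  assumes M: "prob_space M" and U: "\<And>n. n \<ge> 1 \<Longrightarrow> haar_unitary M n (U n)"
    and W: "\<And>n. n \<ge> 1 \<Longrightarrow> op_bounded n C (W n)"
    and x: "\<And>n. n \<ge> 1 \<Longrightarrow> x n \<in> carrier_vec n" "\<And>n. n \<ge> 1 \<Longrightarrow> vec_l2norm (x n) \<le> 1"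
    and y: "\<And>n. n \<ge> 1 \<Longrightarrow> y n \<in> carrier_vec n" "\<And>n. n \<ge> 1 \<Longrightarrow> vec_l2norm (y n) \<le> 1"
  shows "AE \<omega> in M. (\<lambda>n. ((U n \<omega> * W n * mat_adjoint (U n \<omega>)) *\<^sub>v x n) \<bullet>c y n
     - mat_trace (W n) / of_nat n * (x n \<bullet>c y n)) \<longlonglongrightarrow> 0"
proof -
  define H1 where "H1 n = (1 / 2) \<cdot>\<^sub>m (W n + mat_adjoint (W n))" for n
  define H2 where "H2 n = (- \<i> / 2) \<cdot>\<^sub>m (W n + (-1) \<cdot>\<^sub>m mat_adjoint (W n))" for n
  note H = hermitian_parts[OF W, folded H1_def H2_def]
  define z where "z t n = x n + t \<cdot>\<^sub>v y n" for t n
  have zc: "z t n \<in> carrier_vec n" if "n \<ge> 1" for t n using x(1)[OF that] y(1)[OF that] by (simp add: z_def)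
  have zn: "vec_l2norm (z t n) \<le> 2" if "n \<ge> 1" "cmod t = 1" for t n
  proof -
    have "vec_l2norm (z t n) \<le> vec_l2norm (x n) + vec_l2norm (t \<cdot>\<^sub>v y n)"
      unfolding z_def using x(1)[OF that(1)] y(1)[OF that(1)] by (intro vec_l2norm_triangle[of _ n]) auto
    then show ?thesis using x(2)[OF that(1)] y(2)[OF that(1)] that(2) by (simp add: vec_l2norm_smult)
  qed
  define q where "q G t n \<omega> = ((U n \<omega> * G n * mat_adjoint (U n \<omega>)) *\<^sub>v z t n) \<bullet>c z t n
     - mat_trace (G n) / of_nat n * (z t n \<bullet>c z t n)" for G :: "nat \<Rightarrow> complex mat" and t n \<omega>
  have q1: "AE \<omega> in M. (\<lambda>n. q H1 t n \<omega>) \<longlonglongrightarrow> 0" if "cmod t = 1" for t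
    unfolding q_def by (rule haar_hermitian_form_AE[OF M U H(1) H(3)]) (use that zc zn in auto)
  have q2: "AE \<omega> in M. (\<lambda>n. q H2 t n \<omega>) \<longlonglongrightarrow> 0" if "cmod t = 1" for t
    unfolding q_def by (rule haar_hermitian_form_AE[OF M U H(2) H(4)]) (use that zc zn in auto)
  let ?T = "[1, \<i>, -1, -\<i>]"
  have "AE \<omega> in M. \<forall>t\<in>set ?T. (\<lambda>n. q H1 t n \<omega>) \<longlonglongrightarrow> 0 \<and> (\<lambda>n. q H2 t n \<omega>) \<longlonglongrightarrow> 0"
    by (rule AE_finite_allI) (use q1 q2 in auto)
  then show ?thesis
    using AE_space
  proof eventually_elim
    case (elim \<omega>)
    have "(\<lambda>n. (\<Sum>t\<leftarrow>?T. t * (q H1 t n \<omega> + \<i> * q H2 t n \<omega>)) / 4) \<longlonglongrightarrow> (\<Sum>t\<leftarrow>?T. t * (0 + \<i> * 0)) / 4"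
      using elim(1) by (simp only: list.map sum_list.Cons sum_list.Nil) (intro tendsto_intros; simp)
    then have lim: "(\<lambda>n. (\<Sum>t\<leftarrow>?T. t * (q H1 t n \<omega> + \<i> * q H2 t n \<omega>)) / 4) \<longlonglongrightarrow> 0" by simp
    have eq: "((U n \<omega> * W n * mat_adjoint (U n \<omega>)) *\<^sub>v x n) \<bullet>c y n - mat_trace (W n) / of_nat n * (x n \<bullet>c y n)
        = (\<Sum>t\<leftarrow>?T. t * (q H1 t n \<omega> + \<i> * q H2 t n \<omega>)) / 4" if n: "n \<ge> 1" for n
    proof -
      note Uu = haar_unitary_space[OF U[OF n] elim(2)]
      note UD = unitary_groupD[OF Uu]
      let ?c = "\<lambda>G. U n \<omega> * G * mat_adjoint (U n \<omega>)"
      have Hc: "H1 n \<in> carrier_mat n n" "H2 n \<in> carrier_mat n n" "W n \<in> carrier_mat n n"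
        using H(1,2)[OF n] W[OF n] by (auto simp: op_bounded_def)
      have cc: "?c G \<in> carrier_mat n n" if "G \<in> carrier_mat n n" for G
        using mult_carrier_mat[OF mult_carrier_mat[OF UD(1) that] UD(2)] .
      have iH: "\<i> \<cdot>\<^sub>m H2 n \<in> carrier_mat n n" using Hc by simp
      have ceq: "?c (W n) = ?c (H1 n) + \<i> \<cdot>\<^sub>m ?c (H2 n)"
      proof -
        have "U n \<omega> * (H1 n + \<i> \<cdot>\<^sub>m H2 n) = U n \<omega> * H1 n + \<i> \<cdot>\<^sub>m (U n \<omega> * H2 n)"
          using mult_add_distrib_mat[OF UD(1) Hc(1) iH] mult_smult_distrib[OF UD(1) Hc(2), of \<i>] by simp
        moreover have "(U n \<omega> * H1 n + \<i> \<cdot>\<^sub>m (U n \<omega> * H2 n)) * mat_adjoint (U n \<omega>) = ?c (H1 n) + \<i> \<cdot>\<^sub>m ?c (H2 n)"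
          using add_mult_distrib_mat[OF mult_carrier_mat[OF UD(1) Hc(1)] smult_carrier_mat[OF mult_carrier_mat[OF UD(1) Hc(2)]] UD(2), of \<i>]
            mult_smult_assoc_mat[OF mult_carrier_mat[OF UD(1) Hc(2)] UD(2), of \<i>] by simp
        ultimately show ?thesis using H(5)[OF n] by simp
      qed
      have tr: "mat_trace (W n) = mat_trace (H1 n) + \<i> * mat_trace (H2 n)"
        by (subst H(5)[OF n]) (simp add: mat_trace_add[OF Hc(1) iH] mat_trace_smult[OF Hc(2)])
      have form: "(?c (W n) *\<^sub>v v) \<bullet>c v = (?c (H1 n) *\<^sub>v v) \<bullet>c v + \<i> * ((?c (H2 n) *\<^sub>v v) \<bullet>c v)" if v: "v \<in> carrier_vec n" for v
      proof -
        have "?c (W n) *\<^sub>v v = ?c (H1 n) *\<^sub>v v + \<i> \<cdot>\<^sub>v (?c (H2 n) *\<^sub>v v)"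
          unfolding ceq using add_mult_distrib_mat_vec[OF cc[OF Hc(1)] smult_carrier_mat[OF cc[OF Hc(2)]] v, of \<i>]
            smult_mat_vec[OF cc[OF Hc(2)] v, of \<i>] by simp
        then show ?thesis
          using mult_mat_vec_carrier[OF cc[OF Hc(1)] v] mult_mat_vec_carrier[OF cc[OF Hc(2)] v] v
          by (simp add: cscalar_prod_add_left[of _ n] cscalar_prod_smult_left del: conjugate_id)
      qed
      have Q: "q H1 t n \<omega> + \<i> * q H2 t n \<omega> = (?c (W n) *\<^sub>v z t n) \<bullet>c z t n - mat_trace (W n) / of_nat n * (z t n \<bullet>c z t n)" for t
        unfolding q_def form[OF zc[OF n]] tr by (simp add: algebra_simps add_divide_distrib)
      have one: "(1\<^sub>m n *\<^sub>v v) = v" if "v \<in> carrier_vec n" for v :: "complex Matrix.vec" using that by simp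
      have e1: "4 * ((?c (W n) *\<^sub>v x n) \<bullet>c y n) = (\<Sum>t\<leftarrow>?T. t * ((?c (W n) *\<^sub>v z t n) \<bullet>c z t n))"
        unfolding z_def by (rule polarization[OF cc[OF Hc(3)] x(1)[OF n] y(1)[OF n]])
      \<comment> \<open>Polarisation for the identity matrix expresses the inner product in the same
        four vectors.\<close>
      have e2: "4 * (x n \<bullet>c y n) = (\<Sum>t\<leftarrow>?T. t * (z t n \<bullet>c z t n))"
        using polarization[OF one_carrier_mat x(1)[OF n] y(1)[OF n]]
        by (simp only: one[OF x(1)[OF n]] z_def[symmetric] one[OF zc[OF n]])
      have e3: "(\<Sum>t\<leftarrow>?T. t * (f t - r * g t)) = (\<Sum>t\<leftarrow>?T. t * f t) - r * (\<Sum>t\<leftarrow>?T. t * g t)"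
        for f g and r :: complex by (simp add: algebra_simps)
      show ?thesis unfolding Q e3 e1[symmetric] e2[symmetric] by (simp add: algebra_simps)
    qed
    show ?case
      by (rule Lim_transform_eventually[OF lim]) (rule eventually_sequentiallyI[of 1], simp only: eq)
  qed
qed

section \<open>Evaluation of words and *-polynomials\<close>

lemma mat_prod_Nil [simp]: "mat_prod n [] = 1\<^sub>m n"
  and mat_prod_Cons [simp]: "mat_prod n (A # As) = A * mat_prod n As"
  by (simp_all add: mat_prod_def)

lemma mat_prod_carrier: "(\<And>A. A \<in> set As \<Longrightarrow> A \<in> carrier_mat n n) \<Longrightarrow> mat_prod n As \<in> carrier_mat n n"
proof (induction As)
  case (Cons A As)
  then show ?case using mult_carrier_mat[of A n n "mat_prod n As" n] by simp
qed simp

lemma mat_prod_append: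
  assumes "\<And>A. A \<in> set As \<Longrightarrow> A \<in> carrier_mat n n" "\<And>A. A \<in> set Bs \<Longrightarrow> A \<in> carrier_mat n n"
  shows "mat_prod n (As @ Bs) = mat_prod n As * mat_prod n Bs"
  using assms(1)
proof (induction As)
  case Nil
  then show ?case using mat_prod_carrier[of Bs n] assms(2) by simp
next
  case (Cons A As)
  have "mat_prod n As \<in> carrier_mat n n" "mat_prod n Bs \<in> carrier_mat n n" "A \<in> carrier_mat n n"
    using Cons.prems assms(2) by (auto intro!: mat_prod_carrier)
  then show ?case using Cons by (simp add: assoc_mult_mat[of A n n _ n _ n])
qed

lemma mat_prod_adjoint:
  assumes "\<And>A. A \<in> set As \<Longrightarrow> A \<in> carrier_mat n n"
  shows "mat_adjoint (mat_prod n As) = mat_prod n (rev (map mat_adjoint As))"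
  using assms
proof (induction As)
  case (Cons A As)
  have c: "mat_prod n As \<in> carrier_mat n n" "A \<in> carrier_mat n n"
    using Cons.prems by (auto intro!: mat_prod_carrier)
  have "mat_prod n (rev (map mat_adjoint As) @ [mat_adjoint A]) = mat_prod n (rev (map mat_adjoint As)) * mat_prod n [mat_adjoint A]"
    using Cons.prems by (intro mat_prod_append) auto
  then show ?case using Cons c mat_adjoint_mult[OF c(2,1)] mat_adjoint_carrier[OF c(2)] by simp
qed simp

lemma op_bounded_mat_prod:
  assumes "\<And>A. A \<in> set As \<Longrightarrow> op_bounded n K A"
  shows "op_bounded n (K ^ length As) (mat_prod n As)"
  using assms by (induction As) (auto intro: op_bounded_one op_bounded_mult)

text \<open>Telescoping: A P - B Q = A (P - Q) + (A - B) Q. The assumption \<open>K \<ge> 1\<close>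
  allows the powers of K to be rounded up to a common exponent.\<close>

lemma op_bounded_diff_prod:
  assumes "list_all2 (\<lambda>A B. op_bounded n K A \<and> op_bounded n K B \<and> op_bounded n \<epsilon> (A - B)) As Bs" "K \<ge> 1" "\<epsilon> \<ge> 0"
  shows "op_bounded n (real (length As) * K ^ length As * \<epsilon>) (mat_prod n As - mat_prod n Bs)"
  using assms(1)
proof (induction rule: list_all2_induct)
  case Nil
  have "1\<^sub>m n - 1\<^sub>m n = (0\<^sub>m n n :: complex mat)" by auto
  then have "op_bounded n 0 (1\<^sub>m n - 1\<^sub>m n)" by (simp only: op_bounded_zero)
  then show ?case by simp
next
  case (Cons A As B Bs)
  let ?P = "mat_prod n As" and ?Q = "mat_prod n Bs"
  have Q: "op_bounded n (K ^ length As) ?Q"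
  proof -
    have "op_bounded n K C" if C: "C \<in> set Bs" for C
    proof -
      obtain i where "i < length Bs" "C = Bs ! i" using C by (metis in_set_conv_nth)
      then show ?thesis using list_all2_nthD2[OF Cons(2)] by blast
    qed
    then show ?thesis using op_bounded_mat_prod[of Bs n K] list_all2_lengthD[OF Cons(2)] by simp
  qed
  have P: "?P \<in> carrier_mat n n"
  proof (rule mat_prod_carrier)
    fix C assume C: "C \<in> set As"
    then obtain i where "i < length As" "C = As ! i" by (metis in_set_conv_nth)
    then show "C \<in> carrier_mat n n" using list_all2_nthD[OF Cons(2)] by (auto simp: op_bounded_def)
  qed
  have c: "A \<in> carrier_mat n n" "B \<in> carrier_mat n n" "?Q \<in> carrier_mat n n"
    using Cons(1) Q by (auto simp: op_bounded_def)
  have eq: "A * ?P - B * ?Q = A * (?P - ?Q) + (A - B) * ?Q"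
    using c P unfolding mult_minus_distrib_mat[OF c(1) P c(3)] minus_mult_distrib_mat[OF c(1,2,3)] by auto
  have "op_bounded n (K * (real (length As) * K ^ length As * \<epsilon>) + \<epsilon> * K ^ length As) (A * (?P - ?Q) + (A - B) * ?Q)"
    using Cons(1) by (intro op_bounded_add op_bounded_mult Cons(3) Q) auto
  moreover have "K * (real (length As) * K ^ length As * \<epsilon>) + \<epsilon> * K ^ length As \<le> real (length (A # As)) * K ^ length (A # As) * \<epsilon>"
  proof -
    have "\<epsilon> * K ^ length As \<le> \<epsilon> * K ^ Suc (length As)"
      using assms(2,3) by (intro mult_left_mono power_increasing) auto
    then show ?thesis by (simp add: algebra_simps)
  qed
  ultimately show ?case by (simp add: eq op_bounded_mono)
qed

text \<open>A list of coefficient-word pairs may repeat words, so products and powers of polynomials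
  become concatenations without collecting like terms.\<close>

definition terms_eval :: "nat \<Rightarrow> (complex \<times> letter list) list \<Rightarrow> (letter \<Rightarrow> complex mat) \<Rightarrow> complex mat" where
  "terms_eval n cs \<rho> = Matrix.mat n n (\<lambda>ij. \<Sum>(c, w)\<leftarrow>cs. c * (mat_prod n (map \<rho> w) $$ ij))"

lemma terms_eval_carrier [simp]: "terms_eval n cs \<rho> \<in> carrier_mat n n"
  by (simp add: terms_eval_def)

definition poly_terms :: "nc_poly \<Rightarrow> (complex \<times> letter list) list" where
  "poly_terms P = map (\<lambda>w. (Poly_Mapping.lookup P w, w)) (SOME ws. set ws = Poly_Mapping.keys P \<and> distinct ws)"

lemma poly_terms_list:
  obtains ws where "set ws = Poly_Mapping.keys P" "distinct ws"
    "poly_terms P = map (\<lambda>w. (Poly_Mapping.lookup P w, w)) ws"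
proof -
  have "\<exists>ws. set ws = Poly_Mapping.keys P \<and> distinct ws"
    using finite_distinct_list[OF finite_keys] .
  from someI_ex[OF this] that show ?thesis by (auto simp: poly_terms_def)
qed

lemma nc_eval_terms: "nc_eval n P A B = terms_eval n (poly_terms P) (letter_eval A B)"
proof -
  obtain ws where ws: "set ws = Poly_Mapping.keys P" "distinct ws"
    "poly_terms P = map (\<lambda>w. (Poly_Mapping.lookup P w, w)) ws" by (rule poly_terms_list)
  have "(\<Sum>w\<in>Poly_Mapping.keys P. f w) = (\<Sum>w\<leftarrow>ws. f w)" for f :: "letter list \<Rightarrow> complex"
    using sum_list_distinct_conv_sum_set[OF ws(2), of f] ws(1) by simp
  then show ?thesis by (simp add: nc_eval_def terms_eval_def ws(3) o_def)
qed

definition terms_mult :: "(complex \<times> letter list) list \<Rightarrow> (complex \<times> letter list) list \<Rightarrow> (complex \<times> letter list) list" where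
  "terms_mult cs ds = concat (map (\<lambda>(c, v). map (\<lambda>(d, w). (c * d, v @ w)) ds) cs)"

lemma terms_eval_Nil: "terms_eval n [] \<rho> = 0\<^sub>m n n"
  by (auto simp: terms_eval_def)

lemma terms_eval_Cons:
  assumes "mat_prod n (map \<rho> w) \<in> carrier_mat n n"
  shows "terms_eval n ((c, w) # cs) \<rho> = c \<cdot>\<^sub>m mat_prod n (map \<rho> w) + terms_eval n cs \<rho>"
  using assms by (intro eq_matI) (auto simp: terms_eval_def)

lemma terms_eval_append: "terms_eval n (cs @ ds) \<rho> = terms_eval n cs \<rho> + terms_eval n ds \<rho>"
  by (intro eq_matI) (auto simp: terms_eval_def)

lemma mat_trace_terms_eval:
  assumes "\<And>c w. (c, w) \<in> set cs \<Longrightarrow> mat_prod n (map \<rho> w) \<in> carrier_mat n n"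
  shows "mat_trace (terms_eval n cs \<rho>) = (\<Sum>(c, w)\<leftarrow>cs. c * mat_trace (mat_prod n (map \<rho> w)))"
  using assms
proof (induction cs)
  case Nil
  then show ?case by (simp add: terms_eval_Nil mat_trace_def)
next
  case (Cons cw cs)
  obtain c w where cw: "cw = (c, w)" by (cases cw)
  have m: "mat_prod n (map \<rho> w) \<in> carrier_mat n n" using Cons.prems[of c w] by (simp add: cw)
  have "mat_trace (terms_eval n cs \<rho>) = (\<Sum>(c, w)\<leftarrow>cs. c * mat_trace (mat_prod n (map \<rho> w)))"
    by (rule Cons.IH) (use Cons.prems in auto)
  then show ?case
    using m by (simp add: cw terms_eval_Cons[OF m] mat_trace_add[of _ n] mat_trace_smult[of _ n])
qed

lemma terms_eval_mult_single:
  assumes \<rho>: "\<And>x. x \<in> set v \<Longrightarrow> \<rho> x \<in> carrier_mat n n"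
    and ds: "\<And>d w x. (d, w) \<in> set ds \<Longrightarrow> x \<in> set w \<Longrightarrow> \<rho> x \<in> carrier_mat n n"
  shows "(c \<cdot>\<^sub>m mat_prod n (map \<rho> v)) * terms_eval n ds \<rho> = terms_eval n (map (\<lambda>(d, w). (c * d, v @ w)) ds) \<rho>"
  using ds
proof (induction ds)
  case Nil
  have "mat_prod n (map \<rho> v) \<in> carrier_mat n n" by (rule mat_prod_carrier) (use \<rho> in auto)
  then show ?case by (simp add: terms_eval_Nil)
next
  case (Cons dw ds)
  obtain d w where dw: "dw = (d, w)" by (cases dw)
  have v: "mat_prod n (map \<rho> v) \<in> carrier_mat n n" by (rule mat_prod_carrier) (use \<rho> in auto)
  have w: "mat_prod n (map \<rho> w) \<in> carrier_mat n n" by (rule mat_prod_carrier) (use Cons.prems dw in auto)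
  have ap: "mat_prod n (map \<rho> (v @ w)) = mat_prod n (map \<rho> v) * mat_prod n (map \<rho> w)"
    unfolding map_append by (rule mat_prod_append) (use \<rho> Cons.prems dw in auto)
  have vw: "mat_prod n (map \<rho> (v @ w)) \<in> carrier_mat n n" unfolding ap using v w by (rule mult_carrier_mat)
  have IH: "(c \<cdot>\<^sub>m mat_prod n (map \<rho> v)) * terms_eval n ds \<rho> = terms_eval n (map (\<lambda>(d, w). (c * d, v @ w)) ds) \<rho>"
    using Cons by auto
  have "(c \<cdot>\<^sub>m mat_prod n (map \<rho> v)) * (d \<cdot>\<^sub>m mat_prod n (map \<rho> w)) = (c * d) \<cdot>\<^sub>m mat_prod n (map \<rho> (v @ w))"
    unfolding ap using mult_smult_assoc_mat[OF v smult_carrier_mat[OF w], of c d] mult_smult_distrib[OF v w, of d]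
    by (simp add: mult.commute) (auto simp: mult_ac intro!: eq_matI)
  then show ?case
    using mult_add_distrib_mat[OF smult_carrier_mat[OF v] smult_carrier_mat[OF w] terms_eval_carrier, of c d ds \<rho>]
    by (simp add: dw terms_eval_Cons[OF w] terms_eval_Cons[OF vw, unfolded map_append] IH)
qed

lemma terms_eval_mult:
  assumes cs: "\<And>c v x. (c, v) \<in> set cs \<Longrightarrow> x \<in> set v \<Longrightarrow> \<rho> x \<in> carrier_mat n n"
    and ds: "\<And>d w x. (d, w) \<in> set ds \<Longrightarrow> x \<in> set w \<Longrightarrow> \<rho> x \<in> carrier_mat n n"
  shows "terms_eval n cs \<rho> * terms_eval n ds \<rho> = terms_eval n (terms_mult cs ds) \<rho>"
  using cs
proof (induction cs)
  case Nil
  then show ?case by (simp add: terms_eval_Nil terms_mult_def left_mult_zero_mat[OF terms_eval_carrier])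
next
  case (Cons cv cs)
  obtain c v where cv: "cv = (c, v)" by (cases cv)
  have v: "mat_prod n (map \<rho> v) \<in> carrier_mat n n" by (rule mat_prod_carrier) (use Cons.prems cv in auto)
  have IH: "terms_eval n cs \<rho> * terms_eval n ds \<rho> = terms_eval n (terms_mult cs ds) \<rho>" using Cons by auto
  have s: "(c \<cdot>\<^sub>m mat_prod n (map \<rho> v)) * terms_eval n ds \<rho> = terms_eval n (map (\<lambda>(d, w). (c * d, v @ w)) ds) \<rho>"
    by (rule terms_eval_mult_single) (use Cons.prems cv ds in auto)
  show ?case
    unfolding cv terms_eval_Cons[OF v] add_mult_distrib_mat[OF smult_carrier_mat[OF v] terms_eval_carrier terms_eval_carrier] IH s
    by (simp add: terms_mult_def terms_eval_append)
qed

primrec terms_pow :: "(complex \<times> letter list) list \<Rightarrow> nat \<Rightarrow> (complex \<times> letter list) list" where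
  "terms_pow cs 0 = [(1, [])]"
| "terms_pow cs (Suc p) = terms_mult cs (terms_pow cs p)"

lemma set_terms_mult: "(c, w) \<in> set (terms_mult cs ds) \<Longrightarrow>
    \<exists>c1 v1 c2 v2. (c1, v1) \<in> set cs \<and> (c2, v2) \<in> set ds \<and> c = c1 * c2 \<and> w = v1 @ v2"
  by (fastforce simp: terms_mult_def)

lemma terms_pow_letters: "(c, w) \<in> set (terms_pow cs p) \<Longrightarrow> x \<in> set w \<Longrightarrow> \<exists>d v. (d, v) \<in> set cs \<and> x \<in> set v"
proof (induction p arbitrary: c w)
  case (Suc p)
  from Suc.prems(1) obtain c1 v1 c2 v2 where *: "(c1, v1) \<in> set cs" "(c2, v2) \<in> set (terms_pow cs p)" "w = v1 @ v2"
    by (auto dest!: set_terms_mult)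
  then show ?case using Suc.prems(2) Suc.IH[OF *(2)] by (cases "x \<in> set v1") auto
qed simp

lemma terms_pow_eval:
  assumes cs: "\<And>c v x. (c, v) \<in> set cs \<Longrightarrow> x \<in> set v \<Longrightarrow> \<rho> x \<in> carrier_mat n n"
  shows "mat_prod n (replicate p (terms_eval n cs \<rho>)) = terms_eval n (terms_pow cs p) \<rho>"
proof (induction p)
  case 0
  show ?case by (auto simp: terms_eval_def intro!: eq_matI)
next
  case (Suc p)
  have "terms_eval n cs \<rho> * terms_eval n (terms_pow cs p) \<rho> = terms_eval n (terms_mult cs (terms_pow cs p)) \<rho>"
    by (rule terms_eval_mult[OF cs]) (use cs terms_pow_letters in blast)+
  then show ?case by (simp add: Suc)
qed

lemma mat_diag_mult_conj:
  assumes V: "V \<in> unitary_group n"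
  shows "(V * mat_diag n f * mat_adjoint V) * (V * mat_diag n g * mat_adjoint V) = V * mat_diag n (\<lambda>i. f i * g i) * mat_adjoint V"
proof -
  note VD = unitary_groupD[OF V]
  have D: "mat_diag n f \<in> carrier_mat n n" for f :: "nat \<Rightarrow> complex" by simp
  have c: "V * mat_diag n f \<in> carrier_mat n n" "mat_diag n f * mat_adjoint V \<in> carrier_mat n n" for f
    using mult_carrier_mat[OF VD(1) D] mult_carrier_mat[OF D VD(2)] by auto
  have "(V * mat_diag n f * mat_adjoint V) * (V * mat_diag n g * mat_adjoint V) =
      (V * mat_diag n f) * (mat_adjoint V * (V * (mat_diag n g * mat_adjoint V)))"
    using assoc_mult_mat[OF c(1) VD(2) mult_carrier_mat[OF c(1) VD(2)], of f g] assoc_mult_mat[OF VD(1) D VD(2), of g] by simp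
  also have "mat_adjoint V * (V * (mat_diag n g * mat_adjoint V)) = mat_diag n g * mat_adjoint V"
    by (rule unitary_cancel(2)[OF V c(2)])
  also have "(V * mat_diag n f) * (mat_diag n g * mat_adjoint V) = V * (mat_diag n f * mat_diag n g) * mat_adjoint V"
    using assoc_mult_mat[OF c(1) D VD(2), of f g] assoc_mult_mat[OF VD(1) D D, of f g] by simp
  finally show ?thesis by simp
qed

lemma mat_trace_power_diag:
  assumes V: "V \<in> unitary_group n" and A: "A = V * mat_diag n (\<lambda>i. complex_of_real (d i)) * mat_adjoint V"
  shows "mat_trace (mat_prod n (replicate p A)) = complex_of_real (\<Sum>i<n. d i ^ p)"
proof -
  note VD = unitary_groupD[OF V]
  have "mat_prod n (replicate p A) = V * mat_diag n (\<lambda>i. complex_of_real (d i ^ p)) * mat_adjoint V"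
  proof (induction p)
    case 0
    then show ?case using VD by simp
  next
    case (Suc p)
    have "A * (V * mat_diag n (\<lambda>i. complex_of_real (d i ^ p)) * mat_adjoint V) =
        V * mat_diag n (\<lambda>i. complex_of_real (d i) * complex_of_real (d i ^ p)) * mat_adjoint V"
      unfolding A by (rule mat_diag_mult_conj[OF V])
    then show ?case by (simp add: Suc)
  qed
  then show ?thesis by (simp add: mat_trace_conj_unitary[OF V] mat_trace_diag)
qed

section \<open>The polynomial: every monomial contains an x, and the adjoint permutes the
  monomials\<close>

lemma keys_contain_X:
  assumes "subst_X_zero P = 0" "w \<in> Poly_Mapping.keys P"
  shows "\<exists>i. X_var i \<in> set w"
proof (rule ccontr)
  assume nx: "\<not> ?thesis"
  have "0 = Poly_Mapping.lookup (subst_X_zero P) w" using assms(1) by simp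
  also have "\<dots> = (\<Sum>v\<in>Poly_Mapping.keys P. Poly_Mapping.lookup (if \<exists>i. X_var i \<in> set v then 0 else Poly_Mapping.single v (Poly_Mapping.lookup P v)) w)"
    unfolding subst_X_zero_def by (simp add: lookup_sum)
  also have "\<dots> = (\<Sum>v\<in>{w}. Poly_Mapping.lookup P v)"
    using nx assms(2) by (intro sum.mono_neutral_cong_right) (auto simp: lookup_single when_def split: if_splits)
  finally show False using assms(2) by (simp add: in_keys_iff)
qed

definition word_star :: "letter list \<Rightarrow> letter list" where
  "word_star w = rev (map letter_star w)"

lemma letter_star_star [simp]: "letter_star (letter_star x) = x"
  by (cases x) auto

lemma word_star_star [simp]: "word_star (word_star w) = w"
  by (simp add: word_star_def rev_map o_def)

text \<open>\<open>word_star\<close> is an involution, so at most one monomial contributes to a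
  given coefficient of the adjoint.\<close>

lemma nc_star_eq_lookup:
  assumes "nc_star P = P"
  shows "Poly_Mapping.lookup P (word_star w) = cnj (Poly_Mapping.lookup P w)"
proof -
  have "Poly_Mapping.lookup P (word_star w) = Poly_Mapping.lookup (nc_star P) (word_star w)" using assms by simp
  also have "\<dots> = (\<Sum>v\<in>Poly_Mapping.keys P. cnj (Poly_Mapping.lookup P v) when word_star v = word_star w)"
    unfolding nc_star_def by (simp add: lookup_sum lookup_single word_star_def)
  also have "\<dots> = (\<Sum>v\<in>Poly_Mapping.keys P. if v = w then cnj (Poly_Mapping.lookup P w) else 0)"
  proof (rule sum.cong[OF refl])
    fix v
    have "word_star v = word_star w \<longleftrightarrow> v = w" by (metis word_star_star)
    then show "(cnj (Poly_Mapping.lookup P v) when word_star v = word_star w) = (if v = w then cnj (Poly_Mapping.lookup P w) else 0)"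
      by (simp add: when_def)
  qed
  also have "\<dots> = cnj (Poly_Mapping.lookup P w)" by (simp add: in_keys_iff)
  finally show ?thesis .
qed

text \<open>Taking the adjoint reverses each word and stars its letters, which permutes the
  monomials and conjugates their coefficients.\<close>

lemma nc_eval_hermitian:
  assumes P: "nc_star P = P" "nc_poly_in k l P"
    and A: "\<And>i. i < k \<Longrightarrow> A i \<in> carrier_mat n n \<and> mat_adjoint (A i) = A i"
    and B: "\<And>j. j < l \<Longrightarrow> B j \<in> carrier_mat n n"
  shows "mat_adjoint (nc_eval n P A B) = nc_eval n P A B"
proof (rule eq_matI)
  let ?ev = "letter_eval A B" and ?K = "Poly_Mapping.keys P" and ?c = "Poly_Mapping.lookup P"
  fix i j assume "i < dim_row (nc_eval n P A B)" "j < dim_col (nc_eval n P A B)"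
  then have ij: "i < n" "j < n" by (auto simp: nc_eval_def)
  have lc: "?ev x \<in> carrier_mat n n \<and> mat_adjoint (?ev x) = ?ev (letter_star x)" if "w \<in> ?K" "x \<in> set w" for w x
  proof -
    have "x \<in> X_var ` {..<k} \<union> {Y_var j s | j s. j < l}" using P(2) that unfolding nc_poly_in_def by blast
    then show ?thesis using A B by auto
  qed
  have wst: "cnj (mat_prod n (map ?ev w) $$ (j, i)) = mat_prod n (map ?ev (word_star w)) $$ (i, j)" if w: "w \<in> ?K" for w
  proof -
    have c: "mat_prod n (map ?ev w) \<in> carrier_mat n n" by (rule mat_prod_carrier) (use lc w in auto)
    have "mat_prod n (map ?ev (word_star w)) = mat_prod n (rev (map mat_adjoint (map ?ev w)))"
      unfolding word_star_def rev_map[symmetric] map_map using lc[OF w] by (intro arg_cong[where f = "\<lambda>xs. mat_prod n (rev xs)"]) auto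
    also have "\<dots> = mat_adjoint (mat_prod n (map ?ev w))"
      by (rule mat_prod_adjoint[symmetric]) (use lc w in auto)
    finally show ?thesis using c ij by simp
  qed
  have bij: "bij_betw word_star ?K ?K"
    by (rule bij_betwI[of _ _ _ word_star]) (auto simp: in_keys_iff nc_star_eq_lookup[OF P(1)])
  have "mat_adjoint (nc_eval n P A B) $$ (i, j) = (\<Sum>w\<in>?K. cnj (?c w) * cnj (mat_prod n (map ?ev w) $$ (j, i)))"
    using ij by (simp add: nc_eval_def)
  also have "\<dots> = (\<Sum>w\<in>?K. ?c (word_star w) * (mat_prod n (map ?ev (word_star w)) $$ (i, j)))"
    by (intro sum.cong refl) (simp add: wst nc_star_eq_lookup[OF P(1)])
  also have "\<dots> = (\<Sum>w\<in>?K. ?c w * (mat_prod n (map ?ev w) $$ (i, j)))"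
    by (rule sum.reindex_bij_betw[OF bij])
  also have "\<dots> = nc_eval n P A B $$ (i, j)" using ij by (simp add: nc_eval_def)
  finally show "mat_adjoint (nc_eval n P A B) $$ (i, j) = nc_eval n P A B $$ (i, j)" .
qed (auto simp: nc_eval_def)

text \<open>The constant in front of \<epsilon> depends on the polynomial and on K but not on n, so
  it acts as a Lipschitz constant uniform in the dimension.\<close>

lemma terms_eval_close:
  assumes "K \<ge> 1" "\<epsilon> \<ge> 0"
    and \<rho>: "\<And>c w x. (c, w) \<in> set cs \<Longrightarrow> x \<in> set w \<Longrightarrow>
      op_bounded n K (\<rho> x) \<and> op_bounded n K (\<rho>' x) \<and> op_bounded n \<epsilon> (\<rho> x - \<rho>' x)"
  shows "op_bounded n ((\<Sum>(c, w)\<leftarrow>cs. cmod c * (real (length w) * K ^ length w)) * \<epsilon>)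
     (terms_eval n cs \<rho> - terms_eval n cs \<rho>')"
  using \<rho>
proof (induction cs)
  case Nil
  have "0\<^sub>m n n - 0\<^sub>m n n = (0\<^sub>m n n :: complex mat)" by auto
  then have "op_bounded n 0 (0\<^sub>m n n - 0\<^sub>m n n)" by (simp only: op_bounded_zero)
  then show ?case by (simp add: terms_eval_Nil)
next
  case (Cons cw cs)
  obtain c w where cw: "cw = (c, w)" by (cases cw)
  have evw: "op_bounded n K (\<rho> x) \<and> op_bounded n K (\<rho>' x) \<and> op_bounded n \<epsilon> (\<rho> x - \<rho>' x)" if "x \<in> set w" for x
    using Cons.prems[of c w x] that cw by simp
  have m: "mat_prod n (map \<rho> w) \<in> carrier_mat n n" "mat_prod n (map \<rho>' w) \<in> carrier_mat n n"
    using evw by (auto simp: op_bounded_def intro!: mat_prod_carrier)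
  have "op_bounded n (real (length w) * K ^ length w * \<epsilon>) (mat_prod n (map \<rho> w) - mat_prod n (map \<rho>' w))"
    using op_bounded_diff_prod[of n K \<epsilon> "map \<rho> w" "map \<rho>' w"] assms(1,2) evw
    by (simp add: list_all2_map1 list_all2_map2 list_all2_same)
  from op_bounded_add[OF op_bounded_smult[OF this] Cons.IH]
  have "op_bounded n (cmod c * (real (length w) * K ^ length w * \<epsilon>) + (\<Sum>(c, w)\<leftarrow>cs. cmod c * (real (length w) * K ^ length w)) * \<epsilon>)
    (c \<cdot>\<^sub>m (mat_prod n (map \<rho> w) - mat_prod n (map \<rho>' w)) + (terms_eval n cs \<rho> - terms_eval n cs \<rho>'))"
    using Cons.prems by auto
  moreover have "c \<cdot>\<^sub>m (mat_prod n (map \<rho> w) - mat_prod n (map \<rho>' w)) + (terms_eval n cs \<rho> - terms_eval n cs \<rho>') =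
      terms_eval n (cw # cs) \<rho> - terms_eval n (cw # cs) \<rho>'"
    unfolding cw terms_eval_Cons[OF m(1)] terms_eval_Cons[OF m(2)]
    using m carrier_matD[OF terms_eval_carrier[of n cs \<rho>]] carrier_matD[OF terms_eval_carrier[of n cs \<rho>']]
    by (intro eq_matI) (auto simp: algebra_simps)
  ultimately show ?case by (simp add: cw algebra_simps)
qed

section \<open>Asymptotics of traces of words\<close>

lemma tendsto_mult_diff_zero:
  fixes a a' b b' :: "nat \<Rightarrow> complex"
  assumes "(\<lambda>n. a n - a' n) \<longlonglongrightarrow> 0" "(\<lambda>n. b n - b' n) \<longlonglongrightarrow> 0" "Bseq a'" "Bseq b'"
  shows "(\<lambda>n. a n * b n - a' n * b' n) \<longlonglongrightarrow> 0"
proof -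
  have z: "Zfun (\<lambda>n. a n - a' n) sequentially" "Zfun (\<lambda>n. b n - b' n) sequentially"
    using assms by (auto simp: tendsto_Zfun_iff)
  have "Zfun (\<lambda>n. (a n - a' n) * (b n - b' n) + (a n - a' n) * b' n + a' n * (b n - b' n)) sequentially"
    by (intro Zfun_add bounded_bilinear.Zfun[OF bounded_bilinear_mult]
      bounded_bilinear.Zfun_prod_Bfun[OF bounded_bilinear_mult]
      bounded_bilinear.Bfun_prod_Zfun[OF bounded_bilinear_mult] z assms(3,4))
  then show ?thesis by (simp add: tendsto_Zfun_iff algebra_simps)
qed

lemma tendsto_bounded_mult_zero:
  fixes a g :: "nat \<Rightarrow> complex"
  assumes "\<And>n. cmod (g n) \<le> C" "a \<longlonglongrightarrow> 0"
  shows "(\<lambda>n. g n * a n) \<longlonglongrightarrow> 0"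
proof (rule Lim_null_comparison)
  show "\<forall>\<^sub>F n in sequentially. norm (g n * a n) \<le> C * cmod (a n)"
    using assms(1) by (auto simp: norm_mult intro!: always_eventually mult_right_mono)
  show "(\<lambda>n. C * cmod (a n)) \<longlonglongrightarrow> 0"
    using tendsto_mult_right_zero[OF tendsto_norm_zero[OF assms(2)]] by simp
qed

lemma Bseq_sum:
  fixes f :: "'i \<Rightarrow> nat \<Rightarrow> complex"
  assumes "\<And>i. i \<in> I \<Longrightarrow> Bseq (f i)"
  shows "Bseq (\<lambda>n. \<Sum>i\<in>I. f i n)"
proof -
  have "\<forall>i\<in>I. \<exists>K. \<forall>n. norm (f i n) \<le> K"
    using assms unfolding Bseq_def by blast
  from bchoice[OF this] obtain K where K: "\<And>i n. i \<in> I \<Longrightarrow> norm (f i n) \<le> K i" by blast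
  show ?thesis by (rule BseqI'[of _ "\<Sum>i\<in>I. K i"]) (auto intro!: sum_norm_le K)
qed

section \<open>Words as cyclic sequences of blocks\<close>

abbreviation Y_word :: "nat \<Rightarrow> letter list \<Rightarrow> bool" where
  "Y_word l y \<equiv> set y \<subseteq> {Y_var j s | j s. j < l}"

text \<open>A pair (i, y) stands for x_i followed by a word y in the other variables, possibly
  empty. Every word containing an x has this form up to rotation.\<close>

definition word_of :: "(nat \<times> letter list) list \<Rightarrow> letter list" where
  "word_of ps = concat (map (\<lambda>(i, y). X_var i # y) ps)"

lemma word_of_simps [simp]: "word_of [] = []" "word_of ((i, y) # ps) = X_var i # y @ word_of ps"
  by (simp_all add: word_of_def)

definition block_word :: "nat \<Rightarrow> nat \<Rightarrow> (nat \<times> letter list) list \<Rightarrow> bool" where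
  "block_word k l ps \<longleftrightarrow> (\<forall>(i, y)\<in>set ps. i < k \<and> Y_word l y)"

lemma split_word:
  assumes "set w \<subseteq> X_var ` {..<k} \<union> {Y_var j s | j s. j < l}"
  shows "\<exists>y ps. w = y @ word_of ps \<and> Y_word l y \<and> block_word k l ps"
  using assms
proof (induction w)
  case Nil
  then show ?case by (intro exI[of _ "[]"]) (auto simp: block_word_def)
next
  case (Cons x w)
  then obtain y ps where *: "w = y @ word_of ps" "Y_word l y" "block_word k l ps" by auto
  show ?case
  proof (cases x)
    case (X_var i)
    then show ?thesis using * Cons.prems
      by (intro exI[of _ "[]"] exI[of _ "(i, y) # ps"]) (auto simp: block_word_def)
  next
    case (Y_var j s)
    then show ?thesis using * Cons.prems
      by (intro exI[of _ "x # y"] exI[of _ ps]) auto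
  qed
qed

text \<open>The part before the first x is moved to the end by cyclicity of the trace and merged
  into the last block. The blocks are found before n and \<rho> are given, so one choice serves all
  of them.\<close>

lemma rotate_word:
  assumes w: "set w \<subseteq> X_var ` {..<k} \<union> {Y_var j s | j s. j < l}" and X: "\<exists>i. X_var i \<in> set w"
  shows "\<exists>ps. ps \<noteq> [] \<and> block_word k l ps \<and>
    (\<forall>n \<rho>. (\<forall>x\<in>set w. \<rho> x \<in> carrier_mat n n) \<longrightarrow>
       mat_trace (mat_prod n (map \<rho> w)) = mat_trace (mat_prod n (map \<rho> (word_of ps))))"
proof -
  obtain y ps where *: "w = y @ word_of ps" "Y_word l y" "block_word k l ps" using split_word[OF w] by blast
  have "ps \<noteq> []" using X * by auto
  obtain qs where qs: "word_of ps @ y = word_of qs" "qs \<noteq> []" "block_word k l qs"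
  proof -
    define i z where "i = fst (last ps)" and "z = snd (last ps)"
    have ps: "ps = butlast ps @ [(i, z)]" using \<open>ps \<noteq> []\<close> by (simp add: i_def z_def)
    have "word_of ps @ y = word_of (butlast ps @ [(i, z @ y)])"
      by (subst ps) (simp add: word_of_def)
    moreover have "block_word k l (butlast ps @ [(i, z @ y)])"
      using *(2,3) by (subst (asm) ps) (auto simp: block_word_def)
    ultimately show ?thesis using that by blast
  qed
  have "mat_trace (mat_prod n (map \<rho> w)) = mat_trace (mat_prod n (map \<rho> (word_of qs)))"
    if \<rho>: "\<forall>x\<in>set w. \<rho> x \<in> carrier_mat n n" for n \<rho>
  proof -
    have c: "mat_prod n (map \<rho> y) \<in> carrier_mat n n" "mat_prod n (map \<rho> (word_of ps)) \<in> carrier_mat n n"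
      using \<rho> *(1) by (auto intro!: mat_prod_carrier)
    have "mat_prod n (map \<rho> w) = mat_prod n (map \<rho> y) * mat_prod n (map \<rho> (word_of ps))"
      unfolding *(1) map_append by (rule mat_prod_append) (use \<rho> *(1) in auto)
    moreover have "mat_prod n (map \<rho> (word_of qs)) = mat_prod n (map \<rho> (word_of ps)) * mat_prod n (map \<rho> y)"
      unfolding qs(1)[symmetric] map_append by (rule mat_prod_append) (use \<rho> *(1) in auto)
    ultimately show ?thesis using mat_trace_comm[OF c] by simp
  qed
  then show ?thesis using qs by blast
qed

definition low_rank :: "nat \<Rightarrow> nat \<Rightarrow> (nat \<Rightarrow> complex) \<Rightarrow> (nat \<Rightarrow> complex Matrix.vec) \<Rightarrow> complex mat" where
  "low_rank n R g u = Matrix.mat n n (\<lambda>(a, b). \<Sum>q<R. g q * u q $ a * cnj (u q $ b))"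

lemma low_rank_carrier [simp]: "low_rank n R g u \<in> carrier_mat n n"
  by (simp add: low_rank_def)

lemma low_rank_form:
  assumes u: "\<And>q. u q \<in> carrier_vec n" and v: "v \<in> carrier_vec n" and w: "w \<in> carrier_vec n"
  shows "(low_rank n R g u *\<^sub>v v) \<bullet>c w = (\<Sum>q<R. g q * (v \<bullet>c u q) * (u q \<bullet>c w))"
proof -
  have "(low_rank n R g u *\<^sub>v v) \<bullet>c w = (\<Sum>a<n. \<Sum>b<n. \<Sum>q<R. g q * u q $ a * cnj (u q $ b) * v $ b * cnj (w $ a))"
    using v w by (simp add: cscalar_prod_conv mult_mat_vec_conv low_rank_def sum_distrib_right del: index_mult_mat_vec)
  also have "\<dots> = (\<Sum>a<n. \<Sum>q<R. \<Sum>b<n. g q * u q $ a * cnj (u q $ b) * v $ b * cnj (w $ a))"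
    by (intro sum.cong refl sum.swap)
  also have "\<dots> = (\<Sum>q<R. \<Sum>a<n. \<Sum>b<n. g q * u q $ a * cnj (u q $ b) * v $ b * cnj (w $ a))"
    by (rule sum.swap)
  also have "\<dots> = (\<Sum>q<R. g q * ((u q \<bullet>c w) * (v \<bullet>c u q)))"
    using w by (intro sum.cong refl) (simp add: cscalar_prod_conv sum_product sum_distrib_left mult_ac carrier_vecD[OF u])
  finally show ?thesis by (simp only: mult_ac)
qed

lemma low_rank_form_left:
  assumes u: "\<And>q. u q \<in> carrier_vec n" and v: "v \<in> carrier_vec n" and w: "w \<in> carrier_vec n" and A: "A \<in> carrier_mat n n"
  shows "(A *\<^sub>v (low_rank n R g u *\<^sub>v v)) \<bullet>c w = (\<Sum>q<R. g q * (v \<bullet>c u q) * ((A *\<^sub>v u q) \<bullet>c w))"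
proof -
  have Aw: "mat_adjoint A *\<^sub>v w \<in> carrier_vec n" using mat_adjoint_carrier[OF A] w by (rule mult_mat_vec_carrier)
  have "(A *\<^sub>v (low_rank n R g u *\<^sub>v v)) \<bullet>c w = (low_rank n R g u *\<^sub>v v) \<bullet>c (mat_adjoint A *\<^sub>v w)"
    by (rule cscalar_prod_adjoint[OF A mult_mat_vec_carrier[OF low_rank_carrier v] w])
  then show ?thesis
    unfolding low_rank_form[OF u v Aw] by (simp only: cscalar_prod_adjoint[OF A u w])
qed

lemma mat_trace_low_rank:
  assumes u: "\<And>q. u q \<in> carrier_vec n" and Z: "Z \<in> carrier_mat n n"
  shows "mat_trace (low_rank n R g u * Z) = (\<Sum>q<R. g q * ((Z *\<^sub>v u q) \<bullet>c u q))"
proof -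
  have "mat_trace (low_rank n R g u * Z) = (\<Sum>a<n. \<Sum>b<n. low_rank n R g u $$ (a, b) * Z $$ (b, a))"
    using Z by (simp add: mat_trace_carrier[OF mult_carrier_mat[OF low_rank_carrier Z]] mult_mat_conv[OF low_rank_carrier Z] del: index_mult_mat)
  also have "\<dots> = (\<Sum>a<n. \<Sum>b<n. \<Sum>q<R. g q * u q $ a * cnj (u q $ b) * Z $$ (b, a))"
    by (simp add: low_rank_def sum_distrib_right)
  also have "\<dots> = (\<Sum>a<n. \<Sum>q<R. \<Sum>b<n. g q * u q $ a * cnj (u q $ b) * Z $$ (b, a))"
    by (intro sum.cong refl sum.swap)
  also have "\<dots> = (\<Sum>q<R. \<Sum>a<n. \<Sum>b<n. g q * u q $ a * cnj (u q $ b) * Z $$ (b, a))"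
    by (rule sum.swap)
  also have "\<dots> = (\<Sum>q<R. \<Sum>b<n. \<Sum>a<n. g q * u q $ a * cnj (u q $ b) * Z $$ (b, a))"
    by (intro sum.cong refl sum.swap)
  also have "\<dots> = (\<Sum>q<R. g q * ((Z *\<^sub>v u q) \<bullet>c u q))"
    using Z by (intro sum.cong refl)
      (simp add: cscalar_prod_conv mult_mat_vec_conv carrier_vecD[OF u] sum_distrib_left sum_distrib_right mult_ac del: index_mult_mat_vec)
  finally show ?thesis .
qed

text \<open>The deterministic core, at one sample point and one threshold; all randomness is
  contained in \<open>form\<close>. The number R does not depend on n, which permits passing to the
  limit term by term in the sums over q.\<close>

locale word_limit =
  fixes R k l :: nat and g :: "nat \<Rightarrow> nat \<Rightarrow> nat \<Rightarrow> complex" and u :: "nat \<Rightarrow> nat \<Rightarrow> nat \<Rightarrow> complex Matrix.vec"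
    and Y :: "nat \<Rightarrow> nat \<Rightarrow> complex mat" and t :: "letter list \<Rightarrow> nat \<Rightarrow> complex"
    and t_lim :: "letter list \<Rightarrow> complex" and c_lim :: "nat list \<Rightarrow> complex" and C :: real
    and F :: "nat \<Rightarrow> nat \<Rightarrow> complex mat" and \<rho> :: "nat \<Rightarrow> letter \<Rightarrow> complex mat"
  assumes u: "\<And>n i q. u n i q \<in> carrier_vec n" "\<And>n i q. vec_l2norm (u n i q) \<le> 1"
    and g: "\<And>n i q. cmod (g n i q) \<le> C"
    and F: "\<And>n i. F n i = low_rank n R (g n i) (u n i)"
    and Y: "\<And>n j. j < l \<Longrightarrow> Y n j \<in> carrier_mat n n"
    and \<rho>: "\<And>n. \<rho> n = letter_eval (F n) (Y n)"
    and form: "\<And>y i q i' q'. Y_word l y \<Longrightarrow> i < k \<Longrightarrow> q < R \<Longrightarrow> i' < k \<Longrightarrow> q' < R \<Longrightarrow>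
      (\<lambda>n. (mat_prod n (map (\<rho> n) y) *\<^sub>v u n i q) \<bullet>c u n i' q' - t y n * (u n i q \<bullet>c u n i' q')) \<longlonglongrightarrow> 0"
    and t: "\<And>y. Y_word l y \<Longrightarrow> t y \<longlonglongrightarrow> t_lim y"
    and trF: "\<And>is. is \<noteq> [] \<Longrightarrow> set is \<subseteq> {..<k} \<Longrightarrow> (\<lambda>n. mat_trace (mat_prod n (map (F n) is))) \<longlonglongrightarrow> c_lim is"
begin

definition tprod :: "nat \<Rightarrow> (nat \<times> letter list) list \<Rightarrow> complex" where
  "tprod n ps = (\<Prod>p\<leftarrow>ps. t (snd p) n)"

lemma F_carrier: "F n i \<in> carrier_mat n n"
  by (simp add: F)

lemma N_carrier: "mat_prod n (map (F n) is) \<in> carrier_mat n n"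
  by (rule mat_prod_carrier) (auto simp: F_carrier)

lemma \<rho>_carrier:
  assumes "Y_word l y" "x \<in> set y"
  shows "\<rho> n x \<in> carrier_mat n n"
proof -
  obtain j s where "x = Y_var j s" "j < l" using assms by blast
  then show ?thesis by (simp add: \<rho> Y)
qed

lemma Y_word_carrier: "Y_word l y \<Longrightarrow> mat_prod n (map (\<rho> n) y) \<in> carrier_mat n n"
  by (rule mat_prod_carrier) (use \<rho>_carrier in auto)

lemma block_carrier:
  assumes "block_word k l ps" "x \<in> set (word_of ps)"
  shows "\<rho> n x \<in> carrier_mat n n"
proof -
  obtain i y where iy: "(i, y) \<in> set ps" "x = X_var i \<or> x \<in> set y" using assms(2) by (auto simp: word_of_def)
  then have "Y_word l y" using assms(1) unfolding block_word_def by blast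
  then show ?thesis using iy(2) \<rho>_carrier[of y x n] by (auto simp: \<rho> F_carrier)
qed

lemma block_prod_carrier: "block_word k l ps \<Longrightarrow> mat_prod n (map (\<rho> n) (word_of ps)) \<in> carrier_mat n n"
  by (rule mat_prod_carrier) (use block_carrier in auto)

lemma block_prod_Cons:
  assumes "block_word k l ((i, y) # ps)"
  shows "mat_prod n (map (\<rho> n) (word_of ((i, y) # ps))) =
    F n i * (mat_prod n (map (\<rho> n) y) * mat_prod n (map (\<rho> n) (word_of ps)))"
proof -
  have yp: "Y_word l y" "block_word k l ps" using assms by (auto simp: block_word_def)
  have "mat_prod n (map (\<rho> n) y @ map (\<rho> n) (word_of ps)) = mat_prod n (map (\<rho> n) y) * mat_prod n (map (\<rho> n) (word_of ps))"
    using \<rho>_carrier[OF yp(1)] block_carrier[OF yp(2)] by (intro mat_prod_append) auto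
  then show ?thesis by (simp add: \<rho>)
qed

text \<open>Induction on the blocks. Expanding the leftmost F in its rank-one terms gives the same
  recursion for the mixed word and for the word in the F alone, with each y replaced by its trace.
  Differences of products are controlled only for bounded factors, so boundedness is part of the
  induction; y and the left vector vary, the right vector stays.\<close>

lemma word_form_limit:
  assumes "block_word k l ps" "Y_word l y" "i < k" "q < R" "i' < k" "q' < R"
  shows "(\<lambda>n. ((mat_prod n (map (\<rho> n) y) * mat_prod n (map (\<rho> n) (word_of ps))) *\<^sub>v u n i q) \<bullet>c u n i' q'
      - t y n * tprod n ps * ((mat_prod n (map (F n) (map fst ps)) *\<^sub>v u n i q) \<bullet>c u n i' q')) \<longlonglongrightarrow> 0 \<and>
    Bseq (\<lambda>n. t y n * tprod n ps * ((mat_prod n (map (F n) (map fst ps)) *\<^sub>v u n i q) \<bullet>c u n i' q'))"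
  using assms
proof (induction ps arbitrary: y i' q')
  case Nil
  have Bt: "Bseq (t y)" using t[OF Nil.prems(2)] by (intro convergent_imp_Bseq convergentI)
  have Bu: "Bseq (\<lambda>n. u n i q \<bullet>c u n i' q')"
  proof (rule BseqI')
    fix n
    have "cmod (u n i q \<bullet>c u n i' q') \<le> vec_l2norm (u n i q) * vec_l2norm (u n i' q')" by (rule cscalar_prod_bound[OF u(1) u(1)])
    also have "\<dots> \<le> 1 * 1" by (intro mult_mono u) auto
    finally show "norm (u n i q \<bullet>c u n i' q') \<le> 1" by simp
  qed
  have e: "mat_prod n (map (\<rho> n) y) * 1\<^sub>m n = mat_prod n (map (\<rho> n) y)" "1\<^sub>m n *\<^sub>v u n i q = u n i q" for n
    using right_mult_one_mat[OF Y_word_carrier[OF Nil.prems(2)]] one_mult_mat_vec[OF u(1)] by auto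
  show ?case
    using form[OF Nil.prems(2-6)] Bseq_mult[OF Bt Bu] by (simp add: e tprod_def)
next
  case (Cons p ps)
  obtain j z where p: "p = (j, z)" by (cases p)
  have bw: "j < k" "Y_word l z" "block_word k l ps" using Cons.prems(1) by (auto simp: p block_word_def)
  let ?e = "\<lambda>y n. mat_prod n (map (\<rho> n) y)"
  let ?Z = "\<lambda>n. mat_prod n (map (\<rho> n) (word_of ps))"
  let ?N = "\<lambda>n. mat_prod n (map (F n) (map fst ps))"
  define \<alpha> where "\<alpha> r n = ((?e z n * ?Z n) *\<^sub>v u n i q) \<bullet>c u n j r" for r n
  define \<alpha>' where "\<alpha>' r n = t z n * tprod n ps * ((?N n *\<^sub>v u n i q) \<bullet>c u n j r)" for r n
  define \<beta> where "\<beta> r n = (?e y n *\<^sub>v u n j r) \<bullet>c u n i' q'" for r n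
  define \<beta>' where "\<beta>' r n = t y n * (u n j r \<bullet>c u n i' q')" for r n
  have \<alpha>: "(\<lambda>n. \<alpha> r n - \<alpha>' r n) \<longlonglongrightarrow> 0" "Bseq (\<alpha>' r)" if "r < R" for r
    using Cons.IH[OF bw(3,2) Cons.prems(3,4) bw(1) that] by (auto simp: \<alpha>_def [abs_def] \<alpha>'_def [abs_def])
  have \<beta>: "(\<lambda>n. \<beta> r n - \<beta>' r n) \<longlonglongrightarrow> 0" if "r < R" for r
    unfolding \<beta>_def \<beta>'_def using form[OF Cons.prems(2) bw(1) that Cons.prems(5,6)] .
  have B\<beta>: "Bseq (\<beta>' r)" for r
  proof -
    have "Bseq (t y)" using t[OF Cons.prems(2)] by (intro convergent_imp_Bseq convergentI)
    moreover have "Bseq (\<lambda>n. u n j r \<bullet>c u n i' q')"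
    proof (rule BseqI')
      fix n
      have "cmod (u n j r \<bullet>c u n i' q') \<le> vec_l2norm (u n j r) * vec_l2norm (u n i' q')" by (rule cscalar_prod_bound[OF u(1) u(1)])
      also have "\<dots> \<le> 1 * 1" by (intro mult_mono u) auto
      finally show "norm (u n j r \<bullet>c u n i' q') \<le> 1" by simp
    qed
    ultimately show ?thesis unfolding \<beta>'_def by (rule Bseq_mult)
  qed
  \<comment> \<open>Each rank-one term cuts the word in two: \<beta> is the form of y, and \<alpha>
    the form of the shorter word, to which the induction hypothesis applies.\<close>
  have 1: "((?e y n * mat_prod n (map (\<rho> n) (word_of (p # ps)))) *\<^sub>v u n i q) \<bullet>c u n i' q' = (\<Sum>r<R. g n j r * (\<alpha> r n * \<beta> r n))" for n
  proof -
    have c: "?e y n \<in> carrier_mat n n" "?e z n * ?Z n \<in> carrier_mat n n"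
      using Y_word_carrier[OF Cons.prems(2)] mult_carrier_mat[OF Y_word_carrier[OF bw(2)] block_prod_carrier[OF bw(3)]] by auto
    have v: "(?e z n * ?Z n) *\<^sub>v u n i q \<in> carrier_vec n" by (rule mult_mat_vec_carrier[OF c(2) u(1)])
    have "(?e y n * mat_prod n (map (\<rho> n) (word_of (p # ps)))) *\<^sub>v u n i q = ?e y n *\<^sub>v (F n j *\<^sub>v ((?e z n * ?Z n) *\<^sub>v u n i q))"
      unfolding p block_prod_Cons[OF Cons.prems(1)[unfolded p]]
      by (simp only: assoc_mult_mat_vec[OF c(1) mult_carrier_mat[OF F_carrier c(2)] u(1)] assoc_mult_mat_vec[OF F_carrier c(2) u(1)])
    then show ?thesis
      by (simp only: F low_rank_form_left[OF u(1) v u(1) c(1)] \<alpha>_def \<beta>_def mult.assoc)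
  qed
  have 2: "t y n * tprod n (p # ps) * ((mat_prod n (map (F n) (map fst (p # ps))) *\<^sub>v u n i q) \<bullet>c u n i' q') = (\<Sum>r<R. g n j r * (\<alpha>' r n * \<beta>' r n))" for n
  proof -
    have v: "?N n *\<^sub>v u n i q \<in> carrier_vec n" by (rule mult_mat_vec_carrier[OF N_carrier u(1)])
    have "mat_prod n (map (F n) (map fst (p # ps))) *\<^sub>v u n i q = F n j *\<^sub>v (?N n *\<^sub>v u n i q)"
      using assoc_mult_mat_vec[OF F_carrier N_carrier[of n "map fst ps"] u(1)] by (simp add: p)
    then have "(mat_prod n (map (F n) (map fst (p # ps))) *\<^sub>v u n i q) \<bullet>c u n i' q' =
        (\<Sum>r<R. g n j r * ((?N n *\<^sub>v u n i q) \<bullet>c u n j r) * (u n j r \<bullet>c u n i' q'))"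
      by (simp only: F low_rank_form[OF u(1) v u(1)])
    then show ?thesis
      by (simp add: sum_distrib_left \<alpha>'_def \<beta>'_def tprod_def p mult_ac)
  qed
  have "(\<lambda>n. \<Sum>r<R. g n j r * (\<alpha> r n * \<beta> r n - \<alpha>' r n * \<beta>' r n)) \<longlonglongrightarrow> (\<Sum>r<R. 0)"
    by (intro tendsto_sum tendsto_bounded_mult_zero[OF g] tendsto_mult_diff_zero \<alpha> \<beta> B\<beta>) auto
  then have "(\<lambda>n. (\<Sum>r<R. g n j r * (\<alpha> r n * \<beta> r n)) - (\<Sum>r<R. g n j r * (\<alpha>' r n * \<beta>' r n))) \<longlonglongrightarrow> 0"
    by (simp add: sum_subtractf right_diff_distrib)
  moreover have "Bseq (\<lambda>n. \<Sum>r<R. g n j r * (\<alpha>' r n * \<beta>' r n))"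
  proof -
    have gB: "Bseq (\<lambda>n. g n j r)" for r by (rule BseqI'[OF g])
    have "Bseq (\<lambda>n. g n j r * (\<alpha>' r n * \<beta>' r n))" if "r < R" for r
      using that by (intro Bseq_mult gB \<alpha>(2) B\<beta>)
    then show ?thesis by (intro Bseq_sum) auto
  qed
  ultimately show ?case unfolding 1 2 by blast
qed

text \<open>Expanding the first F turns the trace into finitely many forms. After replacing these by
  their asymptotics, the same expansion read backwards restores a trace of F's, whose limit is
  known.\<close>

lemma word_trace_limit:
  assumes "block_word k l ps" "ps \<noteq> []"
  shows "(\<lambda>n. mat_trace (mat_prod n (map (\<rho> n) (word_of ps)))) \<longlonglongrightarrow> (\<Prod>p\<leftarrow>ps. t_lim (snd p)) * c_lim (map fst ps)"
proof -
  obtain i y qs where ps: "ps = (i, y) # qs" using assms(2) by (cases ps) auto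
  have bw: "i < k" "Y_word l y" "block_word k l qs" using assms(1) by (auto simp: ps block_word_def)
  let ?N = "\<lambda>n. mat_prod n (map (F n) (map fst qs))"
  let ?Q = "\<lambda>n. mat_prod n (map (\<rho> n) y) * mat_prod n (map (\<rho> n) (word_of qs))"
  have 1: "mat_trace (mat_prod n (map (\<rho> n) (word_of ps))) = (\<Sum>q<R. g n i q * ((?Q n *\<^sub>v u n i q) \<bullet>c u n i q))" for n
    unfolding ps block_prod_Cons[OF assms(1)[unfolded ps]] F
    by (rule mat_trace_low_rank[OF u(1) mult_carrier_mat[OF Y_word_carrier[OF bw(2)] block_prod_carrier[OF bw(3)]]])
  have 2: "tprod n ps * mat_trace (mat_prod n (map (F n) (map fst ps))) =
      (\<Sum>q<R. g n i q * (t y n * tprod n qs * ((?N n *\<^sub>v u n i q) \<bullet>c u n i q)))" for n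
  proof -
    have "mat_trace (mat_prod n (map (F n) (map fst ps))) = (\<Sum>q<R. g n i q * ((?N n *\<^sub>v u n i q) \<bullet>c u n i q))"
      using mat_trace_low_rank[OF u(1)[of n i] N_carrier[of n "map fst qs"], where R = R and g = "g n i"] by (simp add: ps F)
    then show ?thesis by (simp add: sum_distrib_left ps tprod_def mult_ac)
  qed
  have "(\<lambda>n. \<Sum>q<R. g n i q * (((?Q n *\<^sub>v u n i q) \<bullet>c u n i q) - t y n * tprod n qs * ((?N n *\<^sub>v u n i q) \<bullet>c u n i q))) \<longlonglongrightarrow> (\<Sum>q<R. 0)"
    using word_form_limit[OF bw(3,2,1) _ bw(1)] by (intro tendsto_sum tendsto_bounded_mult_zero[OF g]) auto
  then have diff: "(\<lambda>n. mat_trace (mat_prod n (map (\<rho> n) (word_of ps))) - tprod n ps * mat_trace (mat_prod n (map (F n) (map fst ps)))) \<longlonglongrightarrow> 0"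
    unfolding 1 2 by (simp add: sum_subtractf right_diff_distrib)
  have "(\<lambda>n. tprod n rs) \<longlonglongrightarrow> (\<Prod>p\<leftarrow>rs. t_lim (snd p))" if "block_word k l rs" for rs
    using that
  proof (induction rs)
    case (Cons r rs)
    then have "Y_word l (snd r)" "block_word k l rs" by (auto simp: block_word_def)
    then show ?case using tendsto_mult[OF t Cons.IH] by (simp add: tprod_def)
  qed (simp add: tprod_def)
  moreover have "set (map fst ps) \<subseteq> {..<k}" using assms(1) by (auto simp: block_word_def)
  ultimately have "(\<lambda>n. tprod n ps * mat_trace (mat_prod n (map (F n) (map fst ps)))) \<longlonglongrightarrow> (\<Prod>p\<leftarrow>ps. t_lim (snd p)) * c_lim (map fst ps)"
    using assms by (intro tendsto_mult trF) auto
  from tendsto_add[OF diff this] show ?thesis by simp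
qed

end

section \<open>Compact limits and truncation\<close>

text \<open>A unit eigenvector for t is sent to a vector of norm |t| inside the relatively compact,
  hence bounded, image of the unit ball.\<close>

lemma selfadjoint_compact_eigenvalue_bound:
  fixes a :: "'h::complex_hilbert \<Rightarrow> 'h"
  assumes "selfadjoint_compact a"
  shows "\<exists>K. \<forall>t. eigenspace a t \<noteq> {0} \<longrightarrow> \<bar>t\<bar> \<le> K"
proof -
  have lin: "Vector_Spaces.linear scaleC scaleC a" and cpt: "compact (closure (a ` cball 0 1))"
    using assms by (auto simp: selfadjoint_compact_def)
  interpret a: Vector_Spaces.linear scaleC scaleC a by (rule lin)
  obtain K where K: "\<And>y. y \<in> closure (a ` cball 0 1) \<Longrightarrow> norm y \<le> K"
    using compact_imp_bounded[OF cpt] unfolding bounded_iff by blast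
  have "\<bar>t\<bar> \<le> K" if t: "eigenspace a t \<noteq> {0}" for t
  proof -
    have "0 \<in> eigenspace a t" by (simp add: eigenspace_def a.zero)
    then have "\<exists>x\<in>eigenspace a t. x \<noteq> 0" using t by blast
    then obtain x where x: "x \<noteq> 0" "a x = t *\<^sub>R x" by (auto simp: eigenspace_def)
    define y where "y = (1 / norm x) *\<^sub>R x"
    have "norm y = 1" using x by (simp add: y_def)
    moreover have "a y = t *\<^sub>R y"
      unfolding y_def scaleR_scaleC[of "1 / norm x"] a.scale x(2) by (simp add: scaleR_scaleC scaleC_scaleC mult.commute)
    moreover have "norm (a y) \<le> K"
      by (rule K, rule subsetD[OF closure_subset]) (use \<open>norm y = 1\<close> in auto)
    ultimately show ?thesis by simp
  qed
  then show ?thesis by blast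
qed

text \<open>Used with test functions supported beyond the spectrum of the limit. All other traces of
  the limit operators enter only as values of limits.\<close>

lemma op_trace_op_fun_eq_0:
  fixes a :: "'h::complex_hilbert \<Rightarrow> 'h"
  assumes "\<And>t. eigenspace a t \<noteq> {0} \<Longrightarrow> f t = 0"
  shows "op_trace (foldr (\<circ>) (map (\<lambda>i. op_fun f a) [i]) id) = 0"
proof -
  have "op_fun f a x = 0" for x
    unfolding op_fun_def by (rule infsum_0) (use assms in auto)
  moreover have "cinner e 0 = 0" for e :: 'h
    using cinner_scaleC_right[of e 0 0] by simp
  ultimately show ?thesis by (simp add: op_trace_def o_def)
qed

text \<open>The part of t outside [-\<epsilon>, \<epsilon>], shifted towards 0, which is continuous
  and vanishes near 0. The outer clipping to [-K, K] provides the boundedness demanded by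
  \<open>C0b\<close> and does not act when |t| is at most K.\<close>

definition soft_threshold :: "real \<Rightarrow> real \<Rightarrow> real \<Rightarrow> real" where
  "soft_threshold K \<epsilon> t = max (- K) (min K (t - max (- \<epsilon>) (min \<epsilon> t)))"

lemma soft_threshold_C0b:
  assumes "K \<ge> 0" "\<epsilon> > 0"
  shows "soft_threshold K \<epsilon> \<in> C0b"
  unfolding C0b_def
proof (intro CollectI conjI)
  show "continuous_on UNIV (soft_threshold K \<epsilon>)"
    unfolding soft_threshold_def by (intro continuous_intros)
  show "bounded (range (soft_threshold K \<epsilon>))"
    unfolding bounded_iff using assms by (intro exI[of _ K]) (auto simp: soft_threshold_def)
  show "\<exists>\<delta>>0. \<forall>t. \<bar>t\<bar> < \<delta> \<longrightarrow> soft_threshold K \<epsilon> t = 0"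
    using assms by (intro exI[of _ \<epsilon>]) (auto simp: soft_threshold_def)
qed

lemma soft_threshold_bounds:
  assumes "K \<ge> 0" "\<epsilon> > 0"
  shows "\<bar>soft_threshold K \<epsilon> t\<bar> \<le> K" "\<bar>t\<bar> \<le> \<epsilon> \<Longrightarrow> soft_threshold K \<epsilon> t = 0"
    "\<bar>t\<bar> \<le> K \<Longrightarrow> \<bar>t - soft_threshold K \<epsilon> t\<bar> \<le> \<epsilon>"
  using assms by (auto simp: soft_threshold_def max_def min_def abs_if)

section \<open>Functions of diagonalised matrices as low-rank sums\<close>

lemma op_bounded_diag_conj:
  assumes V: "V \<in> unitary_group n" and d: "\<And>i. i < n \<Longrightarrow> \<bar>d i\<bar> \<le> C" and C: "C \<ge> 0"
  shows "op_bounded n C (V * mat_diag n (\<lambda>i. complex_of_real (d i)) * mat_adjoint V)"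
proof -
  let ?D = "mat_diag n (\<lambda>i. complex_of_real (d i))"
  have "op_bounded n C ?D"
    unfolding op_bounded_def
  proof (intro conjI ballI C)
    fix v :: "complex Matrix.vec" assume v: "v \<in> carrier_vec n"
    have "vec_l2norm (?D *\<^sub>v v) \<le> L2_set (\<lambda>i. C * cmod (v $ i)) {..<n}"
      unfolding mult_mat_diag_vec[OF v] vec_l2norm_L2 using d
      by (auto simp: norm_mult intro!: L2_set_mono mult_right_mono)
    also have "\<dots> = C * vec_l2norm v" using v C by (simp add: vec_l2norm_L2 L2_set_right_distrib)
    finally show "vec_l2norm (?D *\<^sub>v v) \<le> C * vec_l2norm v" .
  qed simp
  from op_bounded_mult[OF op_bounded_mult[OF op_bounded_unitary[OF V] this] op_bounded_unitary[OF unitary_group_adjoint[OF V]]]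
  show ?thesis by simp
qed

lemma diag_conj_diff:
  assumes V: "V \<in> unitary_group n"
  shows "V * mat_diag n (\<lambda>i. complex_of_real (d i)) * mat_adjoint V - V * mat_diag n (\<lambda>i. complex_of_real (e i)) * mat_adjoint V
    = V * mat_diag n (\<lambda>i. complex_of_real (d i - e i)) * mat_adjoint V"
proof -
  note VD = unitary_groupD[OF V]
  have D: "mat_diag n f \<in> carrier_mat n n" for f :: "nat \<Rightarrow> complex" by simp
  have "mat_diag n (\<lambda>i. complex_of_real (d i - e i)) = mat_diag n (\<lambda>i. complex_of_real (d i)) - mat_diag n (\<lambda>i. complex_of_real (e i))"
    by (intro eq_matI) (auto simp: mat_diag_def)
  then show ?thesis
    by (simp only: mult_minus_distrib_mat[OF VD(1) D D] minus_mult_distrib_mat[OF mult_carrier_mat[OF VD(1) D] mult_carrier_mat[OF VD(1) D] VD(2)])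
qed

lemma diag_conj_index:
  assumes V: "V \<in> unitary_group n" and ab: "a < n" "b < n"
  shows "(V * mat_diag n f * mat_adjoint V) $$ (a, b) = (\<Sum>j<n. f j * V $$ (a, j) * cnj (V $$ (b, j)))"
proof -
  note VD = unitary_groupD[OF V]
  have "V * mat_diag n f = Matrix.mat n n (\<lambda>(i, j). V $$ (i, j) * f j)" by (rule mat_diag_mult_right[OF VD(1)])
  then have "(V * mat_diag n f * mat_adjoint V) $$ (a, b) = (\<Sum>j<n. Matrix.mat n n (\<lambda>(i, j). V $$ (i, j) * f j) $$ (a, j) * mat_adjoint V $$ (j, b))"
    using mult_mat_conv[OF mat_carrier VD(2) ab, of "\<lambda>(i, j). V $$ (i, j) * f j"] by simp
  also have "\<dots> = (\<Sum>j<n. f j * V $$ (a, j) * cnj (V $$ (b, j)))"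
    using VD ab by (intro sum.cong refl) (auto simp: mult_ac)
  finally show ?thesis .
qed

definition big_eig :: "nat \<Rightarrow> (nat \<Rightarrow> real) \<Rightarrow> real \<Rightarrow> nat set" where
  "big_eig n d \<epsilon> = {j. j < n \<and> \<epsilon> < \<bar>d j\<bar>}"

text \<open>Eigenvectors for the eigenvalues of modulus above \<epsilon>, listed in increasing index
  order. Padding with zero vectors makes the family total in q and allows any rank bound R from the
  actual number upwards.\<close>

definition big_vec :: "nat \<Rightarrow> complex mat \<Rightarrow> (nat \<Rightarrow> real) \<Rightarrow> real \<Rightarrow> nat \<Rightarrow> complex Matrix.vec" where
  "big_vec n V d \<epsilon> q = (if q < card (big_eig n d \<epsilon>) then col V (sorted_list_of_set (big_eig n d \<epsilon>) ! q) else 0\<^sub>v n)"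

definition big_val :: "nat \<Rightarrow> (real \<Rightarrow> real) \<Rightarrow> (nat \<Rightarrow> real) \<Rightarrow> real \<Rightarrow> nat \<Rightarrow> real" where
  "big_val n f d \<epsilon> q = (if q < card (big_eig n d \<epsilon>) then f (d (sorted_list_of_set (big_eig n d \<epsilon>) ! q)) else 0)"

lemma big_eig_enum:
  "bij_betw (\<lambda>q. sorted_list_of_set (big_eig n d \<epsilon>) ! q) {..<card (big_eig n d \<epsilon>)} (big_eig n d \<epsilon>)"
proof -
  have "finite (big_eig n d \<epsilon>)" by (simp add: big_eig_def)
  then show ?thesis using bij_betw_nth[of "sorted_list_of_set (big_eig n d \<epsilon>)"] by simp
qed

lemma big_vec_carrier:
  assumes V: "V \<in> unitary_group n"
  shows "big_vec n V d \<epsilon> q \<in> carrier_vec n" "vec_l2norm (big_vec n V d \<epsilon> q) \<le> 1"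
proof -
  note VD = unitary_groupD[OF V]
  show "big_vec n V d \<epsilon> q \<in> carrier_vec n" using VD by (auto simp: big_vec_def intro!: carrier_vecI)
  show "vec_l2norm (big_vec n V d \<epsilon> q) \<le> 1"
  proof (cases "q < card (big_eig n d \<epsilon>)")
    case True
    let ?j = "sorted_list_of_set (big_eig n d \<epsilon>) ! q"
    have "?j \<in> big_eig n d \<epsilon>" using bij_betwE[OF big_eig_enum] True by blast
    then have j: "?j < n" by (simp add: big_eig_def)
    have "V *\<^sub>v unit_vec n ?j = col V ?j" using VD j by (intro eq_vecI) auto
    then have "vec_l2norm (col V ?j) = 1"
      using vec_l2norm_unitary[OF V unit_vec_carrier, of ?j] vec_l2norm_unit_vec[OF j] by simp
    then show ?thesis using True by (simp add: big_vec_def)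
  qed (simp add: big_vec_def)
qed

text \<open>f annihilates all eigenvalues outside \<open>big_eig\<close>, so only their rank-one
  terms remain in the spectral sum.\<close>

lemma diag_conj_low_rank:
  assumes V: "V \<in> unitary_group n" and f: "\<And>t. \<bar>t\<bar> \<le> \<epsilon> \<Longrightarrow> f t = 0" and R: "card (big_eig n d \<epsilon>) \<le> R"
  shows "V * mat_diag n (\<lambda>i. complex_of_real (f (d i))) * mat_adjoint V =
    low_rank n R (\<lambda>q. complex_of_real (big_val n f d \<epsilon> q)) (big_vec n V d \<epsilon>)"
proof (rule eq_matI)
  note VD = unitary_groupD[OF V]
  let ?S = "big_eig n d \<epsilon>" and ?e = "\<lambda>q. sorted_list_of_set (big_eig n d \<epsilon>) ! q"
  fix a b assume "a < dim_row (low_rank n R (\<lambda>q. complex_of_real (big_val n f d \<epsilon> q)) (big_vec n V d \<epsilon>))"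
    "b < dim_col (low_rank n R (\<lambda>q. complex_of_real (big_val n f d \<epsilon> q)) (big_vec n V d \<epsilon>))"
  then have ab: "a < n" "b < n" by (auto simp: low_rank_def)
  have e: "?e q < n" if "q < card ?S" for q using bij_betwE[OF big_eig_enum] that by (fastforce simp: big_eig_def)
  have "(V * mat_diag n (\<lambda>i. complex_of_real (f (d i))) * mat_adjoint V) $$ (a, b) =
      (\<Sum>j<n. complex_of_real (f (d j)) * V $$ (a, j) * cnj (V $$ (b, j)))"
    by (rule diag_conj_index[OF V ab])
  also have "\<dots> = (\<Sum>j\<in>?S. complex_of_real (f (d j)) * V $$ (a, j) * cnj (V $$ (b, j)))"
  proof (rule sum.mono_neutral_right)
    have "complex_of_real (f (d j)) = 0" if "j < n" "j \<notin> ?S" for j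
      using f[of "d j"] that by (simp add: big_eig_def)
    then show "\<forall>j\<in>{..<n} - ?S. complex_of_real (f (d j)) * V $$ (a, j) * cnj (V $$ (b, j)) = 0" by simp
  qed (auto simp: big_eig_def)
  also have "\<dots> = (\<Sum>q<card ?S. complex_of_real (f (d (?e q))) * V $$ (a, ?e q) * cnj (V $$ (b, ?e q)))"
    by (rule sum.reindex_bij_betw[OF big_eig_enum, symmetric])
  also have "\<dots> = (\<Sum>q<R. complex_of_real (big_val n f d \<epsilon> q) * big_vec n V d \<epsilon> q $ a * cnj (big_vec n V d \<epsilon> q $ b))"
    using R VD ab e by (intro sum.mono_neutral_cong_left) (auto simp: big_val_def big_vec_def)
  finally show "(V * mat_diag n (\<lambda>i. complex_of_real (f (d i))) * mat_adjoint V) $$ (a, b) =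
    low_rank n R (\<lambda>q. complex_of_real (big_val n f d \<epsilon> q)) (big_vec n V d \<epsilon>) $$ (a, b)"
    using ab by (simp add: low_rank_def)
qed (use unitary_groupD[OF V] in \<open>auto simp: low_rank_def\<close>)

lemma low_rank_hermitian: "mat_adjoint (low_rank n R (\<lambda>q. complex_of_real (g q)) u) = low_rank n R (\<lambda>q. complex_of_real (g q)) u"
  by (rule eq_matI) (auto simp: low_rank_def mult_ac)

section \<open>Perturbation of eigenvalue counts\<close>

lemma op_bounded_form_le:
  assumes "op_bounded n \<delta> (X - Z)" "X \<in> carrier_mat n n" "Z \<in> carrier_mat n n" "v \<in> carrier_vec n"
  shows "\<bar>Re ((X *\<^sub>v v) \<bullet>c v) - Re ((Z *\<^sub>v v) \<bullet>c v)\<bar> \<le> \<delta> * (vec_l2norm v)\<^sup>2"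
proof -
  have c: "X *\<^sub>v v \<in> carrier_vec n" "Z *\<^sub>v v \<in> carrier_vec n" using assms by auto
  have "(X - Z) *\<^sub>v v = X *\<^sub>v v - Z *\<^sub>v v" by (rule minus_mult_distrib_mat_vec[OF assms(2-4)])
  then have "((X - Z) *\<^sub>v v) \<bullet>c v = (X *\<^sub>v v) \<bullet>c v - (Z *\<^sub>v v) \<bullet>c v"
    using minus_scalar_prod_distrib[OF c carrier_vec_conjugate[OF assms(4)]] by simp
  then have "\<bar>Re ((X *\<^sub>v v) \<bullet>c v) - Re ((Z *\<^sub>v v) \<bullet>c v)\<bar> \<le> cmod (((X - Z) *\<^sub>v v) \<bullet>c v)"
    by (metis abs_Re_le_cmod minus_complex.simps(1))
  also have "\<dots> \<le> vec_l2norm ((X - Z) *\<^sub>v v) * vec_l2norm v"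
    using assms by (intro cscalar_prod_bound[of _ n] mult_mat_vec_carrier[of _ n n]) auto
  also have "\<dots> \<le> \<delta> * vec_l2norm v * vec_l2norm v"
    using assms by (intro mult_right_mono) (auto simp: op_bounded_def)
  finally show ?thesis by (simp add: power2_eq_square mult.assoc)
qed

text \<open>Weyl's inequality in both directions, for the matrices and for their negatives; the
  latter controls the negative eigenvalues.\<close>

lemma eig_count_close:
  assumes V: "V \<in> unitary_group n" and X: "X = V * mat_diag n (\<lambda>i. complex_of_real (d i)) * mat_adjoint V"
    and W: "W \<in> unitary_group n" and Z: "Z = W * mat_diag n (\<lambda>i. complex_of_real (e i)) * mat_adjoint W"
    and XZ: "op_bounded n \<delta> (X - Z)"
  shows "eig_count n d (t + \<delta>) \<le> eig_count n e t" "eig_count n e (t + \<delta>) \<le> eig_count n d t"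
    "eig_count n (\<lambda>i. - d i) (t + \<delta>) \<le> eig_count n (\<lambda>i. - e i) t"
    "eig_count n (\<lambda>i. - e i) (t + \<delta>) \<le> eig_count n (\<lambda>i. - d i) t"
proof -
  have D: "mat_diag n f \<in> carrier_mat n n" for f :: "nat \<Rightarrow> complex" by simp
  have c: "X \<in> carrier_mat n n" "Z \<in> carrier_mat n n"
    unfolding X Z using unitary_groupD[OF V] unitary_groupD[OF W]
    by (meson mult_carrier_mat D)+
  note fb = op_bounded_form_le[OF XZ c]
  have 1: "Re ((X *\<^sub>v v) \<bullet>c v) \<le> Re ((Z *\<^sub>v v) \<bullet>c v) + \<delta> * (vec_l2norm v)\<^sup>2"
    "Re ((Z *\<^sub>v v) \<bullet>c v) \<le> Re ((X *\<^sub>v v) \<bullet>c v) + \<delta> * (vec_l2norm v)\<^sup>2" if "v \<in> carrier_vec n" for v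
    using fb[OF that] by linarith+
  show "eig_count n d (t + \<delta>) \<le> eig_count n e t" "eig_count n e (t + \<delta>) \<le> eig_count n d t"
    unfolding eig_count_def using weyl_count[OF V X W Z 1(1)] weyl_count[OF W Z V X 1(2)] by auto
  let ?X = "V * mat_diag n (\<lambda>i. complex_of_real (- d i)) * mat_adjoint V"
  let ?Z = "W * mat_diag n (\<lambda>i. complex_of_real (- e i)) * mat_adjoint W"
  have mX: "Re ((?X *\<^sub>v v) \<bullet>c v) = - Re ((X *\<^sub>v v) \<bullet>c v)" and mZ: "Re ((?Z *\<^sub>v v) \<bullet>c v) = - Re ((Z *\<^sub>v v) \<bullet>c v)"
    if v: "v \<in> carrier_vec n" for v
    unfolding quadratic_form_diag[OF V v X] quadratic_form_diag[OF V v refl] quadratic_form_diag[OF W v Z] quadratic_form_diag[OF W v refl]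
    by (simp_all add: sum_negf)
  have 2: "Re ((?X *\<^sub>v v) \<bullet>c v) \<le> Re ((?Z *\<^sub>v v) \<bullet>c v) + \<delta> * (vec_l2norm v)\<^sup>2"
    "Re ((?Z *\<^sub>v v) \<bullet>c v) \<le> Re ((?X *\<^sub>v v) \<bullet>c v) + \<delta> * (vec_l2norm v)\<^sup>2" if "v \<in> carrier_vec n" for v
    unfolding mX[OF that] mZ[OF that] using 1[OF that] by linarith+
  show "eig_count n (\<lambda>i. - d i) (t + \<delta>) \<le> eig_count n (\<lambda>i. - e i) t"
    "eig_count n (\<lambda>i. - e i) (t + \<delta>) \<le> eig_count n (\<lambda>i. - d i) t"
    unfolding eig_count_def using weyl_count[OF V refl W refl 2(1)] weyl_count[OF W refl V refl 2(2)] by auto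
qed

text \<open>Inner factors of Q and its adjoint cancel, so a word in the conjugated matrices is the
  conjugate of the word, to which the concentration result for forms applies.\<close>

lemma conj_word:
  assumes Q: "Q \<in> unitary_group n" and B: "\<And>j s. (j, s) \<in> set w \<Longrightarrow> B j \<in> carrier_mat n n"
  shows "mat_prod n (map (letter_eval F (\<lambda>j. Q * B j * mat_adjoint Q)) (map (\<lambda>(j, s). Y_var j s) w)) =
    Q * mat_prod n (map (\<lambda>(j, s). if s then mat_adjoint (B j) else B j) w) * mat_adjoint Q"
  using B
proof (induction w)
  case Nil
  then show ?case using unitary_groupD[OF Q] by simp
next
  case (Cons js w)
  obtain j s where js: "js = (j, s)" by (cases js)
  note QD = unitary_groupD[OF Q]
  define G where "G = (if s then mat_adjoint (B j) else B j)"
  define H where "H = mat_prod n (map (\<lambda>(j, s). if s then mat_adjoint (B j) else B j) w)"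
  have Bj: "B j \<in> carrier_mat n n" using Cons.prems[of j s] by (simp add: js)
  have G: "G \<in> carrier_mat n n" using Bj by (simp add: G_def)
  have H: "H \<in> carrier_mat n n" unfolding H_def
  proof (rule mat_prod_carrier)
    fix A assume "A \<in> set (map (\<lambda>(j, s). if s then mat_adjoint (B j) else B j) w)"
    then obtain i r where "(i, r) \<in> set w" "A = (if r then mat_adjoint (B i) else B i)" by auto
    then show "A \<in> carrier_mat n n" using Cons.prems[of i r] by auto
  qed
  have "mat_adjoint (Q * B j * mat_adjoint Q) = Q * mat_adjoint (B j) * mat_adjoint Q"
    using mat_adjoint_mult[OF mult_carrier_mat[OF QD(1) Bj] QD(2)] mat_adjoint_mult[OF QD(1) Bj]
      assoc_mult_mat[OF QD(1) mat_adjoint_carrier[OF Bj] QD(2)] by simp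
  then have l: "letter_eval F (\<lambda>j. Q * B j * mat_adjoint Q) (Y_var j s) = Q * G * mat_adjoint Q"
    by (simp add: G_def)
  have "Q * G * mat_adjoint Q * (Q * H * mat_adjoint Q) = Q * (G * H) * mat_adjoint Q"
  proof -
    have HQ: "H * mat_adjoint Q \<in> carrier_mat n n" using H QD(2) by (rule mult_carrier_mat)
    have "Q * G * mat_adjoint Q * (Q * H * mat_adjoint Q) = (Q * G) * (mat_adjoint Q * (Q * (H * mat_adjoint Q)))"
      using assoc_mult_mat[OF mult_carrier_mat[OF QD(1) G] QD(2) mult_carrier_mat[OF QD(1) HQ]] assoc_mult_mat[OF QD(1) H QD(2)] by simp
    also have "mat_adjoint Q * (Q * (H * mat_adjoint Q)) = H * mat_adjoint Q" by (rule unitary_cancel(2)[OF Q HQ])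
    also have "(Q * G) * (H * mat_adjoint Q) = Q * (G * H) * mat_adjoint Q"
      using assoc_mult_mat[OF mult_carrier_mat[OF QD(1) G] H QD(2)] assoc_mult_mat[OF QD(1) G H] by simp
    finally show ?thesis .
  qed
  moreover have "mat_prod n (map (letter_eval F (\<lambda>j. Q * B j * mat_adjoint Q)) (map (\<lambda>(j, s). Y_var j s) w)) = Q * H * mat_adjoint Q"
    unfolding H_def by (rule Cons.IH) (use Cons.prems in auto)
  ultimately show ?case using l by (simp add: js G_def H_def del: letter_eval.simps)
qed

lemma Y_word_conv:
  assumes "Y_word l y"
  shows "\<exists>w. y = map (\<lambda>(j, s). Y_var j s) w \<and> fst ` set w \<subseteq> {..<l}"
  using assms
proof (induction y)
  case (Cons x y)
  then obtain w where w: "y = map (\<lambda>(j, s). Y_var j s) w" "fst ` set w \<subseteq> {..<l}" by auto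
  obtain j s where "x = Y_var j s" "j < l" using Cons.prems by auto
  then show ?case using w by (intro exI[of _ "(j, s) # w"]) auto
qed simp

section \<open>The limiting eigenvalues\<close>

locale haar_polynomial =
  fixes M :: "'w measure"
    and U :: "nat \<Rightarrow> 'w \<Rightarrow> complex mat"
    and k l :: nat
    and A B :: "nat \<Rightarrow> nat \<Rightarrow> complex mat"
    and a :: "nat \<Rightarrow> 'h::complex_hilbert \<Rightarrow> 'h"
    and b :: "nat \<Rightarrow> 'b::complex_star_algebra"
    and \<tau> :: "'b \<Rightarrow> complex"
    and P :: nc_poly
  assumes M: "prob_space M"
    and U: "\<And>n. n \<ge> 1 \<Longrightarrow> haar_unitary M n (U n)"
    and A_carrier: "\<And>n i. n \<ge> 1 \<Longrightarrow> i < k \<Longrightarrow> A n i \<in> carrier_mat n n"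
    and B_carrier: "\<And>n j. n \<ge> 1 \<Longrightarrow> j < l \<Longrightarrow> B n j \<in> carrier_mat n n"
    and A_herm: "\<And>n i. n \<ge> 1 \<Longrightarrow> i < k \<Longrightarrow> mat_adjoint (A n i) = A n i"
    and a: "\<And>i. i < k \<Longrightarrow> selfadjoint_compact (a i)"
    and A_conv: "converges_in_compact_distribution k A a"
    and B_conv: "converges_in_distribution l B b \<tau>"
    and B_bounded: "\<And>j. j < l \<Longrightarrow> bdd_above ((\<lambda>n. mat_op_norm (B n j)) ` {1..})"
    and P_in: "nc_poly_in k l P"
    and P_star: "nc_star P = P"
    and P_zero: "subst_X_zero P = 0"
begin

text \<open>For \<open>n = 0\<close> the given matrices are unconstrained; replacing them by zero matrices there
  makes all dimensions match for every \<open>n\<close>.\<close>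

definition A0 :: "nat \<Rightarrow> nat \<Rightarrow> complex mat" where
  "A0 n i = (if n \<ge> 1 then A n i else 0\<^sub>m n n)"

definition BU :: "nat \<Rightarrow> 'w \<Rightarrow> nat \<Rightarrow> complex mat" where
  "BU n \<omega> j = (if n \<ge> 1 then U n \<omega> * B n j * mat_adjoint (U n \<omega>) else 0\<^sub>m n n)"

lemma A0_carrier: "i < k \<Longrightarrow> A0 n i \<in> carrier_mat n n"
  and A0_herm: "i < k \<Longrightarrow> mat_adjoint (A0 n i) = A0 n i"
  using A_carrier[of n i] A_herm[of n i] by (auto simp: A0_def intro!: eq_matI)

lemma BU_carrier: "\<omega> \<in> space M \<Longrightarrow> j < l \<Longrightarrow> BU n \<omega> j \<in> carrier_mat n n"
proof -
  assume w: "\<omega> \<in> space M" and j: "j < l"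
  show ?thesis
  proof (cases "n \<ge> 1")
    case True
    note UD = unitary_groupD[OF haar_unitary_space[OF U[OF True] w]]
    show ?thesis using mult_carrier_mat[OF mult_carrier_mat[OF UD(1) B_carrier[OF True j]] UD(2)] True by (simp add: BU_def)
  qed (simp add: BU_def)
qed

text \<open>One fixed diagonalisation for every matrix, so that eigenvalues and eigenvectors become
  functions of n and of the sample point.\<close>

definition spectral_data :: "nat \<Rightarrow> complex mat \<Rightarrow> complex mat \<times> (nat \<Rightarrow> real)" where
  "spectral_data n X = (SOME Vd. fst Vd \<in> unitary_group n \<and>
     X = fst Vd * mat_diag n (\<lambda>i. complex_of_real (snd Vd i)) * mat_adjoint (fst Vd))"

lemma spectral_data:
  assumes "X \<in> carrier_mat n n" "mat_adjoint X = X"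
  shows "fst (spectral_data n X) \<in> unitary_group n"
    "X = fst (spectral_data n X) * mat_diag n (\<lambda>i. complex_of_real (snd (spectral_data n X) i)) * mat_adjoint (fst (spectral_data n X))"
proof -
  obtain V d where "V \<in> unitary_group n" "X = V * mat_diag n (\<lambda>i. complex_of_real (d i)) * mat_adjoint V"
    using hermitian_spectral[OF assms] by blast
  then have "\<exists>Vd. fst Vd \<in> unitary_group n \<and>
     X = fst Vd * mat_diag n (\<lambda>i. complex_of_real (snd Vd i)) * mat_adjoint (fst Vd)"
    by (intro exI[of _ "(V, d)"]) simp
  from someI_ex[OF this, folded spectral_data_def]
  show "fst (spectral_data n X) \<in> unitary_group n"
    "X = fst (spectral_data n X) * mat_diag n (\<lambda>i. complex_of_real (snd (spectral_data n X) i)) * mat_adjoint (fst (spectral_data n X))"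
    by auto
qed

abbreviation "VA n i \<equiv> fst (spectral_data n (A0 n i))"
abbreviation "dA n i \<equiv> snd (spectral_data n (A0 n i))"

lemma VA: "i < k \<Longrightarrow> VA n i \<in> unitary_group n"
  and A0_diag: "i < k \<Longrightarrow> A0 n i = VA n i * mat_diag n (\<lambda>j. complex_of_real (dA n i j)) * mat_adjoint (VA n i)"
  by (rule spectral_data[OF A0_carrier A0_herm]; assumption)+

lemma mat_fun_A:
  "n \<ge> 1 \<Longrightarrow> i < k \<Longrightarrow> mat_fun n f (A n i) = VA n i * mat_diag n (\<lambda>j. complex_of_real (f (dA n i j))) * mat_adjoint (VA n i)"
  using mat_fun_diag[OF VA A0_diag, of i n f] by (simp add: A0_def)

section \<open>Bounded spectrum and bounded rank from compact distribution\<close>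

lemma sum_f_convergent:
  assumes f: "f \<in> C0b" and i: "i < k"
  shows "(\<lambda>n. complex_of_real (\<Sum>j<n. f (dA n i j))) \<longlonglongrightarrow> op_trace (foldr (\<circ>) (map (\<lambda>i. op_fun f (a i)) [i]) id)"
proof -
  have "(\<lambda>n. mat_trace (mat_prod n (map (\<lambda>i. mat_fun n f (A n i)) [i]))) \<longlonglongrightarrow> op_trace (foldr (\<circ>) (map (\<lambda>i. op_fun f (a i)) [i]) id)"
    using A_conv[unfolded converges_in_compact_distribution_def, rule_format, of "\<lambda>_. f" "[i]"] f i by simp
  then show ?thesis
  proof (rule Lim_transform_eventually, intro eventually_sequentiallyI[of 1])
    fix n :: nat assume n: "n \<ge> 1"
    have D: "mat_diag n (\<lambda>j. complex_of_real (f (dA n i j))) \<in> carrier_mat n n" by simp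
    note VD = unitary_groupD[OF VA[OF i, of n]]
    have "mat_prod n (map (\<lambda>i. mat_fun n f (A n i)) [i]) = VA n i * mat_diag n (\<lambda>j. complex_of_real (f (dA n i j))) * mat_adjoint (VA n i)"
      using right_mult_one_mat[OF mult_carrier_mat[OF mult_carrier_mat[OF VD(1) D] VD(2)]] by (simp add: mat_fun_A[OF n i])
    then show "mat_trace (mat_prod n (map (\<lambda>i. mat_fun n f (A n i)) [i])) = complex_of_real (\<Sum>j<n. f (dA n i j))"
      by (simp only: mat_trace_conj_unitary[OF VA[OF i] D] mat_trace_diag of_real_sum)
  qed
qed

text \<open>A nonnegative test function that vanishes on the limit spectrum has sums over the
  eigenvalues of A_i(n) tending to 0, whereas one eigenvalue far outside would contribute 1.\<close>

lemma bounded_spectrum: "\<exists>K\<ge>1. \<forall>i<k. \<forall>\<^sub>F n in sequentially. \<forall>j<n. \<bar>dA n i j\<bar> \<le> K"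
proof -
  have "\<exists>K. \<forall>\<^sub>F n in sequentially. \<forall>j<n. \<bar>dA n i j\<bar> \<le> K" if i: "i < k" for i
  proof -
    from selfadjoint_compact_eigenvalue_bound[OF a[OF i]]
    obtain K0 where K0: "\<forall>t. eigenspace (a i) t \<noteq> {0} \<longrightarrow> \<bar>t\<bar> \<le> K0" ..
    define K where "K = max K0 1"
    \<comment> \<open>Zero up to modulus K and 1 from K + 1 on; K at least 1 guarantees that it
      vanishes near 0.\<close>
    define f where "f t = max 0 (min 1 (\<bar>t\<bar> - K))" for t :: real
    have f: "f \<in> C0b"
      unfolding C0b_def
    proof (intro CollectI conjI)
      show "continuous_on UNIV f" unfolding f_def by (intro continuous_intros)
      show "bounded (range f)" unfolding bounded_iff by (intro exI[of _ 1]) (auto simp: f_def)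
      show "\<exists>\<delta>>0. \<forall>t. \<bar>t\<bar> < \<delta> \<longrightarrow> f t = 0" by (intro exI[of _ 1]) (auto simp: f_def K_def)
    qed
    have "f t = 0" if "eigenspace (a i) t \<noteq> {0}" for t using K0[rule_format, OF that] by (simp add: f_def K_def)
    then have "op_trace (foldr (\<circ>) (map (\<lambda>i. op_fun f (a i)) [i]) id) = 0"
      using op_trace_op_fun_eq_0[of "a i" f i] by simp
    then have "(\<lambda>n. complex_of_real (\<Sum>j<n. f (dA n i j))) \<longlonglongrightarrow> 0" using sum_f_convergent[OF f i] by simp
    then have "(\<lambda>n. complex_of_real (\<Sum>j<n. f (dA n i j))) \<longlonglongrightarrow> complex_of_real 0" by simp
    then have "(\<lambda>n. \<Sum>j<n. f (dA n i j)) \<longlonglongrightarrow> 0" by (rule tendsto_of_real_iff[THEN iffD1])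
    then have "\<forall>\<^sub>F n in sequentially. (\<Sum>j<n. f (dA n i j)) < 1" by (rule order_tendstoD) simp
    then have "\<forall>\<^sub>F n in sequentially. \<forall>j<n. \<bar>dA n i j\<bar> \<le> K + 1"
    proof eventually_elim
      case (elim n)
      show ?case
      proof (intro allI impI)
        fix j assume j: "j < n"
        have "f (dA n i j) \<le> (\<Sum>j<n. f (dA n i j))" using j by (intro member_le_sum) (auto simp: f_def)
        then have "f (dA n i j) < 1" using elim by linarith
        then show "\<bar>dA n i j\<bar> \<le> K + 1" unfolding f_def by linarith
      qed
    qed
    then show ?thesis by blast
  qed
  then have "\<forall>i. \<exists>K. i < k \<longrightarrow> (\<forall>\<^sub>F n in sequentially. \<forall>j<n. \<bar>dA n i j\<bar> \<le> K)" by blast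
  from choice[OF this] obtain K where K: "\<And>i. i < k \<Longrightarrow> \<forall>\<^sub>F n in sequentially. \<forall>j<n. \<bar>dA n i j\<bar> \<le> K i" by blast
  define K1 where "K1 = 1 + (\<Sum>i<k. \<bar>K i\<bar>)"
  have le: "K i \<le> K1" if "i < k" for i
  proof -
    have "\<bar>K i\<bar> \<le> (\<Sum>i<k. \<bar>K i\<bar>)" using that by (intro member_le_sum) auto
    then show ?thesis by (simp add: K1_def)
  qed
  have "\<forall>\<^sub>F n in sequentially. \<forall>j<n. \<bar>dA n i j\<bar> \<le> K1" if i: "i < k" for i
    using K[OF i] by (rule eventually_mono) (meson le[OF i] order_trans)
  moreover have "K1 \<ge> 1" by (simp add: K1_def sum_nonneg)
  ultimately show ?thesis by blast
qed

text \<open>A ramp between \<epsilon>/2 and \<epsilon> dominates the indicator of modulus above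
  \<epsilon>, and its sums over the eigenvalues converge, hence stay bounded.\<close>

lemma bounded_rank:
  assumes \<epsilon>: "\<epsilon> > 0"
  shows "\<exists>R. \<forall>i<k. \<forall>\<^sub>F n in sequentially. card (big_eig n (dA n i) \<epsilon>) \<le> R"
proof -
  define f where "f t = max 0 (min 1 (2 * \<bar>t\<bar> / \<epsilon> - 1))" for t :: real
  have f: "f \<in> C0b"
    unfolding C0b_def
  proof (intro CollectI conjI)
    show "continuous_on UNIV f" unfolding f_def using \<epsilon> by (intro continuous_intros) auto
    show "bounded (range f)" unfolding bounded_iff by (intro exI[of _ 1]) (auto simp: f_def)
    show "\<exists>\<delta>>0. \<forall>t. \<bar>t\<bar> < \<delta> \<longrightarrow> f t = 0" using \<epsilon> by (intro exI[of _ "\<epsilon> / 2"]) (auto simp: f_def field_simps)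
  qed
  have "\<exists>R. \<forall>n. card (big_eig n (dA n i) \<epsilon>) \<le> R" if i: "i < k" for i
  proof -
    have "Bseq (\<lambda>n. complex_of_real (\<Sum>j<n. f (dA n i j)))"
      by (intro convergent_imp_Bseq convergentI[OF sum_f_convergent[OF f i]])
    then obtain C where C: "\<And>n. cmod (complex_of_real (\<Sum>j<n. f (dA n i j))) \<le> C" unfolding Bseq_def by blast
    have "card (big_eig n (dA n i) \<epsilon>) \<le> nat \<lceil>C\<rceil>" for n
    proof -
      have "real (card (big_eig n (dA n i) \<epsilon>)) = (\<Sum>j\<in>big_eig n (dA n i) \<epsilon>. 1)" by simp
      also have "\<dots> \<le> (\<Sum>j\<in>big_eig n (dA n i) \<epsilon>. f (dA n i j))"
        using \<epsilon> by (intro sum_mono) (auto simp: big_eig_def f_def field_simps)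
      also have "\<dots> \<le> (\<Sum>j<n. f (dA n i j))" by (intro sum_mono2) (auto simp: big_eig_def f_def)
      also have "\<dots> \<le> C" using C[of n] unfolding norm_of_real by linarith
      finally show ?thesis by linarith
    qed
    then show ?thesis by blast
  qed
  then have "\<forall>i. \<exists>R. i < k \<longrightarrow> (\<forall>n. card (big_eig n (dA n i) \<epsilon>) \<le> R)" by blast
  from choice[OF this] obtain R where R: "\<And>i n. i < k \<Longrightarrow> card (big_eig n (dA n i) \<epsilon>) \<le> R i" by blast
  have "R i \<le> (\<Sum>i<k. R i)" if "i < k" for i using that by (intro member_le_sum) auto
  then have "\<forall>i<k. \<forall>n. card (big_eig n (dA n i) \<epsilon>) \<le> (\<Sum>i<k. R i)" using R le_trans by blast
  then show ?thesis by (intro exI[of _ "\<Sum>i<k. R i"]) auto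
qed

definition uvec :: "real \<Rightarrow> nat \<Rightarrow> nat \<Rightarrow> nat \<Rightarrow> complex Matrix.vec" where
  "uvec \<epsilon> n i q = (if i < k then big_vec n (VA n i) (dA n i) \<epsilon> q else 0\<^sub>v n)"

lemma uvec: "uvec \<epsilon> n i q \<in> carrier_vec n" "vec_l2norm (uvec \<epsilon> n i q) \<le> 1"
  using big_vec_carrier[OF VA] by (auto simp: uvec_def)

definition Bword :: "nat \<Rightarrow> (nat \<times> bool) list \<Rightarrow> complex mat" where
  "Bword n w = mat_prod n (map (\<lambda>(j, s). if s then mat_adjoint (B n j) else B n j) w)"

text \<open>Adjacent x's leave an empty word between them, while convergence in distribution speaks
  of nonempty words. The empty word gets 1, the normalized trace of the identity for n at least
  1.\<close>

definition tword :: "(nat \<times> bool) list \<Rightarrow> complex" where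
  "tword w = (if w = [] then 1 else \<tau> (prod_list (map (\<lambda>(j, s). if s then star (b j) else b j) w)))"

lemma tword_limit:
  assumes "fst ` set w \<subseteq> {..<l}"
  shows "(\<lambda>n. mat_trace (Bword n w) / of_nat n) \<longlonglongrightarrow> tword w"
proof (cases "w = []")
  case True
  have "(\<lambda>n. 1) \<longlonglongrightarrow> tword w" by (simp add: tword_def True)
  then show ?thesis
    by (rule Lim_transform_eventually, intro eventually_sequentiallyI[of 1])
      (simp add: True Bword_def mat_trace_def)
next
  case False
  then show ?thesis
    using B_conv[unfolded converges_in_distribution_def, rule_format, of w] assms by (simp add: Bword_def tword_def)
qed

lemma B_bound: "\<exists>C\<ge>1. \<forall>n\<ge>1. \<forall>j<l. op_bounded n C (B n j)"
proof -
  have "\<forall>j. \<exists>C. j < l \<longrightarrow> (\<forall>n\<ge>1. mat_op_norm (B n j) \<le> C)"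
  proof
    fix j
    show "\<exists>C. j < l \<longrightarrow> (\<forall>n\<ge>1. mat_op_norm (B n j) \<le> C)"
      using B_bounded[of j] unfolding bdd_above_def by (cases "j < l") auto
  qed
  from choice[OF this] obtain C where C: "\<And>j n. j < l \<Longrightarrow> n \<ge> 1 \<Longrightarrow> mat_op_norm (B n j) \<le> C j" by blast
  define C1 where "C1 = 1 + (\<Sum>j<l. \<bar>C j\<bar>)"
  have le: "C j \<le> C1" if "j < l" for j
  proof -
    have "\<bar>C j\<bar> \<le> (\<Sum>j<l. \<bar>C j\<bar>)" using that by (intro member_le_sum) auto
    then show ?thesis by (simp add: C1_def)
  qed
  have "op_bounded n C1 (B n j)" if "n \<ge> 1" "j < l" for n j
    using op_bounded_mat_op_norm[OF B_carrier[OF that] order_trans[OF C[OF that(2,1)] le[OF that(2)]]] .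
  moreover have "C1 \<ge> 1" by (simp add: C1_def sum_nonneg)
  ultimately show ?thesis by blast
qed

text \<open>The thresholds are restricted to 1/(m+1) so that the conditions are countably many; the
  vectors in them come from the deterministic matrices.\<close>

definition good :: "'w set" where
  "good = {\<omega> \<in> space M. \<forall>w. fst ` set w \<subseteq> {..<l} \<longrightarrow> (\<forall>m i q i' q'.
     (\<lambda>n. ((U n \<omega> * Bword n w * mat_adjoint (U n \<omega>)) *\<^sub>v uvec (1 / real (Suc m)) n i q) \<bullet>c uvec (1 / real (Suc m)) n i' q'
        - mat_trace (Bword n w) / of_nat n * (uvec (1 / real (Suc m)) n i q \<bullet>c uvec (1 / real (Suc m)) n i' q')) \<longlonglongrightarrow> 0)}"

lemma AE_good: "AE \<omega> in M. \<omega> \<in> good"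
proof -
  obtain C where C: "C \<ge> 1" "\<And>n j. n \<ge> 1 \<Longrightarrow> j < l \<Longrightarrow> op_bounded n C (B n j)" using B_bound by blast
  have "AE \<omega> in M. \<forall>w m i q i' q'. fst ` set w \<subseteq> {..<l} \<longrightarrow>
     (\<lambda>n. ((U n \<omega> * Bword n w * mat_adjoint (U n \<omega>)) *\<^sub>v uvec (1 / real (Suc m)) n i q) \<bullet>c uvec (1 / real (Suc m)) n i' q'
        - mat_trace (Bword n w) / of_nat n * (uvec (1 / real (Suc m)) n i q \<bullet>c uvec (1 / real (Suc m)) n i' q')) \<longlonglongrightarrow> 0"
    unfolding AE_all_countable
  proof (intro allI)
    fix w :: "(nat \<times> bool) list" and m i q i' q' :: nat
    show "AE \<omega> in M. fst ` set w \<subseteq> {..<l} \<longrightarrow>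
     (\<lambda>n. ((U n \<omega> * Bword n w * mat_adjoint (U n \<omega>)) *\<^sub>v uvec (1 / real (Suc m)) n i q) \<bullet>c uvec (1 / real (Suc m)) n i' q'
        - mat_trace (Bword n w) / of_nat n * (uvec (1 / real (Suc m)) n i q \<bullet>c uvec (1 / real (Suc m)) n i' q')) \<longlonglongrightarrow> 0"
    proof (cases "fst ` set w \<subseteq> {..<l}")
      case True
      have "op_bounded n (C ^ length w) (Bword n w)" if n: "n \<ge> 1" for n
      proof -
        have "op_bounded n C G" if G: "G \<in> set (map (\<lambda>(j, s). if s then mat_adjoint (B n j) else B n j) w)" for G
        proof -
          obtain j s where js: "(j, s) \<in> set w" "G = (if s then mat_adjoint (B n j) else B n j)" using G by auto
          then have "j < l" using True by force
          then show ?thesis using js(2) C(2)[OF n] op_bounded_adjoint by auto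
        qed
        then have "op_bounded n (C ^ length (map (\<lambda>(j, s). if s then mat_adjoint (B n j) else B n j) w)) (Bword n w)"
          unfolding Bword_def by (rule op_bounded_mat_prod)
        then show ?thesis by simp
      qed
      from haar_bilinear_form_AE[OF M U this uvec(1) uvec(2) uvec(1) uvec(2)] show ?thesis by simp
    qed simp
  qed
  then show ?thesis
    using AE_space
  proof eventually_elim
    case (elim \<omega>)
    then show ?case unfolding good_def by blast
  qed
qed

section \<open>The random polynomial and the words of its powers\<close>

definition X :: "nat \<Rightarrow> 'w \<Rightarrow> complex mat" where
  "X n \<omega> = nc_eval n P (A0 n) (BU n \<omega>)"

lemma P_terms:
  assumes "(c, w) \<in> set (poly_terms P)"
  shows "set w \<subseteq> X_var ` {..<k} \<union> {Y_var j s | j s. j < l}" "\<exists>i. X_var i \<in> set w"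
proof -
  obtain ws where ws: "set ws = Poly_Mapping.keys P" "poly_terms P = map (\<lambda>w. (Poly_Mapping.lookup P w, w)) ws"
    by (rule poly_terms_list)
  then have w: "w \<in> Poly_Mapping.keys P" using assms by auto
  show "set w \<subseteq> X_var ` {..<k} \<union> {Y_var j s | j s. j < l}" using P_in w unfolding nc_poly_in_def by blast
  show "\<exists>i. X_var i \<in> set w" by (rule keys_contain_X[OF P_zero w])
qed

text \<open>Stated for exponents \<open>Suc p\<close>: the power 0 consists of the empty word, which
  contains no x.\<close>

lemma pow_terms:
  assumes "(c, w) \<in> set (terms_pow (poly_terms P) (Suc p))"
  shows "set w \<subseteq> X_var ` {..<k} \<union> {Y_var j s | j s. j < l}" "\<exists>i. X_var i \<in> set w"
proof -
  show "set w \<subseteq> X_var ` {..<k} \<union> {Y_var j s | j s. j < l}"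
  proof
    fix x assume "x \<in> set w"
    then obtain d v where "(d, v) \<in> set (poly_terms P)" "x \<in> set v" using terms_pow_letters[OF assms] by blast
    then show "x \<in> X_var ` {..<k} \<union> {Y_var j s | j s. j < l}" using P_terms(1) by blast
  qed
  obtain c1 v1 v2 where "(c1, v1) \<in> set (poly_terms P)" "w = v1 @ v2"
    using set_terms_mult[of c w "poly_terms P" "terms_pow (poly_terms P) p"] assms by auto
  then show "\<exists>i. X_var i \<in> set w" using P_terms(2) by fastforce
qed

lemma hermitian_eval:
  assumes w: "\<omega> \<in> space M" and G: "\<And>i. i < k \<Longrightarrow> G i \<in> carrier_mat n n \<and> mat_adjoint (G i) = G i"
  shows "nc_eval n P G (BU n \<omega>) \<in> carrier_mat n n" "mat_adjoint (nc_eval n P G (BU n \<omega>)) = nc_eval n P G (BU n \<omega>)"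
proof -
  show "nc_eval n P G (BU n \<omega>) \<in> carrier_mat n n" by (simp add: nc_eval_def)
  show "mat_adjoint (nc_eval n P G (BU n \<omega>)) = nc_eval n P G (BU n \<omega>)"
    by (rule nc_eval_hermitian[OF P_star P_in G BU_carrier[OF w]])
qed

end

text \<open>Fixes the constants whose existence was just shown, so that the definitions below can
  mention them. K serves both for the spectra of the A_i(n), eventually, and for the norms of the
  B_j(n); \<open>R m\<close> bounds the rank at threshold 1/(m+1).\<close>

locale haar_polynomial_bounded = haar_polynomial M U k l A B a b \<tau> P
  for M :: "'w measure" and U k l A B and a :: "nat \<Rightarrow> 'h::complex_hilbert \<Rightarrow> 'h"
    and b :: "nat \<Rightarrow> 'b::complex_star_algebra" and \<tau> P +
  fixes K :: real and R :: "nat \<Rightarrow> nat"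
  assumes K: "K \<ge> 1" "\<And>i. i < k \<Longrightarrow> \<forall>\<^sub>F n in sequentially. \<forall>j<n. \<bar>dA n i j\<bar> \<le> K"
    and R: "\<And>i m. i < k \<Longrightarrow> \<forall>\<^sub>F n in sequentially. card (big_eig n (dA n i) (1 / real (Suc m))) \<le> R m"
    and KB: "\<And>n j. n \<ge> 1 \<Longrightarrow> j < l \<Longrightarrow> op_bounded n K (B n j)"
begin

abbreviation "eps m \<equiv> 1 / real (Suc m)"
abbreviation "thr m \<equiv> soft_threshold K (eps m)"

definition gval :: "nat \<Rightarrow> nat \<Rightarrow> nat \<Rightarrow> nat \<Rightarrow> real" where
  "gval m n i q = (if i < k then big_val n (thr m) (dA n i) (eps m) q else 0)"

text \<open>Built with exactly \<open>R m\<close> rank-one terms for every n, as the word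
  asymptotics require. It agrees with the thresholded matrix once the rank bound holds, which is
  eventually.\<close>

definition F :: "nat \<Rightarrow> nat \<Rightarrow> nat \<Rightarrow> complex mat" where
  "F m n i = low_rank n (R m) (\<lambda>q. complex_of_real (gval m n i q)) (uvec (eps m) n i)"

lemma F_carrier [simp]: "F m n i \<in> carrier_mat n n"
  by (simp add: F_def)

lemma F_herm: "mat_adjoint (F m n i) = F m n i"
  unfolding F_def by (rule low_rank_hermitian)

lemma gval_bound: "\<bar>gval m n i q\<bar> \<le> K"
  using soft_threshold_bounds(1)[of K "eps m"] K(1) by (auto simp: gval_def big_val_def)

lemma F_eq:
  assumes i: "i < k" and "card (big_eig n (dA n i) (eps m)) \<le> R m"
  shows "F m n i = VA n i * mat_diag n (\<lambda>j. complex_of_real (thr m (dA n i j))) * mat_adjoint (VA n i)"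
proof -
  have "gval m n i = big_val n (thr m) (dA n i) (eps m)" "uvec (eps m) n i = big_vec n (VA n i) (dA n i) (eps m)"
    using i by (auto simp: gval_def uvec_def fun_eq_iff)
  then have "F m n i = low_rank n (R m) (\<lambda>q. complex_of_real (big_val n (thr m) (dA n i) (eps m) q)) (big_vec n (VA n i) (dA n i) (eps m))"
    by (simp only: F_def)
  also have "\<dots> = VA n i * mat_diag n (\<lambda>j. complex_of_real (thr m (dA n i j))) * mat_adjoint (VA n i)"
    by (rule diag_conj_low_rank[symmetric, OF VA[OF i] _ assms(2)]) (use soft_threshold_bounds(2)[of K "eps m"] K(1) in auto)
  finally show ?thesis .
qed

definition c_lim :: "nat \<Rightarrow> nat list \<Rightarrow> complex" where
  "c_lim m is = op_trace (foldr (\<circ>) (map (\<lambda>i. op_fun (thr m) (a i)) is) id)"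

definition unY :: "letter list \<Rightarrow> (nat \<times> bool) list" where
  "unY y = (SOME w. y = map (\<lambda>(j, s). Y_var j s) w \<and> fst ` set w \<subseteq> {..<l})"

lemma unY: "Y_word l y \<Longrightarrow> y = map (\<lambda>(j, s). Y_var j s) (unY y) \<and> fst ` set (unY y) \<subseteq> {..<l}"
  unfolding unY_def by (rule someI_ex[OF Y_word_conv])

lemma F_trace_limit:
  assumes "is \<noteq> []" "set is \<subseteq> {..<k}"
  shows "(\<lambda>n. mat_trace (mat_prod n (map (F m n) is))) \<longlonglongrightarrow> c_lim m is"
proof -
  have "thr m \<in> C0b" using K(1) by (intro soft_threshold_C0b) auto
  then have "(\<lambda>n. mat_trace (mat_prod n (map (\<lambda>i. mat_fun n (thr m) (A n i)) is))) \<longlonglongrightarrow> c_lim m is"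
    using A_conv[unfolded converges_in_compact_distribution_def, rule_format, of "\<lambda>_. thr m" "is"] assms
    by (simp add: c_lim_def)
  moreover have "\<forall>\<^sub>F n in sequentially. \<forall>i\<in>{..<k}. card (big_eig n (dA n i) (eps m)) \<le> R m"
    using R by (intro eventually_ball_finite) auto
  then have "\<forall>\<^sub>F n in sequentially. mat_trace (mat_prod n (map (\<lambda>i. mat_fun n (thr m) (A n i)) is)) = mat_trace (mat_prod n (map (F m n) is))"
    using eventually_ge_at_top[of 1]
  proof eventually_elim
    case (elim n)
    have "mat_fun n (thr m) (A n i) = F m n i" if "i \<in> set is" for i
      using F_eq[of i n m] mat_fun_A[of n i "thr m"] elim assms(2) that by auto
    then show ?case by (intro arg_cong[where f = "\<lambda>x. mat_trace (mat_prod n x)"] map_cong) auto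
  qed
  ultimately show ?thesis by (rule Lim_transform_eventually)
qed

lemma word_limit:
  assumes w: "\<omega> \<in> good"
  shows "word_limit (R m) k l (\<lambda>n i q. complex_of_real (gval m n i q)) (uvec (eps m)) (\<lambda>n. BU n \<omega>)
    (\<lambda>y n. mat_trace (Bword n (unY y)) / of_nat n) (\<lambda>y. tword (unY y)) (c_lim m) K (F m)
    (\<lambda>n. letter_eval (F m n) (BU n \<omega>))"
proof (unfold_locales)
  have wM: "\<omega> \<in> space M" using w by (simp add: good_def)
  show "uvec (eps m) n i q \<in> carrier_vec n" "vec_l2norm (uvec (eps m) n i q) \<le> 1" for n i q by (rule uvec)+
  show "cmod (complex_of_real (gval m n i q)) \<le> K" for n i q using gval_bound by simp
  show "F m n i = low_rank n (R m) (\<lambda>q. complex_of_real (gval m n i q)) (uvec (eps m) n i)" for n i by (rule F_def)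
  show "BU n \<omega> j \<in> carrier_mat n n" if "j < l" for n j by (rule BU_carrier[OF wM that])
  show "(\<lambda>n. mat_trace (Bword n (unY y)) / of_nat n) \<longlonglongrightarrow> tword (unY y)" if "Y_word l y" for y
    by (rule tword_limit) (use unY[OF that] in blast)
  show "(\<lambda>n. mat_trace (mat_prod n (map (F m n) is))) \<longlonglongrightarrow> c_lim m is" if "is \<noteq> []" "set is \<subseteq> {..<k}" for "is"
    by (rule F_trace_limit[OF that])
  show "(\<lambda>n. (mat_prod n (map (letter_eval (F m n) (BU n \<omega>)) y) *\<^sub>v uvec (eps m) n i q) \<bullet>c uvec (eps m) n i' q' -
       mat_trace (Bword n (unY y)) / of_nat n * (uvec (eps m) n i q \<bullet>c uvec (eps m) n i' q')) \<longlonglongrightarrow> 0"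
    if y: "Y_word l y" for y i q i' q'
  proof -
    have fs: "fst ` set (unY y) \<subseteq> {..<l}" using unY[OF y] by blast
    have "(\<lambda>n. ((U n \<omega> * Bword n (unY y) * mat_adjoint (U n \<omega>)) *\<^sub>v uvec (eps m) n i q) \<bullet>c uvec (eps m) n i' q'
        - mat_trace (Bword n (unY y)) / of_nat n * (uvec (eps m) n i q \<bullet>c uvec (eps m) n i' q')) \<longlonglongrightarrow> 0"
      using w fs unfolding good_def by blast
    then show ?thesis
    proof (rule Lim_transform_eventually, intro eventually_sequentiallyI[of 1])
      fix n :: nat assume n: "n \<ge> 1"
      have BUn: "BU n \<omega> = (\<lambda>j. U n \<omega> * B n j * mat_adjoint (U n \<omega>))" using n by (auto simp: BU_def)
      have "mat_prod n (map (letter_eval (F m n) (BU n \<omega>)) (map (\<lambda>(j, s). Y_var j s) (unY y))) =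
          U n \<omega> * Bword n (unY y) * mat_adjoint (U n \<omega>)"
        unfolding BUn Bword_def by (rule conj_word[OF haar_unitary_space[OF U[OF n] wM]]) (use fs B_carrier[OF n] in force)
      then have "mat_prod n (map (letter_eval (F m n) (BU n \<omega>)) y) = U n \<omega> * Bword n (unY y) * mat_adjoint (U n \<omega>)"
        using unY[OF y] by simp
      then show "((U n \<omega> * Bword n (unY y) * mat_adjoint (U n \<omega>)) *\<^sub>v uvec (eps m) n i q) \<bullet>c uvec (eps m) n i' q'
        - mat_trace (Bword n (unY y)) / of_nat n * (uvec (eps m) n i q \<bullet>c uvec (eps m) n i' q') =
        (mat_prod n (map (letter_eval (F m n) (BU n \<omega>)) y) *\<^sub>v uvec (eps m) n i q) \<bullet>c uvec (eps m) n i' q' -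
        mat_trace (Bword n (unY y)) / of_nat n * (uvec (eps m) n i q \<bullet>c uvec (eps m) n i' q')" by simp
    qed
  qed
qed auto

text \<open>The block form is chosen from the word alone, so \<open>word_lim\<close> depends neither
  on n nor on the sample point.\<close>

definition rot :: "letter list \<Rightarrow> (nat \<times> letter list) list" where
  "rot w = (SOME ps. ps \<noteq> [] \<and> block_word k l ps \<and>
    (\<forall>n \<rho>. (\<forall>x\<in>set w. \<rho> x \<in> carrier_mat n n) \<longrightarrow>
       mat_trace (mat_prod n (map \<rho> w)) = mat_trace (mat_prod n (map \<rho> (word_of ps)))))"

definition word_lim :: "nat \<Rightarrow> letter list \<Rightarrow> complex" where
  "word_lim m w = (\<Prod>p\<leftarrow>rot w. tword (unY (snd p))) * c_lim m (map fst (rot w))"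

lemma letter_carrier:
  assumes "\<omega> \<in> space M" "x \<in> X_var ` {..<k} \<union> {Y_var j s | j s. j < l}" "\<And>i. i < k \<Longrightarrow> G i \<in> carrier_mat n n"
  shows "letter_eval G (BU n \<omega>) x \<in> carrier_mat n n"
  using assms BU_carrier by auto

lemma trace_word_limit:
  assumes \<omega>: "\<omega> \<in> good" and w: "set w \<subseteq> X_var ` {..<k} \<union> {Y_var j s | j s. j < l}" "\<exists>i. X_var i \<in> set w"
  shows "(\<lambda>n. mat_trace (mat_prod n (map (letter_eval (F m n) (BU n \<omega>)) w))) \<longlonglongrightarrow> word_lim m w"
proof -
  have wM: "\<omega> \<in> space M" using \<omega> by (simp add: good_def)
  have rot: "rot w \<noteq> [] \<and> block_word k l (rot w) \<and>
    (\<forall>n \<rho>. (\<forall>x\<in>set w. \<rho> x \<in> carrier_mat n n) \<longrightarrow>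
       mat_trace (mat_prod n (map \<rho> w)) = mat_trace (mat_prod n (map \<rho> (word_of (rot w)))))"
    unfolding rot_def by (rule someI_ex[OF rotate_word[OF w]])
  have c: "\<forall>x\<in>set w. letter_eval (F m n) (BU n \<omega>) x \<in> carrier_mat n n" for n
    by (intro ballI letter_carrier[OF wM subsetD[OF w(1)]]) simp_all
  interpret wl: word_limit "R m" k l "\<lambda>n i q. complex_of_real (gval m n i q)" "uvec (eps m)" "\<lambda>n. BU n \<omega>"
    "\<lambda>y n. mat_trace (Bword n (unY y)) / of_nat n" "\<lambda>y. tword (unY y)" "c_lim m" K "F m"
    "\<lambda>n. letter_eval (F m n) (BU n \<omega>)" by (rule word_limit[OF \<omega>])
  have "mat_trace (mat_prod n (map (letter_eval (F m n) (BU n \<omega>)) w)) =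
      mat_trace (mat_prod n (map (letter_eval (F m n) (BU n \<omega>)) (word_of (rot w))))" for n
    using rot c[of n] by blast
  then show ?thesis unfolding word_lim_def using wl.word_trace_limit[of "rot w"] rot by simp
qed

definition Xm :: "nat \<Rightarrow> nat \<Rightarrow> 'w \<Rightarrow> complex mat" where
  "Xm m n \<omega> = nc_eval n P (F m n) (BU n \<omega>)"

abbreviation "dX \<omega> n \<equiv> snd (spectral_data n (X n \<omega>))"
abbreviation "eX \<omega> m n \<equiv> snd (spectral_data n (Xm m n \<omega>))"

lemma spec_X:
  assumes "\<omega> \<in> space M"
  shows "fst (spectral_data n (X n \<omega>)) \<in> unitary_group n"
    "X n \<omega> = fst (spectral_data n (X n \<omega>)) * mat_diag n (\<lambda>i. complex_of_real (dX \<omega> n i)) * mat_adjoint (fst (spectral_data n (X n \<omega>)))"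
  using spectral_data[of "X n \<omega>" n] hermitian_eval[OF assms, of "A0 n" n] A0_carrier A0_herm by (auto simp: X_def)

lemma spec_Xm:
  assumes "\<omega> \<in> space M"
  shows "fst (spectral_data n (Xm m n \<omega>)) \<in> unitary_group n"
    "Xm m n \<omega> = fst (spectral_data n (Xm m n \<omega>)) * mat_diag n (\<lambda>i. complex_of_real (eX \<omega> m n i)) * mat_adjoint (fst (spectral_data n (Xm m n \<omega>)))"
  using spectral_data[of "Xm m n \<omega>" n] hermitian_eval[OF assms, of "F m n" n] F_herm by (auto simp: Xm_def)

definition \<mu> :: "nat \<Rightarrow> nat \<Rightarrow> real" where
  "\<mu> m p = Re (\<Sum>(c, w)\<leftarrow>terms_pow (poly_terms P) p. c * word_lim m w)"

text \<open>The p-th moment is the trace of the p-th power, a combination of traces of words. The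
  exponent is at least 1, so that each of these words contains an x and its trace has a finite
  limit.\<close>

lemma moments_limit:
  assumes \<omega>: "\<omega> \<in> good" and p: "p \<ge> 1"
  shows "(\<lambda>n. \<Sum>j<n. eX \<omega> m n j ^ p) \<longlonglongrightarrow> \<mu> m p"
proof -
  have wM: "\<omega> \<in> space M" using \<omega> by (simp add: good_def)
  obtain p' where p': "p = Suc p'" using p by (cases p) auto
  let ?\<rho> = "\<lambda>n. letter_eval (F m n) (BU n \<omega>)" and ?T = "terms_pow (poly_terms P) p"
  have c: "?\<rho> n x \<in> carrier_mat n n" if "(c, w) \<in> set (poly_terms P)" "x \<in> set w" for c w x n
    by (rule letter_carrier[OF wM]) (use P_terms(1)[OF that(1)] that(2) in auto)
  have ct: "mat_prod n (map (?\<rho> n) w) \<in> carrier_mat n n" if "(c, w) \<in> set ?T" for c w n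
  proof (rule mat_prod_carrier)
    fix G assume "G \<in> set (map (?\<rho> n) w)"
    then obtain x where x: "x \<in> set w" "G = ?\<rho> n x" by auto
    from terms_pow_letters[OF that x(1)] show "G \<in> carrier_mat n n" using c x(2) by blast
  qed
  have tr: "complex_of_real (\<Sum>j<n. eX \<omega> m n j ^ p) = (\<Sum>(c, w)\<leftarrow>?T. c * mat_trace (mat_prod n (map (?\<rho> n) w)))" for n
  proof -
    have "complex_of_real (\<Sum>j<n. eX \<omega> m n j ^ p) = mat_trace (mat_prod n (replicate p (Xm m n \<omega>)))"
      by (rule mat_trace_power_diag[OF spec_Xm[OF wM], symmetric])
    also have "mat_prod n (replicate p (Xm m n \<omega>)) = terms_eval n ?T (?\<rho> n)"
      unfolding Xm_def nc_eval_terms by (rule terms_pow_eval) (rule c)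
    also have "mat_trace \<dots> = (\<Sum>(c, w)\<leftarrow>?T. c * mat_trace (mat_prod n (map (?\<rho> n) w)))"
      by (rule mat_trace_terms_eval) (rule ct)
    finally show ?thesis .
  qed
  have "(\<lambda>n. \<Sum>(c, w)\<leftarrow>cs. c * mat_trace (mat_prod n (map (?\<rho> n) w))) \<longlonglongrightarrow> (\<Sum>(c, w)\<leftarrow>cs. c * word_lim m w)"
    if "set cs \<subseteq> set ?T" for cs
    using that
  proof (induction cs)
    case (Cons cw cs)
    obtain c w where cw: "cw = (c, w)" by (cases cw)
    then have "(c, w) \<in> set ?T" using Cons.prems by simp
    from tendsto_mult_left[OF trace_word_limit[OF \<omega> pow_terms[OF this[unfolded p']]], of c m]
    show ?case using tendsto_add Cons by (simp add: cw)
  qed simp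
  from this[OF subset_refl, folded tr] have "(\<lambda>n. Re (complex_of_real (\<Sum>j<n. eX \<omega> m n j ^ p))) \<longlonglongrightarrow> \<mu> m p"
    unfolding \<mu>_def by (rule tendsto_Re)
  then show ?thesis by simp
qed

text \<open>A Lipschitz constant of P in operator norm, uniform in n, on letters of norm at most
  K.\<close>

definition eta_const :: real where
  "eta_const = (\<Sum>(c, w)\<leftarrow>poly_terms P. cmod c * (real (length w) * K ^ length w))"

lemma eta_const_nonneg: "eta_const \<ge> 0"
  unfolding eta_const_def by (rule sum_list_nonneg) (use K in auto)

text \<open>The two evaluations share the conjugated B's and differ only in the x letters, by at
  most the threshold.\<close>

lemma close_X:
  assumes \<omega>: "\<omega> \<in> space M"
  shows "\<forall>\<^sub>F n in sequentially. op_bounded n (eta_const * eps m) (X n \<omega> - Xm m n \<omega>)"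
proof -
  have "\<forall>\<^sub>F n in sequentially. \<forall>i\<in>{..<k}. card (big_eig n (dA n i) (eps m)) \<le> R m"
    using R by (intro eventually_ball_finite) auto
  moreover have "\<forall>\<^sub>F n in sequentially. \<forall>i\<in>{..<k}. \<forall>j<n. \<bar>dA n i j\<bar> \<le> K"
    using K(2) by (intro eventually_ball_finite) auto
  ultimately show ?thesis
    using eventually_ge_at_top[of 1]
  proof eventually_elim
    case (elim n)
    show ?case
      unfolding X_def Xm_def nc_eval_terms eta_const_def
    proof (rule terms_eval_close[OF K(1)])
      fix c w x assume cw: "(c, w) \<in> set (poly_terms P)" "x \<in> set w"
      then have x: "x \<in> X_var ` {..<k} \<union> {Y_var j s | j s. j < l}" using P_terms(1) by blast
      show "op_bounded n K (letter_eval (A0 n) (BU n \<omega>) x) \<and> op_bounded n K (letter_eval (F m n) (BU n \<omega>) x) \<and>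
        op_bounded n (eps m) (letter_eval (A0 n) (BU n \<omega>) x - letter_eval (F m n) (BU n \<omega>) x)"
      proof (cases x)
        case (X_var i)
        then have i: "i < k" using x by auto
        have dK: "\<And>j. j < n \<Longrightarrow> \<bar>dA n i j\<bar> \<le> K" using elim i by blast
        note Feq = F_eq[OF i, of n m]
        have 1: "op_bounded n K (A0 n i)"
          by (subst A0_diag[OF i]) (rule op_bounded_diag_conj[OF VA[OF i] dK], use K in auto)
        have 2: "op_bounded n K (F m n i)"
          using elim i K(1) soft_threshold_bounds(1)[of K "eps m"]
          by (subst Feq) (auto intro!: op_bounded_diag_conj[OF VA[OF i]])
        have "A0 n i - F m n i = VA n i * mat_diag n (\<lambda>j. complex_of_real (dA n i j - thr m (dA n i j))) * mat_adjoint (VA n i)"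
        proof -
          have "F m n i = VA n i * mat_diag n (\<lambda>j. complex_of_real (thr m (dA n i j))) * mat_adjoint (VA n i)"
            using elim i by (intro Feq) blast
          then show ?thesis using A0_diag[OF i, of n] diag_conj_diff[OF VA[OF i], of n "dA n i" "\<lambda>j. thr m (dA n i j)"] by simp
        qed
        moreover have "op_bounded n (eps m) \<dots>"
          by (rule op_bounded_diag_conj[OF VA[OF i] soft_threshold_bounds(3)]) (use K(1) dK in auto)
        ultimately show ?thesis using 1 2 X_var by simp
      next
        case (Y_var j s)
        then have j: "j < l" using x by auto
        note Uu = haar_unitary_space[OF U[OF elim(3)] \<omega>]
        have BK: "op_bounded n K (BU n \<omega> j)"
          using op_bounded_mult[OF op_bounded_mult[OF op_bounded_unitary[OF Uu] KB[OF elim(3) j]] op_bounded_unitary[OF unitary_group_adjoint[OF Uu]]]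
            elim(3) by (simp add: BU_def)
        define G where "G = letter_eval (A0 n) (BU n \<omega>) x"
        have G: "op_bounded n K G" using BK op_bounded_adjoint[OF BK] by (simp add: G_def Y_var)
        have "G - G = 0\<^sub>m n n" using G by (auto simp: op_bounded_def)
        then have "op_bounded n (eps m) (G - G)" using op_bounded_mono[OF op_bounded_zero, of "eps m" n] by (simp only:) simp
        moreover have "letter_eval (F m n) (BU n \<omega>) x = G" by (simp add: G_def Y_var)
        ultimately show ?thesis using G unfolding G_def[symmetric] by simp
      qed
    qed simp
  qed
qed

text \<open>The second statement is the first for the negated eigenvalues, whose moments acquire the
  sign (-1)^p.\<close>

lemma eigenvalue_limits:
  "\<exists>s. decseq s \<and> (\<forall>i. 0 \<le> s i) \<and> s \<longlonglongrightarrow> 0 \<and> (\<forall>\<omega>\<in>good. \<forall>i. (\<lambda>n. eig_list n (dX \<omega> n) i) \<longlonglongrightarrow> s i)"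
  "\<exists>s. decseq s \<and> (\<forall>i. 0 \<le> s i) \<and> s \<longlonglongrightarrow> 0 \<and> (\<forall>\<omega>\<in>good. \<forall>i. (\<lambda>n. eig_list n (\<lambda>j. - dX \<omega> n j) i) \<longlonglongrightarrow> s i)"
proof -
  define \<eta> where "\<eta> m = eta_const * eps m" for m
  have "(\<lambda>m. eta_const * eps m) \<longlonglongrightarrow> eta_const * 0"
    by (intro tendsto_mult tendsto_const LIMSEQ_Suc[OF lim_1_over_n])
  then have \<eta>: "\<eta> \<longlonglongrightarrow> 0" by (simp add: \<eta>_def [abs_def])
  have \<eta>0: "\<eta> m \<ge> 0" for m using eta_const_nonneg by (simp add: \<eta>_def)
  have close: "\<forall>\<^sub>F n in sequentially. \<forall>t.
      (eig_count n (dX \<omega> n) (t + \<eta> m) \<le> eig_count n (eX \<omega> m n) t \<and> eig_count n (eX \<omega> m n) (t + \<eta> m) \<le> eig_count n (dX \<omega> n) t) \<and>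
      (eig_count n (\<lambda>j. - dX \<omega> n j) (t + \<eta> m) \<le> eig_count n (\<lambda>j. - eX \<omega> m n j) t \<and>
       eig_count n (\<lambda>j. - eX \<omega> m n j) (t + \<eta> m) \<le> eig_count n (\<lambda>j. - dX \<omega> n j) t)"
    if "\<omega> \<in> good" for \<omega> m
  proof -
    have wM: "\<omega> \<in> space M" using that by (simp add: good_def)
    show ?thesis
      using close_X[OF wM, of m]
    proof eventually_elim
      case (elim n)
      note cc = eig_count_close[OF spec_X[OF wM] spec_Xm[OF wM] elim[folded \<eta>_def]]
      show ?case by (intro allI conjI cc)
    qed
  qed
  show "\<exists>s. decseq s \<and> (\<forall>i. 0 \<le> s i) \<and> s \<longlonglongrightarrow> 0 \<and> (\<forall>\<omega>\<in>good. \<forall>i. (\<lambda>n. eig_list n (dX \<omega> n) i) \<longlonglongrightarrow> s i)"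
  proof (rule eig_list_approx_limit[OF \<eta> \<eta>0, where e = eX and \<mu> = \<mu>])
    show "(\<lambda>n. \<Sum>j<n. eX \<omega> m n j ^ p) \<longlonglongrightarrow> \<mu> m p" if "\<omega> \<in> good" "p \<ge> 2" for \<omega> m p
      using moments_limit[OF that(1), of p m] that(2) by simp
    show "\<forall>\<^sub>F n in sequentially. \<forall>t. eig_count n (dX \<omega> n) (t + \<eta> m) \<le> eig_count n (eX \<omega> m n) t \<and>
        eig_count n (eX \<omega> m n) (t + \<eta> m) \<le> eig_count n (dX \<omega> n) t" if "\<omega> \<in> good" for \<omega> m
      using close[OF that, of m] by (rule eventually_mono) simp
  qed
  show "\<exists>s. decseq s \<and> (\<forall>i. 0 \<le> s i) \<and> s \<longlonglongrightarrow> 0 \<and> (\<forall>\<omega>\<in>good. \<forall>i. (\<lambda>n. eig_list n (\<lambda>j. - dX \<omega> n j) i) \<longlonglongrightarrow> s i)"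
  proof (rule eig_list_approx_limit[OF \<eta> \<eta>0, where e = "\<lambda>\<omega> m n j. - eX \<omega> m n j" and \<mu> = "\<lambda>m p. (-1) ^ p * \<mu> m p"])
    show "(\<lambda>n. \<Sum>j<n. (- eX \<omega> m n j) ^ p) \<longlonglongrightarrow> (-1) ^ p * \<mu> m p" if "\<omega> \<in> good" "p \<ge> 2" for \<omega> m p
    proof -
      have "(\<Sum>j<n. (- eX \<omega> m n j) ^ p) = (-1) ^ p * (\<Sum>j<n. eX \<omega> m n j ^ p)" for n
        unfolding sum_distrib_left by (intro sum.cong refl) (rule power_minus)
      then show ?thesis using tendsto_mult_left[OF moments_limit[OF that(1), of p m], of "(-1) ^ p"] that(2) by simp
    qed
    show "\<forall>\<^sub>F n in sequentially. \<forall>t. eig_count n (\<lambda>j. - dX \<omega> n j) (t + \<eta> m) \<le> eig_count n (\<lambda>j. - eX \<omega> m n j) t \<and>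
        eig_count n (\<lambda>j. - eX \<omega> m n j) (t + \<eta> m) \<le> eig_count n (\<lambda>j. - dX \<omega> n j) t" if "\<omega> \<in> good" for \<omega> m
      using close[OF that, of m] by (rule eventually_mono) simp
  qed
qed

lemma converges_in_eigenvalues_good:
  "\<exists>T :: ell2 \<Rightarrow> ell2. selfadjoint_compact T \<and> (\<forall>\<omega>\<in>good. converges_in_eigenvalues
     (\<lambda>n. nc_eval n P (A n) (\<lambda>j. U n \<omega> * B n j * mat_adjoint (U n \<omega>))) T)"
proof -
  obtain s where s: "decseq s" "\<And>i. 0 \<le> s i" "s \<longlonglongrightarrow> 0"
    "\<And>\<omega> i. \<omega> \<in> good \<Longrightarrow> (\<lambda>n. eig_list n (dX \<omega> n) i) \<longlonglongrightarrow> s i"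
    using eigenvalue_limits(1) by blast
  obtain s' where s': "decseq s'" "\<And>i. 0 \<le> s' i" "s' \<longlonglongrightarrow> 0"
    "\<And>\<omega> i. \<omega> \<in> good \<Longrightarrow> (\<lambda>n. eig_list n (\<lambda>j. - dX \<omega> n j) i) \<longlonglongrightarrow> s' i"
    using eigenvalue_limits(2) by blast
  obtain T :: "ell2 \<Rightarrow> ell2" where T: "selfadjoint_compact T" "pos_eigenvalues (op_multiplicity T) = s"
    "neg_eigenvalues (op_multiplicity T) = (\<lambda>i. - s' i)"
    using exists_compact_operator_with_eigenvalues[OF s(1-3) s'(1-3)] by blast
  have "converges_in_eigenvalues (\<lambda>n. nc_eval n P (A n) (\<lambda>j. U n \<omega> * B n j * mat_adjoint (U n \<omega>))) T"
    if \<omega>: "\<omega> \<in> good" for \<omega>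
  proof -
    have wM: "\<omega> \<in> space M" using \<omega> by (simp add: good_def)
    have mult: "mat_multiplicity (nc_eval n P (A n) (\<lambda>j. U n \<omega> * B n j * mat_adjoint (U n \<omega>))) = eig_mult n (dX \<omega> n)"
      if n: "n \<ge> 1" for n
    proof -
      have "nc_eval n P (A n) (\<lambda>j. U n \<omega> * B n j * mat_adjoint (U n \<omega>)) = X n \<omega>"
        using n by (simp add: X_def A0_def [abs_def] BU_def [abs_def])
      then show ?thesis
        using mat_multiplicity_diag[OF spec_X[OF wM]] by (simp add: fun_eq_iff eig_mult_def)
    qed
    show ?thesis
      unfolding converges_in_eigenvalues_def T
    proof (intro conjI allI)
      fix i
      show "(\<lambda>n. pos_eigenvalues (mat_multiplicity (nc_eval n P (A n) (\<lambda>j. U n \<omega> * B n j * mat_adjoint (U n \<omega>)))) i) \<longlonglongrightarrow> s i"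
        by (rule Lim_transform_eventually[OF s(4)[OF \<omega>]], rule eventually_sequentiallyI[of 1])
          (simp only: mult eig_list_def)
      \<comment> \<open>The negative eigenvalues are the negated list of the negated spectrum, which
        is why s' was taken along -\<open>dX\<close>.\<close>
      have "neg_eigenvalues (eig_mult n (dX \<omega> n)) = (\<lambda>i. - eig_list n (\<lambda>j. - dX \<omega> n j) i)" for n
        using neg_eigenvalues_eig_list[of n "\<lambda>j. - dX \<omega> n j"] by simp
      then show "(\<lambda>n. neg_eigenvalues (mat_multiplicity (nc_eval n P (A n) (\<lambda>j. U n \<omega> * B n j * mat_adjoint (U n \<omega>)))) i) \<longlonglongrightarrow> - s' i"
        by (intro Lim_transform_eventually[OF tendsto_minus[OF s'(4)[OF \<omega>]]] eventually_sequentiallyI[of 1])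
          (simp only: mult)
    qed
  qed
  then show ?thesis using T(1) by blast
qed

end

theorem theorem4p7:
  fixes M :: "'w measure"
    and U :: "nat \<Rightarrow> 'w \<Rightarrow> complex mat"
    and k l :: nat
    and A B :: "nat \<Rightarrow> nat \<Rightarrow> complex mat"
    and a :: "nat \<Rightarrow> 'h::complex_hilbert \<Rightarrow> 'h"
    and b :: "nat \<Rightarrow> 'b::complex_star_algebra"
    and \<tau> :: "'b \<Rightarrow> complex"
    and P :: nc_poly
  assumes "prob_space M"
    and "\<And>n. n \<ge> 1 \<Longrightarrow> haar_unitary M n (U n)"
    and "\<And>n i. n \<ge> 1 \<Longrightarrow> i < k \<Longrightarrow> A n i \<in> carrier_mat n n"
    and "\<And>n j. n \<ge> 1 \<Longrightarrow> j < l \<Longrightarrow> B n j \<in> carrier_mat n n"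
    and "\<And>n i. n \<ge> 1 \<Longrightarrow> i < k \<Longrightarrow> mat_adjoint (A n i) = A n i"
    and "separable_space (euclidean :: 'h topology)"
    and "\<And>i. i < k \<Longrightarrow> selfadjoint_compact (a i)"
    and "converges_in_compact_distribution k A a"
    and "nc_probability \<tau>"
    and "converges_in_distribution l B b \<tau>"
    and "\<And>j. j < l \<Longrightarrow> bdd_above ((\<lambda>n. mat_op_norm (B n j)) ` {1..})"
    and "nc_poly_in k l P"
    and "nc_star P = P"
    and "subst_X_zero P = 0"
  shows "\<exists>T :: ell2 \<Rightarrow> ell2. selfadjoint_compact T \<and>
    (AE \<omega> in M. converges_in_eigenvalues
       (\<lambda>n. nc_eval n P (A n) (\<lambda>j. U n \<omega> * B n j * mat_adjoint (U n \<omega>))) T)"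
proof -
  interpret haar_polynomial M U k l A B a b \<tau> P
    by (rule haar_polynomial.intro) (fact assms)+
  obtain K1 where K1: "K1 \<ge> 1" "\<And>i. i < k \<Longrightarrow> \<forall>\<^sub>F n in sequentially. \<forall>j<n. \<bar>dA n i j\<bar> \<le> K1"
    using bounded_spectrum by blast
  obtain K2 where K2: "K2 \<ge> 1" "\<And>n j. n \<ge> 1 \<Longrightarrow> j < l \<Longrightarrow> op_bounded n K2 (B n j)"
    using B_bound by blast
  have "\<forall>m. \<exists>R. \<forall>i<k. \<forall>\<^sub>F n in sequentially. card (big_eig n (dA n i) (1 / real (Suc m))) \<le> R"
    by (intro allI bounded_rank) simp
  from choice[OF this] obtain R where R: "\<And>m i. i < k \<Longrightarrow> \<forall>\<^sub>F n in sequentially. card (big_eig n (dA n i) (1 / real (Suc m))) \<le> R m"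
    by blast
  interpret haar_polynomial_bounded M U k l A B a b \<tau> P "max K1 K2" R
  proof unfold_locales
    show "max K1 K2 \<ge> 1" using K1 by simp
    show "\<forall>\<^sub>F n in sequentially. \<forall>j<n. \<bar>dA n i j\<bar> \<le> max K1 K2" if "i < k" for i
      using K1(2)[OF that] by (rule eventually_mono) (meson max.coboundedI1)
    show "op_bounded n (max K1 K2) (B n j)" if "n \<ge> 1" "j < l" for n j
      by (rule op_bounded_mono[OF K2(2)[OF that]]) simp
  qed (rule R)
  obtain T :: "ell2 \<Rightarrow> ell2" where T: "selfadjoint_compact T" "\<And>\<omega>. \<omega> \<in> good \<Longrightarrow> converges_in_eigenvalues
     (\<lambda>n. nc_eval n P (A n) (\<lambda>j. U n \<omega> * B n j * mat_adjoint (U n \<omega>))) T"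
    using converges_in_eigenvalues_good by blast
  have "AE \<omega> in M. converges_in_eigenvalues
       (\<lambda>n. nc_eval n P (A n) (\<lambda>j. U n \<omega> * B n j * mat_adjoint (U n \<omega>))) T"
    using AE_good by eventually_elim (rule T(2))
  then show ?thesis using T(1) by blast
qed

end
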